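(* For every integer $k\ge 6$, $$\biggl\|\biggl(\frac43\biggr)^k\biggr\| > \biggl(\frac49\biggr)^k,$$ where for a real number $x$, $\|x\|$ denotes the distance from $x$ to the nearest integer.
   Context: $\|x\| = \min_{n\in\mathbb Z}|x-n|$ for real $x$. *)

theory Defs
  imports Complex_Main
begin

definition dist_nint :: "real \<Rightarrow> real" where
  "dist_nint x = (INF n::int. \<bar>x - real_of_int n\<bar>)"

end

theory Submission
  imports Defs "HOL-Analysis.Analysis" "HOL-Number_Theory.Number_Theory"
begin

text \<open>Pade approximants to a tail of the binomial series for \<open>(1 - z) ^ (- m)\<close> at \<open>z = 1/9\<close> give integer linear forms in
  \<open>1\<close> and \<open>(4/3) ^ k\<close> up to powers of \<open>3\<close>. All coefficients of such a form share a large common factor, a product of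
  primes \<open>p\<close> for which certain fractional parts are large; after division by it the form is small
  enough to keep \<open>(4/3) ^ k\<close> away from the integers. The size of the common factor is bounded from
  below by a weighted Chebyshev argument for large \<open>k\<close>, by a prime table for \<open>1600 < k < 96000\<close>, and
  the remaining \<open>k\<close> are settled by residues of powers of \<open>4\<close> modulo powers of \<open>3\<close>.\<close>

text \<open>With \<open>w = b + 1\<close>, the forms come from
  \<open>(16/9) ^ w = 2 ^ w * (1 + 1/8) ^ (- w)\<close>. Two points shape the proof. Non-vanishing:
  the remainder of a form has the explicit sign \<open>(-1) ^ (A + 1)\<close>, so for one of the
  parameters \<open>A\<close> and \<open>A - 1\<close> it cannot cancel against the deviation of
  \<open>(4/3) ^ k\<close> from the nearest integer. Size: the forms are not small by themselves.
  Integrality rests on \<open>2 ^ w\<close> clearing powers of \<open>8\<close>, which caps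
  \<open>A - n\<close> at \<open>w / 3\<close>. With \<open>A - n\<close> at this cap and
  \<open>n\<close> about \<open>0.4326 * w\<close>, which balances the two contributions, both
  bounds grow like \<open>exp (0.1354 * w)\<close>, whereas the common factor is shown to grow at
  least like \<open>exp (0.1437 * w)\<close>. This narrow gap has to pay for every error term, and
  it does so for \<open>w \<ge> 48000\<close>. Hence the finely tuned weights, the long certified
  computations, and the separate treatment of \<open>k < 96000\<close>.\<close>

section \<open>Binomial identities and the Pade approximants\<close>

lemma gbinomial_neg_nat:
  "((- real A - 1) gchoose k) = (-1) ^ k * real ((A + k) choose k)"
proof -
  have "((- (real A + 1)) gchoose k) = (-1) ^ k * ((real A + 1 + real k - 1) gchoose k)"
    by (rule gbinomial_minus)
  also have "real A + 1 + real k - 1 = real (A + k)" by simp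
  also have "- (real A + 1) = - real A - 1" by simp
  finally show ?thesis by (simp only: binomial_gbinomial)
qed

text \<open>By \<open>gbinomial_neg_nat\<close> the signed factor is
  \<open>(- A - 1) gchoose k\<close>, so this is Vandermonde's convolution for the upper arguments
  \<open>- A - 1\<close> and \<open>A + 1 + m\<close>, whose sum is \<open>m\<close>.\<close>

lemma vandermonde_neg:
  fixes A m n :: nat
  shows "(\<Sum>k\<le>n. (-1) ^ k * real ((A + k) choose k) * real ((A + 1 + m) choose (n - k)))
    = real (m choose n)"
proof -
  have "(\<Sum>k\<le>n. (-1) ^ k * real ((A + k) choose k) * real ((A + 1 + m) choose (n - k)))
    = (\<Sum>k=0..n. ((- real A - 1) gchoose k) * (real (A + 1 + m) gchoose (n - k)))"
    unfolding gbinomial_neg_nat binomial_gbinomial by (simp add: atMost_atLeast0)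
  also have "\<dots> = ((- real A - 1 + real (A + 1 + m)) gchoose n)"
    by (rule gbinomial_Vandermonde)
  also have "- real A - 1 + real (A + 1 + m) = real m" by simp
  finally show ?thesis by (simp add: binomial_gbinomial)
qed

text \<open>Factorial moments of the alternating weights. After the shift
  \<open>\<mu> = \<mu>' + i\<close>, the product of \<open>(A + \<mu>) choose \<mu>\<close> and
  \<open>\<mu> choose i\<close> splits into \<open>(A + i) choose i\<close> and
  \<open>(A + i + \<mu>') choose \<mu>'\<close>, which leaves an instance of
  \<open>vandermonde_neg\<close> with \<open>A + i\<close> and \<open>b - i\<close>.\<close>

lemma shifted_sum:
  fixes A b n i :: nat
  assumes "n \<le> b"
  shows "(\<Sum>\<mu>\<le>n. (-1) ^ \<mu> * real ((A + \<mu>) choose \<mu>) * real ((A + 1 + b) choose (n - \<mu>)) * real (\<mu> choose i))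
     = (if i \<le> n then (-1) ^ i * real ((A + i) choose i) * real ((b - i) choose (n - i)) else 0)"
proof (cases "i \<le> n")
  case False
  thus ?thesis by (auto intro!: sum.neutral)
next
  case True
  have "(\<Sum>\<mu>\<le>n. (-1) ^ \<mu> * real ((A + \<mu>) choose \<mu>) * real ((A + 1 + b) choose (n - \<mu>)) * real (\<mu> choose i))
      = (\<Sum>\<mu>\<in>{i..n}. (-1) ^ \<mu> * real ((A + \<mu>) choose \<mu>) * real ((A + 1 + b) choose (n - \<mu>)) * real (\<mu> choose i))"
    by (rule sum.mono_neutral_right) auto
  also have "\<dots> = (\<Sum>\<mu>\<le>n - i. (-1) ^ (\<mu> + i) * real ((A + (\<mu> + i)) choose (\<mu> + i)) * real ((A + 1 + b) choose (n - (\<mu> + i))) * real ((\<mu> + i) choose i))"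
    using True
    by (intro sum.reindex_bij_witness[of _ "\<lambda>\<mu>. \<mu> + i" "\<lambda>\<mu>. \<mu> - i"]) auto
  also have "\<dots> = (\<Sum>\<mu>\<le>n - i. (-1) ^ i * real ((A + i) choose i) *
      ((-1) ^ \<mu> * real ((A + i + \<mu>) choose \<mu>) * real ((A + i + 1 + (b - i)) choose (n - i - \<mu>))))"
  proof (intro sum.cong refl)
    fix \<mu> assume "\<mu> \<in> {..n - i}"
    have "((A + (\<mu> + i)) choose (\<mu> + i)) * ((\<mu> + i) choose i)
        = ((A + (\<mu> + i)) choose i) * ((A + (\<mu> + i) - i) choose (\<mu> + i - i))"
      by (rule choose_mult) auto
    also have "\<dots> = ((A + i + \<mu>) choose i) * ((A + \<mu>) choose \<mu>)" by (simp add: add_ac)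
    also have "((A + i + \<mu>) choose i) * ((A + \<mu>) choose \<mu>) = ((A + i) choose i) * ((A + i + \<mu>) choose \<mu>)"
    proof -
      have "((A + i + \<mu>) choose (\<mu> + i)) * ((\<mu> + i) choose \<mu>)
          = ((A + i + \<mu>) choose \<mu>) * ((A + i + \<mu> - \<mu>) choose (\<mu> + i - \<mu>))"
        by (rule choose_mult) auto
      moreover have "((A + i + \<mu>) choose (\<mu> + i)) * ((\<mu> + i) choose i)
          = ((A + i + \<mu>) choose i) * ((A + i + \<mu> - i) choose (\<mu> + i - i))"
        by (rule choose_mult) auto
      moreover have "((\<mu> + i) choose i) = ((\<mu> + i) choose \<mu>)"
        using binomial_symmetric[of i "\<mu> + i"] by simp
      ultimately show ?thesis by (simp add: mult.commute add.commute add.left_commute)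
    qed
    finally have "real ((A + (\<mu> + i)) choose (\<mu> + i)) * real ((\<mu> + i) choose i)
       = real ((A + i) choose i) * real ((A + i + \<mu>) choose \<mu>)"
      by (metis of_nat_mult)
    moreover have "A + i + 1 + (b - i) = A + 1 + b" using True assms by simp
    ultimately show "(-1) ^ (\<mu> + i) * real ((A + (\<mu> + i)) choose (\<mu> + i)) * real ((A + 1 + b) choose (n - (\<mu> + i))) * real ((\<mu> + i) choose i)
      = (-1) ^ i * real ((A + i) choose i) *
      ((-1) ^ \<mu> * real ((A + i + \<mu>) choose \<mu>) * real ((A + i + 1 + (b - i)) choose (n - i - \<mu>)))"
      by (simp add: power_add mult_ac add.commute)
  qed
  also have "\<dots> = (-1) ^ i * real ((A + i) choose i) * real ((b - i) choose (n - i))"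
    by (simp only: sum_distrib_left[symmetric] vandermonde_neg)
  finally show ?thesis using True by simp
qed

text \<open>Up to the sign \<open>(-1) ^ \<mu>\<close>, the coefficients of the Pade denominator for
  a tail of \<open>(1 - z) ^ (- b - 1)\<close>. Being products of two binomials, they have prime
  factorizations accessible through Legendre's formula.\<close>

definition pq :: "nat \<Rightarrow> nat \<Rightarrow> nat \<Rightarrow> nat \<Rightarrow> nat" where
  "pq A b n \<mu> = ((A + \<mu>) choose \<mu>) * ((A + 1 + b) choose (n - \<mu>))"

text \<open>Up to powers of \<open>z\<close>, this is a coefficient of the product of the series
  tail with the denominator. It is \<open>0\<close> for \<open>j < n\<close>, which is the Pade
  condition. The last binomial is expanded in the basis \<open>\<mu> choose i\<close>,
  \<open>shifted_sum\<close> evaluates each moment, and \<open>vandermonde_neg\<close> recombines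
  them.\<close>

lemma pade_vanishing:
  fixes A b n j :: nat
  assumes nb: "n \<le> b" and nA: "n \<le> A"
  shows "(\<Sum>\<mu>\<le>n. (-1) ^ \<mu> * real (pq A b n \<mu>) * real ((b + (A - n + 1 + j) + \<mu>) choose b))
     = real (j choose n) * real ((A + 1 + b - n + j) choose (b - n))"
proof -
  define X where "X = b + (A - n + 1 + j)"
  have V: "real ((X + \<mu>) choose b) = (\<Sum>i\<le>b. real (\<mu> choose i) * real (X choose (b - i)))" for \<mu>
    using vandermonde[of \<mu> X b] by (simp add: add.commute flip: of_nat_mult of_nat_sum)
  have "(\<Sum>\<mu>\<le>n. (-1) ^ \<mu> * real (pq A b n \<mu>) * real ((X + \<mu>) choose b))
     = (\<Sum>i\<le>b. (\<Sum>\<mu>\<le>n. (-1) ^ \<mu> * real ((A + \<mu>) choose \<mu>) * real ((A + 1 + b) choose (n - \<mu>)) * real (\<mu> choose i)) * real (X choose (b - i)))"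
    unfolding V pq_def sum_distrib_left sum_distrib_right
    by (subst sum.swap) (simp add: mult_ac)
  also have "\<dots> = (\<Sum>i\<le>b. (if i \<le> n then (-1) ^ i * real ((A + i) choose i) * real ((b - i) choose (n - i)) else 0) * real (X choose (b - i)))"
    by (simp only: shifted_sum[OF nb])
  also have "\<dots> = (\<Sum>i\<le>n. (-1) ^ i * real ((A + i) choose i) * real ((b - i) choose (n - i)) * real (X choose (b - i)))"
    using nb by (intro sum.mono_neutral_cong_right) auto
  also have "\<dots> = (\<Sum>i\<le>n. real (X choose (b - n)) * ((-1) ^ i * real ((A + i) choose i) * real ((A + 1 + j) choose (n - i))))"
  proof (intro sum.cong refl)
    fix i assume "i \<in> {..n}"
    hence i: "i \<le> n" by simp
    have "(X choose (b - i)) * ((b - i) choose (b - n)) = (X choose (b - n)) * ((X - (b - n)) choose (b - i - (b - n)))"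
      using i nb by (intro choose_mult) (auto simp: X_def)
    moreover have "((b - i) choose (b - n)) = ((b - i) choose (n - i))"
      using binomial_symmetric[of "n - i" "b - i"] i nb by simp
    moreover have "X - (b - n) = A + 1 + j" "b - i - (b - n) = n - i"
      using i nb nA by (auto simp: X_def)
    ultimately have "(X choose (b - i)) * ((b - i) choose (n - i)) = (X choose (b - n)) * ((A + 1 + j) choose (n - i))"
      by simp
    hence "real (X choose (b - i)) * real ((b - i) choose (n - i)) = real (X choose (b - n)) * real ((A + 1 + j) choose (n - i))"
      by (metis of_nat_mult)
    thus "(-1) ^ i * real ((A + i) choose i) * real ((b - i) choose (n - i)) * real (X choose (b - i))
       = real (X choose (b - n)) * ((-1) ^ i * real ((A + i) choose i) * real ((A + 1 + j) choose (n - i)))"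
      by (simp add: mult_ac)
  qed
  also have "\<dots> = real (X choose (b - n)) * real (j choose n)"
    by (simp only: sum_distrib_left[symmetric] vandermonde_neg)
  finally have "(\<Sum>\<mu>\<le>n. (-1) ^ \<mu> * real (pq A b n \<mu>) * real ((X + \<mu>) choose b))
    = real (X choose (b - n)) * real (j choose n)" .
  moreover have "X = A + 1 + b - n + j" using nA nb by (simp add: X_def)
  ultimately show ?thesis unfolding X_def[symmetric] by (metis mult.commute)
qed


lemma sum_choose_choose:
  fixes p A N :: nat
  shows "(\<Sum>t\<le>N. real ((p + t) choose t) * real ((A + N - t) choose (N - t))) = real ((p + A + N + 1) choose N)"
proof -
  have "(\<Sum>t\<le>N. (-1) ^ N * (real ((p + t) choose t) * real ((A + N - t) choose (N - t))))
     = (\<Sum>t=0..N. ((- real p - 1) gchoose t) * ((- real A - 1) gchoose (N - t)))"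
    unfolding gbinomial_neg_nat atMost_atLeast0
  proof (intro sum.cong refl)
    fix t assume "t \<in> {0..N}"
    hence t: "t \<le> N" by simp
    have "(-1::real) ^ N = (-1) ^ t * (-1) ^ (N - t)"
      using t by (simp flip: power_add)
    thus "(-1) ^ N * (real ((p + t) choose t) * real ((A + N - t) choose (N - t)))
       = (-1) ^ t * real ((p + t) choose t) * ((-1) ^ (N - t) * real ((A + (N - t)) choose (N - t)))"
      using t by (simp add: mult_ac)
  qed
  also have "\<dots> = ((- real p - 1 + (- real A - 1)) gchoose N)"
    by (rule gbinomial_Vandermonde)
  also have "- real p - 1 + (- real A - 1) = - real (p + A + 1) - 1" by simp
  also have "(\<dots> gchoose N) = (-1) ^ N * real ((p + A + 1 + N) choose N)"
    by (rule gbinomial_neg_nat)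
  finally have "(-1) ^ N * (\<Sum>t\<le>N. real ((p + t) choose t) * real ((A + N - t) choose (N - t)))
      = (-1) ^ N * real ((p + A + 1 + N) choose N)"
    by (simp only: sum_distrib_left)
  thus ?thesis by (simp add: add_ac)
qed

lemma neg_binomial_sums:
  fixes z :: real
  assumes "\<bar>z\<bar> < 1"
  shows "(\<lambda>\<nu>. real ((b + \<nu>) choose b) * z ^ \<nu>) sums (1 / (1 - z) ^ Suc b)"
proof -
  have "(\<lambda>\<nu>. ((- real b - 1) gchoose \<nu>) * (-z) ^ \<nu>) sums (1 + - z) powr (- real b - 1)"
    using assms by (intro gen_binomial_real) simp
  moreover have "((- real b - 1) gchoose \<nu>) * (-z) ^ \<nu> = real ((b + \<nu>) choose b) * z ^ \<nu>" for \<nu>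
  proof -
    have "((- real b - 1) gchoose \<nu>) * (-z) ^ \<nu> = ((-1) ^ \<nu> * (-1) ^ \<nu>) * (real ((b + \<nu>) choose \<nu>) * z ^ \<nu>)"
      unfolding gbinomial_neg_nat power_minus[of z] by (simp add: mult_ac)
    also have "(-1::real) ^ \<nu> * (-1) ^ \<nu> = 1" by (simp flip: power_mult_distrib)
    also have "((b + \<nu>) choose \<nu>) = ((b + \<nu>) choose b)"
      using binomial_symmetric[of \<nu> "b + \<nu>"] by simp
    finally show ?thesis by simp
  qed
  moreover have "(1 + - z) powr (- real b - 1) = 1 / (1 - z) ^ Suc b"
  proof -
    have pos: "1 - z > 0" using assms by auto
    have "- real b - 1 = - real (Suc b)" by simp
    hence "(1 + - z) powr (- real b - 1) = (1 - z) powr (- real (Suc b))"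
      by (simp only: add_uminus_conv_diff)
    also have "\<dots> = inverse ((1 - z) powr real (Suc b))" by (rule powr_minus)
    also have "(1 - z) powr real (Suc b) = (1 - z) ^ Suc b" using pos by (rule powr_realpow)
    finally show ?thesis by (simp add: divide_inverse)
  qed
  ultimately show ?thesis by simp
qed

text \<open>Both sides are the trinomial coefficient of \<open>n + i + t\<close> with parts
  \<open>n\<close>, \<open>i\<close>, \<open>t\<close>.\<close>

lemma choose_product_swap:
  "((n + i) choose n) * ((n + i + t) choose t) = ((n + t) choose n) * ((n + t + i) choose (n + t))"
proof -
  have "((n + t + i) choose (n + t)) * ((n + t) choose n) = ((n + t + i) choose n) * ((n + t + i - n) choose (n + t - n))"
    by (rule choose_mult) auto
  moreover have "((n + t + i) choose (n + i)) * ((n + i) choose n) = ((n + t + i) choose n) * ((n + t + i - n) choose (n + i - n))"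
    by (rule choose_mult) auto
  moreover have "((n + t + i) choose (n + i)) = ((n + i + t) choose t)"
    using binomial_symmetric[of t "n + i + t"] by (simp add: add_ac)
  moreover have "((t + i) choose i) = ((t + i) choose t)"
    using binomial_symmetric[of t "t + i"] by simp
  ultimately show ?thesis by (simp add: mult.commute add.commute add.left_commute)
qed

text \<open>Needed at \<open>z = -1/8\<close>, where the series alternates while the finite sum has
  only positive terms, so that sign and size of the remainder become visible.
  \<open>sum_choose_choose\<close> expands the second binomial over \<open>t\<close>; for fixed
  \<open>t\<close> the sum over \<open>i\<close> is a negative binomial series.\<close>

lemma tail_sums:
  fixes z :: real
  assumes "\<bar>z\<bar> < 1"
  shows "(\<lambda>i. z ^ i * real ((n + i) choose n) * real ((A + 1 + n + N + i) choose N)) sums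
    (\<Sum>t\<le>N. real ((A + N - t) choose A) * real ((n + t) choose n) * (1 / (1 - z) ^ (n + t + 1)))"
proof -
  have "(\<lambda>i. \<Sum>t\<le>N. real ((A + N - t) choose A) * real ((n + t) choose n) * (real ((n + t + i) choose (n + t)) * z ^ i))
    sums (\<Sum>t\<le>N. real ((A + N - t) choose A) * real ((n + t) choose n) * (1 / (1 - z) ^ Suc (n + t)))"
    by (intro sums_sum sums_mult neg_binomial_sums assms)
  moreover have "(\<Sum>t\<le>N. real ((A + N - t) choose A) * real ((n + t) choose n) * (real ((n + t + i) choose (n + t)) * z ^ i))
      = z ^ i * real ((n + i) choose n) * real ((A + 1 + n + N + i) choose N)" for i
  proof -
    have e1: "real ((A + 1 + n + N + i) choose N) = (\<Sum>t\<le>N. real ((n + i + t) choose t) * real ((A + N - t) choose (N - t)))"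
      using sum_choose_choose[of "n + i" A N] by (simp add: add_ac)
    show ?thesis unfolding e1 sum_distrib_left
    proof (intro sum.cong refl)
      fix t assume "t \<in> {..N}"
      hence t: "t \<le> N" by simp
      have "((A + N - t) choose (N - t)) = ((A + N - t) choose A)"
        using binomial_symmetric[of A "A + N - t"] t by simp
      moreover have "real ((n + i) choose n) * real ((n + i + t) choose t) = real ((n + t) choose n) * real ((n + t + i) choose (n + t))"
        by (metis choose_product_swap of_nat_mult)
      ultimately show "real ((A + N - t) choose A) * real ((n + t) choose n) * (real ((n + t + i) choose (n + t)) * z ^ i)
        = z ^ i * real ((n + i) choose n) * (real ((n + i + t) choose t) * real ((A + N - t) choose (N - t)))"
        by (simp add: mult_ac)
    qed
  qed
  ultimately show ?thesis by simp
qed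

definition padeQ :: "nat \<Rightarrow> nat \<Rightarrow> nat \<Rightarrow> nat" where
  "padeQ A b n = (\<Sum>\<mu>\<le>n. pq A b n \<mu> * 8 ^ \<mu>)"

text \<open>Absolute value of the remainder in \<open>pade_form\<close>. The power of
  \<open>8\<close> is the leading power of \<open>z = -1/8\<close>, and \<open>8 / 9\<close> is
  \<open>1 / (1 - z)\<close>.\<close>

definition padeE :: "nat \<Rightarrow> nat \<Rightarrow> nat \<Rightarrow> real" where
  "padeE A b n = 2 ^ (b + 1) / 8 ^ (A + 1) *
     (\<Sum>t\<le>b - n. real ((A + (b - n) - t) choose A) * real ((n + t) choose n) * (8 / 9) ^ (n + t + 1))"

lemma padeE_pos: "padeE A b n > 0"
  unfolding padeE_def by (intro mult_pos_pos sum_pos) auto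

text \<open>Multiply the expansion of \<open>(8/9) ^ (b + 1)\<close> at \<open>-1/8\<close> by
  \<open>8 ^ \<mu>\<close> and split off the first \<open>A - n + 1 + \<mu>\<close> terms. The
  factor \<open>2 ^ (b + 1)\<close> turns \<open>8/9\<close> into \<open>16/9\<close> and makes
  these terms integers, because \<open>3 * (A - n) \<le> b + 1\<close>. In the combination of the
  tails the first \<open>n\<close> terms cancel by \<open>pade_vanishing\<close>, and
  \<open>tail_sums\<close> evaluates the rest. The integer part stays a combination of the
  \<open>pq A b n \<mu>\<close>, so that any common divisor of these divides it.\<close>

theorem pade_form:
  assumes nb: "n \<le> b" and nA: "n \<le> A" and A3: "3 * (A - n) \<le> b + 1"
  shows "\<exists>I :: nat \<Rightarrow> int. (16 / 9) ^ (b + 1) * real (padeQ A b n)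
     = (\<Sum>\<mu>\<le>n. real (pq A b n \<mu>) * of_int (I \<mu>)) + (-1) ^ (A + 1) * padeE A b n"
proof -
  define a where "a = A - n + 1"
  define h where "h = (\<lambda>\<nu>. real ((b + \<nu>) choose b) * (-1/8 :: real) ^ \<nu>)"
  have hs: "h sums (8/9) ^ (b + 1)"
    using neg_binomial_sums[of "-1/8" b] by (simp add: h_def power_divide)
  have int: "\<exists>m::int. 2 ^ (b + 1) * (\<Sum>\<nu><a + \<mu>. h \<nu> * 8 ^ \<mu>) = of_int m" for \<mu>
  proof -
    have "2 ^ (b + 1) * (h \<nu> * 8 ^ \<mu>) \<in> \<int>" if "\<nu> < a + \<mu>" for \<nu>
    proof -
      have le: "3 * \<nu> \<le> b + 1 + 3 * \<mu>" using that A3 by (simp add: a_def)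
      have e1: "(-1/8 :: real) ^ \<nu> = (-1) ^ \<nu> / 2 ^ (3 * \<nu>)"
        by (subst power_divide) (simp add: power_mult)
      have e2: "(2::real) ^ (b + 1 + 3 * \<mu>) = 2 ^ (b + 1) * 8 ^ \<mu>"
        by (simp add: power_add power_mult)
      have "2 ^ (b + 1) * (h \<nu> * 8 ^ \<mu>) = real ((b + \<nu>) choose b) * (-1) ^ \<nu> * (2 ^ (b + 1 + 3 * \<mu>) / 2 ^ (3 * \<nu>))"
        unfolding h_def e1 e2 by (simp only: mult_ac times_divide_eq_left times_divide_eq_right)
      also have "2 ^ (b + 1 + 3 * \<mu>) / (2::real) ^ (3 * \<nu>) = 2 ^ (b + 1 + 3 * \<mu> - 3 * \<nu>)"
        using le by (simp add: power_diff)
      finally show ?thesis by (simp add: Ints_mult Ints_power)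
    qed
    hence "2 ^ (b + 1) * (\<Sum>\<nu><a + \<mu>. h \<nu> * 8 ^ \<mu>) \<in> \<int>"
      unfolding sum_distrib_left by (intro Ints_sum) auto
    thus ?thesis by (auto elim!: Ints_cases)
  qed
  then obtain I :: "nat \<Rightarrow> int" where I: "\<And>\<mu>. 2 ^ (b + 1) * (\<Sum>\<nu><a + \<mu>. h \<nu> * 8 ^ \<mu>) = of_int (I \<mu>)"
    by metis
  have tail: "(\<lambda>j. h (j + (a + \<mu>)) * 8 ^ \<mu>) sums ((8/9) ^ (b + 1) * 8 ^ \<mu> - (\<Sum>\<nu><a + \<mu>. h \<nu> * 8 ^ \<mu>))" for \<mu>
    using sums_split_initial_segment[OF sums_mult2[OF hs, of "8 ^ \<mu>"], of "a + \<mu>"] by simp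
  have tot: "(\<lambda>j. \<Sum>\<mu>\<le>n. real (pq A b n \<mu>) * (h (j + (a + \<mu>)) * 8 ^ \<mu>)) sums
     (\<Sum>\<mu>\<le>n. real (pq A b n \<mu>) * ((8/9) ^ (b + 1) * 8 ^ \<mu> - (\<Sum>\<nu><a + \<mu>. h \<nu> * 8 ^ \<mu>)))"
    by (intro sums_sum sums_mult tail)
  have term_eq: "(\<Sum>\<mu>\<le>n. real (pq A b n \<mu>) * (h (j + (a + \<mu>)) * 8 ^ \<mu>))
      = (-1/8) ^ (a + j) * (real (j choose n) * real ((A + 1 + b - n + j) choose (b - n)))" for j
  proof -
    have "real (pq A b n \<mu>) * (h (j + (a + \<mu>)) * 8 ^ \<mu>)
       = (-1/8) ^ (a + j) * ((-1) ^ \<mu> * real (pq A b n \<mu>) * real ((b + (A - n + 1 + j) + \<mu>) choose b))" for \<mu>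
    proof -
      have "(-1/8 :: real) ^ (j + (a + \<mu>)) * 8 ^ \<mu> = (-1/8) ^ (a + j) * ((-1/8) ^ \<mu> * 8 ^ \<mu>)"
        by (simp add: power_add mult_ac)
      also have "(-1/8 :: real) ^ \<mu> * 8 ^ \<mu> = (-1) ^ \<mu>"
        by (simp flip: power_mult_distrib)
      finally have e1: "(-1/8 :: real) ^ (j + (a + \<mu>)) * 8 ^ \<mu> = (-1/8) ^ (a + j) * (-1) ^ \<mu>" .
      have e2: "b + (j + (a + \<mu>)) = b + (A - n + 1 + j) + \<mu>" by (simp add: a_def)
      show ?thesis unfolding h_def mult.assoc e1 e2 by (simp only: mult_ac)
    qed
    thus ?thesis by (simp only: sum_distrib_left[symmetric] pade_vanishing[OF nb nA])
  qed
  have "(\<lambda>j. (-1/8) ^ (a + j) * (real (j choose n) * real ((A + 1 + b - n + j) choose (b - n)))) sums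
     (\<Sum>\<mu>\<le>n. real (pq A b n \<mu>) * ((8/9) ^ (b + 1) * 8 ^ \<mu> - (\<Sum>\<nu><a + \<mu>. h \<nu> * 8 ^ \<mu>)))" (is "?f sums ?s")
    using tot by (simp only: term_eq)
  \<comment> \<open>The terms below \<open>n\<close> contain \<open>j choose n = 0\<close>; the
    first surviving power of \<open>-1/8\<close> is therefore \<open>A + 1\<close>.\<close>
  hence "(\<lambda>i. ?f (i + n)) sums ?s"
    using sums_split_initial_segment[of ?f ?s n] by (simp add: binomial_eq_0)
  moreover have "?f (i + n) = (-1/8) ^ (A + 1) * ((-1/8) ^ i * real ((n + i) choose n) * real ((A + 1 + n + (b - n) + i) choose (b - n)))" for i
  proof -
    have "A + 1 + b - n + (i + n) = A + 1 + n + (b - n) + i" using nb by simp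
    moreover have "a + (i + n) = (A + 1) + i" using nA by (simp add: a_def)
    ultimately show ?thesis by (simp only: power_add) (simp add: mult_ac add.commute)
  qed
  moreover have "(\<lambda>i. (-1/8) ^ (A + 1) * ((-1/8) ^ i * real ((n + i) choose n) * real ((A + 1 + n + (b - n) + i) choose (b - n)))) sums
     ((-1/8) ^ (A + 1) * (\<Sum>t\<le>b - n. real ((A + (b - n) - t) choose A) * real ((n + t) choose n) * (1 / (1 - (-1/8)) ^ (n + t + 1))))"
    by (intro sums_mult tail_sums) simp
  ultimately have "?s = (-1/8) ^ (A + 1) * (\<Sum>t\<le>b - n. real ((A + (b - n) - t) choose A) * real ((n + t) choose n) * (1 / (1 - (-1/8)) ^ (n + t + 1)))"
    by (simp only: sums_unique2)
  also have "(\<lambda>t. 1 / (1 - (-1/8::real)) ^ (n + t + 1)) = (\<lambda>t. (8/9) ^ (n + t + 1))"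
    by (simp add: power_divide)
  also have "(-1/8 :: real) ^ (A + 1) = (-1) ^ (A + 1) / 8 ^ (A + 1)" by (rule power_divide)
  finally have s: "2 ^ (b + 1) * ?s = (-1) ^ (A + 1) * padeE A b n"
    by (simp add: padeE_def)
  have "2 ^ (b + 1) * ?s = (2 * (8/9)) ^ (b + 1) * real (padeQ A b n) - (\<Sum>\<mu>\<le>n. real (pq A b n \<mu>) * of_int (I \<mu>))"
    unfolding padeQ_def I[symmetric] power_mult_distrib
    by (simp add: sum_subtractf sum_distrib_left algebra_simps)
  hence "(16 / 9) ^ (b + 1) * real (padeQ A b n) = (\<Sum>\<mu>\<le>n. real (pq A b n \<mu>) * of_int (I \<mu>)) + (-1) ^ (A + 1) * padeE A b n"
    unfolding s by simp
  thus ?thesis by blast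
qed

section \<open>Valuations and the common divisor of the coefficients\<close>

text \<open>Legendre's formula. An arbitrary cut-off \<open>L \<ge> n\<close> lets several
  factorials share one index range, so that their sums can be compared term by term.\<close>

lemma multiplicity_fact:
  assumes p: "prime (p :: nat)" and "n \<le> L"
  shows "multiplicity p (fact n :: nat) = (\<Sum>i\<in>{1..L}. n div p ^ i)"
  using assms(2)
proof (induction n)
  case 0
  show ?case by simp
next
  case (Suc n)
  have sub: "multiplicity p (Suc n) \<le> L"
  proof -
    have "p ^ multiplicity p (Suc n) dvd Suc n" by (rule multiplicity_dvd)
    hence "p ^ multiplicity p (Suc n) \<le> Suc n" by (rule dvd_imp_le) simp
    moreover have "multiplicity p (Suc n) < p ^ multiplicity p (Suc n)"
      using prime_gt_1_nat[OF p] by (simp add: power_gt_expt)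
    ultimately show ?thesis using Suc.prems by linarith
  qed
  have "multiplicity p (fact (Suc n) :: nat) = multiplicity p (Suc n) + multiplicity p (fact n :: nat)"
    using p by (simp add: prime_elem_multiplicity_mult_distrib del: mult_Suc)
  also have "multiplicity p (Suc n) = card {i\<in>{1..L}. p ^ i dvd Suc n}"
  proof -
    define m where "m = multiplicity p (Suc n)"
    have iff: "p ^ i dvd Suc n \<longleftrightarrow> i \<le> m" for i
      unfolding m_def using p not_prime_unit[of p]
      by (intro power_dvd_iff_le_multiplicity finite_divisor_powers) auto
    have "m \<le> L" using sub by (simp only: m_def)
    hence "{i\<in>{1..L}. i \<le> m} = {1..m}" by auto
    thus ?thesis unfolding iff m_def[symmetric] by simp
  qed
  also have "\<dots> = (\<Sum>i\<in>{1..L}. if p ^ i dvd Suc n then 1 else 0)"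
    by (simp add: sum.If_cases Int_def)
  also have "\<dots> + multiplicity p (fact n :: nat) = (\<Sum>i\<in>{1..L}. (if p ^ i dvd Suc n then 1 else 0) + n div p ^ i)"
    using Suc by (simp add: sum.distrib)
  also have "\<dots> = (\<Sum>i\<in>{1..L}. Suc n div p ^ i)"
    by (intro sum.cong refl) (auto simp: div_Suc dvd_eq_mod_eq_0)
  finally show ?case .
qed

lemma multiplicity_choose:
  assumes p: "prime (p :: nat)" and "k \<le> m" "m \<le> L"
  shows "multiplicity p (m choose k) + (\<Sum>i\<in>{1..L}. k div p ^ i + (m - k) div p ^ i) = (\<Sum>i\<in>{1..L}. m div p ^ i)"
proof -
  have "multiplicity p (fact m :: nat) = multiplicity p (fact k * fact (m - k) * (m choose k))"
    using binomial_fact_lemma[OF assms(2)] by simp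
  also have "\<dots> = multiplicity p (fact k :: nat) + multiplicity p (fact (m - k) :: nat) + multiplicity p (m choose k)"
    using p assms(2) by (simp add: prime_elem_multiplicity_mult_distrib)
  finally show ?thesis
    using assms by (simp add: multiplicity_fact[OF p, of _ L] sum.distrib)
qed

text \<open>The contribution of a prime power \<open>d\<close> to the valuation of
  \<open>pq\<close>, bounded below uniformly in \<open>\<mu>\<close>. If the truncated difference is
  \<open>0\<close>, both binomials contribute a nonnegative amount. Otherwise it suffices that
  splitting \<open>n\<close> does not increase the sum of the floors, and that adding
  \<open>N + 1\<close> raises a floor by at most \<open>N div d + 1\<close>.\<close>

lemma pq_floor:
  fixes A n N \<mu> d :: nat
  assumes "\<mu> \<le> n" "d > 0"
  shows "\<mu> div d + A div d + (n - \<mu>) div d + (A + N + 1 + \<mu>) div d + ((A + n + N + 1) div d - (A div d + n div d + N div d + 1))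
     \<le> (A + \<mu>) div d + (A + n + N + 1) div d"
proof -
  have a: "\<mu> div d + A div d \<le> (A + \<mu>) div d"
    using div_add1_eq[of A \<mu> d] by simp
  have b: "(n - \<mu>) div d + (A + N + 1 + \<mu>) div d \<le> (A + n + N + 1) div d"
  proof -
    have "A + n + N + 1 = (n - \<mu>) + (A + N + 1 + \<mu>)" using assms by simp
    thus ?thesis using div_add1_eq[of "n - \<mu>" "A + N + 1 + \<mu>" d] by (metis le_add1)
  qed
  have c: "\<mu> div d + (n - \<mu>) div d \<le> n div d"
    using div_add1_eq[of \<mu> "n - \<mu>" d] assms by simp
  have e: "(A + N + 1 + \<mu>) div d \<le> (A + \<mu>) div d + N div d + 1"
  proof -
    have "N + 1 \<le> (N div d + 1) * d"
      using dividend_less_div_times[OF assms(2), of N] by simp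
    hence "A + N + 1 + \<mu> \<le> (A + \<mu>) + (N div d + 1) * d" by simp
    hence "(A + N + 1 + \<mu>) div d \<le> ((A + \<mu>) + (N div d + 1) * d) div d" by (rule div_le_mono)
    also have "\<dots> = (N div d + 1) + (A + \<mu>) div d"
      using assms(2) by (intro div_mult_self1) simp
    finally show ?thesis by simp
  qed
  show ?thesis
  proof (cases "(A + n + N + 1) div d \<le> A div d + n div d + N div d + 1")
    case True thus ?thesis using a b by linarith
  next
    case False thus ?thesis using c e by linarith
  qed
qed

definition content :: "nat \<Rightarrow> (nat \<Rightarrow> bool) \<Rightarrow> nat" where
  "content y e = (\<Prod>d\<in>{1..y}. if primepow d \<and> e (y div d) then aprimedivisor d else 1)"

lemma content_pos: "content y e > 0"
  unfolding content_def by (intro prod_pos) (auto simp: aprimedivisor_pos_nat dest: primepow_gt_Suc_0)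

lemma ln_content: "ln (real (content y e)) = (\<Sum>d\<in>{1..y}. mangoldt d * of_bool (e (y div d)))"
proof -
  have "ln (real (content y e)) = (\<Sum>d\<in>{1..y}. ln (real (if primepow d \<and> e (y div d) then aprimedivisor d else 1)))"
    unfolding content_def of_nat_prod
    by (rule ln_prod) (auto simp: aprimedivisor_pos_nat dest: primepow_gt_Suc_0)
  also have "\<dots> = (\<Sum>d\<in>{1..y}. mangoldt d * of_bool (e (y div d)))"
    by (intro sum.cong refl) (auto simp: mangoldt_def)
  finally show ?thesis .
qed

lemma multiplicity_content:
  assumes p: "prime (p :: nat)" and L: "y \<le> L"
  shows "multiplicity p (content y e) \<le> (\<Sum>i\<in>{1..L}. of_bool (e (y div p ^ i)))"
proof -
  have fin: "0 < (if primepow d \<and> e (y div d) then aprimedivisor d else 1)" for d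
    using aprimedivisor_pos_nat[of d] primepow_gt_Suc_0[of d] by (cases "primepow d") auto
  have "multiplicity p (content y e) = (\<Sum>d\<in>{1..y}. multiplicity p (if primepow d \<and> e (y div d) then aprimedivisor d else 1))"
    unfolding content_def
  proof (rule prime_elem_multiplicity_prod_distrib)
    show "0 \<notin> (\<lambda>d. if primepow d \<and> e (y div d) then aprimedivisor d else 1) ` {1..y}"
      using fin by (metis (no_types, lifting) imageE less_irrefl)
  qed (use p in auto)
  also have "\<dots> = (\<Sum>d\<in>{1..y}. if primepow d \<and> e (y div d) \<and> aprimedivisor d = p then 1 else 0)"
  proof (intro sum.cong refl)
    fix d assume d: "d \<in> {1..y}"
    show "multiplicity p (if primepow d \<and> e (y div d) then aprimedivisor d else 1) = (if primepow d \<and> e (y div d) \<and> aprimedivisor d = p then 1 else 0)"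
    proof (cases "primepow d \<and> e (y div d)")
      case True
      hence "prime (aprimedivisor d)"
        by (intro prime_aprimedivisor') (auto simp: primepow_def prime_gt_0_nat)
      thus ?thesis using True p by (auto simp: prime_multiplicity_other multiplicity_self not_prime_unit)
    qed auto
  qed
  also have "\<dots> = card {d\<in>{1..y}. primepow d \<and> e (y div d) \<and> aprimedivisor d = p}"
    by (simp add: sum.If_cases Int_def)
  also have "\<dots> \<le> card ((\<lambda>i. p ^ i) ` {i\<in>{1..L}. e (y div p ^ i)})"
  proof (intro card_mono subsetI)
    fix d assume "d \<in> {d\<in>{1..y}. primepow d \<and> e (y div d) \<and> aprimedivisor d = p}"
    hence d: "d \<le> y" "primepow d" "e (y div d)" "aprimedivisor d = p" by auto
    from d(2) obtain r i where ri: "prime r" "i > 0" "d = r ^ i"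
      by (auto simp: primepow_def)
    have "r = p" using ri d(4) by (simp add: aprimedivisor_prime_power)
    moreover have "i < d" using ri prime_gt_1_nat[OF ri(1)] by (simp add: power_gt_expt)
    ultimately show "d \<in> (\<lambda>i. p ^ i) ` {i\<in>{1..L}. e (y div p ^ i)}"
      using ri d L by auto
  qed auto
  also have "\<dots> \<le> card {i\<in>{1..L}. e (y div p ^ i)}" by (rule card_image_le) auto
  also have "\<dots> = (\<Sum>i\<in>{1..L}. of_bool (e (y div p ^ i)))"
    by (simp add: of_bool_def sum.If_cases Int_def)
  finally show ?thesis .
qed

text \<open>The hypothesis says that the fractional parts of \<open>A / d\<close>,
  \<open>n / d\<close>, \<open>N / d\<close> together with \<open>1 / d\<close> add up to at least
  \<open>2\<close>. Then \<open>pq_floor\<close> gains at least one factor at \<open>d\<close> for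
  every \<open>\<mu>\<close> simultaneously, and the divisibility follows prime by prime.\<close>

lemma content_dvd_pq:
  assumes e: "\<And>d. d > 0 \<Longrightarrow> e (y div d) \<Longrightarrow> A div d + n div d + N div d + 2 \<le> (A + n + N + 1) div d"
    and "\<mu> \<le> n"
  shows "content y e dvd pq A (n + N) n \<mu>"
proof (rule multiplicity_le_imp_dvd)
  show "content y e \<noteq> 0" using content_pos[of y e] by simp
next
  fix p :: nat assume p: "prime p"
  define L where "L = y + A + n + N + 1"
  have "multiplicity p (content y e) \<le> (\<Sum>i\<in>{1..L}. of_bool (e (y div p ^ i)))"
    by (rule multiplicity_content[OF p]) (simp add: L_def)
  also have "\<dots> \<le> (\<Sum>i\<in>{1..L}. (A + n + N + 1) div p ^ i - (A div p ^ i + n div p ^ i + N div p ^ i + 1))"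
  proof (rule sum_mono)
    fix i
    have "p ^ i > 0" using prime_gt_0_nat[OF p] by simp
    from e[OF this] show "of_bool (e (y div p ^ i)) \<le> (A + n + N + 1) div p ^ i - (A div p ^ i + n div p ^ i + N div p ^ i + 1)"
      by (cases "e (y div p ^ i)") auto
  qed
  finally have 1: "multiplicity p (content y e) \<le> (\<Sum>i\<in>{1..L}. (A + n + N + 1) div p ^ i - (A div p ^ i + n div p ^ i + N div p ^ i + 1))" (is "_ \<le> ?S") .
  have m1: "multiplicity p ((A + \<mu>) choose \<mu>) + (\<Sum>i\<in>{1..L}. \<mu> div p ^ i + A div p ^ i) = (\<Sum>i\<in>{1..L}. (A + \<mu>) div p ^ i)"
    using multiplicity_choose[OF p, of \<mu> "A + \<mu>" L] assms(2) by (simp add: L_def)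
  have m2: "multiplicity p ((A + 1 + (n + N)) choose (n - \<mu>)) + (\<Sum>i\<in>{1..L}. (n - \<mu>) div p ^ i + (A + N + 1 + \<mu>) div p ^ i)
     = (\<Sum>i\<in>{1..L}. (A + n + N + 1) div p ^ i)"
  proof -
    have "A + 1 + (n + N) - (n - \<mu>) = A + N + 1 + \<mu>" using assms(2) by simp
    thus ?thesis
      using multiplicity_choose[OF p, of "n - \<mu>" "A + 1 + (n + N)" L] by (simp add: L_def add_ac)
  qed
  have "?S + (\<Sum>i\<in>{1..L}. \<mu> div p ^ i + A div p ^ i) + (\<Sum>i\<in>{1..L}. (n - \<mu>) div p ^ i + (A + N + 1 + \<mu>) div p ^ i)
      = (\<Sum>i\<in>{1..L}. \<mu> div p ^ i + A div p ^ i + (n - \<mu>) div p ^ i + (A + N + 1 + \<mu>) div p ^ i + ((A + n + N + 1) div p ^ i - (A div p ^ i + n div p ^ i + N div p ^ i + 1)))"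
    by (simp add: sum.distrib)
  also have "\<dots> \<le> (\<Sum>i\<in>{1..L}. (A + \<mu>) div p ^ i + (A + n + N + 1) div p ^ i)"
    by (intro sum_mono pq_floor assms(2)) (use prime_gt_0_nat[OF p] in auto)
  also have "\<dots> = (\<Sum>i\<in>{1..L}. (A + \<mu>) div p ^ i) + (\<Sum>i\<in>{1..L}. (A + n + N + 1) div p ^ i)"
    by (rule sum.distrib)
  finally have "?S \<le> multiplicity p ((A + \<mu>) choose \<mu>) + multiplicity p ((A + 1 + (n + N)) choose (n - \<mu>))"
    unfolding m1[symmetric] m2[symmetric] by linarith
  also have "\<dots> = multiplicity p (pq A (n + N) n \<mu>)"
    unfolding pq_def using p assms(2) by (subst prime_elem_multiplicity_mult_distrib) auto
  finally show "multiplicity p (content y e) \<le> multiplicity p (pq A (n + N) n \<mu>)" using 1 by linarith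
qed

section \<open>From the linear forms to a lower bound for the distance\<close>

lemma dist_nint_eq: "dist_nint x = \<bar>x - of_int (round x)\<bar>"
proof (rule antisym)
  show "dist_nint x \<le> \<bar>x - of_int (round x)\<bar>"
    unfolding dist_nint_def by (rule cINF_lower) (auto intro!: bdd_belowI[of _ 0])
  show "\<bar>x - of_int (round x)\<bar> \<le> dist_nint x"
    unfolding dist_nint_def by (rule cINF_greatest) (auto simp: round_diff_minimal)
qed

lemma padeQ_mono: "A \<le> A' \<Longrightarrow> padeQ A b n \<le> padeQ A' b n"
  unfolding padeQ_def pq_def
  by (intro sum_mono mult_right_mono mult_mono)
     (auto intro!: binomial_right_mono)

text \<open>If the distance were at most \<open>(4/9) ^ k\<close>, the integer form \<open>Z\<close>
  would be divisible by \<open>D\<close> and smaller than \<open>D\<close> in absolute value, hence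
  zero. But \<open>Z\<close> is a deviation term minus a nonzero signed remainder, and for
  \<open>A\<close> or for \<open>A - 1\<close> these two do not cancel. The free exponent
  \<open>j\<close> lets one approximant serve several \<open>k\<close>, at the cost of the factor
  \<open>4 ^ j\<close>.\<close>

theorem dist_nint_gt_of_content:
  assumes n: "n \<le> b" "n < A" and A3: "3 * (A - n) \<le> b + 1"
    and D: "\<And>\<mu>. \<mu> \<le> n \<Longrightarrow> D dvd pq A b n \<mu>" "\<And>\<mu>. \<mu> \<le> n \<Longrightarrow> D dvd pq (A - 1) b n \<mu>"
    and E: "padeE A b n \<le> E" "padeE (A - 1) b n \<le> E" and Q: "real (padeQ A b n) \<le> Q"
    and big: "4 ^ j * E + Q * (4/9) ^ (2 * (b + 1)) * (4/3) ^ j < real D"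
  shows "dist_nint ((4/3) ^ (2 * (b + 1) + j)) > (4/9) ^ (2 * (b + 1) + j)"
proof -
  define k where "k = 2 * (b + 1) + j"
  define M where "M = round ((4/3 :: real) ^ k)"
  define \<delta> :: real where "\<delta> = (4/3) ^ k - of_int M"
  \<comment> \<open>\<open>C\<close> is the parameter for which the two parts of \<open>Z\<close>
    add up in absolute value; \<open>sgn\<close> holds for at least one of the two choices since
    their signs are opposite.\<close>
  have main: False if "\<bar>\<delta>\<bar> \<le> (4/9) ^ k" and C: "C = A \<or> C = A - 1" and sgn: "(-1) ^ (C + 1) * \<delta> \<le> 0" for C
  proof -
    have nC: "n \<le> C" "3 * (C - n) \<le> b + 1" using n A3 C by auto
    have DC: "D dvd pq C b n \<mu>" if "\<mu> \<le> n" for \<mu> using D that C by auto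
    have EC: "padeE C b n \<le> E" using E C by auto
    have "padeQ C b n \<le> padeQ A b n" using C by (auto intro: padeQ_mono)
    hence QC: "real (padeQ C b n) \<le> Q" using Q by linarith
    obtain I :: "nat \<Rightarrow> int" where I: "(16 / 9) ^ (b + 1) * real (padeQ C b n)
        = (\<Sum>\<mu>\<le>n. real (pq C b n \<mu>) * of_int (I \<mu>)) + (-1) ^ (C + 1) * padeE C b n"
      using pade_form[OF n(1) nC] by blast
    define Z where "Z = 4 ^ j * (\<Sum>\<mu>\<le>n. int (pq C b n \<mu>) * I \<mu>) - 3 ^ j * int (padeQ C b n) * M"
    have "int D dvd Z"
      unfolding Z_def padeQ_def
      by (intro dvd_diff dvd_mult dvd_mult2 dvd_sum) (auto simp: DC intro!: dvd_mult2 dvd_sum)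
    \<comment> \<open>The factor \<open>3 ^ j\<close> clears the denominator that belongs to the
      exponent beyond \<open>2 * (b + 1)\<close>.\<close>
    have X: "3 ^ j * (4/3 :: real) ^ k = 4 ^ j * (16/9) ^ (b + 1)"
    proof -
      have "(4/3 :: real) ^ k = (16/9) ^ (b + 1) * (4/3) ^ j"
        unfolding k_def power_add power_mult by (simp add: power2_eq_square)
      thus ?thesis by (simp add: power_divide)
    qed
    have "of_int Z = 4 ^ j * ((16/9) ^ (b + 1) * real (padeQ C b n) - (-1) ^ (C + 1) * padeE C b n) - 3 ^ j * real (padeQ C b n) * of_int M"
      unfolding I Z_def by simp
    also have "\<dots> = (4 ^ j * (16/9) ^ (b + 1)) * real (padeQ C b n) - 3 ^ j * real (padeQ C b n) * of_int M - 4 ^ j * ((-1) ^ (C + 1) * padeE C b n)"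
      by (simp add: algebra_simps)
    also have "\<dots> = 3 ^ j * real (padeQ C b n) * \<delta> - 4 ^ j * ((-1) ^ (C + 1) * padeE C b n)"
      unfolding X[symmetric] \<delta>_def by (simp add: algebra_simps)
    finally have Zeq: "of_int Z = 3 ^ j * real (padeQ C b n) * \<delta> - 4 ^ j * ((-1) ^ (C + 1) * padeE C b n)" .
    define \<sigma> :: real where "\<sigma> = (-1) ^ (C + 1)"
    have \<sigma>: "\<sigma> = 1 \<or> \<sigma> = -1" unfolding \<sigma>_def using neg_one_even_power neg_one_odd_power by blast
    have pE: "padeE C b n > 0" by (rule padeE_pos)
    have abs: "\<bar>of_int Z\<bar> = 3 ^ j * real (padeQ C b n) * \<bar>\<delta>\<bar> + 4 ^ j * padeE C b n"
    proof (cases "\<sigma> = 1")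
      case True
      have \<delta>0: "\<delta> \<le> 0" using sgn True by (simp add: \<sigma>_def)
      have "0 \<le> 3 ^ j * real (padeQ C b n) * - \<delta>" using \<delta>0 by (intro mult_nonneg_nonneg) auto
      moreover have "0 \<le> 4 ^ j * padeE C b n" using pE by simp
      moreover have "of_int Z = 3 ^ j * real (padeQ C b n) * \<delta> - 4 ^ j * padeE C b n"
        using Zeq True by (simp add: \<sigma>_def)
      ultimately have "\<bar>of_int Z\<bar> = 4 ^ j * padeE C b n - 3 ^ j * real (padeQ C b n) * \<delta>" by linarith
      moreover have "\<bar>\<delta>\<bar> = - \<delta>" using \<delta>0 by simp
      ultimately show ?thesis by simp
    next
      case False
      hence s1: "\<sigma> = -1" using \<sigma> by auto
      have \<delta>0: "\<delta> \<ge> 0" using sgn s1 by (simp add: \<sigma>_def)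
      have "0 \<le> 3 ^ j * real (padeQ C b n) * \<delta>" using \<delta>0 by (intro mult_nonneg_nonneg) auto
      moreover have "0 \<le> 4 ^ j * padeE C b n" using pE by simp
      moreover have "of_int Z = 3 ^ j * real (padeQ C b n) * \<delta> + 4 ^ j * padeE C b n"
        using Zeq s1 by (simp add: \<sigma>_def)
      ultimately have "\<bar>of_int Z\<bar> = 4 ^ j * padeE C b n + 3 ^ j * real (padeQ C b n) * \<delta>" by linarith
      moreover have "\<bar>\<delta>\<bar> = \<delta>" using \<delta>0 by simp
      ultimately show ?thesis by simp
    qed
    have "0 \<le> 3 ^ j * real (padeQ C b n) * \<bar>\<delta>\<bar>" by simp
    hence "\<bar>real_of_int Z\<bar> > 0" unfolding abs using pE by (simp add: add_nonneg_pos)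
    hence "Z \<noteq> 0" by auto
    with \<open>int D dvd Z\<close> have "int D \<le> \<bar>Z\<bar>" using dvd_imp_le_int by force
    hence "real D \<le> \<bar>of_int Z\<bar>" by linarith
    also have "\<dots> \<le> 3 ^ j * Q * (4/9) ^ k + 4 ^ j * E"
      unfolding abs using QC EC that(1) by (intro add_mono mult_mono mult_left_mono) auto
    also have "3 ^ j * Q * (4/9) ^ k = Q * (4/9) ^ (2 * (b + 1)) * (4/3) ^ j"
    proof -
      have e: "(3::real) ^ j * (4/9) ^ j = (4/3) ^ j" by (simp flip: power_mult_distrib)
      show ?thesis unfolding k_def power_add[of _ "2 * (b + 1)" j] e[symmetric] by (simp only: mult_ac)
    qed
    finally show False using big by linarith
  qed
  have "\<not> \<bar>\<delta>\<bar> \<le> (4/9) ^ k"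
  proof
    assume le: "\<bar>\<delta>\<bar> \<le> (4/9) ^ k"
    have "(-1) ^ (A + 1) * \<delta> \<le> 0 \<or> (-1) ^ (A - 1 + 1) * \<delta> \<le> 0"
    proof -
      have "(-1::real) ^ (A + 1) = - ((-1) ^ (A - 1 + 1))" using n by simp
      thus ?thesis by (metis linear minus_mult_left neg_le_0_iff_le)
    qed
    thus False using main[OF le] by blast
  qed
  thus ?thesis unfolding dist_nint_eq by (simp add: \<delta>_def M_def k_def)
qed

section \<open>Size of the denominators and remainders\<close>

lemma neg_binomial_partial_le:
  fixes z :: real
  assumes "0 \<le> z" "z < 1"
  shows "(\<Sum>i\<le>n. real ((A + i) choose A) * z ^ i) \<le> (1 / (1 - z)) ^ (A + 1)"
proof -
  have s: "(\<lambda>\<nu>. real ((A + \<nu>) choose A) * z ^ \<nu>) sums (1 / (1 - z) ^ Suc A)"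
    using assms by (intro neg_binomial_sums) auto
  have "(\<Sum>i\<in>{..n}. real ((A + i) choose A) * z ^ i) \<le> (\<Sum>i. real ((A + i) choose A) * z ^ i)"
    using assms by (intro sum_le_suminf sums_summable[OF s]) auto
  thus ?thesis using sums_unique[OF s] by (simp add: power_divide)
qed

lemma binomial_partial_le:
  fixes z :: real
  assumes "0 \<le> z"
  shows "(\<Sum>i\<le>n. real (m choose i) * z ^ i) \<le> (1 + z) ^ m"
proof -
  have "(\<Sum>i\<le>n. real (m choose i) * z ^ i) \<le> (\<Sum>i\<le>max n m. real (m choose i) * z ^ i)"
    using assms by (intro sum_mono2) auto
  also have "\<dots> = (\<Sum>i\<le>m. real (m choose i) * z ^ i)"
    by (rule sum.mono_neutral_right) auto
  also have "\<dots> = (z + 1) ^ m" by (simp add: binomial_ring)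
  finally show ?thesis by (simp add: add.commute)
qed

lemma convolution_le:
  fixes f g :: "nat \<Rightarrow> real"
  assumes "\<And>i. f i \<ge> 0" "\<And>i. g i \<ge> 0"
  shows "(\<Sum>i\<le>n. f i * g (n - i)) \<le> (\<Sum>i\<le>n. f i) * (\<Sum>i\<le>n. g i)"
proof -
  have "(\<Sum>i\<le>n. f i * g (n - i)) \<le> (\<Sum>i\<le>n. f i * (\<Sum>i\<le>n. g i))"
    using assms by (intro sum_mono mult_left_mono member_le_sum) auto
  thus ?thesis by (simp add: sum_distrib_right)
qed

text \<open>The sum is the \<open>n\<close>-th coefficient of a product of a negative binomial
  series and a binomial polynomial, estimated by the values of both factors at \<open>1/25\<close>.
  This radius is close to the saddle point for the parameter ratios used for large
  \<open>w\<close>.\<close>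

lemma padeQ_le: "real (padeQ A b n) \<le> 25 ^ n * (25 / 17) ^ (A + 1) * (26 / 25) ^ (A + b + 1)"
proof -
  define f where "f = (\<lambda>i. real ((A + i) choose A) * (8 / 25 :: real) ^ i)"
  define g where "g = (\<lambda>i. real ((A + 1 + b) choose i) * (1 / 25 :: real) ^ i)"
  have "real (padeQ A b n) = 25 ^ n * (\<Sum>\<mu>\<le>n. f \<mu> * g (n - \<mu>))"
    unfolding padeQ_def pq_def of_nat_sum sum_distrib_left
  proof (intro sum.cong refl)
    fix \<mu> assume "\<mu> \<in> {..n}"
    hence "(25::real) ^ n = 25 ^ \<mu> * 25 ^ (n - \<mu>)" by (simp flip: power_add)
    moreover have "((A + \<mu>) choose \<mu>) = ((A + \<mu>) choose A)"
      using binomial_symmetric[of \<mu> "A + \<mu>"] by simp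
    ultimately show "real (((A + \<mu>) choose \<mu>) * ((A + 1 + b) choose (n - \<mu>)) * 8 ^ \<mu>) = 25 ^ n * (f \<mu> * g (n - \<mu>))"
      by (simp add: f_def g_def power_divide)
  qed
  also have "\<dots> \<le> 25 ^ n * ((\<Sum>\<mu>\<le>n. f \<mu>) * (\<Sum>\<mu>\<le>n. g \<mu>))"
    by (intro mult_left_mono convolution_le) (auto simp: f_def g_def)
  also have "\<dots> \<le> 25 ^ n * ((1 / (1 - 8 / 25)) ^ (A + 1) * (1 + 1 / 25) ^ (A + 1 + b))"
    unfolding f_def g_def
    by (intro mult_left_mono mult_mono neg_binomial_partial_le binomial_partial_le sum_nonneg) auto
  finally show ?thesis by (simp add: add_ac)
qed

text \<open>The same coefficient estimate, now for the \<open>(b - n)\<close>-th coefficient and at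
  radius \<open>1/3\<close>, again close to the saddle point. The bases arise as
  \<open>3/16 = 1/8 * 3/2\<close> and \<open>24/19 = 8/9 * 27/19\<close>.\<close>

lemma padeE_le:
  assumes "n \<le> b"
  shows "padeE A b n \<le> 2 ^ (b + 1) * 3 ^ (b - n) * (3 / 16) ^ (A + 1) * (24 / 19) ^ (n + 1)"
proof -
  define N where "N = b - n"
  define f where "f = (\<lambda>i. real ((n + i) choose n) * (8 / 27 :: real) ^ i)"
  define g where "g = (\<lambda>i. real ((A + i) choose A) * (1 / 3 :: real) ^ i)"
  have "(\<Sum>t\<le>N. real ((A + N - t) choose A) * real ((n + t) choose n) * (8 / 9) ^ (n + t + 1))
      = (8 / 9) ^ (n + 1) * 3 ^ N * (\<Sum>t\<le>N. f t * g (N - t))"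
    unfolding sum_distrib_left
  proof (intro sum.cong refl)
    fix t assume "t \<in> {..N}"
    hence t: "t \<le> N" by simp
    hence e: "(3::real) ^ N = 3 ^ t * 3 ^ (N - t)" by (simp flip: power_add)
    have "(8 / 27 :: real) ^ t * 3 ^ t = (8 / 9) ^ t" by (simp flip: power_mult_distrib)
    moreover have "(1 / 3 :: real) ^ (N - t) * 3 ^ (N - t) = 1" by (simp flip: power_mult_distrib)
    ultimately have "((8 / 27 :: real) ^ t * 3 ^ t) * ((1 / 3) ^ (N - t) * 3 ^ (N - t)) = (8 / 9) ^ t" by simp
    hence "(3::real) ^ N * ((8 / 27) ^ t * (1 / 3) ^ (N - t)) = (8 / 9) ^ t"
      unfolding e by (simp only: mult_ac)
    hence "(8 / 9) ^ (n + 1) * 3 ^ N * ((8 / 27 :: real) ^ t * (1 / 3) ^ (N - t)) = (8 / 9) ^ (n + t + 1)"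
      by (simp add: power_add mult_ac)
    moreover have "A + N - t = A + (N - t)" using t by simp
    ultimately show "real ((A + N - t) choose A) * real ((n + t) choose n) * (8 / 9) ^ (n + t + 1) = (8 / 9) ^ (n + 1) * 3 ^ N * (f t * g (N - t))"
      unfolding f_def g_def by (simp only: mult_ac)
  qed
  hence "padeE A b n = 2 ^ (b + 1) / 8 ^ (A + 1) * ((8 / 9) ^ (n + 1) * 3 ^ N * (\<Sum>t\<le>N. f t * g (N - t)))"
    by (simp only: padeE_def N_def)
  also have "\<dots> \<le> 2 ^ (b + 1) / 8 ^ (A + 1) * ((8 / 9) ^ (n + 1) * 3 ^ N * ((\<Sum>t\<le>N. f t) * (\<Sum>t\<le>N. g t)))"
    by (intro mult_left_mono convolution_le) (auto simp: f_def g_def)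
  also have "\<dots> \<le> 2 ^ (b + 1) / 8 ^ (A + 1) * ((8 / 9) ^ (n + 1) * 3 ^ N * ((1 / (1 - 8 / 27)) ^ (n + 1) * (1 / (1 - 1 / 3)) ^ (A + 1)))"
    unfolding f_def g_def
    by (intro mult_left_mono mult_mono neg_binomial_partial_le sum_nonneg) auto
  also have "\<dots> = 2 ^ (b + 1) * 3 ^ N * ((1 / 8) * (3 / 2)) ^ (A + 1) * ((8 / 9) * (27 / 19)) ^ (n + 1)"
    unfolding power_mult_distrib by (simp add: power_divide)
  finally show ?thesis by (simp add: N_def)
qed

text \<open>Logarithmic form of the criterion; \<open>ln 2\<close> reserves half of the common
  divisor for each of the two contributions. Everything is arranged to serve \<open>A\<close> and
  \<open>A - 1\<close> at once: the separation hypothesis uses \<open>A + n + N\<close> without the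
  \<open>+ 1\<close>, and the bound for the remainder uses the exponent \<open>A\<close> of
  \<open>3/16\<close> instead of \<open>A + 1\<close>.\<close>

theorem dist_nint_gt_of_ln_content:
  assumes e: "\<And>d. d > 0 \<Longrightarrow> e (y div d) \<Longrightarrow> A div d + n div d + N div d + 2 \<le> (A + n + N) div d"
    and n: "n < A" "3 * (A - n) \<le> w" and w: "w = n + N + 1"
    and E: "real w * ln 2 + real N * ln 3 + real A * ln (3 / 16) + (real n + 1) * ln (24 / 19) + real j * ln 4 + ln 2
          \<le> ln (real (content y e))"
    and Q: "real n * ln 25 + (real A + 1) * ln (25 / 17) + (real A + real w) * ln (26 / 25) - 2 * real w * ln (9 / 4) + real j * ln (4 / 3) + ln 2
          < ln (real (content y e))"
  shows "dist_nint ((4/3) ^ (2 * w + j)) > (4/9) ^ (2 * w + j)"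
proof -
  define b where "b = n + N"
  define D where "D = content y e"
  have Dpos: "real D > 0" using content_pos by (simp add: D_def)
  have A0: "A > 0" using n by simp
  define EE :: real where "EE = 2 ^ w * 3 ^ N * (3 / 16) ^ A * (24 / 19) ^ (n + 1)"
  define QQ :: real where "QQ = 25 ^ n * (25 / 17) ^ (A + 1) * (26 / 25) ^ (A + w)"
  have D1: "D dvd pq A b n \<mu>" if "\<mu> \<le> n" for \<mu>
    unfolding D_def b_def
  proof (rule content_dvd_pq[OF _ that])
    fix d :: nat assume "d > 0" "e (y div d)"
    hence "A div d + n div d + N div d + 2 \<le> (A + n + N) div d" by (rule e)
    also have "\<dots> \<le> (A + n + N + 1) div d" by (intro div_le_mono) simp
    finally show "A div d + n div d + N div d + 2 \<le> (A + n + N + 1) div d" .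
  qed
  have D2: "D dvd pq (A - 1) b n \<mu>" if "\<mu> \<le> n" for \<mu>
    unfolding D_def b_def
  proof (rule content_dvd_pq[OF _ that])
    fix d :: nat assume "d > 0" "e (y div d)"
    hence "A div d + n div d + N div d + 2 \<le> (A + n + N) div d" by (rule e)
    moreover have "(A - 1) div d \<le> A div d" by (intro div_le_mono) simp
    moreover have "A - 1 + n + N + 1 = A + n + N" using A0 by simp
    ultimately show "(A - 1) div d + n div d + N div d + 2 \<le> (A - 1 + n + N + 1) div d" by simp
  qed
  have E1: "padeE A b n \<le> EE"
  proof -
    have "padeE A b n \<le> 2 ^ (b + 1) * 3 ^ (b - n) * (3 / 16) ^ (A + 1) * (24 / 19) ^ (n + 1)"
      by (rule padeE_le) (simp add: b_def)
    also have "\<dots> \<le> 2 ^ (b + 1) * 3 ^ (b - n) * (3 / 16) ^ A * (24 / 19) ^ (n + 1)"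
      by (intro mult_right_mono mult_left_mono power_decreasing) auto
    finally show ?thesis by (simp add: EE_def b_def w)
  qed
  have E2: "padeE (A - 1) b n \<le> EE"
    using padeE_le[of n b "A - 1"] A0 by (simp add: EE_def b_def w)
  have Q1: "real (padeQ A b n) \<le> QQ"
    using padeQ_le[of A b n] by (simp add: QQ_def b_def w)
  have "ln (4 ^ j * EE) = real w * ln 2 + real N * ln 3 + real A * ln (3 / 16) + (real n + 1) * ln (24 / 19) + real j * ln 4"
  proof -
    have "ln (4 ^ j * EE) = ln (4 ^ j) + (ln (2 ^ w) + ln (3 ^ N) + ln ((3 / 16) ^ A) + ln ((24 / 19) ^ (n + 1)))"
      unfolding EE_def by (subst ln_mult_pos, (simp; fail), (simp; fail))+ (rule refl)
    thus ?thesis by (simp add: ln_realpow algebra_simps del: power_Suc)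
  qed
  hence "ln (4 ^ j * EE) + ln 2 \<le> ln (real D)" using E by (simp add: D_def)
  hence "ln (2 * (4 ^ j * EE)) \<le> ln (real D)"
    by (subst ln_mult_pos) (auto simp: EE_def)
  hence a: "2 * (4 ^ j * EE) \<le> real D"
    using Dpos by (subst (asm) ln_le_cancel_iff) (auto simp: EE_def)
  have qpos: "QQ * (4/9) ^ (2 * w) * (4/3) ^ j > 0" by (simp add: QQ_def)
  have "ln (4 / 9 :: real) = - ln (9 / 4)" using ln_div[of 4 9] ln_div[of 9 4] by simp
  moreover have "ln (QQ * (4/9) ^ (2 * w) * (4/3) ^ j) = ln (25 ^ n) + ln ((25 / 17) ^ (A + 1)) + ln ((26 / 25) ^ (A + w)) + ln ((4 / 9) ^ (2 * w)) + ln ((4 / 3) ^ j)"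
    unfolding QQ_def by (subst ln_mult_pos, (simp; fail), (simp; fail))+ (rule refl)
  ultimately have "ln (QQ * (4/9) ^ (2 * w) * (4/3) ^ j) = real n * ln 25 + (real A + 1) * ln (25 / 17) + (real A + real w) * ln (26 / 25) - 2 * real w * ln (9 / 4) + real j * ln (4 / 3)"
    by (simp add: ln_realpow algebra_simps del: power_Suc)
  hence "ln (QQ * (4/9) ^ (2 * w) * (4/3) ^ j) + ln 2 < ln (real D)" using Q by (simp add: D_def)
  hence "ln (2 * (QQ * (4/9) ^ (2 * w) * (4/3) ^ j)) < ln (real D)"
    using qpos by (subst ln_mult_pos) auto
  hence c: "2 * (QQ * (4/9) ^ (2 * w) * (4/3) ^ j) < real D"
    using Dpos qpos by (subst (asm) ln_less_cancel_iff) auto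
  have "dist_nint ((4/3) ^ (2 * (b + 1) + j)) > (4/9) ^ (2 * (b + 1) + j)"
  proof (rule dist_nint_gt_of_content[OF _ _ _ D1 D2 E1 E2 Q1])
    show "4 ^ j * EE + QQ * (4/9) ^ (2 * (b + 1)) * (4/3) ^ j < real D"
      using a c by (simp add: b_def w)
  qed (use n w in \<open>auto simp: b_def\<close>)
  thus ?thesis by (simp add: b_def w)
qed

section \<open>Chebyshev's method with weighted factorials\<close>

definition psi :: "nat \<Rightarrow> real" where
  "psi n = (\<Sum>d\<in>{1..n}. mangoldt d)"

lemma psi_nonneg: "psi n \<ge> 0"
  unfolding psi_def by (intro sum_nonneg mangoldt_nonneg)

lemma psi_mono: "m \<le> n \<Longrightarrow> psi m \<le> psi n"
  unfolding psi_def by (intro sum_mono2) (auto intro: mangoldt_nonneg)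

lemma ln_fact_mangoldt:
  assumes "n \<le> y"
  shows "ln (fact n) = (\<Sum>d\<in>{1..y}. mangoldt d * real (n div d))"
  using assms
proof (induction n)
  case 0
  show ?case by simp
next
  case (Suc n)
  have "ln (fact (Suc n) :: real) = ln (real (Suc n)) + ln (fact n)"
    by (simp add: ln_mult_pos del: of_nat_Suc)
  also have "ln (real (Suc n)) = (\<Sum>d | d dvd Suc n. mangoldt d)"
    using mangoldt_sum[of "Suc n", where ?'a = real] by simp
  also have "{d. d dvd Suc n} = {d\<in>{1..y}. d dvd Suc n}"
    using Suc.prems by (auto dest: dvd_imp_le intro!: Nat.gr0I simp: Suc_le_eq)
  also have "(\<Sum>d\<in>{d\<in>{1..y}. d dvd Suc n}. mangoldt d) = (\<Sum>d\<in>{1..y}. if d dvd Suc n then mangoldt d else (0::real))"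
    by (simp add: sum.If_cases Int_def)
  also have "ln (fact n) = (\<Sum>d\<in>{1..y}. mangoldt d * real (n div d))"
    using Suc by simp
  also have "(\<Sum>d\<in>{1..y}. if d dvd Suc n then mangoldt d else (0::real)) + (\<Sum>d\<in>{1..y}. mangoldt d * real (n div d))
     = (\<Sum>d\<in>{1..y}. mangoldt d * real (Suc n div d))"
    unfolding sum.distrib[symmetric]
    by (intro sum.cong refl) (auto simp: div_Suc dvd_eq_mod_eq_0 algebra_simps)
  finally show ?case .
qed

definition floor_sum :: "(nat \<times> real) list \<Rightarrow> nat \<Rightarrow> real" where
  "floor_sum cs z = (\<Sum>(r, c)\<leftarrow>cs. c * real (z div r))"

definition fact_sum :: "(nat \<times> real) list \<Rightarrow> nat \<Rightarrow> real" where
  "fact_sum cs y = (\<Sum>(r, c)\<leftarrow>cs. c * ln (fact (y div r)))"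

text \<open>Chebyshev's device: pointwise bounds for the step function \<open>floor_sum cs\<close>
  turn into inequalities between log-factorials, which Stirling controls, and sums over prime
  powers. It rests on the two floor divisions by \<open>r\<close> and by \<open>d\<close>
  commuting.\<close>

lemma fact_sum_mangoldt: "fact_sum cs y = (\<Sum>d\<in>{1..y}. mangoldt d * floor_sum cs (y div d))"
proof (induction cs)
  case Nil
  show ?case by (simp add: fact_sum_def floor_sum_def)
next
  case (Cons a cs)
  obtain r c where a: "a = (r, c)" by (cases a)
  have "ln (fact (y div r)) = (\<Sum>d\<in>{1..y}. mangoldt d * real (y div r div d))"
    by (rule ln_fact_mangoldt) simp
  also have "\<dots> = (\<Sum>d\<in>{1..y}. mangoldt d * real (y div d div r))"
    by (simp only: div_mult2_eq[symmetric] mult.commute)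
  finally have "c * ln (fact (y div r)) = (\<Sum>d\<in>{1..y}. mangoldt d * (c * real (y div d div r)))"
    by (simp add: sum_distrib_left mult_ac)
  thus ?case using Cons.IH
    by (simp add: a fact_sum_def floor_sum_def sum.distrib distrib_left)
qed

lemma psi_div:
  assumes "X > 0"
  shows "psi (y div X) = (\<Sum>d\<in>{1..y}. mangoldt d * of_bool (X \<le> y div d))"
proof -
  have "(\<Sum>d\<in>{1..y}. mangoldt d * of_bool (X \<le> y div d)) = (\<Sum>d\<in>{1..y}. if d \<le> y div X then mangoldt d else (0::real))"
  proof (intro sum.cong refl)
    fix d assume "d \<in> {1..y}"
    hence "d > 0" by simp
    hence "X \<le> y div d \<longleftrightarrow> d \<le> y div X"
      using assms by (simp add: less_eq_div_iff_mult_less_eq mult.commute)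
    thus "mangoldt d * of_bool (X \<le> y div d) = (if d \<le> y div X then mangoldt d else (0::real))" by simp
  qed
  also have "\<dots> = (\<Sum>d\<in>{1..y div X}. mangoldt d)"
  proof -
    have "{1..y} \<inter> {d. d \<le> y div X} = {1..y div X}"
      using div_le_dividend[of y X] by (auto simp del: div_le_dividend dest: order_trans)
    thus ?thesis by (simp add: sum.If_cases)
  qed
  finally show ?thesis by (simp add: psi_def)
qed

text \<open>Induction on \<open>n\<close>: the increment
  \<open>(n + 1/2) * (ln (n + 1) - ln n)\<close> is at least \<open>1\<close> by the midpoint
  estimate of the logarithm and little more than \<open>1\<close> by the trapezoidal one. The term
  \<open>1 / (4 * n)\<close> makes this surplus telescope.\<close>

lemma stirling_bounds:
  assumes "n > 0"
  shows "ln (fact n) \<le> (real n + 1/2) * ln (real n) - real n + 1"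
    and "ln (fact n) \<ge> (real n + 1/2) * ln (real n) - real n + 3/4 + 1 / (4 * real n)"
proof -
  have "ln (fact n) \<le> (real n + 1/2) * ln (real n) - real n + 1 \<and>
    ln (fact n) \<ge> (real n + 1/2) * ln (real n) - real n + 3/4 + 1 / (4 * real n)"
    using assms
  proof (induction n rule: nat_induct_non_zero)
    case 1
    show ?case by simp
  next
    case (Suc n)
    have n: "real n > 0" using Suc by simp
    have lo: "2 / (2 * real n + 1) \<le> ln (real n + 1) - ln (real n)"
      using ln_inverse_approx_ge[of "real n" "real n + 1"] n by (simp add: field_simps)
    have hi: "ln (real n + 1) - ln (real n) \<le> (1 / real n + 1 / (real n + 1)) / 2"
      using ln_inverse_approx_le[of "real n" 1] n by (simp add: inverse_eq_divide)
    have f: "ln (fact (Suc n)) = ln (real n + 1) + ln (fact n)"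
      by (simp add: ln_mult_pos add.commute)
    have a: "1 \<le> (real n + 1/2) * (ln (real n + 1) - ln (real n))"
      using mult_left_mono[OF lo, of "real n + 1/2"] n by (simp add: field_simps)
    have b: "(real n + 1/2) * (ln (real n + 1) - ln (real n)) \<le> 1 + 1 / (4 * real n) - 1 / (4 * (real n + 1))"
    proof -
      have "(real n + 1/2) * (ln (real n + 1) - ln (real n)) \<le> (real n + 1/2) * ((1 / real n + 1 / (real n + 1)) / 2)"
        using mult_left_mono[OF hi, of "real n + 1/2"] n by simp
      also have "\<dots> = 1 + 1 / (4 * real n) - 1 / (4 * (real n + 1))"
        using n by (simp add: divide_simps) (simp add: algebra_simps)
      finally show ?thesis .
    qed
    show ?case
    proof
      show "ln (fact (Suc n)) \<le> (real (Suc n) + 1/2) * ln (real (Suc n)) - real (Suc n) + 1"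
        using Suc.IH a unfolding f by (simp add: algebra_simps)
      show "(real (Suc n) + 1/2) * ln (real (Suc n)) - real (Suc n) + 3/4 + 1 / (4 * real (Suc n)) \<le> ln (fact (Suc n))"
        using Suc.IH b unfolding f by (simp add: algebra_simps)
    qed
  qed
  thus "ln (fact n) \<le> (real n + 1/2) * ln (real n) - real n + 1"
    and "ln (fact n) \<ge> (real n + 1/2) * ln (real n) - real n + 3/4 + 1 / (4 * real n)" by auto
qed

lemma xlnx_mono:
  assumes "1 \<le> x" "x \<le> (y::real)"
  shows "x * ln x - x \<le> y * ln y - y"
proof -
  have "x * (ln y - ln x) \<le> x * (ln y - ln x) + 0" by simp
  have "ln (x / y) \<le> x / y - 1" using assms by (intro ln_le_minus_one) auto
  hence "y * (ln x - ln y) \<le> x - y" using assms by (simp add: ln_div field_simps)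
  hence 1: "x * ln x - x \<le> y * ln y - y - (y - x) * ln x" by (simp add: algebra_simps)
  have "(y - x) * ln x \<ge> 0" using assms by simp
  thus ?thesis using 1 by linarith
qed

lemma ln_fact_div_bounds:
  assumes "r > 0" "r \<le> y"
  defines "v \<equiv> real y / real r"
  shows "ln (fact (y div r)) \<le> v * ln v - v + ln v / 2 + 1"
    and "ln (fact (y div r)) \<ge> v * ln v - v - ln v / 2 + 1/4"
proof -
  define n where "n = y div r"
  have n1: "n \<ge> 1" using assms by (simp add: n_def div_greater_zero_iff Suc_le_eq)
  have "n * r \<le> y" "y \<le> (n + 1) * r"
    using dividend_less_div_times[OF assms(1), of y] by (auto simp: n_def)
  hence "real (n * r) \<le> real y" "real y \<le> real ((n + 1) * r)" by (simp_all only: of_nat_le_iff)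
  hence "real n * real r \<le> real y" "real y \<le> (real n + 1) * real r"
    by (simp_all add: algebra_simps)
  hence nv: "real n \<le> v" and vn: "v \<le> real n + 1"
    using assms(1) by (simp_all add: v_def pos_le_divide_eq pos_divide_le_eq)
  have v1: "v \<ge> 1" using nv n1 by linarith
  have "ln (fact n) \<le> real n * ln (real n) - real n + ln (real n) / 2 + 1"
    using stirling_bounds(1)[of n] n1 by (simp add: algebra_simps)
  also have "\<dots> \<le> v * ln v - v + ln v / 2 + 1"
  proof -
    have "ln (real n) \<le> ln v" using nv n1 by simp
    moreover have "real n * ln (real n) - real n \<le> v * ln v - v" using nv n1 by (intro xlnx_mono) auto
    ultimately show ?thesis by linarith
  qed
  finally show "ln (fact (y div r)) \<le> v * ln v - v + ln v / 2 + 1" by (simp add: n_def)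
  \<comment> \<open>The real quotient \<open>v\<close> may exceed the integer \<open>n\<close>, so
    monotonicity is applied up to \<open>n + 1\<close>. Returning from \<open>fact (Suc n)\<close>
    to \<open>fact n\<close> costs a full logarithm, which is why half a logarithm is lost instead
    of gained.\<close>
  have "v * ln v - v \<le> (real n + 1) * ln (real n + 1) - (real n + 1)"
    using v1 vn by (intro xlnx_mono) auto
  also have "\<dots> \<le> ln (fact (Suc n)) - ln (real n + 1) / 2 - 3/4"
  proof -
    have "1 / (4 * real (Suc n)) \<ge> 0" by simp
    hence "(real (Suc n) + 1/2) * ln (real (Suc n)) - real (Suc n) + 3/4 \<le> ln (fact (Suc n))"
      using stirling_bounds(2)[of "Suc n"] by linarith
    thus ?thesis by (simp add: algebra_simps)
  qed
  also have "ln (fact (Suc n)) = ln (real n + 1) + ln (fact n)"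
    by (simp add: ln_mult_pos add.commute)
  also have "ln (real n + 1) \<le> ln v + 1"
  proof -
    have "ln (real n + 1) \<le> ln (2 * v)" using nv n1 by simp
    also have "\<dots> = ln 2 + ln v" using v1 by (simp add: ln_mult_pos)
    finally show ?thesis using ln_2_less_1 by linarith
  qed
  finally have "v * ln v - v \<le> ln (fact n) + (ln v + 1) / 2 - 3/4" by (simp add: field_simps)
  thus "ln (fact (y div r)) \<ge> v * ln v - v - ln v / 2 + 1/4"
    unfolding n_def add_divide_distrib by linarith
qed

text \<open>The coefficient of \<open>y\<close> in Stirling's expansion of
  \<open>fact_sum cs y\<close> once the reciprocal sum of the weights is zero.\<close>

definition main_sum :: "(nat \<times> real) list \<Rightarrow> real" where
  "main_sum cs = - (\<Sum>(r, c)\<leftarrow>cs. c * ln (real r) / real r)"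

text \<open>The losses of \<open>ln_fact_div_bounds\<close>: a nonnegative weight uses the lower
  bound with its constant \<open>1/4\<close>, a negative weight the upper bound with its constant
  \<open>1\<close>.\<close>

definition err_sum :: "(nat \<times> real) list \<Rightarrow> real \<Rightarrow> real" where
  "err_sum cs y = (\<Sum>(r, c)\<leftarrow>cs. \<bar>c\<bar> * ln (y / real r) / 2 + (if c \<ge> 0 then - c / 4 else - c))"

text \<open>Each factorial contributes \<open>c / r\<close> times \<open>y * (ln y - 1)\<close>; the
  condition \<open>zero\<close> removes this dominant part and leaves a term linear in
  \<open>y\<close>.\<close>

lemma fact_sum_bounds:
  assumes r: "\<forall>(r, c)\<in>set cs. 0 < r \<and> r \<le> y" and zero: "(\<Sum>(r, c)\<leftarrow>cs. c / real r) = 0"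
  shows "fact_sum cs y \<ge> main_sum cs * real y - err_sum cs (real y)"
proof -
  have "fact_sum cs y \<ge> (\<Sum>(r, c)\<leftarrow>cs. c / real r) * (real y * (ln (real y) - 1)) + main_sum cs * real y - err_sum cs (real y)"
    using r
  proof (induction cs)
    case Nil
    show ?case by (simp add: fact_sum_def main_sum_def err_sum_def)
  next
    case (Cons a cs)
    obtain r c where a: "a = (r, c)" by (cases a)
    have ry: "0 < r" "r \<le> y" using Cons.prems by (auto simp: a)
    define v where "v = real y / real r"
    have lv: "ln v = ln (real y) - ln (real r)" using ry by (simp add: v_def ln_div)
    have "c * ln (fact (y div r)) \<ge> c * (v * ln v - v) - (\<bar>c\<bar> * ln v / 2 + (if c \<ge> 0 then - c / 4 else - c))"
    proof (cases "c \<ge> 0")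
      case True
      have "c * (v * ln v - v - ln v / 2 + 1/4) \<le> c * ln (fact (y div r))"
        using ln_fact_div_bounds(2)[OF ry] True by (intro mult_left_mono) (auto simp: v_def)
      thus ?thesis using True by (simp add: algebra_simps)
    next
      case False
      have "c * (v * ln v - v + ln v / 2 + 1) \<le> c * ln (fact (y div r))"
        using ln_fact_div_bounds(1)[OF ry] False by (intro mult_left_mono_neg) (auto simp: v_def)
      thus ?thesis using False by (simp add: algebra_simps)
    qed
    moreover have "c * (v * ln v - v) = c / real r * (real y * (ln (real y) - 1)) - c * ln (real r) / real r * real y"
      unfolding lv by (simp add: v_def algebra_simps diff_divide_distrib)
    moreover have "fact_sum cs y \<ge> (\<Sum>(r, c)\<leftarrow>cs. c / real r) * (real y * (ln (real y) - 1)) + main_sum cs * real y - err_sum cs (real y)"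
      using Cons.prems by (intro Cons.IH) auto
    ultimately show ?case
      by (simp add: a fact_sum_def main_sum_def err_sum_def v_def algebra_simps)
  qed
  thus ?thesis using zero by simp
qed


lemma floor_sum_Nil [simp]: "floor_sum [] z = 0" by (simp add: floor_sum_def)
lemma floor_sum_Cons [simp]: "floor_sum ((r, c) # cs) z = c * real (z div r) + floor_sum cs z" by (simp add: floor_sum_def)

text \<open>If the step function stays below the indicator of \<open>e\<close> plus an envelope of
  jumps, it transfers to the logarithm of \<open>content\<close>, and a jump of height
  \<open>\<kappa>\<close> at \<open>X\<close> costs \<open>\<kappa> * psi (y div X)\<close>. So
  upper bounds for \<open>psi\<close> at small arguments are enough.\<close>

lemma ln_content_ge:
  assumes e: "\<And>z. floor_sum cs z \<le> of_bool (e z) + (\<Sum>(X, \<kappa>)\<leftarrow>ks. \<kappa> * of_bool (X \<le> z))"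
    and X: "\<forall>(X, \<kappa>)\<in>set ks. 0 < X"
  shows "ln (real (content y e)) \<ge> fact_sum cs y - (\<Sum>(X, \<kappa>)\<leftarrow>ks. \<kappa> * psi (y div X))"
proof -
  have ks: "(\<Sum>(X, \<kappa>)\<leftarrow>ks. \<kappa> * psi (y div X)) = (\<Sum>d\<in>{1..y}. mangoldt d * (\<Sum>(X, \<kappa>)\<leftarrow>ks. \<kappa> * of_bool (X \<le> y div d)))"
    using X
  proof (induction ks)
    case (Cons a ks)
    obtain X \<kappa> where a: "a = (X, \<kappa>)" by (cases a)
    have "\<kappa> * psi (y div X) = (\<Sum>d\<in>{1..y}. mangoldt d * (\<kappa> * of_bool (X \<le> y div d)))"
    proof -
      have X0: "X > 0" using Cons.prems by (simp add: a)
      show ?thesis unfolding psi_div[OF X0] sum_distrib_left by (simp only: mult_ac)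
    qed
    thus ?case using Cons by (simp add: a sum.distrib distrib_left)
  qed simp
  have "fact_sum cs y \<le> (\<Sum>d\<in>{1..y}. mangoldt d * (of_bool (e (y div d)) + (\<Sum>(X, \<kappa>)\<leftarrow>ks. \<kappa> * of_bool (X \<le> y div d))))"
    unfolding fact_sum_mangoldt by (intro sum_mono mult_left_mono e mangoldt_nonneg)
  also have "\<dots> = ln (real (content y e)) + (\<Sum>(X, \<kappa>)\<leftarrow>ks. \<kappa> * psi (y div X))"
    unfolding ks ln_content by (simp add: distrib_left sum.distrib)
  finally show ?thesis by linarith
qed

section \<open>Basic logarithms and recursions for upper bounds of \<open>psi\<close>\<close>

lemma ln_2_bounds': "ln 2 \<in> {0.69314718 .. 0.69314719::real}"
  using ln_approx_bounds[of 2 11] by (simp add: eval_nat_numeral)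
lemma ln_3_2_bounds: "ln (3/2) \<in> {0.40546510 .. 0.40546511::real}"
  using ln_approx_bounds[of "3/2" 6] by (simp add: eval_nat_numeral)
lemma ln_5_4_bounds: "ln (5/4) \<in> {0.22314355 .. 0.22314356::real}"
  using ln_approx_bounds[of "5/4" 5] by (simp add: eval_nat_numeral)

lemma ln_2_lower: "0.69314718 \<le> ln (2::real)" and ln_2_upper: "ln (2::real) \<le> 0.69314719"
  using ln_2_bounds' by auto
lemma ln_3_bounds: "1.09861228 \<le> ln (3::real)" "ln (3::real) \<le> 1.09861230"
proof -
  have "ln (3::real) = ln 2 + ln (3/2)" by (simp add: ln_div)
  thus "1.09861228 \<le> ln (3::real)" "ln (3::real) \<le> 1.09861230"
    using ln_2_bounds' ln_3_2_bounds by auto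
qed
lemma ln_5_bounds: "1.60943791 \<le> ln (5::real)" "ln (5::real) \<le> 1.60943794"
proof -
  have "ln (4::real) = 2 * ln 2" using ln_mult_pos[of 2 "2::real"] by simp
  hence "ln (5::real) = 2 * ln 2 + ln (5/4)" by (simp add: ln_div)
  thus "1.60943791 \<le> ln (5::real)" "ln (5::real) \<le> 1.60943794"
    using ln_2_bounds' ln_5_4_bounds by auto
qed

text \<open>Chebyshev's classical combination with all signs reversed, so that the lower bound of
  \<open>fact_sum_bounds\<close> produces an upper bound for \<open>psi\<close>.\<close>

definition cheb :: "(nat \<times> real) list" where
  "cheb = [(1, -1), (2, 1), (3, 1), (5, 1), (30, -1)]"

text \<open>Since \<open>1/2 + 1/3 + 1/5 - 1/30 = 1\<close>, the combination has period
  \<open>30\<close>, and only residues need checking; for \<open>1 \<le> z < 6\<close> it is at most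
  \<open>-1\<close>.\<close>

lemma cheb_floor: "floor_sum cheb z \<le> 0 + of_bool (z < 1) - of_bool (z < 6)"
proof -
  define q s where "q = z div 30" and "s = z mod 30"
  have z: "z = 30 * q + s" and s: "s < 30" by (simp_all add: q_def s_def)
  have d: "z div 2 = 15 * q + s div 2" "z div 3 = 10 * q + s div 3" "z div 5 = 6 * q + s div 5" "z div 30 = q"
    unfolding z using s by auto
  have "\<forall>s\<in>set [0..<30]. s div 2 + s div 3 + s div 5 \<le> s" by (simp add: upt_rec)
  hence "s div 2 + s div 3 + s div 5 \<le> s" using s by auto
  moreover have "s div 2 + s div 3 + s div 5 + 1 \<le> s" if "z < 6" "z \<ge> 1"
  proof -
    have "\<forall>s\<in>set [1..<6]. s div 2 + s div 3 + s div 5 + 1 \<le> s" by (simp add: upt_rec)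
    moreover have "s \<in> set [1..<6]" using that z by (cases q) auto
    ultimately show ?thesis by blast
  qed
  ultimately have "z div 2 + z div 3 + z div 5 \<le> z + z div 30"
    "1 \<le> z \<Longrightarrow> z < 6 \<Longrightarrow> z div 2 + z div 3 + z div 5 + 1 \<le> z + z div 30"
    unfolding d unfolding z by auto
  thus ?thesis by (auto simp: cheb_def of_nat_diff)
qed

text \<open>The quotients \<open>m div d\<close> below \<open>6\<close> each account for a full
  \<open>mangoldt d\<close>, those from \<open>6\<close> on are given away as
  \<open>psi (m div 6)\<close>. The coefficient rounds up Chebyshev's constant, and
  \<open>2.15\<close> rounds down \<open>ln 30 - 5/4\<close>.\<close>

lemma psi_step:
  assumes "m \<ge> 30"
  shows "psi m \<le> psi (m div 6) + 0.9213 * real m + 5/2 * ln (real m) - 2.15"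
proof -
  have 1: "fact_sum cheb m \<ge> main_sum cheb * real m - err_sum cheb (real m)"
    using assms by (intro fact_sum_bounds) (auto simp: cheb_def)
  have "fact_sum cheb m = (\<Sum>d\<in>{1..m}. mangoldt d * floor_sum cheb (m div d))" by (rule fact_sum_mangoldt)
  also have "\<dots> \<le> (\<Sum>d\<in>{1..m}. mangoldt d * (of_bool (6 \<le> m div d) - 1))"
  proof (intro sum_mono mult_left_mono mangoldt_nonneg)
    fix d assume d: "d \<in> {1..m}"
    hence "m div d \<ge> 1" by (simp add: div_greater_zero_iff Suc_le_eq)
    thus "floor_sum cheb (m div d) \<le> of_bool (6 \<le> m div d) - 1"
      using cheb_floor[of "m div d"] by (auto simp: not_less split: if_splits)
  qed
  also have "\<dots> = psi (m div 6) - psi m"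
    unfolding psi_div[of 6 m, simplified] unfolding psi_def by (simp add: algebra_simps sum_subtractf)
  finally have 2: "psi m \<le> psi (m div 6) - main_sum cheb * real m + err_sum cheb (real m)"
    using 1 by linarith
  have l30: "ln (30::real) = ln 2 + ln 3 + ln 5"
    using ln_mult_pos[of 6 "5::real"] ln_mult_pos[of 2 "3::real"] by simp
  have "- main_sum cheb = 14/30 * ln 2 + 9/30 * ln 3 + 5/30 * ln 5"
    by (simp add: main_sum_def cheb_def l30 field_simps)
  also have "\<dots> \<le> 0.9213" using ln_2_upper ln_3_bounds(2) ln_5_bounds(2) by simp
  finally have 3: "- main_sum cheb * real m \<le> 0.9213 * real m" by (intro mult_right_mono) auto
  have m: "real m > 0" using assms by simp
  have "err_sum cheb (real m) = 5/2 * ln (real m) - (ln 2 + ln 3 + ln 5) + 5/4"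
    using m by (simp add: err_sum_def cheb_def ln_div l30 field_simps)
  also have "\<dots> \<le> 5/2 * ln (real m) - 2.15" using ln_2_lower ln_3_bounds(1) ln_5_bounds(1) by simp
  finally show ?thesis using 2 3 by linarith
qed


text \<open>An integer upper bound for \<open>exp (psi m)\<close>, obtained by iterating
  \<open>psi_le_half\<close> through the successive halves of \<open>m\<close>; it can be evaluated
  by rewriting.\<close>

fun lcmb :: "nat \<Rightarrow> nat" where
  "lcmb m = (if m < 2 then 1 else lcmb (m div 2) * (fact m div (fact (m div 2))\<^sup>2))"

definition cheb2 :: "(nat \<times> real) list" where "cheb2 = [(1, 1), (2, -2)]"

text \<open>The step function \<open>z - 2 * (z div 2)\<close> is nonnegative and equals
  \<open>1\<close> at \<open>z = 1\<close>, so the logarithm of the quotient of factorials dominates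
  the prime powers in the upper half.\<close>

lemma psi_le_half: 
  assumes "m \<ge> 1"
  shows "psi m \<le> psi (m div 2) + ln (real (fact m div (fact (m div 2))\<^sup>2))"
proof -
  have dv: "(fact (m div 2))\<^sup>2 dvd (fact m :: nat)"
  proof -
    have "fact (m div 2) * fact (m div 2) dvd (fact (m div 2 + m div 2) :: nat)" by (rule fact_fact_dvd_fact)
    also have "(fact (m div 2 + m div 2) :: nat) dvd fact m" by (rule fact_dvd) simp
    finally show ?thesis by (simp add: power2_eq_square)
  qed
  have "ln (real (fact m div (fact (m div 2))\<^sup>2)) = ln (fact m) - 2 * ln (fact (m div 2))"
    using dv by (simp add: real_of_nat_div ln_div ln_realpow)
  also have "\<dots> = fact_sum cheb2 m" by (simp add: fact_sum_def cheb2_def)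
  also have "\<dots> = (\<Sum>d\<in>{1..m}. mangoldt d * floor_sum cheb2 (m div d))" by (rule fact_sum_mangoldt)
  also have "\<dots> \<ge> (\<Sum>d\<in>{1..m}. mangoldt d * (1 - of_bool (2 \<le> m div d)))"
  proof (intro sum_mono mult_left_mono mangoldt_nonneg)
    fix d assume d: "d \<in> {1..m}"
    define z where "z = m div d"
    have "z \<ge> 1" using d by (simp add: z_def div_greater_zero_iff Suc_le_eq)
    hence "(1::nat) - of_bool (2 \<le> z) + 2 * (z div 2) \<le> z" by (auto simp: of_bool_def)
    hence "1 - of_bool (2 \<le> z) \<le> real z - 2 * real (z div 2)" 
      by (cases "2 \<le> z") (auto simp: of_bool_def)
    thus "1 - of_bool (2 \<le> m div d) \<le> floor_sum cheb2 (m div d)" by (simp add: cheb2_def z_def)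
  qed
  finally have "(\<Sum>d\<in>{1..m}. mangoldt d * (1 - of_bool (2 \<le> m div d))) \<le> ln (real (fact m div (fact (m div 2))\<^sup>2))" .
  moreover have "(\<Sum>d\<in>{1..m}. mangoldt d * (1 - of_bool (2 \<le> m div d))) = psi m - psi (m div 2)"
    unfolding psi_div[of 2 m, simplified] unfolding psi_def by (simp add: algebra_simps sum_subtractf)
  ultimately show ?thesis by linarith
qed

declare lcmb.simps [simp del]

lemma psi_le_lcmb: "psi m \<le> ln (real (lcmb m))" and lcmb_pos: "lcmb m > 0"
proof -
  have "psi m \<le> ln (real (lcmb m)) \<and> lcmb m > 0"
  proof (induction m rule: lcmb.induct)
    case (1 m)
    show ?case
    proof (cases "m < 2")
      case True
      have "psi m = 0" using True by (cases m) (auto simp: psi_def)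
      thus ?thesis using True by (simp add: lcmb.simps[of m])
    next
      case False
      have dv: "(fact (m div 2))\<^sup>2 \<le> (fact m :: nat)"
      proof -
        have "fact (m div 2) * fact (m div 2) dvd (fact (m div 2 + m div 2) :: nat)" by (rule fact_fact_dvd_fact)
        also have "(fact (m div 2 + m div 2) :: nat) dvd fact m" by (rule fact_dvd) simp
        finally show ?thesis by (simp add: power2_eq_square dvd_imp_le)
      qed
      have pos: "fact m div (fact (m div 2))\<^sup>2 > (0::nat)" using dv by (simp add: div_greater_zero_iff)
      have IH: "psi (m div 2) \<le> ln (real (lcmb (m div 2)))" "lcmb (m div 2) > 0" using 1 False by auto
      have "psi m \<le> psi (m div 2) + ln (real (fact m div (fact (m div 2))\<^sup>2))"
        using False by (intro psi_le_half) auto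
      also have "\<dots> \<le> ln (real (lcmb (m div 2))) + ln (real (fact m div (fact (m div 2))\<^sup>2))" using IH by simp
      also have "\<dots> = ln (real (lcmb m))"
        using False IH pos by (simp add: lcmb.simps[of m] ln_mult_pos)
      finally show ?thesis using False IH pos by (simp add: lcmb.simps[of m])
    qed
  qed
  thus "psi m \<le> ln (real (lcmb m))" "lcmb m > 0" by auto
qed

section \<open>Exponents up to 1600: residues of powers of 4\<close>

text \<open>One division settles all \<open>k\<close> from \<open>i\<close> to \<open>k0\<close>. A
  counterexample yields \<open>r\<close> congruent to \<open>4 ^ k\<close> modulo
  \<open>3 ^ k\<close> with \<open>\<bar>r\<bar> \<le> (4/3) ^ k\<close>. Multiplying by
  \<open>4 ^ (k0 - k)\<close> gives an integer congruent to \<open>R\<close> modulo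
  \<open>3 ^ i\<close> and of size at most \<open>4 ^ k0 / 3 ^ i\<close>, hence at most
  \<open>q\<close>; but \<open>R\<close> is farther than \<open>q\<close> from every multiple of
  \<open>P\<close>.\<close>

lemma dist_nint_gt_of_residue:
  fixes q P R i k k0 :: nat
  assumes eq: "4 ^ k0 = q * P + R" and P: "P = 3 ^ i" and R: "q + 1 < R" "R + q + 1 < P" and k: "i \<le> k" "k \<le> k0"
  shows "dist_nint ((4/3) ^ k) > (4/9) ^ k"
proof (rule ccontr)
  define M where "M = round ((4/3 :: real) ^ k)"
  define r where "r = 4 ^ k - M * 3 ^ k"
  define s where "s = 4 ^ (k0 - k) * r"
  assume "\<not> dist_nint ((4/3) ^ k) > (4/9) ^ k"
  hence "\<bar>(4/3 :: real) ^ k - of_int M\<bar> \<le> (4/9) ^ k" by (simp add: dist_nint_eq M_def)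
  hence "\<bar>(4/3 :: real) ^ k - of_int M\<bar> * 3 ^ k \<le> (4/9) ^ k * 3 ^ k" by (intro mult_right_mono) auto
  also have "(4/9 :: real) ^ k * 3 ^ k = (4/3) ^ k" by (simp flip: power_mult_distrib)
  also have "\<bar>(4/3 :: real) ^ k - of_int M\<bar> * 3 ^ k = \<bar>of_int r\<bar>"
  proof -
    have "of_int r = ((4/3 :: real) ^ k - of_int M) * 3 ^ k"
      by (simp add: r_def left_diff_distrib power_divide)
    thus ?thesis by (simp add: abs_mult)
  qed
  finally have r: "\<bar>of_int r\<bar> \<le> (4/3 :: real) ^ k" .
  have "\<bar>real_of_int s\<bar> = 4 ^ (k0 - k) * \<bar>of_int r\<bar>" by (simp add: s_def abs_mult)
  also have "\<dots> \<le> 4 ^ (k0 - k) * (4/3) ^ k" using r by simp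
  also have "\<dots> = 4 ^ k0 / 3 ^ k" using k by (simp add: power_divide flip: power_add)
  also have "\<dots> \<le> 4 ^ k0 / 3 ^ i" using k by (intro divide_left_mono power_increasing) auto
  also have "\<dots> = real (4 ^ k0) / real P" by (simp add: P)
  also have "\<dots> < real q + 1"
  proof -
    have "real R < real P" using R by simp
    moreover have "real P > 0" by (simp add: P)
    ultimately show ?thesis unfolding eq by (simp add: field_simps)
  qed
  finally have s: "\<bar>s\<bar> \<le> int q" by linarith
  have "int P dvd s - int R"
  proof -
    have "s = 4 ^ k0 - 4 ^ (k0 - k) * M * 3 ^ k"
      using k by (simp add: s_def r_def right_diff_distrib mult_ac flip: power_add)
    moreover have "(4::int) ^ k0 = int q * int P + int R" using eq by (metis of_nat_add of_nat_mult of_nat_numeral of_nat_power)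
    ultimately have "s - int R = int q * int P - 4 ^ (k0 - k) * M * 3 ^ k" by simp
    moreover have "int P dvd 3 ^ k" using k by (simp add: P le_imp_power_dvd)
    ultimately show ?thesis by (simp add: dvd_diff)
  qed
  then obtain t where t: "s - int R = int P * t" by (auto simp: dvd_def)
  show False
  proof (cases "t \<ge> 0")
    case True
    hence "int P * t \<ge> 0" by simp
    thus False using t s R by linarith
  next
    case False
    hence "int P * t \<le> int P * (-1)" by (intro mult_left_mono) auto
    thus False using t s R by linarith
  qed
qed

lemmas big_arith = power_numeral Num.pow.simps Num.sqr.simps numeral_times_numeral mult_num_simps numeral_plus_numeral add_num_simps BitM.simps
  numeral_less_iff numeral_eq_iff le_num_simps less_num_simps num.inject num.distinct simp_thms eq_num_simps one_plus_numeral numeral_plus_one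

text \<open>The three long numbers are the quotient of \<open>4 ^ 1600\<close> by
  \<open>3 ^ 1011\<close>, this power of \<open>3\<close>, and the remainder. The quotient must stay
  below about half of the modulus, which limits the ratio of the end points to about
  \<open>ln 9 / ln 4\<close>, roughly \<open>1.58\<close>; the ranges below descend by this
  ratio.\<close>

lemma small_1600: "1011 \<le> k \<Longrightarrow> k \<le> 1600 \<Longrightarrow> dist_nint ((4/3) ^ k) > (4/9) ^ k"
  by (rule dist_nint_gt_of_residue[of 1600 8441071970151621669223443282364637230372222815910600956652946593010490719213084552886922763233739625215948218416112764370757296801139023137503894468320458406039435371124969308484042691431760421412650971832748555701866065556145081352244936227854283339583301180110576427259560524342778685599108503018356102604185842189910907969146557200416929967998120623106814203146817899708659770478001633602243036071859454642050728279540418515209274076916871856045680449460454360107917166247263029 234200879458566453305233477899313117997676616835944791457337648470278005534176732838950255963693666352720725389667887346609643751355378338380209867751270719492970840033206935444578683210338434737234436209630470920131869718694184310419292262858012292125969697936394466570409444045272249277376537590253628783111419585267684516967093279711047417275431511314427592100687641731016067124060094708372810268361755727300507026380459221253727766518614185643184303117216068636202834093657517147 73523311852524976236460524445173401064358181630636169366567521253766844571751088324037563029750047589956612318633820757218558840420839722041751977950308882462245726848212925632468016659688856841993545472463296526114810861853430621479007243258047765306944149866732674992692406113030533736937851519183862861654243236075550969419635676689103082770517321733391604610598001342646800810587972677583025186610375836449272317211607603947303522991292970586118285028019368184298424221851523113 1011]) (assumption | simp only: big_arith)+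
lemma small_1010: "639 \<le> k \<Longrightarrow> k \<le> 1010 \<Longrightarrow> dist_nint ((4/3) ^ k) > (4/9) ^ k"
  by (rule dist_nint_gt_of_residue[of 1010 1585292756946581425107978500039265420075435065668893027520444732408307686036231675980829689595530332597140284283404329831745923647634239132048990928559425015171955844177493315431320476529249797677229674502682619418791855042106391874133319298870363312052499432461101970130265409314613112225125878553160569 75941953727633401495975387751402956733923326118809345407235519553869229325728583088194883594381036053597459297291102962102235616819707779337063631974568333458859243134297205349383789755750791996147438576859815194787239674509466480142883732823561088188983876043363828900117645006918265145966606872521220267 24820177019717649905235978024494423869211500398330340512029976324158840575839532634221026719739940788585453958095830705788393603521990869328050220323880625675495820755433322051872156473707353596144639188772639062466533603529520315435869837572363002189375530533442838373487473606212373133899560351158916653 639]) (assumption | simp only: big_arith)+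
lemma small_638: "404 \<le> k \<Longrightarrow> k \<le> 638 \<Longrightarrow> dist_nint ((4/3) ^ k) > (4/9) ^ k"
  by (rule dist_nint_gt_of_residue[of 638 227660434558322372136103735701270145066457577455044661008005834495625525072693803019065465794802011597275937873286712394613506055224812410779373522816833793950600241750271208369538599934217339 5714614078010819382709605997650718493537143918635772576792569079950228929678217666682923180885217866810551139120853828861221313238817789902225751840817355819264783111224585368587905950061128081 3353592929139957962349301589754992580269928330654252775036015558541944989472024124800815557475232993450850101244624091548802041859016024415978768356438047687441252715638116572428146980726094677 404]) (assumption | simp only: big_arith)+
lemma small_403: "256 \<le> k \<Longrightarrow> k \<le> 403 \<Longrightarrow> dist_nint ((4/3) ^ k) > (4/9) ^ k"
  by (rule dist_nint_gt_of_residue[of 403 3069978238060550097727752909262783937006920996663877932419915702975010432073266733307164365382692901372309800985960273887 139008452377144732764939786789661303114218850808529137991604824430036072629766435941001769154109609521811665540548899435521 40211053097193868005028526950576345774248592572201278402475744234496416247409642743383125212328775603229295959929631611937 256]) (assumption | simp only: big_arith)+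
lemma small_255: "162 \<le> k \<Longrightarrow> k \<le> 255 \<Longrightarrow> dist_nint ((4/3) ^ k) > (4/9) ^ k"
  by (rule dist_nint_gt_of_residue[of 255 17047257609666504427639451822489233392506451994651851865489366603468384343413 196627050475552913618075908526912116283103450944214766927315415537966391196809 162154351808979495908725179280384422094596507875453214546471402802925525751907 162]) (assumption | simp only: big_arith)+
lemma small_161: "103 \<le> k \<Longrightarrow> k \<le> 161 \<Longrightarrow> dist_nint ((4/3) ^ k) > (4/9) ^ k"
  by (rule dist_nint_gt_of_residue[of 161 614001408890862834764352497854724507221053520398 13915193059764305937984450503671774362956903094027 8067910665894270850507660375812746712441591283558 103]) (assumption | simp only: big_arith)+
lemma small_102: "65 \<le> k \<Longrightarrow> k \<le> 102 \<Longrightarrow> dist_nint ((4/3) ^ k) > (4/9) ^ k"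
  by (rule dist_nint_gt_of_residue[of 102 2495959641187303256120531873628 10301051460877537453973547267843 7444844469173437974148220677612 65]) (assumption | simp only: big_arith)+
lemma small_64: "42 \<le> k \<Longrightarrow> k \<le> 64 \<Longrightarrow> dist_nint ((4/3) ^ k) > (4/9) ^ k"
  by (rule dist_nint_gt_of_residue[of 64 3109902308747779363 109418989131512359209 35914217863835007589 42]) (assumption | simp only: big_arith)+
lemma small_41: "27 \<le> k \<Longrightarrow> k \<le> 41 \<Longrightarrow> dist_nint ((4/3) ^ k) > (4/9) ^ k"
  by (rule dist_nint_gt_of_residue[of 41 634140903447 7625597484987 5689499774515 27]) (assumption | simp only: big_arith)+
lemma small_26: "17 \<le> k \<Longrightarrow> k \<le> 26 \<Longrightarrow> dist_nint ((4/3) ^ k) > (4/9) ^ k"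
  by (rule dist_nint_gt_of_residue[of 26 34873733 129140163 63332017 17]) (assumption | simp only: big_arith)+
lemma small_16: "11 \<le> k \<Longrightarrow> k \<le> 16 \<Longrightarrow> dist_nint ((4/3) ^ k) > (4/9) ^ k"
  by (rule dist_nint_gt_of_residue[of 16 24245 177147 38281 11]) (assumption | simp only: big_arith)+
lemma small_10: "7 \<le> k \<Longrightarrow> k \<le> 10 \<Longrightarrow> dist_nint ((4/3) ^ k) > (4/9) ^ k"
  by (rule dist_nint_gt_of_residue[of 10 479 2187 1003 7]) (assumption | simp only: big_arith)+
lemma small_6: "5 \<le> k \<Longrightarrow> k \<le> 6 \<Longrightarrow> dist_nint ((4/3) ^ k) > (4/9) ^ k"
  by (rule dist_nint_gt_of_residue[of 6 16 243 208 5]) (assumption | simp only: big_arith)+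

section \<open>A certified sweep over a step function\<close>

text \<open>\<open>Ct k j c\<close> is a countdown: \<open>k\<close> unit steps remain until the
  next multiple of \<open>j\<close>, where the term with weight \<open>c\<close> jumps. Tracking
  floors this way replaces every division by a decrement of a binary numeral.\<close>

datatype ctr = Ct num num int

primrec cj :: "ctr \<Rightarrow> int" where "cj (Ct k j c) = numeral j"
primrec cc :: "ctr \<Rightarrow> int" where "cc (Ct k j c) = c"
primrec ck :: "ctr \<Rightarrow> int" where "ck (Ct k j c) = numeral k"

definition cval :: "ctr list \<Rightarrow> int \<Rightarrow> int" where
  "cval L t = (\<Sum>x\<leftarrow>L. cc x * (t div cj x))"

definition cok :: "int \<Rightarrow> ctr \<Rightarrow> bool" where
  "cok t x \<longleftrightarrow> ck x \<le> cj x \<and> cj x dvd t + ck x"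

primrec pd :: "num \<Rightarrow> num" where "pd num.One = num.One" | "pd (num.Bit0 n) = Num.BitM n" | "pd (num.Bit1 n) = num.Bit0 n"

lemma pd_numeral: "k \<noteq> num.One \<Longrightarrow> (numeral (pd k) :: int) = numeral k - 1"
proof (cases k)
  case (Bit0 n)
  show ?thesis unfolding Bit0 by (simp only: pd.simps numeral_BitM)
qed simp_all

fun tick1 :: "ctr \<Rightarrow> ctr" where "tick1 (Ct k j c) = (if k = num.One then Ct j j c else Ct (pd k) j c)"
fun tickd :: "ctr \<Rightarrow> int" where "tickd (Ct k j c) = (if k = num.One then c else 0)"

lemma tick1_simps [simp]: "cj (tick1 x) = cj x" "cc (tick1 x) = cc x" by (cases x; simp)+

lemma tick1_ok:
  assumes "cok t x"
  shows "cok (t + 1) (tick1 x)" "cc x * ((t + 1) div cj x) = cc x * (t div cj x) + tickd x"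
proof -
  obtain k j c where x: "x = Ct k j c" by (cases x)
  have k: "numeral k \<le> (numeral j :: int)" "numeral j dvd t + numeral k" using assms by (auto simp: x cok_def)
  define kk jj where "kk = (numeral k :: int)" and "jj = (numeral j :: int)"
  have kj: "1 \<le> kk" "kk \<le> jj" "jj dvd t + kk" using k by (auto simp: kk_def jj_def)
  then obtain q where q: "t + kk = jj * q" by (auto simp: dvd_def)
  have t: "t = jj * (q - 1) + (jj - kk)" using q by (simp add: algebra_simps)
  have d1: "t div jj = q - 1"
    using kj by (intro div_pos_pos_trivial[THEN arg_cong[where f = "\<lambda>x. x"]] int_div_pos_eq[OF t]) auto
  show "cok (t + 1) (tick1 x)"
  proof (cases "k = num.One")
    case True
    thus ?thesis using k by (auto simp: x cok_def)
  next
    case False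
    have e: "(numeral (pd k) :: int) = kk - 1" using pd_numeral[OF False] by (simp only: kk_def)
    have "cok (t + 1) (tick1 x) \<longleftrightarrow> kk - 1 \<le> jj \<and> jj dvd t + 1 + (kk - 1)"
      using False by (simp add: x cok_def e jj_def[symmetric])
    thus ?thesis using kj by simp
  qed
  show "cc x * ((t + 1) div cj x) = cc x * (t div cj x) + tickd x"
  proof (cases "k = num.One")
    case True
    hence "t + 1 = jj * q + 0" using q by (simp add: kk_def)
    hence e1: "(t + 1) div jj = t div jj + 1" using kj d1 by simp
    have "c * ((t + 1) div jj) = c * (t div jj) + c" unfolding e1 by (simp add: distrib_left)
    thus ?thesis using True by (simp add: x jj_def)
  next
    case False
    hence "kk \<ge> 2" unfolding kk_def by (cases k) auto
    moreover have t1: "t + 1 = jj * (q - 1) + (jj - kk + 1)" using t by simp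
    ultimately have "(t + 1) div jj = q - 1" using kj by (intro int_div_pos_eq[OF t1]) auto
    thus ?thesis using False d1 by (simp add: x jj_def)
  qed
qed

lemma cval_rev [simp]: "cval (rev L) t = cval L t"
  by (simp add: cval_def rev_map[symmetric] sum_list_rev)

lemma cval_tick: "cval (map tick1 L) t = cval L t"
  by (simp add: cval_def comp_def)

lemma cval_tick_Suc:
  assumes "\<forall>x\<in>set L. cok t x"
  shows "cval L (t + 1) = cval L t + (\<Sum>x\<leftarrow>L. tickd x)"
  using assms by (induction L) (auto simp: cval_def tick1_ok(2))

text \<open>All terms depending on \<open>z div \<theta>\<close>. \<open>T\<close> is the next
  multiple of \<open>\<theta>\<close>, the only place where they can change; the counters describe
  the state just before \<open>T\<close>; \<open>dg\<close> is the coefficient of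
  \<open>z div \<theta>\<close> itself in a second quantity followed alongside.\<close>

datatype fam = Fm int int int "ctr list"

primrec fT :: "fam \<Rightarrow> int" where "fT (Fm T \<theta> dg L) = T"
primrec fth :: "fam \<Rightarrow> int" where "fth (Fm T \<theta> dg L) = \<theta>"
primrec fdg :: "fam \<Rightarrow> int" where "fdg (Fm T \<theta> dg L) = dg"
primrec fL :: "fam \<Rightarrow> ctr list" where "fL (Fm T \<theta> dg L) = L"

definition semF :: "fam list \<Rightarrow> int \<Rightarrow> int" where
  "semF fs z = (\<Sum>f\<leftarrow>fs. cval (fL f) (z div fth f))"
definition semG :: "fam list \<Rightarrow> int \<Rightarrow> int" where
  "semG fs z = (\<Sum>f\<leftarrow>fs. fdg f * (z div fth f))"

fun ins :: "fam \<Rightarrow> fam list \<Rightarrow> fam list" where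
  "ins f [] = [f]"
| "ins f (g # gs) = (if fT f \<le> fT g then f # g # gs else g # ins f gs)"

text \<open>Reversing the counters does not affect \<open>cval\<close> and matches an accumulating
  pass that never has to turn its result around.\<close>

definition advance :: "fam \<Rightarrow> fam" where
  "advance f = Fm (fT f + fth f) (fth f) (fdg f) (rev (map tick1 (fL f)))"

text \<open>An event-driven sweep: \<open>fs\<close> is a queue ordered by next event,
  \<open>F\<close> and \<open>G\<close> are the current values of the weighted sum and of the second
  quantity. Coinciding events are processed one after the other and tested each time, which is only
  stricter. The final clause ensures that the horizon \<open>z1\<close> has been reached.\<close>

primrec rn :: "nat \<Rightarrow> int \<Rightarrow> int \<Rightarrow> fam list \<Rightarrow> int \<Rightarrow> int \<Rightarrow> bool" where
  "rn 0 z1 E fs F G = (z1 \<le> fT (hd fs))"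
| "rn (Suc n) z1 E fs F G =
     (let f = hd fs; F' = F + (\<Sum>x\<leftarrow>fL f. tickd x); G' = G + fdg f in
      (F' \<le> E \<or> (2 \<le> G' \<and> F' \<le> E + 100)) \<and> rn n z1 E (ins (advance f) (tl fs)) F' G')"

definition fok :: "fam \<Rightarrow> bool" where
  "fok f \<longleftrightarrow> fth f > 0 \<and> fth f dvd fT f \<and> (\<forall>x\<in>set (fL f). cok (fT f div fth f - 1) x)"

lemma ins_set: "set (ins f gs) = insert f (set gs)"
  by (induction gs) auto
lemma ins_sum: "(\<Sum>f\<leftarrow>ins f gs. (h f :: int)) = h f + (\<Sum>f\<leftarrow>gs. h f)"
  by (induction gs) auto
lemma ins_sorted: "sorted (map fT gs) \<Longrightarrow> sorted (map fT (ins f gs))"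
  by (induction gs) (auto simp: ins_set)
lemma ins_ne [simp]: "ins f gs \<noteq> []" by (cases gs) auto

text \<open>Between two events every quotient \<open>z div fth f\<close> is frozen at
  \<open>fT f div fth f - 1\<close>, so the running values are the true values until the head event
  passes \<open>z\<close>. The premise \<open>fT f - fth f \<le> fT (hd fs)\<close> states that no
  family has been advanced beyond its turn.\<close>

lemma rn_sound:
  assumes "rn n z1 E fs F G" "fs \<noteq> []" "sorted (map fT fs)" "\<forall>f\<in>set fs. fok f"
    "F = (\<Sum>f\<leftarrow>fs. cval (fL f) (fT f div fth f - 1))" "G = (\<Sum>f\<leftarrow>fs. fdg f * (fT f div fth f - 1))"
    "\<forall>f\<in>set fs. fT f - fth f \<le> fT (hd fs)"
    "fT (hd fs) \<le> z" "z < z1"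
  shows "semF fs z \<le> E \<or> (2 \<le> semG fs z \<and> semF fs z \<le> E + 100)"
  using assms
proof (induction n arbitrary: fs F G)
  case 0
  thus ?case by simp
next
  case (Suc n)
  obtain f gs where fs: "fs = f # gs" using Suc.prems(2) by (cases fs) auto
  define f' where "f' = advance f"
  define fs' where "fs' = ins f' gs"
  define T where "T = fT f"
  define F' where "F' = F + (\<Sum>x\<leftarrow>fL f. tickd x)"
  define G' where "G' = G + fdg f"
  have r: "F' \<le> E \<or> (2 \<le> G' \<and> F' \<le> E + 100)" "rn n z1 E fs' F' G'"
    using Suc.prems(1) by (auto simp: fs Let_def F'_def G'_def fs'_def f'_def)
  have okf: "fok f" using Suc.prems(4) by (simp add: fs)
  have th: "fth f > 0" and dv: "fth f dvd T" using okf by (auto simp: fok_def T_def)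
  have Tq: "(T + fth f) div fth f - 1 = T div fth f" using th by simp
  have f'_simps [simp]: "fT f' = T + fth f" "fth f' = fth f" "fdg f' = fdg f" "fL f' = rev (map tick1 (fL f))"
    by (simp_all add: f'_def advance_def T_def)
  have ok': "fok f'"
  proof -
    have "cok (T div fth f) (tick1 x)" if "x \<in> set (fL f)" for x
      using tick1_ok(1)[of "T div fth f - 1" x] okf that by (simp add: fok_def T_def)
    thus ?thesis unfolding fok_def using th dv Tq by auto
  qed
  have cv: "cval (fL f') (fT f' div fth f' - 1) = cval (fL f) (T div fth f - 1) + (\<Sum>x\<leftarrow>fL f. tickd x)"
    using cval_tick_Suc[of "fL f" "T div fth f - 1"] okf Tq by (simp add: cval_tick fok_def T_def)
  have sem: "semF fs' x = semF fs x" "semG fs' x = semG fs x" for x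
    by (simp_all add: fs'_def fs semF_def semG_def ins_sum cval_tick)
  have F': "F' = (\<Sum>f\<leftarrow>fs'. cval (fL f) (fT f div fth f - 1))"
    unfolding fs'_def ins_sum cv F'_def Suc.prems(5) by (simp add: fs T_def)
  have G': "G' = (\<Sum>f\<leftarrow>fs'. fdg f * (fT f div fth f - 1))"
    unfolding fs'_def ins_sum G'_def Suc.prems(6) using Tq by (simp add: fs T_def algebra_simps)
  have srt: "sorted (map fT fs')" using Suc.prems(3) by (simp add: fs'_def fs ins_sorted)
  have hdT: "fT (hd fs') \<le> fT g" if "g \<in> set fs'" for g
    using srt that by (cases fs') auto
  have hd_in: "hd fs' \<in> set fs'" by (simp add: fs'_def)
  have hd_ge: "T \<le> fT (hd fs')"
    using hd_in Suc.prems(3) th by (auto simp: fs'_def ins_set fs T_def)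
  have last: "fT g - fth g \<le> T" if "g \<in> set fs'" for g
    using that Suc.prems(7) by (auto simp: fs'_def ins_set fs T_def)
  have okall: "\<forall>g\<in>set fs'. fok g" using ok' Suc.prems(4) by (auto simp: fs'_def ins_set fs)
  show ?case
  proof (cases "fT (hd fs') \<le> z")
    case True
    have "semF fs' z \<le> E \<or> (2 \<le> semG fs' z \<and> semF fs' z \<le> E + 100)"
      by (rule Suc.IH[OF r(2) _ srt okall F' G' _ True Suc.prems(9)])
         (use last hd_ge in \<open>force simp: fs'_def\<close>)+
    thus ?thesis by (simp add: sem)
  next
    case False
    have zT: "T \<le> z" using Suc.prems(8) by (simp add: fs T_def)
    have "z div fth g = fT g div fth g - 1" if g: "g \<in> set fs'" for g
    proof -
      have og: "fth g > 0" "fth g dvd fT g" using okall g by (auto simp: fok_def)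
      then obtain q where q: "fT g = fth g * q" by (auto simp: dvd_def)
      have "fT g - fth g \<le> z" "z < fT g" using last[OF g] zT hdT[OF g] False by linarith+
      hence "z = fth g * (q - 1) + (z - fth g * (q - 1))" "0 \<le> z - fth g * (q - 1)" "z - fth g * (q - 1) < fth g"
        using q by (auto simp: algebra_simps)
      hence "z div fth g = q - 1" by (intro int_div_pos_eq)
      thus ?thesis using q og by simp
    qed
    hence "semF fs' z = F'" "semG fs' z = G'"
      unfolding F' G' semF_def semG_def by (auto intro!: arg_cong[where f = sum_list] map_cong)
    thus ?thesis using r(1) by (simp add: sem)
  qed
qed

text \<open>The counters are held in chunks, of at most ten after \<open>groups\<close>, to keep the
  terms rewritten in one pass short.\<close>

definition FG :: "int \<Rightarrow> int \<Rightarrow> int \<Rightarrow> ctr list list \<Rightarrow> fam" where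
  "FG T \<theta> dg gl = Fm T \<theta> dg (concat gl)"

lemma FG_simps [simp]: "fT (FG T \<theta> dg gl) = T" "fth (FG T \<theta> dg gl) = \<theta>" "fdg (FG T \<theta> dg gl) = dg" "fL (FG T \<theta> dg gl) = concat gl"
  by (simp_all add: FG_def)

fun groups :: "'a list \<Rightarrow> 'a list list" where
  "groups xs = (if length xs \<le> 10 then [xs] else take 10 xs # groups (drop 10 xs))"

declare groups.simps [simp del]

lemma concat_groups: "concat (groups xs) = xs"
  by (induction xs rule: groups.induct) (subst groups.simps, auto)

lemma Fm_groups: "Fm T \<theta> dg L = FG T \<theta> dg (groups L)"
  by (simp add: FG_def concat_groups)

text \<open>One step of \<open>rn\<close> is divided into phases: \<open>rnn\<close> selects the
  head, \<open>tg\<close> ticks one chunk, \<open>tk\<close> runs through the chunks,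
  \<open>cki\<close> tests the new values, \<open>insi\<close> reinserts the family. Each phase
  becomes a set of unconditional or nearly unconditional equations, so the whole sweep runs by plain
  rewriting.\<close>

datatype tpr = Pr "ctr list" int

definition tg :: "ctr list \<Rightarrow> ctr list \<Rightarrow> int \<Rightarrow> tpr" where
  "tg xs ys d = Pr (rev (map tick1 xs) @ ys) (d + (\<Sum>x\<leftarrow>xs. tickd x))"

definition tk :: "tpr \<Rightarrow> ctr list list \<Rightarrow> ctr list list \<Rightarrow> num \<Rightarrow> int \<Rightarrow> int \<Rightarrow> int \<Rightarrow> int \<Rightarrow> int \<Rightarrow> fam list \<Rightarrow> int \<Rightarrow> bool" where
  "tk r gl acc n z1 E T \<theta> dg gs G = (case r of Pr ys F \<Rightarrow> (let F' = F + (\<Sum>x\<leftarrow>concat gl. tickd x); G' = G + dg in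
      (F' \<le> E \<or> (2 \<le> G' \<and> F' \<le> E + 100)) \<and>
      rn (nat_of_num n - 1) z1 E (ins (FG (T + \<theta>) \<theta> dg (rev (map tick1 (concat gl)) # ys # acc)) gs) F' G'))"

text \<open>The numeral exceeds the number of remaining steps by one, because \<open>num\<close>
  starts at \<open>num.One\<close> while a run ends after zero steps.\<close>

definition rnn :: "num \<Rightarrow> int \<Rightarrow> int \<Rightarrow> fam list \<Rightarrow> int \<Rightarrow> int \<Rightarrow> bool" where
  "rnn n z1 E fs F G = rn (nat_of_num n - 1) z1 E fs F G"

definition cki :: "int \<Rightarrow> int \<Rightarrow> ctr list list \<Rightarrow> int \<Rightarrow> num \<Rightarrow> int \<Rightarrow> int \<Rightarrow> int \<Rightarrow> int \<Rightarrow> int \<Rightarrow> fam list \<Rightarrow> bool" where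
  "cki d G' ys F n z1 E T' \<theta> dg gs = ((0 \<le> d \<or> (2 \<le> G' \<and> -100 \<le> d)) \<and> rn (nat_of_num n - 1) z1 E (ins (FG T' \<theta> dg ys) gs) F G')"

definition insi :: "int \<Rightarrow> fam list \<Rightarrow> int \<Rightarrow> int \<Rightarrow> int \<Rightarrow> ctr list list \<Rightarrow> fam list \<Rightarrow> num \<Rightarrow> int \<Rightarrow> int \<Rightarrow> int \<Rightarrow> int \<Rightarrow> bool" where
  "insi d hs T' \<theta> dg ys gs n z1 E F G = (case gs of [] \<Rightarrow> rnn n z1 E (rev hs @ [FG T' \<theta> dg ys]) F G
     | g # gs' \<Rightarrow> rnn n z1 E (rev hs @ (if d \<le> 0 then FG T' \<theta> dg ys # gs else g # ins (FG T' \<theta> dg ys) gs')) F G)"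

lemma tk_Cons: "tk (Pr ys F) (g # gl) acc n z1 E T \<theta> dg gs G = tk (tg g [] F) gl (ys # acc) n z1 E T \<theta> dg gs G"
  by (simp add: tk_def tg_def FG_def add.assoc)
lemma tk_Nil: "tk (Pr ys F) [] acc n z1 E T \<theta> dg gs G = cki (E - F) (G + dg) (ys # acc) F n z1 E (T + \<theta>) \<theta> dg gs"
  by (auto simp: tk_def cki_def Let_def FG_def)
lemma tg_One: "tg (Ct num.One j c # xs) ys d = tg xs (Ct j j c # ys) (d + c)"
  by (simp add: tg_def add.assoc)
lemma tg_pd: "k \<noteq> num.One \<Longrightarrow> tg (Ct k j c # xs) ys d = tg xs (Ct (pd k) j c # ys) d"
  by (simp add: tg_def)
lemma tg_Nil: "tg [] ys d = Pr ys d"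
  by (simp add: tg_def)
text \<open>One equation for each number of trailing zero bits, so that a decrement is a single
  rewrite without any arithmetic. The powers of two need their own equations because the leading bit
  disappears. All keys are at most \<open>200\<close>, so the patterns up to eight bits
  suffice.\<close>

lemma tg_p0: "tg (Ct (Num.Bit1 k) j c # xs) ys d = tg xs (Ct (Num.Bit0 k) j c # ys) d"
  by (subst tg_pd) simp_all
lemma tg_p1: "tg (Ct (Num.Bit0 (Num.Bit1 k)) j c # xs) ys d = tg xs (Ct (Num.Bit1 (Num.Bit0 k)) j c # ys) d"
  by (subst tg_pd) simp_all
lemma tg_p2: "tg (Ct (Num.Bit0 (Num.Bit0 (Num.Bit1 k))) j c # xs) ys d = tg xs (Ct (Num.Bit1 (Num.Bit1 (Num.Bit0 k))) j c # ys) d"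
  by (subst tg_pd) simp_all
lemma tg_p3: "tg (Ct (Num.Bit0 (Num.Bit0 (Num.Bit0 (Num.Bit1 k)))) j c # xs) ys d = tg xs (Ct (Num.Bit1 (Num.Bit1 (Num.Bit1 (Num.Bit0 k)))) j c # ys) d"
  by (subst tg_pd) simp_all
lemma tg_p4: "tg (Ct (Num.Bit0 (Num.Bit0 (Num.Bit0 (Num.Bit0 (Num.Bit1 k))))) j c # xs) ys d = tg xs (Ct (Num.Bit1 (Num.Bit1 (Num.Bit1 (Num.Bit1 (Num.Bit0 k))))) j c # ys) d"
  by (subst tg_pd) simp_all
lemma tg_p5: "tg (Ct (Num.Bit0 (Num.Bit0 (Num.Bit0 (Num.Bit0 (Num.Bit0 (Num.Bit1 k)))))) j c # xs) ys d = tg xs (Ct (Num.Bit1 (Num.Bit1 (Num.Bit1 (Num.Bit1 (Num.Bit1 (Num.Bit0 k)))))) j c # ys) d"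
  by (subst tg_pd) simp_all
lemma tg_p6: "tg (Ct (Num.Bit0 (Num.Bit0 (Num.Bit0 (Num.Bit0 (Num.Bit0 (Num.Bit0 (Num.Bit1 k))))))) j c # xs) ys d = tg xs (Ct (Num.Bit1 (Num.Bit1 (Num.Bit1 (Num.Bit1 (Num.Bit1 (Num.Bit1 (Num.Bit0 k))))))) j c # ys) d"
  by (subst tg_pd) simp_all
lemma tg_p7: "tg (Ct (Num.Bit0 (Num.Bit0 (Num.Bit0 (Num.Bit0 (Num.Bit0 (Num.Bit0 (Num.Bit0 (Num.Bit1 k)))))))) j c # xs) ys d = tg xs (Ct (Num.Bit1 (Num.Bit1 (Num.Bit1 (Num.Bit1 (Num.Bit1 (Num.Bit1 (Num.Bit1 (Num.Bit0 k)))))))) j c # ys) d"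
  by (subst tg_pd) simp_all
lemma tg_q1: "tg (Ct (Num.Bit0 num.One) j c # xs) ys d = tg xs (Ct num.One j c # ys) d"
  by (subst tg_pd) simp_all
lemma tg_q2: "tg (Ct (Num.Bit0 (Num.Bit0 num.One)) j c # xs) ys d = tg xs (Ct (Num.Bit1 num.One) j c # ys) d"
  by (subst tg_pd) simp_all
lemma tg_q3: "tg (Ct (Num.Bit0 (Num.Bit0 (Num.Bit0 num.One))) j c # xs) ys d = tg xs (Ct (Num.Bit1 (Num.Bit1 num.One)) j c # ys) d"
  by (subst tg_pd) simp_all
lemma tg_q4: "tg (Ct (Num.Bit0 (Num.Bit0 (Num.Bit0 (Num.Bit0 num.One)))) j c # xs) ys d = tg xs (Ct (Num.Bit1 (Num.Bit1 (Num.Bit1 num.One))) j c # ys) d"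
  by (subst tg_pd) simp_all
lemma tg_q5: "tg (Ct (Num.Bit0 (Num.Bit0 (Num.Bit0 (Num.Bit0 (Num.Bit0 num.One))))) j c # xs) ys d = tg xs (Ct (Num.Bit1 (Num.Bit1 (Num.Bit1 (Num.Bit1 num.One)))) j c # ys) d"
  by (subst tg_pd) simp_all
lemma tg_q6: "tg (Ct (Num.Bit0 (Num.Bit0 (Num.Bit0 (Num.Bit0 (Num.Bit0 (Num.Bit0 num.One)))))) j c # xs) ys d = tg xs (Ct (Num.Bit1 (Num.Bit1 (Num.Bit1 (Num.Bit1 (Num.Bit1 num.One))))) j c # ys) d"
  by (subst tg_pd) simp_all
lemma tg_q7: "tg (Ct (Num.Bit0 (Num.Bit0 (Num.Bit0 (Num.Bit0 (Num.Bit0 (Num.Bit0 (Num.Bit0 num.One))))))) j c # xs) ys d = tg xs (Ct (Num.Bit1 (Num.Bit1 (Num.Bit1 (Num.Bit1 (Num.Bit1 (Num.Bit1 num.One)))))) j c # ys) d"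
  by (subst tg_pd) simp_all
lemma tg_q8: "tg (Ct (Num.Bit0 (Num.Bit0 (Num.Bit0 (Num.Bit0 (Num.Bit0 (Num.Bit0 (Num.Bit0 (Num.Bit0 num.One)))))))) j c # xs) ys d = tg xs (Ct (Num.Bit1 (Num.Bit1 (Num.Bit1 (Num.Bit1 (Num.Bit1 (Num.Bit1 (Num.Bit1 num.One))))))) j c # ys) d"
  by (subst tg_pd) simp_all

text \<open>As congruence rules these confine the simplifier to the component currently being
  computed; the waiting chunks and families are not traversed at every step.\<close>

lemma tk_cong: "r = r' \<Longrightarrow> tk r gl acc n z1 E T \<theta> dg gs G = tk r' gl acc n z1 E T \<theta> dg gs G" by simp
lemma tg_cong: "d = d' \<Longrightarrow> tg xs ys d = tg xs ys d'" by simp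
lemma cki_cong: "d = d' \<Longrightarrow> G = G' \<Longrightarrow> T = T' \<Longrightarrow> cki d G ys F n z1 E T \<theta> dg gs = cki d' G' ys F n z1 E T' \<theta> dg gs" by simp
lemma insi_cong: "d = d' \<Longrightarrow> insi d hs T \<theta> dg ys gs n z1 E F G = insi d' hs T \<theta> dg ys gs n z1 E F G" by simp
lemma rnn_cong: "rnn n z1 E fs F G = rnn n z1 E fs F G" by simp

lemma ins_unfold: "ins f gs = (case gs of [] \<Rightarrow> [f] | g # gs' \<Rightarrow> if fT f - fT g \<le> 0 then f # gs else g # ins f gs')"
  by (cases gs) auto

lemma cki_ok: "(0 \<le> d \<or> (2 \<le> G \<and> -100 \<le> d)) \<Longrightarrow> gs = FG T2 \<theta>2 dg2 L2 # gs' \<Longrightarrow>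
   cki d G ys F n z1 E T \<theta> dg gs = insi (T - T2) [] T \<theta> dg ys gs n z1 E F G"
  by (simp add: cki_def insi_def rnn_def)

lemma cki_pos: "cki (numeral d) G ys F n z1 E T \<theta> dg (FG T2 \<theta>2 dg2 L2 # gs') = insi (T - T2) [] T \<theta> dg ys (FG T2 \<theta>2 dg2 L2 # gs') n z1 E F G"
  by (rule cki_ok) simp_all
lemma cki_1: "cki 1 G ys F n z1 E T \<theta> dg (FG T2 \<theta>2 dg2 L2 # gs') = insi (T - T2) [] T \<theta> dg ys (FG T2 \<theta>2 dg2 L2 # gs') n z1 E F G"
  by (rule cki_ok) simp_all
lemma cki_0: "cki 0 G ys F n z1 E T \<theta> dg (FG T2 \<theta>2 dg2 L2 # gs') = insi (T - T2) [] T \<theta> dg ys (FG T2 \<theta>2 dg2 L2 # gs') n z1 E F G"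
  by (rule cki_ok) simp_all
lemma cki_neg: "numeral d \<le> (100::int) \<Longrightarrow> cki (- numeral d) 2 ys F n z1 E T \<theta> dg (FG T2 \<theta>2 dg2 L2 # gs') = insi (T - T2) [] T \<theta> dg ys (FG T2 \<theta>2 dg2 L2 # gs') n z1 E F 2"
  by (intro cki_ok) simp_all
lemma cki_m1: "cki (- 1) 2 ys F n z1 E T \<theta> dg (FG T2 \<theta>2 dg2 L2 # gs') = insi (T - T2) [] T \<theta> dg ys (FG T2 \<theta>2 dg2 L2 # gs') n z1 E F 2"
  by (intro cki_ok) simp_all

lemma insi_le: "insi (- numeral d) hs T \<theta> dg ys gs n z1 E F G = rnn n z1 E (rev hs @ FG T \<theta> dg ys # gs) F G"
  "insi (- 1) hs T \<theta> dg ys gs n z1 E F G = rnn n z1 E (rev hs @ FG T \<theta> dg ys # gs) F G"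
  "insi 0 hs T \<theta> dg ys gs n z1 E F G = rnn n z1 E (rev hs @ FG T \<theta> dg ys # gs) F G"
  by (auto simp: insi_def split: list.splits)
lemma insi_gt1: "0 < d \<Longrightarrow> insi d hs T \<theta> dg ys (g # FG T2 \<theta>2 dg2 L2 # gs') n z1 E F G = insi (T - T2) (g # hs) T \<theta> dg ys (FG T2 \<theta>2 dg2 L2 # gs') n z1 E F G"
  by (simp add: insi_def)
lemma insi_gt: "insi (numeral d) hs T \<theta> dg ys (g # FG T2 \<theta>2 dg2 L2 # gs') n z1 E F G = insi (T - T2) (g # hs) T \<theta> dg ys (FG T2 \<theta>2 dg2 L2 # gs') n z1 E F G"
  "insi 1 hs T \<theta> dg ys (g # FG T2 \<theta>2 dg2 L2 # gs') n z1 E F G = insi (T - T2) (g # hs) T \<theta> dg ys (FG T2 \<theta>2 dg2 L2 # gs') n z1 E F G"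
  by (rule insi_gt1, simp)+
lemma insi_end: "insi (numeral d) hs T \<theta> dg ys [g] n z1 E F G = rnn n z1 E (rev hs @ [g, FG T \<theta> dg ys]) F G"
  "insi 1 hs T \<theta> dg ys [g] n z1 E F G = rnn n z1 E (rev hs @ [g, FG T \<theta> dg ys]) F G"
  by (auto simp: insi_def)
lemma rnn_rev: "rnn n z1 E (rev (h # hs) @ gs) F G = rnn n z1 E (rev hs @ h # gs) F G"
  "rnn n z1 E (rev [] @ gs) F G = rnn n z1 E gs F G"
  by simp_all

lemma rnn_step: "nat_of_num n = Suc (nat_of_num m) \<Longrightarrow> rnn n z1 E (FG T \<theta> dg (g # gl) # gs) F G = tk (tg g [] F) gl [] m z1 E T \<theta> dg gs G"
proof -
  assume "nat_of_num n = Suc (nat_of_num m)"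
  moreover have "nat_of_num m > 0" by (rule nat_of_num_pos)
  ultimately have "nat_of_num n - 1 = Suc (nat_of_num m - 1)" by simp
  thus ?thesis by (simp add: rnn_def tk_def tg_def advance_def Let_def FG_def add.assoc)
qed
lemma nat_of_num_pd: "n \<noteq> num.One \<Longrightarrow> nat_of_num n = Suc (nat_of_num (pd n))"
proof -
  assume "n \<noteq> num.One"
  hence "(numeral (pd n) :: int) = numeral n - 1" by (rule pd_numeral)
  hence "int (nat_of_num (pd n)) = int (nat_of_num n) - 1" by (simp add: nat_of_num_numeral)
  thus ?thesis by simp
qed
lemma rnn_One: "rnn num.One z1 E (FG T \<theta> dg L # gs) F G = (z1 \<le> T)" by (simp add: rnn_def)
lemma rnn_p0: "rnn (Num.Bit1 k) z1 E (FG T \<theta> dg (g # gl) # gs) F G = tk (tg g [] F) gl [] (Num.Bit0 k) z1 E T \<theta> dg gs G"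
  by (rule rnn_step, subst nat_of_num_pd) (simp_all only: pd.simps BitM.simps num.distinct simp_thms)
lemma rnn_p1: "rnn (Num.Bit0 (Num.Bit1 k)) z1 E (FG T \<theta> dg (g # gl) # gs) F G = tk (tg g [] F) gl [] (Num.Bit1 (Num.Bit0 k)) z1 E T \<theta> dg gs G"
  by (rule rnn_step, subst nat_of_num_pd) (simp_all only: pd.simps BitM.simps num.distinct simp_thms)
lemma rnn_p2: "rnn (Num.Bit0 (Num.Bit0 (Num.Bit1 k))) z1 E (FG T \<theta> dg (g # gl) # gs) F G = tk (tg g [] F) gl [] (Num.Bit1 (Num.Bit1 (Num.Bit0 k))) z1 E T \<theta> dg gs G"
  by (rule rnn_step, subst nat_of_num_pd) (simp_all only: pd.simps BitM.simps num.distinct simp_thms)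
lemma rnn_p3: "rnn (Num.Bit0 (Num.Bit0 (Num.Bit0 (Num.Bit1 k)))) z1 E (FG T \<theta> dg (g # gl) # gs) F G = tk (tg g [] F) gl [] (Num.Bit1 (Num.Bit1 (Num.Bit1 (Num.Bit0 k)))) z1 E T \<theta> dg gs G"
  by (rule rnn_step, subst nat_of_num_pd) (simp_all only: pd.simps BitM.simps num.distinct simp_thms)
lemma rnn_p4: "rnn (Num.Bit0 (Num.Bit0 (Num.Bit0 (Num.Bit0 (Num.Bit1 k))))) z1 E (FG T \<theta> dg (g # gl) # gs) F G = tk (tg g [] F) gl [] (Num.Bit1 (Num.Bit1 (Num.Bit1 (Num.Bit1 (Num.Bit0 k))))) z1 E T \<theta> dg gs G"
  by (rule rnn_step, subst nat_of_num_pd) (simp_all only: pd.simps BitM.simps num.distinct simp_thms)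
lemma rnn_p5: "rnn (Num.Bit0 (Num.Bit0 (Num.Bit0 (Num.Bit0 (Num.Bit0 (Num.Bit1 k)))))) z1 E (FG T \<theta> dg (g # gl) # gs) F G = tk (tg g [] F) gl [] (Num.Bit1 (Num.Bit1 (Num.Bit1 (Num.Bit1 (Num.Bit1 (Num.Bit0 k)))))) z1 E T \<theta> dg gs G"
  by (rule rnn_step, subst nat_of_num_pd) (simp_all only: pd.simps BitM.simps num.distinct simp_thms)
lemma rnn_p6: "rnn (Num.Bit0 (Num.Bit0 (Num.Bit0 (Num.Bit0 (Num.Bit0 (Num.Bit0 (Num.Bit1 k))))))) z1 E (FG T \<theta> dg (g # gl) # gs) F G = tk (tg g [] F) gl [] (Num.Bit1 (Num.Bit1 (Num.Bit1 (Num.Bit1 (Num.Bit1 (Num.Bit1 (Num.Bit0 k))))))) z1 E T \<theta> dg gs G"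
  by (rule rnn_step, subst nat_of_num_pd) (simp_all only: pd.simps BitM.simps num.distinct simp_thms)
lemma rnn_p7: "rnn (Num.Bit0 (Num.Bit0 (Num.Bit0 (Num.Bit0 (Num.Bit0 (Num.Bit0 (Num.Bit0 (Num.Bit1 k)))))))) z1 E (FG T \<theta> dg (g # gl) # gs) F G = tk (tg g [] F) gl [] (Num.Bit1 (Num.Bit1 (Num.Bit1 (Num.Bit1 (Num.Bit1 (Num.Bit1 (Num.Bit1 (Num.Bit0 k)))))))) z1 E T \<theta> dg gs G"
  by (rule rnn_step, subst nat_of_num_pd) (simp_all only: pd.simps BitM.simps num.distinct simp_thms)
lemma rnn_p8: "rnn (Num.Bit0 (Num.Bit0 (Num.Bit0 (Num.Bit0 (Num.Bit0 (Num.Bit0 (Num.Bit0 (Num.Bit0 (Num.Bit1 k))))))))) z1 E (FG T \<theta> dg (g # gl) # gs) F G = tk (tg g [] F) gl [] (Num.Bit1 (Num.Bit1 (Num.Bit1 (Num.Bit1 (Num.Bit1 (Num.Bit1 (Num.Bit1 (Num.Bit1 (Num.Bit0 k))))))))) z1 E T \<theta> dg gs G"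
  by (rule rnn_step, subst nat_of_num_pd) (simp_all only: pd.simps BitM.simps num.distinct simp_thms)
lemma rnn_p9: "rnn (Num.Bit0 (Num.Bit0 (Num.Bit0 (Num.Bit0 (Num.Bit0 (Num.Bit0 (Num.Bit0 (Num.Bit0 (Num.Bit0 (Num.Bit1 k)))))))))) z1 E (FG T \<theta> dg (g # gl) # gs) F G = tk (tg g [] F) gl [] (Num.Bit1 (Num.Bit1 (Num.Bit1 (Num.Bit1 (Num.Bit1 (Num.Bit1 (Num.Bit1 (Num.Bit1 (Num.Bit1 (Num.Bit0 k)))))))))) z1 E T \<theta> dg gs G"
  by (rule rnn_step, subst nat_of_num_pd) (simp_all only: pd.simps BitM.simps num.distinct simp_thms)
lemma rnn_p10: "rnn (Num.Bit0 (Num.Bit0 (Num.Bit0 (Num.Bit0 (Num.Bit0 (Num.Bit0 (Num.Bit0 (Num.Bit0 (Num.Bit0 (Num.Bit0 (Num.Bit1 k))))))))))) z1 E (FG T \<theta> dg (g # gl) # gs) F G = tk (tg g [] F) gl [] (Num.Bit1 (Num.Bit1 (Num.Bit1 (Num.Bit1 (Num.Bit1 (Num.Bit1 (Num.Bit1 (Num.Bit1 (Num.Bit1 (Num.Bit1 (Num.Bit0 k))))))))))) z1 E T \<theta> dg gs G"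
  by (rule rnn_step, subst nat_of_num_pd) (simp_all only: pd.simps BitM.simps num.distinct simp_thms)
lemma rnn_p11: "rnn (Num.Bit0 (Num.Bit0 (Num.Bit0 (Num.Bit0 (Num.Bit0 (Num.Bit0 (Num.Bit0 (Num.Bit0 (Num.Bit0 (Num.Bit0 (Num.Bit0 (Num.Bit1 k)))))))))))) z1 E (FG T \<theta> dg (g # gl) # gs) F G = tk (tg g [] F) gl [] (Num.Bit1 (Num.Bit1 (Num.Bit1 (Num.Bit1 (Num.Bit1 (Num.Bit1 (Num.Bit1 (Num.Bit1 (Num.Bit1 (Num.Bit1 (Num.Bit1 (Num.Bit0 k)))))))))))) z1 E T \<theta> dg gs G"
  by (rule rnn_step, subst nat_of_num_pd) (simp_all only: pd.simps BitM.simps num.distinct simp_thms)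
lemma rnn_p12: "rnn (Num.Bit0 (Num.Bit0 (Num.Bit0 (Num.Bit0 (Num.Bit0 (Num.Bit0 (Num.Bit0 (Num.Bit0 (Num.Bit0 (Num.Bit0 (Num.Bit0 (Num.Bit0 (Num.Bit1 k))))))))))))) z1 E (FG T \<theta> dg (g # gl) # gs) F G = tk (tg g [] F) gl [] (Num.Bit1 (Num.Bit1 (Num.Bit1 (Num.Bit1 (Num.Bit1 (Num.Bit1 (Num.Bit1 (Num.Bit1 (Num.Bit1 (Num.Bit1 (Num.Bit1 (Num.Bit1 (Num.Bit0 k))))))))))))) z1 E T \<theta> dg gs G"
  by (rule rnn_step, subst nat_of_num_pd) (simp_all only: pd.simps BitM.simps num.distinct simp_thms)
lemma rnn_p13: "rnn (Num.Bit0 (Num.Bit0 (Num.Bit0 (Num.Bit0 (Num.Bit0 (Num.Bit0 (Num.Bit0 (Num.Bit0 (Num.Bit0 (Num.Bit0 (Num.Bit0 (Num.Bit0 (Num.Bit0 (Num.Bit1 k)))))))))))))) z1 E (FG T \<theta> dg (g # gl) # gs) F G = tk (tg g [] F) gl [] (Num.Bit1 (Num.Bit1 (Num.Bit1 (Num.Bit1 (Num.Bit1 (Num.Bit1 (Num.Bit1 (Num.Bit1 (Num.Bit1 (Num.Bit1 (Num.Bit1 (Num.Bit1 (Num.Bit1 (Num.Bit0 k)))))))))))))) z1 E T \<theta> dg gs G"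
  by (rule rnn_step, subst nat_of_num_pd) (simp_all only: pd.simps BitM.simps num.distinct simp_thms)
lemma rnn_p14: "rnn (Num.Bit0 (Num.One)) z1 E (FG T \<theta> dg (g # gl) # gs) F G = tk (tg g [] F) gl [] (Num.One) z1 E T \<theta> dg gs G"
  by (rule rnn_step, subst nat_of_num_pd) (simp_all only: pd.simps BitM.simps num.distinct simp_thms)
lemma rnn_p15: "rnn (Num.Bit0 (Num.Bit0 (Num.One))) z1 E (FG T \<theta> dg (g # gl) # gs) F G = tk (tg g [] F) gl [] (Num.Bit1 (Num.One)) z1 E T \<theta> dg gs G"
  by (rule rnn_step, subst nat_of_num_pd) (simp_all only: pd.simps BitM.simps num.distinct simp_thms)
lemma rnn_p16: "rnn (Num.Bit0 (Num.Bit0 (Num.Bit0 (Num.One)))) z1 E (FG T \<theta> dg (g # gl) # gs) F G = tk (tg g [] F) gl [] (Num.Bit1 (Num.Bit1 (Num.One))) z1 E T \<theta> dg gs G"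
  by (rule rnn_step, subst nat_of_num_pd) (simp_all only: pd.simps BitM.simps num.distinct simp_thms)
lemma rnn_p17: "rnn (Num.Bit0 (Num.Bit0 (Num.Bit0 (Num.Bit0 (Num.One))))) z1 E (FG T \<theta> dg (g # gl) # gs) F G = tk (tg g [] F) gl [] (Num.Bit1 (Num.Bit1 (Num.Bit1 (Num.One)))) z1 E T \<theta> dg gs G"
  by (rule rnn_step, subst nat_of_num_pd) (simp_all only: pd.simps BitM.simps num.distinct simp_thms)
lemma rnn_p18: "rnn (Num.Bit0 (Num.Bit0 (Num.Bit0 (Num.Bit0 (Num.Bit0 (Num.One)))))) z1 E (FG T \<theta> dg (g # gl) # gs) F G = tk (tg g [] F) gl [] (Num.Bit1 (Num.Bit1 (Num.Bit1 (Num.Bit1 (Num.One))))) z1 E T \<theta> dg gs G"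
  by (rule rnn_step, subst nat_of_num_pd) (simp_all only: pd.simps BitM.simps num.distinct simp_thms)
lemma rnn_p19: "rnn (Num.Bit0 (Num.Bit0 (Num.Bit0 (Num.Bit0 (Num.Bit0 (Num.Bit0 (Num.One))))))) z1 E (FG T \<theta> dg (g # gl) # gs) F G = tk (tg g [] F) gl [] (Num.Bit1 (Num.Bit1 (Num.Bit1 (Num.Bit1 (Num.Bit1 (Num.One)))))) z1 E T \<theta> dg gs G"
  by (rule rnn_step, subst nat_of_num_pd) (simp_all only: pd.simps BitM.simps num.distinct simp_thms)
lemma rnn_p20: "rnn (Num.Bit0 (Num.Bit0 (Num.Bit0 (Num.Bit0 (Num.Bit0 (Num.Bit0 (Num.Bit0 (Num.One)))))))) z1 E (FG T \<theta> dg (g # gl) # gs) F G = tk (tg g [] F) gl [] (Num.Bit1 (Num.Bit1 (Num.Bit1 (Num.Bit1 (Num.Bit1 (Num.Bit1 (Num.One))))))) z1 E T \<theta> dg gs G"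
  by (rule rnn_step, subst nat_of_num_pd) (simp_all only: pd.simps BitM.simps num.distinct simp_thms)
lemma rnn_p21: "rnn (Num.Bit0 (Num.Bit0 (Num.Bit0 (Num.Bit0 (Num.Bit0 (Num.Bit0 (Num.Bit0 (Num.Bit0 (Num.One))))))))) z1 E (FG T \<theta> dg (g # gl) # gs) F G = tk (tg g [] F) gl [] (Num.Bit1 (Num.Bit1 (Num.Bit1 (Num.Bit1 (Num.Bit1 (Num.Bit1 (Num.Bit1 (Num.One)))))))) z1 E T \<theta> dg gs G"
  by (rule rnn_step, subst nat_of_num_pd) (simp_all only: pd.simps BitM.simps num.distinct simp_thms)
lemma rnn_p22: "rnn (Num.Bit0 (Num.Bit0 (Num.Bit0 (Num.Bit0 (Num.Bit0 (Num.Bit0 (Num.Bit0 (Num.Bit0 (Num.Bit0 (Num.One)))))))))) z1 E (FG T \<theta> dg (g # gl) # gs) F G = tk (tg g [] F) gl [] (Num.Bit1 (Num.Bit1 (Num.Bit1 (Num.Bit1 (Num.Bit1 (Num.Bit1 (Num.Bit1 (Num.Bit1 (Num.One))))))))) z1 E T \<theta> dg gs G"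
  by (rule rnn_step, subst nat_of_num_pd) (simp_all only: pd.simps BitM.simps num.distinct simp_thms)
lemma rnn_p23: "rnn (Num.Bit0 (Num.Bit0 (Num.Bit0 (Num.Bit0 (Num.Bit0 (Num.Bit0 (Num.Bit0 (Num.Bit0 (Num.Bit0 (Num.Bit0 (Num.One))))))))))) z1 E (FG T \<theta> dg (g # gl) # gs) F G = tk (tg g [] F) gl [] (Num.Bit1 (Num.Bit1 (Num.Bit1 (Num.Bit1 (Num.Bit1 (Num.Bit1 (Num.Bit1 (Num.Bit1 (Num.Bit1 (Num.One)))))))))) z1 E T \<theta> dg gs G"
  by (rule rnn_step, subst nat_of_num_pd) (simp_all only: pd.simps BitM.simps num.distinct simp_thms)
lemma rnn_p24: "rnn (Num.Bit0 (Num.Bit0 (Num.Bit0 (Num.Bit0 (Num.Bit0 (Num.Bit0 (Num.Bit0 (Num.Bit0 (Num.Bit0 (Num.Bit0 (Num.Bit0 (Num.One)))))))))))) z1 E (FG T \<theta> dg (g # gl) # gs) F G = tk (tg g [] F) gl [] (Num.Bit1 (Num.Bit1 (Num.Bit1 (Num.Bit1 (Num.Bit1 (Num.Bit1 (Num.Bit1 (Num.Bit1 (Num.Bit1 (Num.Bit1 (Num.One))))))))))) z1 E T \<theta> dg gs G"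
  by (rule rnn_step, subst nat_of_num_pd) (simp_all only: pd.simps BitM.simps num.distinct simp_thms)
lemma rnn_p25: "rnn (Num.Bit0 (Num.Bit0 (Num.Bit0 (Num.Bit0 (Num.Bit0 (Num.Bit0 (Num.Bit0 (Num.Bit0 (Num.Bit0 (Num.Bit0 (Num.Bit0 (Num.Bit0 (Num.One))))))))))))) z1 E (FG T \<theta> dg (g # gl) # gs) F G = tk (tg g [] F) gl [] (Num.Bit1 (Num.Bit1 (Num.Bit1 (Num.Bit1 (Num.Bit1 (Num.Bit1 (Num.Bit1 (Num.Bit1 (Num.Bit1 (Num.Bit1 (Num.Bit1 (Num.One)))))))))))) z1 E T \<theta> dg gs G"
  by (rule rnn_step, subst nat_of_num_pd) (simp_all only: pd.simps BitM.simps num.distinct simp_thms)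
lemma rnn_p26: "rnn (Num.Bit0 (Num.Bit0 (Num.Bit0 (Num.Bit0 (Num.Bit0 (Num.Bit0 (Num.Bit0 (Num.Bit0 (Num.Bit0 (Num.Bit0 (Num.Bit0 (Num.Bit0 (Num.Bit0 (Num.One)))))))))))))) z1 E (FG T \<theta> dg (g # gl) # gs) F G = tk (tg g [] F) gl [] (Num.Bit1 (Num.Bit1 (Num.Bit1 (Num.Bit1 (Num.Bit1 (Num.Bit1 (Num.Bit1 (Num.Bit1 (Num.Bit1 (Num.Bit1 (Num.Bit1 (Num.Bit1 (Num.One))))))))))))) z1 E T \<theta> dg gs G"
  by (rule rnn_step, subst nat_of_num_pd) (simp_all only: pd.simps BitM.simps num.distinct simp_thms)

lemmas run_rules = rnn_One rnn_rev insi_le insi_gt insi_end cki_pos cki_1 cki_0 cki_neg cki_m1 tk_Cons tk_Nil tg_One tg_Nil tg_p0 tg_p1 tg_p2 tg_p3 tg_p4 tg_p5 tg_p6 tg_p7 tg_q1 tg_q2 tg_q3 tg_q4 tg_q5 tg_q6 tg_q7 tg_q8 rnn_p0 rnn_p1 rnn_p2 rnn_p3 rnn_p4 rnn_p5 rnn_p6 rnn_p7 rnn_p8 rnn_p9 rnn_p10 rnn_p11 rnn_p12 rnn_p13 rnn_p14 rnn_p15 rnn_p16 rnn_p17 rnn_p18 rnn_p19 rnn_p20 rnn_p21 rnn_p22 rnn_p23 rnn_p24 rnn_p25 rnn_p26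
lemmas run_congs = tk_cong tg_cong cki_cong insi_cong rnn_cong if_weak_cong
lemma small_arith: "(0::int) + 1 = 1" "(1::int) + 1 = 2" "(2::int) + 1 = 3" "(3::int) + 1 = 4" "(-1::int) + 1 = 0"
  "(1::int) + -1 = 0" "(2::int) + -1 = 1" "(3::int) + -1 = 2" "(4::int) + -1 = 3" "(0::int) + -1 = -1" by simp_all
lemmas num_arith = small_arith Num.inc.simps arith_simps add_numeral_special add_neg_numeral_special diff_numeral_special add_0 add_0_right diff_0 diff_0_right minus_zero minus_minus rel_simps num.distinct simp_thms

definition num_of :: "int \<Rightarrow> num" where "num_of i = num_of_nat (nat i)"
lemma num_of_numeral: "num_of (numeral k) = k" "num_of 1 = num.One"
  by (simp_all add: num_of_def nat_of_num_numeral[symmetric] nat_of_num_inverse)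
   
text \<open>The counter of a weighted key started at time \<open>n\<close>, when
  \<open>j - n mod j\<close> steps remain to the next multiple of \<open>j\<close>.\<close>

definition mkc :: "int \<Rightarrow> int \<times> int \<Rightarrow> ctr" where
  "mkc n = (\<lambda>(j, c). Ct (num_of (j - n mod j)) (num_of j) c)"

lemma numeral_num_of:
  assumes "j > 0"
  shows "(numeral (num_of j) :: int) = j"
proof -
  have "nat_of_num (num_of j) = nat j" using assms by (simp add: num_of_def num_of_nat_inverse)
  hence "(numeral (num_of j) :: nat) = nat j" by (simp add: nat_of_num_numeral)
  hence "int (numeral (num_of j)) = int (nat j)" by simp
  thus ?thesis using assms by simp
qed

lemma ln_const_bounds:
  "ln (3/16 :: real) \<le> -1.67397642" "ln (24/19 :: real) \<le> 0.23361487" "ln (4 :: real) \<le> 1.38629438" "ln (25 :: real) \<le> 3.21887589"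
  "ln (25/17 :: real) \<le> 0.38566249" "ln (26/25 :: real) \<le> 0.03922072" "ln (9/4 :: real) \<ge> 0.81093018" "ln (4/3 :: real) \<le> 0.28768210"
proof -
  have p: "ln (16::real) = 4 * ln 2" "ln (4::real) = 2 * ln 2" "ln (9::real) = 2 * ln 3" "ln (25::real) = 2 * ln 5"
    using ln_realpow[of 2 4] ln_realpow[of 2 2] ln_realpow[of 3 2] ln_realpow[of 5 2] by simp_all
  have a: "ln (24/19 :: real) \<le> 0.23361487" using ln_approx_bounds[of "24/19" 6] by (simp add: eval_nat_numeral)
  have b: "ln (25/17 :: real) \<le> 0.38566249" using ln_approx_bounds[of "25/17" 8] by (simp add: eval_nat_numeral)
  have c: "ln (26/25 :: real) \<le> 0.03922072" using ln_approx_bounds[of "26/25" 4] by (simp add: eval_nat_numeral)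
  show "ln (3/16 :: real) \<le> -1.67397642" "ln (4 :: real) \<le> 1.38629438" "ln (25 :: real) \<le> 3.21887589"
    "ln (9/4 :: real) \<ge> 0.81093018" "ln (4/3 :: real) \<le> 0.28768210"
    using ln_2_bounds' ln_3_bounds ln_5_bounds by (simp_all add: ln_div p)
  show "ln (24/19 :: real) \<le> 0.23361487" "ln (25/17 :: real) \<le> 0.38566249" "ln (26/25 :: real) \<le> 0.03922072" by fact+
qed

section \<open>A verified sieve on odd numbers\<close>

text \<open>Position \<open>i\<close> stands for the number \<open>a + 2 * i\<close>, and
  \<open>k - 1\<close> is the distance to the next position divisible by \<open>q\<close>. After a
  hit the countdown restarts at \<open>q\<close>: a step of \<open>q\<close> positions is a step of
  \<open>2 * q\<close> in value.\<close>

fun sv :: "num \<Rightarrow> num \<Rightarrow> bool list \<Rightarrow> bool list" where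
  "sv k q [] = []"
| "sv k q (b # bs) = (if k = num.One then False # sv q q bs else b # sv (pd k) q bs)"

lemma length_sv [simp]: "length (sv k q bs) = length bs"
  by (induction k q bs rule: sv.induct) auto

text \<open>A position that is not a hit is not divisible by \<open>q\<close>: otherwise
  \<open>q\<close> would divide \<open>2 * (k - 1)\<close>, hence \<open>k - 1\<close> as
  \<open>q\<close> is odd, although \<open>0 < k - 1 < q\<close>.\<close>

lemma sv_sound:
  assumes "odd (numeral q :: int)" "numeral k \<le> (numeral q :: int)" "(numeral q :: int) dvd a + 2 * (numeral k - 1)"
    "i < length bs" "sv k q bs ! i"
  shows "bs ! i \<and> \<not> (numeral q :: int) dvd a + 2 * int i"
  using assms
proof (induction k q bs arbitrary: a i rule: sv.induct)
  case (2 k q b bs)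
  show ?case
  proof (cases "k = num.One")
    case True
    obtain i' where i: "i = Suc i'" using "2.prems"(5) True by (cases i) auto
    have d: "(numeral q :: int) dvd (a + 2) + 2 * (numeral q - 1)"
    proof -
      have e: "(a + 2) + 2 * (Q - 1) = a + 2 * Q" for Q :: int by simp
      have "(numeral q :: int) dvd a" using "2.prems"(3) True by simp
      thus ?thesis unfolding e by (rule dvd_add) (rule dvd_triv_right)
    qed
    have "bs ! i' \<and> \<not> (numeral q :: int) dvd (a + 2) + 2 * int i'"
      using "2.IH"(1)[OF True "2.prems"(1) _ d, of i'] "2.prems" True i by simp
    thus ?thesis by (simp add: i algebra_simps)
  next
    case False
    have e: "(numeral (pd k) :: int) = numeral k - 1" by (rule pd_numeral[OF False])
    show ?thesis
    proof (cases i)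
      case 0
      have "\<not> (numeral q :: int) dvd a"
      proof
        assume "(numeral q :: int) dvd a"
        hence "(numeral q :: int) dvd 2 * (numeral k - 1)" using "2.prems"(3) by (simp add: dvd_add_right_iff)
        moreover have "coprime (numeral q :: int) 2" using "2.prems"(1) by simp
        ultimately have "(numeral q :: int) dvd numeral k - 1" by (metis coprime_dvd_mult_right_iff)
        moreover have "(numeral k :: int) - 1 > 0" unfolding e[symmetric] by simp
        ultimately have "(numeral q :: int) \<le> numeral k - 1" by (rule zdvd_imp_le)
        thus False using "2.prems"(2) by linarith
      qed
      thus ?thesis using "2.prems"(5) False 0 by simp
    next
      case (Suc i')
      have d: "(numeral q :: int) dvd (a + 2) + 2 * (numeral (pd k) - 1)" unfolding e using "2.prems"(3) by (simp add: algebra_simps)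
      have le: "(numeral (pd k) :: int) \<le> numeral q" unfolding e using "2.prems"(2) by linarith
      have i': "i' < length bs" "sv (pd k) q bs ! i'" using "2.prems"(4,5) False Suc by simp_all
      have "bs ! i' \<and> \<not> (numeral q :: int) dvd (a + 2) + 2 * int i'"
        by (rule "2.IH"(2)[OF False "2.prems"(1) le d i'])
      thus ?thesis by (simp add: Suc algebra_simps)
    qed
  qed
qed simp

lemma sv_p0: "sv (Num.Bit1 k) q (b # bs) = b # sv (Num.Bit0 k) q bs" by simp
lemma sv_p1: "sv (Num.Bit0 (Num.Bit1 k)) q (b # bs) = b # sv (Num.Bit1 (Num.Bit0 k)) q bs" by simp
lemma sv_p2: "sv (Num.Bit0 (Num.Bit0 (Num.Bit1 k))) q (b # bs) = b # sv (Num.Bit1 (Num.Bit1 (Num.Bit0 k))) q bs" by simp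
lemma sv_p3: "sv (Num.Bit0 (Num.Bit0 (Num.Bit0 (Num.Bit1 k)))) q (b # bs) = b # sv (Num.Bit1 (Num.Bit1 (Num.Bit1 (Num.Bit0 k)))) q bs" by simp
lemma sv_p4: "sv (Num.Bit0 (Num.Bit0 (Num.Bit0 (Num.Bit0 (Num.Bit1 k))))) q (b # bs) = b # sv (Num.Bit1 (Num.Bit1 (Num.Bit1 (Num.Bit1 (Num.Bit0 k))))) q bs" by simp
lemma sv_p5: "sv (Num.Bit0 (Num.Bit0 (Num.Bit0 (Num.Bit0 (Num.Bit0 (Num.Bit1 k)))))) q (b # bs) = b # sv (Num.Bit1 (Num.Bit1 (Num.Bit1 (Num.Bit1 (Num.Bit1 (Num.Bit0 k)))))) q bs" by simp
lemma sv_p6: "sv (Num.Bit0 (Num.Bit0 (Num.Bit0 (Num.Bit0 (Num.Bit0 (Num.Bit0 (Num.Bit1 k))))))) q (b # bs) = b # sv (Num.Bit1 (Num.Bit1 (Num.Bit1 (Num.Bit1 (Num.Bit1 (Num.Bit1 (Num.Bit0 k))))))) q bs" by simp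
lemma sv_p7: "sv (Num.Bit0 (Num.Bit0 (Num.Bit0 (Num.Bit0 (Num.Bit0 (Num.Bit0 (Num.Bit0 (Num.Bit1 k)))))))) q (b # bs) = b # sv (Num.Bit1 (Num.Bit1 (Num.Bit1 (Num.Bit1 (Num.Bit1 (Num.Bit1 (Num.Bit1 (Num.Bit0 k)))))))) q bs" by simp
lemma sv_q1: "sv (Num.Bit0 num.One) q (b # bs) = b # sv num.One q bs" by simp
lemma sv_q2: "sv (Num.Bit0 (Num.Bit0 num.One)) q (b # bs) = b # sv (Num.Bit1 num.One) q bs" by simp
lemma sv_q3: "sv (Num.Bit0 (Num.Bit0 (Num.Bit0 num.One))) q (b # bs) = b # sv (Num.Bit1 (Num.Bit1 num.One)) q bs" by simp
lemma sv_q4: "sv (Num.Bit0 (Num.Bit0 (Num.Bit0 (Num.Bit0 num.One)))) q (b # bs) = b # sv (Num.Bit1 (Num.Bit1 (Num.Bit1 num.One))) q bs" by simp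
lemma sv_q5: "sv (Num.Bit0 (Num.Bit0 (Num.Bit0 (Num.Bit0 (Num.Bit0 num.One))))) q (b # bs) = b # sv (Num.Bit1 (Num.Bit1 (Num.Bit1 (Num.Bit1 num.One)))) q bs" by simp
lemma sv_q6: "sv (Num.Bit0 (Num.Bit0 (Num.Bit0 (Num.Bit0 (Num.Bit0 (Num.Bit0 num.One)))))) q (b # bs) = b # sv (Num.Bit1 (Num.Bit1 (Num.Bit1 (Num.Bit1 (Num.Bit1 num.One))))) q bs" by simp
lemma sv_q7: "sv (Num.Bit0 (Num.Bit0 (Num.Bit0 (Num.Bit0 (Num.Bit0 (Num.Bit0 (Num.Bit0 num.One))))))) q (b # bs) = b # sv (Num.Bit1 (Num.Bit1 (Num.Bit1 (Num.Bit1 (Num.Bit1 (Num.Bit1 num.One)))))) q bs" by simp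
lemma sv_q8: "sv (Num.Bit0 (Num.Bit0 (Num.Bit0 (Num.Bit0 (Num.Bit0 (Num.Bit0 (Num.Bit0 (Num.Bit0 num.One)))))))) q (b # bs) = b # sv (Num.Bit1 (Num.Bit1 (Num.Bit1 (Num.Bit1 (Num.Bit1 (Num.Bit1 (Num.Bit1 num.One))))))) q bs" by simp
lemma sv_One: "sv num.One q (b # bs) = False # sv q q bs" by simp
lemmas sv_rules = sv.simps(1) sv_One sv_p0 sv_p1 sv_p2 sv_p3 sv_p4 sv_p5 sv_p6 sv_p7 sv_q1 sv_q2 sv_q3 sv_q4 sv_q5 sv_q6 sv_q7 sv_q8
declare sv.simps [simp del]

primrec svs :: "(num \<times> num) list \<Rightarrow> bool list \<Rightarrow> bool list" where
  "svs [] bs = bs"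
| "svs (c # cs) bs = svs cs (sv (fst c) (snd c) bs)"

lemma length_svs [simp]: "length (svs cs bs) = length bs"
  by (induction cs arbitrary: bs) auto

text \<open>\<open>(q + 1) div 2\<close> is the inverse of \<open>2\<close> modulo the odd number
  \<open>q\<close>, so \<open>h\<close> is the first position \<open>i\<close> with
  \<open>q dvd a + 2 * i\<close>; the countdown is one larger.\<close>

definition sieve_key :: "int \<Rightarrow> int \<Rightarrow> num \<times> num" where
  "sieve_key a q = (let h = ((q + 1) div 2 * (- a)) mod q in (num_of (h + 1), num_of q))"

lemma sieve_key_ok:
  assumes "odd q" "q > 0"
  shows "numeral (snd (sieve_key a q)) = q" "(numeral (fst (sieve_key a q)) :: int) \<le> q"
    "q dvd a + 2 * (numeral (fst (sieve_key a q)) - 1)"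
proof -
  define h where "h = ((q + 1) div 2 * (- a)) mod q"
  have h: "0 \<le> h" "h < q" using assms by (auto simp: h_def)
  have k: "sieve_key a q = (num_of (h + 1), num_of q)" by (simp add: sieve_key_def h_def)
  have n: "(numeral (num_of (h + 1)) :: int) = h + 1" "(numeral (num_of q) :: int) = q"
    using h assms by (simp_all add: numeral_num_of)
  show "numeral (snd (sieve_key a q)) = q" "(numeral (fst (sieve_key a q)) :: int) \<le> q" using h by (simp_all add: k n)
  have "2 * ((q + 1) div 2) = q + 1" using assms by (auto elim!: oddE)
  hence e: "2 * ((q + 1) div 2 * (- a)) = - a - q * a" by (simp add: algebra_simps)
  have "[2 * h = 2 * ((q + 1) div 2 * (- a))] (mod q)" unfolding h_def by (simp add: cong_def mod_mult_right_eq)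
  hence "q dvd 2 * h - (- a - q * a)" unfolding e by (simp add: cong_iff_dvd_diff)
  hence "q dvd (2 * h - (- a - q * a)) - q * a" by (rule dvd_diff) simp
  thus "q dvd a + 2 * (numeral (fst (sieve_key a q)) - 1)" unfolding k fst_conv n by (simp add: algebra_simps)
qed

lemma svs_sound:
  assumes "\<forall>q\<in>set qs. odd q \<and> q > 0" "i < length bs" "svs (map (sieve_key a) qs) bs ! i"
  shows "\<forall>q\<in>set qs. \<not> q dvd a + 2 * int i"
  using assms
proof (induction qs arbitrary: bs)
  case (Cons q qs)
  have q: "odd q" "q > 0" using Cons.prems by auto
  have l: "i < length (sv (fst (sieve_key a q)) (snd (sieve_key a q)) bs)" using Cons.prems by simp
  have 1: "\<forall>q\<in>set qs. \<not> q dvd a + 2 * int i"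
    using Cons.prems by (intro Cons.IH[OF _ l]) auto
  have mono: "svs cs bs ! i \<Longrightarrow> i < length bs \<Longrightarrow> bs ! i" for cs bs
  proof (induction cs arbitrary: bs)
    case (Cons c cs)
    have "sv (fst c) (snd c) bs ! i" using Cons by simp
    moreover have "sv k q bs ! i \<Longrightarrow> i < length bs \<Longrightarrow> bs ! i" for k q bs
      by (induction k q bs arbitrary: i rule: sv.induct) (auto simp: sv.simps nth_Cons split: nat.splits if_splits)
    ultimately show ?case using Cons.prems by blast
  qed simp
  have "sv (fst (sieve_key a q)) (snd (sieve_key a q)) bs ! i" using Cons.prems l by (intro mono[OF _ l]) simp
  hence "\<not> q dvd a + 2 * int i"
    using sv_sound[of "snd (sieve_key a q)" "fst (sieve_key a q)" a i bs] sieve_key_ok[OF q, of a] q Cons.prems(2) by simp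
  thus ?case using 1 by simp
qed simp

text \<open>A composite \<open>t\<close> below \<open>B * B\<close> has an odd divisor
  \<open>r\<close> with \<open>3 \<le> r < B\<close>, and \<open>cover\<close> supplies a sieving
  number dividing \<open>r\<close>. Formulating the cover for all odd \<open>r\<close> avoids any
  primality claim about the sieving numbers.\<close>

lemma prime_if_no_divisor:
  fixes t B :: nat
  assumes "odd t" "1 < t" "t < B * B" and qs: "\<forall>q\<in>set qs. \<not> q dvd int t"
    and cover: "\<forall>r\<in>set [3..<B]. even r \<or> (\<exists>q\<in>set qs. q dvd int r)"
  shows "prime t"
proof (rule ccontr)
  assume "\<not> prime t"
  then obtain r where r: "r dvd t" "r\<^sup>2 \<le> t" "r \<noteq> 1"
    using prime_divisor_sqrt[of t] assms(2) by auto
  have "r < B"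
  proof (rule ccontr)
    assume "\<not> r < B"
    hence "B * B \<le> r * r" by (intro mult_mono) auto
    thus False using r assms by (simp add: power2_eq_square)
  qed
  moreover have "odd r" using r assms(1) by (metis dvd_trans)
  moreover from this have "r \<ge> 3" using r(3) by (cases r) (auto elim: oddE)
  ultimately have "\<exists>q\<in>set qs. q dvd int r" using cover by auto
  thus False using qs r(1) by (meson dvd_trans of_nat_dvd_iff)
qed

lemma coverI:
  assumes "filter odd [a..<B] = map fst ws" "\<forall>(r, q)\<in>set ws. q \<in> set qs \<and> q dvd int r"
  shows "\<forall>r\<in>set [a..<B]. even r \<or> (\<exists>q\<in>set qs. q dvd int r)"
proof
  fix r assume r: "r \<in> set [a..<B]"
  show "even r \<or> (\<exists>q\<in>set qs. q dvd int r)"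
  proof (cases "even r")
    case False
    hence "r \<in> set (filter odd [a..<B])" using r by simp
    hence "r \<in> fst ` set ws" unfolding assms(1) by simp
    thus ?thesis using assms(2) by fastforce
  qed simp
qed

lemma ball_upt_join:
  assumes "\<forall>r\<in>set [a..<b]. P r" "\<forall>r\<in>set [b..<c]. P r"
  shows "\<forall>r\<in>set [a..<c]. P r"
  using assms by (metis atLeastLessThan_iff atLeastLessThan_upt not_less)

section \<open>A table of lower bounds for logarithms of primes\<close>

definition prime_logs :: "nat \<Rightarrow> nat \<Rightarrow> real" where
  "prime_logs a b = (\<Sum>p | prime p \<and> a < p \<and> p \<le> b. ln (real p))"

lemma finite_prime_range: "finite {p :: nat. prime p \<and> a < p \<and> p \<le> b}"
  by (rule finite_subset[of _ "{..b}"]) auto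

lemma prime_logs_same [simp]: "prime_logs a a = 0"
  unfolding prime_logs_def by (rule sum.neutral) auto

lemma prime_logs_add:
  assumes "a \<le> b" "b \<le> c"
  shows "prime_logs a c = prime_logs a b + prime_logs b c"
proof -
  have "{p :: nat. prime p \<and> a < p \<and> p \<le> c} = {p. prime p \<and> a < p \<and> p \<le> b} \<union> {p. prime p \<and> b < p \<and> p \<le> c}"
    using assms by auto
  thus ?thesis unfolding prime_logs_def by (simp, intro sum.union_disjoint finite_prime_range) auto
qed

text \<open>A row \<open>(l, c, \<nu>)\<close> at position \<open>X\<close> covers the next
  \<open>l\<close> odd numbers: it records \<open>c\<close> primes among them and the value
  \<open>\<nu> / 10 ^ 6\<close> as a lower bound for the logarithm of each.\<close>

type_synonym row = "nat \<times> int \<times> int"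

definition row_ok :: "nat \<Rightarrow> row \<Rightarrow> bool" where
  "row_ok X = (\<lambda>(l, c, \<nu>). prime_logs X (X + 2 * l) \<ge> of_int c * of_int \<nu> / 10 ^ 6)"

primrec rows_ok :: "nat \<Rightarrow> row list \<Rightarrow> bool" where
  "rows_ok X [] = True"
| "rows_ok X (r # rs) = (row_ok X r \<and> rows_ok (X + 2 * fst r) rs)"

definition count_true :: "bool list \<Rightarrow> int" where "count_true bs = int (length (filter id bs))"

lemma count_true_simps [simp]: "count_true [] = 0" "count_true (True # bs) = count_true bs + 1" "count_true (False # bs) = count_true bs"
  by (simp_all add: count_true_def)

primrec blk :: "row list \<Rightarrow> bool list \<Rightarrow> bool" where
  "blk [] bs = True"
| "blk (r # rs) bs = (count_true (take (fst r) bs) = fst (snd r) \<and> fst r \<le> length bs \<and> blk rs (drop (fst r) bs))"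

text \<open>Checks in integers that the recorded values remain below \<open>10 ^ 6 * ln X\<close>,
  passing from row to row by \<open>ln y - ln x \<ge> 2 * (y - x) / (x + y)\<close> with
  \<open>y - x = 2 * l\<close>. Only the logarithm at the very first position has to be
  computed.\<close>

primrec lams :: "nat \<Rightarrow> int \<Rightarrow> row list \<Rightarrow> int \<Rightarrow> bool" where
  "lams X \<nu>0 [] \<nu>1 = (\<nu>1 \<le> \<nu>0)"
| "lams X \<nu>0 (r # rs) \<nu>1 = (fst (snd r) \<ge> 0 \<and> snd (snd r) \<ge> 0 \<and> snd (snd r) \<le> \<nu>0 \<and> (let X' = X + 2 * fst r; \<mu> = (case rs of [] \<Rightarrow> \<nu>1 | s # _ \<Rightarrow> snd (snd s)) in
      (\<mu> - snd (snd r)) * int (X + X') \<le> 4 * 10 ^ 6 * int (fst r) \<and> lams X' \<mu> rs \<nu>1))"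

lemma lams_rules:
  "lams X \<nu>0 [(l, c, \<nu>)] \<nu>1 \<longleftrightarrow> c \<ge> 0 \<and> \<nu> \<ge> 0 \<and> \<nu> \<le> \<nu>0 \<and> (\<nu>1 - \<nu>) * int (X + (X + 2 * l)) \<le> 4 * 10 ^ 6 * int l"
  "lams X \<nu>0 ((l, c, \<nu>) # (l', c', \<nu>') # rs) \<nu>1 \<longleftrightarrow> c \<ge> 0 \<and> \<nu> \<ge> 0 \<and> \<nu> \<le> \<nu>0 \<and>
    (\<nu>' - \<nu>) * int (X + (X + 2 * l)) \<le> 4 * 10 ^ 6 * int l \<and> lams (X + 2 * l) \<nu>' ((l', c', \<nu>') # rs) \<nu>1"
  by (simp_all only: lams.simps Let_def list.case fst_conv snd_conv order_refl simp_thms)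

lemma ln_ge_step:
  assumes "0 < x" "x \<le> y" "\<nu> \<le> 10 ^ 6 * ln x" "(\<mu> - \<nu>) * (x + y) \<le> 2 * 10 ^ 6 * (y - x)"
  shows "\<mu> \<le> 10 ^ 6 * ln (y::real)"
proof (cases "x = y")
  case True
  thus ?thesis using assms by (auto simp: mult_le_0_iff)
next
  case False
  define t where "t = 2 * (y - x) / (x + y)"
  have 1: "t \<le> ln y - ln x" unfolding t_def using assms False by (intro ln_inverse_approx_ge) auto
  have 2: "\<mu> - \<nu> \<le> 1000000 * t" unfolding t_def using assms by (simp add: field_simps)
  have "\<nu> \<le> 1000000 * ln x" using assms(3) by simp
  hence "\<mu> \<le> 1000000 * ln y" using 1 2 by linarith
  thus ?thesis by simp
qed

text \<open>Every prime of the row exceeds \<open>X\<close>, so the logarithm of the left end may be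
  charged for each of them.\<close>

lemma row_ok_of_count:
  assumes p: "\<And>i. i < l \<Longrightarrow> bs ! i \<Longrightarrow> prime (X + 2 + 2 * i)" and l: "l \<le> length bs"
    and c: "count_true (take l bs) = c" and \<nu>: "0 \<le> \<nu>" "of_int \<nu> \<le> 10 ^ 6 * ln (real X)" and X: "X > 0"
  shows "row_ok X (l, c, \<nu>)"
proof -
  define I where "I = {i. i < l \<and> bs ! i}"
  have I: "finite I" by (simp add: I_def)
  have "c = int (card I)"
  proof -
    have "length (filter id (take l bs)) = card {i. i < length (take l bs) \<and> id (take l bs ! i)}" by (rule length_filter_conv_card)
    also have "{i. i < length (take l bs) \<and> id (take l bs ! i)} = I" using l by (auto simp: I_def)
    finally show ?thesis using c unfolding count_true_def by linarith
  qed
  hence "of_int c * of_int \<nu> / 10 ^ 6 = (\<Sum>i\<in>I. of_int \<nu> / 10 ^ 6 :: real)" by simp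
  also have "\<dots> \<le> (\<Sum>i\<in>I. ln (real (X + 2 + 2 * i)))"
  proof (intro sum_mono)
    fix i
    have "ln (real X) \<le> ln (real (X + 2 + 2 * i))" using X by (subst ln_le_cancel_iff) auto
    thus "of_int \<nu> / 10 ^ 6 \<le> ln (real (X + 2 + 2 * i))" using \<nu> by simp
  qed
  also have "\<dots> = (\<Sum>p\<in>(\<lambda>i. X + 2 + 2 * i) ` I. ln (real p))" by (subst sum.reindex) (auto simp: inj_on_def)
  also have "\<dots> \<le> prime_logs X (X + 2 * l)"
    unfolding prime_logs_def
  proof (intro sum_mono2 finite_prime_range)
    show "(\<lambda>i. X + 2 + 2 * i) ` I \<subseteq> {p. prime p \<and> X < p \<and> p \<le> X + 2 * l}" using p by (auto simp: I_def)
  qed (auto intro: ln_ge_zero simp: prime_nat_iff)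
  finally show ?thesis by (simp add: row_ok_def)
qed

lemma rows_ok_of_blk:
  assumes "blk rs bs" "\<And>i. i < length bs \<Longrightarrow> bs ! i \<Longrightarrow> prime (X + 2 + 2 * i)" "lams X \<nu>0 rs \<nu>1" "of_int \<nu>0 \<le> 10 ^ 6 * ln (real X)" "X > 0"
  shows "rows_ok X rs \<and> of_int \<nu>1 \<le> 10 ^ 6 * ln (real (X + 2 * (\<Sum>r\<leftarrow>rs. fst r)))"
  using assms
proof (induction rs arbitrary: X bs \<nu>0)
  case (Cons r rs)
  obtain l c \<nu> where r: "r = (l, c, \<nu>)" by (cases r)
  define \<mu> where "\<mu> = (case rs of [] \<Rightarrow> \<nu>1 | s # _ \<Rightarrow> snd (snd s))"
  have b: "count_true (take l bs) = c" "l \<le> length bs" "blk rs (drop l bs)" using Cons.prems(1) by (auto simp: r)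
  have g: "c \<ge> 0" "\<nu> \<ge> 0" "\<nu> \<le> \<nu>0" "(\<mu> - \<nu>) * int (X + (X + 2 * l)) \<le> 4 * 10 ^ 6 * int l" "lams (X + 2 * l) \<mu> rs \<nu>1"
    using Cons.prems(3) by (auto simp: r \<mu>_def Let_def)
  have lam: "of_int \<nu> \<le> 10 ^ 6 * ln (real X)"
  proof -
    have "real_of_int \<nu> \<le> of_int \<nu>0" using g(3) by (simp only: of_int_le_iff)
    thus ?thesis using Cons.prems(4) by linarith
  qed
  have "row_ok X (l, c, \<nu>)" using Cons.prems(2,5) b g lam by (intro row_ok_of_count[of l bs]) auto
  moreover have "rows_ok (X + 2 * l) rs \<and> of_int \<nu>1 \<le> 10 ^ 6 * ln (real (X + 2 * l + 2 * (\<Sum>r\<leftarrow>rs. fst r)))"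
  proof (rule Cons.IH[OF b(3) _ g(5)])
    show "prime (X + 2 * l + 2 + 2 * i)" if "i < length (drop l bs)" "drop l bs ! i" for i
      using Cons.prems(2)[of "l + i"] that b(2) by (simp add: algebra_simps)
    have "real_of_int ((\<mu> - \<nu>) * int (X + (X + 2 * l))) \<le> of_int (4 * 10 ^ 6 * int l)" using g(4) by (simp only: of_int_le_iff)
    hence m: "(of_int \<mu> - of_int \<nu>) * (real X + real (X + 2 * l)) \<le> 2 * 10 ^ 6 * (real (X + 2 * l) - real X)" by simp
    show "of_int \<mu> \<le> 10 ^ 6 * ln (real (X + 2 * l))"
      using Cons.prems(5) by (intro ln_ge_step[OF _ _ lam m]) auto
  qed (use Cons.prems(5) in simp)
  ultimately show ?case by (simp add: r algebra_simps)
next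
  case Nil
  have "real_of_int \<nu>1 \<le> of_int \<nu>0" using Nil.prems(3) by simp
  thus ?case using Nil.prems(4) by simp
qed

primrec trues :: "num \<Rightarrow> bool list" where
  "trues num.One = [True]"
| "trues (num.Bit0 n) = trues n @ trues n"
| "trues (num.Bit1 n) = True # trues n @ trues n"

lemma length_trues: "length (trues n) = numeral n"
  by (induction n) (simp_all add: numeral_Bit0 numeral_Bit1)

primrec segs :: "int \<Rightarrow> int list \<Rightarrow> num list \<Rightarrow> bool list" where
  "segs a qs [] = []"
| "segs a qs (M # Ms) = svs (map (sieve_key a) qs) (trues M) @ segs (a + 2 * numeral M) qs Ms"

lemma length_segs: "length (segs a qs Ms) = (\<Sum>M\<leftarrow>Ms. numeral M)"
  by (induction Ms arbitrary: a) (simp_all add: length_trues)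

lemma segs_arith: "(a + 2 * m) + 2 * (i - m) = a + 2 * (i :: int)"
  by simp

lemma segs_sound:
  assumes qs: "\<forall>q\<in>set qs. odd q \<and> q > 0" and "i < length (segs a qs Ms)" "segs a qs Ms ! i"
  shows "\<forall>q\<in>set qs. \<not> q dvd a + 2 * int i"
  using assms(2,3)
proof (induction Ms arbitrary: a i)
  case (Cons M Ms)
  define S where "S = svs (map (sieve_key a) qs) (trues M)"
  have lS: "length S = numeral M" by (simp add: S_def length_trues)
  show ?case
  proof (cases "i < numeral M")
    case True
    hence "S ! i" using Cons.prems by (simp add: S_def[symmetric] nth_append lS)
    thus ?thesis unfolding S_def using True by (intro svs_sound[OF qs]) (simp_all add: length_trues)
  next
    case False
    have "segs (a + 2 * numeral M) qs Ms ! (i - numeral M)" "i - numeral M < length (segs (a + 2 * numeral M) qs Ms)"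
      using Cons.prems False by (auto simp: S_def[symmetric] nth_append lS)
    hence F: "\<forall>q\<in>set qs. \<not> q dvd (a + 2 * numeral M) + 2 * int (i - numeral M)" by (intro Cons.IH)
    have "int (i - numeral M) = int i - numeral M" using False by (simp add: of_nat_diff)
    hence eq: "(a + 2 * numeral M) + 2 * int (i - numeral M) = a + 2 * int i" by (simp only:) (rule segs_arith)
    show ?thesis using F unfolding eq .
  qed
qed simp

text \<open>The second conclusion, a bound for the logarithm at the right end, is the starting value
  needed for the next block of rows.\<close>

lemma rows_ok_of_sieve:
  assumes run: "blk rs (segs (int X + 2) qs Ms)" and qs: "\<forall>q\<in>set qs. odd q \<and> q > 0"
    and cover: "\<forall>r\<in>set [3..<B]. even r \<or> (\<exists>q\<in>set qs. q dvd int r)"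
    and X: "odd X" "X + 2 * (\<Sum>M\<leftarrow>Ms. numeral M) < B * B"
    and lam: "lams X \<nu>0 rs \<nu>1" "of_int \<nu>0 \<le> 10 ^ 6 * ln (real X)"
  shows "rows_ok X rs \<and> of_int \<nu>1 \<le> 10 ^ 6 * ln (real (X + 2 * (\<Sum>r\<leftarrow>rs. fst r)))"
proof (rule rows_ok_of_blk[OF run _ lam])
  show "X > 0" using X by (cases X) auto
  show "prime (X + 2 + 2 * i)" if s: "i < length (segs (int X + 2) qs Ms)" "segs (int X + 2) qs Ms ! i" for i
  proof (rule prime_if_no_divisor[OF _ _ _ _ cover])
    show "\<forall>q\<in>set qs. \<not> q dvd int (X + 2 + 2 * i)"
      using segs_sound[OF qs s] by (simp add: algebra_simps)
    have "i < (\<Sum>M\<leftarrow>Ms. numeral M)" using s(1) by (simp add: length_segs)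
    thus "X + 2 + 2 * i < B * B" using X(2) by linarith
  qed (use X in auto)
qed

text \<open>Break points with running totals in units of \<open>10 ^ (-6)\<close>. The difference of
  two totals bounds the logarithms of the primes in between, which is what \<open>pts_diff\<close>
  extracts.\<close>

primrec pts :: "nat \<Rightarrow> int \<Rightarrow> row list \<Rightarrow> (nat \<times> int) list" where
  "pts X P [] = [(X, P)]"
| "pts X P (r # rs) = (X, P) # pts (X + 2 * fst r) (P + fst (snd r) * snd (snd r)) rs"

lemma pts_ge: "rows_ok X rs \<Longrightarrow> (x, p) \<in> set (pts X P rs) \<Longrightarrow> X \<le> x \<and> prime_logs X x \<ge> of_int (p - P) / 10 ^ 6"
proof (induction rs arbitrary: X P)
  case Nil
  thus ?case by simp
next
  case (Cons r rs)
  obtain l c \<nu> where r: "r = (l, c, \<nu>)" by (cases r)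
  have ok: "row_ok X (l, c, \<nu>)" "rows_ok (X + 2 * l) rs" using Cons.prems(1) by (auto simp: r)
  show ?case
  proof (cases "(x, p) = (X, P)")
    case True
    thus ?thesis by simp
  next
    case False
    hence mem: "(x, p) \<in> set (pts (X + 2 * l) (P + c * \<nu>) rs)" using Cons.prems(2) by (auto simp: r)
    have *: "X + 2 * l \<le> x" "of_int (p - (P + c * \<nu>)) / 10 ^ 6 \<le> prime_logs (X + 2 * l) x"
      using Cons.IH[OF ok(2) mem] by blast+
    have e: "prime_logs X x = prime_logs X (X + 2 * l) + prime_logs (X + 2 * l) x" using * by (intro prime_logs_add) auto
    have f: "of_int c * of_int \<nu> / 10 ^ 6 \<le> prime_logs X (X + 2 * l)" using ok(1) unfolding row_ok_def prod.case .
    have g: "of_int (p - P) / 10 ^ 6 = of_int (p - (P + c * \<nu>)) / 10 ^ 6 + of_int c * of_int \<nu> / (10 ^ 6 :: real)"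
      by (simp add: add_divide_distrib diff_divide_distrib)
    show ?thesis
    proof
      show "X \<le> x" using *(1) by linarith
      show "of_int (p - P) / 10 ^ 6 \<le> prime_logs X x" unfolding g e using *(2) f by linarith
    qed
  qed
qed

lemma pts_diff:
  assumes "rows_ok X rs" "(x, p) \<in> set (pts X P rs)" "(x', p') \<in> set (pts X P rs)" "x < x'"
  shows "prime_logs x x' \<ge> of_int (p' - p) / 10 ^ 6"
  using assms
proof (induction rs arbitrary: X P)
  case (Cons r rs)
  have ok: "rows_ok (X + 2 * fst r) rs" using Cons.prems(1) by simp
  show ?case
  proof (cases "(x, p) = (X, P)")
    case True
    thus ?thesis using pts_ge[OF Cons.prems(1,3)] by auto
  next
    case False
    hence m: "(x, p) \<in> set (pts (X + 2 * fst r) (P + fst (snd r) * snd (snd r)) rs)" using Cons.prems(2) by auto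
    hence "x \<ge> X" using pts_ge[OF ok m] by simp
    hence "(x', p') \<in> set (pts (X + 2 * fst r) (P + fst (snd r) * snd (snd r)) rs)" using Cons.prems(3,4) by auto
    thus ?thesis using Cons.IH[OF ok m _ Cons.prems(4)] by simp
  qed
qed simp

lemma pts_unique:
  assumes "\<forall>r\<in>set rs. fst r > 0" "(x, p) \<in> set (pts X P rs)" "(x, p') \<in> set (pts X P rs)"
  shows "p = p'"
proof -
  have ge: "(x, p) \<in> set (pts X P rs) \<Longrightarrow> X \<le> x" for x p X P rs
    by (induction rs arbitrary: X P) fastforce+
  show ?thesis using assms
  proof (induction rs arbitrary: X P)
    case (Cons r rs)
    have "x \<noteq> X" if "(x, q) \<in> set (pts (X + 2 * fst r) (P + fst (snd r) * snd (snd r)) rs)" for q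
      using ge[OF that] Cons.prems(1) by auto
    thus ?case using Cons by auto
  qed simp
qed

lemma rows_ok_append:
  "rows_ok X (rs @ ss) \<longleftrightarrow> rows_ok X rs \<and> rows_ok (X + 2 * (\<Sum>r\<leftarrow>rs. fst r)) ss"
  by (induction rs arbitrary: X) (auto simp: algebra_simps)

lemma pts_append:
  "set (pts X P (rs @ ss)) = set (pts X P rs) \<union> set (pts (X + 2 * (\<Sum>r\<leftarrow>rs. fst r)) (P + (\<Sum>r\<leftarrow>rs. fst (snd r) * snd (snd r))) ss)"
proof (induction rs arbitrary: X P)
  case Nil
  show ?case by (cases ss) auto
next
  case (Cons r rs)
  show ?case by (simp add: Cons algebra_simps)
qed

fun chain :: "nat \<Rightarrow> (nat \<times> nat) list \<Rightarrow> bool" where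
  "chain c [] = True"
| "chain c (ab # r) = (c \<le> fst ab \<and> fst ab < snd ab \<and> chain (snd ab) r)"

lemma chain_lt: "chain c ivs \<Longrightarrow> \<forall>(a, b)\<in>set ivs. a < b"
  by (induction c ivs rule: chain.induct) auto

lemma prime_logs_chain:
  assumes "chain c ivs"
  shows "(\<Sum>(a, b)\<leftarrow>ivs. prime_logs a b) = (\<Sum>p | prime p \<and> (\<exists>(a, b)\<in>set ivs. a < p \<and> p \<le> b). ln (real p))
    \<and> finite {p :: nat. prime p \<and> (\<exists>(a, b)\<in>set ivs. a < p \<and> p \<le> b)} \<and> (\<forall>(a, b)\<in>set ivs. c \<le> a)"
  using assms
proof (induction ivs arbitrary: c)
  case (Cons ab ivs)
  obtain a b where ab: "ab = (a, b)" by (cases ab)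
  define S where "S = {p :: nat. prime p \<and> (\<exists>(a, b)\<in>set ivs. a < p \<and> p \<le> b)}"
  have ch: "c \<le> a" "a < b" "chain b ivs" using Cons.prems by (auto simp: ab)
  have IH: "(\<Sum>(a, b)\<leftarrow>ivs. prime_logs a b) = (\<Sum>p\<in>S. ln (real p))" "finite S" "\<forall>(a', b')\<in>set ivs. b \<le> a'"
    using Cons.IH[OF ch(3)] unfolding S_def by blast+
  have gt: "b < p" if "p \<in> S" for p using that IH(3) by (force simp: S_def)
  have "{p. prime p \<and> (\<exists>(a, b)\<in>set (ab # ivs). a < p \<and> p \<le> b)} = {p. prime p \<and> a < p \<and> p \<le> b} \<union> S"
    by (auto simp: S_def ab)
  moreover have "(\<Sum>p\<in>{p. prime p \<and> a < p \<and> p \<le> b} \<union> S. ln (real p)) = prime_logs a b + (\<Sum>p\<in>S. ln (real p))"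
  proof -
    have "{p. prime p \<and> a < p \<and> p \<le> b} \<inter> S = {}"
    proof (rule equals0I)
      fix p assume "p \<in> {p. prime p \<and> a < p \<and> p \<le> b} \<inter> S"
      hence "p \<le> b" "p \<in> S" by auto
      thus False using gt[of p] by simp
    qed
    thus ?thesis unfolding prime_logs_def by (rule sum.union_disjoint[OF finite_prime_range IH(2)])
  qed
  moreover have "\<forall>(a', b')\<in>set ivs. c \<le> a'" using IH(3) ch by fastforce
  ultimately show ?case using IH ch finite_prime_range by (simp add: ab)
qed simp

text \<open>Converts a condition on \<open>d\<close> into a condition on the quotient
  \<open>y div d\<close>, as \<open>content\<close> demands. The universal quantifier makes it sound
  for every \<open>d\<close>; it loses nothing where the quotient determines
  \<open>d\<close>.\<close>

definition sep :: "nat \<Rightarrow> (nat \<Rightarrow> bool) \<Rightarrow> nat \<Rightarrow> bool" where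
  "sep y P z \<longleftrightarrow> (\<forall>d>0. y div d = z \<longrightarrow> P d)"

text \<open>For \<open>y = m (m + 1)\<close> the quotients \<open>y div d\<close> with \<open>d \<le> m\<close> determine \<open>d\<close>.\<close>

lemma div_strict:
  fixes p d m :: nat
  assumes "0 < p" "p < d" "p \<le> m"
  shows "m * (m + 1) div d < m * (m + 1) div p"
proof -
  define y q where "y = m * (m + 1)" and "q = y div d"
  have "p * (p + 1) \<le> y" unfolding y_def using assms by (intro mult_mono) auto
  have "q * d \<le> y" by (simp add: q_def)
  have "(q + 1) * p \<le> y"
  proof (cases "q \<ge> p")
    case True
    have "(q + 1) * p = q * p + p" by simp
    also have "\<dots> \<le> q * p + q" using True by simp
    also have "\<dots> = q * (p + 1)" by simp
    also have "\<dots> \<le> q * d" using assms by (intro mult_left_mono) auto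
    finally show ?thesis using \<open>q * d \<le> y\<close> by linarith
  next
    case False
    hence "(q + 1) * p \<le> p * p" by (intro mult_right_mono) auto
    also have "\<dots> \<le> p * (p + 1)" by simp
    finally show ?thesis using \<open>p * (p + 1) \<le> y\<close> by linarith
  qed
  hence "q + 1 \<le> y div p" using assms(1) by (simp add: less_eq_div_iff_mult_less_eq)
  thus ?thesis by (simp add: q_def y_def)
qed

text \<open>For the middle range only primes, no higher powers, are counted. By
  \<open>div_strict\<close> a prime \<open>p \<le> m\<close> is the only \<open>d\<close> with its
  quotient, so \<open>sep\<close> reduces to \<open>P p\<close>.\<close>

lemma ln_content_ge_primes:
  fixes m :: nat
  assumes S: "finite S" "\<And>p. p \<in> S \<Longrightarrow> prime p \<and> p \<le> m \<and> P p"
  shows "(\<Sum>p\<in>S. ln (real p)) \<le> ln (real (content (m * (m + 1)) (sep (m * (m + 1)) P)))"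
proof -
  define y where "y = m * (m + 1)"
  have e: "sep y P (y div p)" if "p \<in> S" for p
    unfolding sep_def
  proof (intro allI impI)
    fix d :: nat
    assume d: "d > 0" "y div d = y div p"
    have p: "0 < p" "p \<le> m" using S(2)[OF that] prime_gt_0_nat by auto
    have "d = p"
    proof (rule ccontr)
      assume "d \<noteq> p"
      hence "p < d \<or> d < p" by linarith
      thus False using div_strict[of p d m] div_strict[of d p m] d p by (auto simp: y_def)
    qed
    thus "P d" using S(2)[OF that] by simp
  qed
  have sub: "S \<subseteq> {1..y}"
  proof
    fix p assume "p \<in> S"
    hence p: "1 \<le> p" "p \<le> m" using S(2) prime_ge_1_nat by auto
    have "m * 1 \<le> m * (m + 1)" by (intro mult_left_mono) auto
    thus "p \<in> {1..y}" using p by (simp add: y_def)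
  qed
  have "(\<Sum>p\<in>S. ln (real p)) = (\<Sum>p\<in>S. mangoldt p * of_bool (sep y P (y div p)))"
    using e S(2) by (intro sum.cong) auto
  also have "\<dots> \<le> (\<Sum>d\<in>{1..y}. mangoldt d * of_bool (sep y P (y div d)))"
    using sub by (intro sum_mono2) (auto intro: mangoldt_nonneg)
  also have "\<dots> = ln (real (content y (sep y P)))" by (rule ln_content[symmetric])
  finally show ?thesis by (simp add: y_def)
qed

text \<open>The starting value of the table, from \<open>61 = 60 * (61/60)\<close> and the prime
  factors of \<open>60\<close>.\<close>

lemma ln_start: "of_int 4110872 \<le> 10 ^ 6 * ln (real 61)"
proof -
  have "ln (61/60 :: real) \<ge> 0.016529" using ln_approx_bounds[of "61/60" 3] by (simp add: eval_nat_numeral)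
  moreover have "ln (61/60 :: real) = ln 61 - ln 60" by (rule ln_divide_pos) simp_all
  moreover have "ln (60 :: real) = 2 * ln 2 + ln 3 + ln 5"
    using ln_mult_pos[of 12 "5::real"] ln_mult_pos[of 4 "3::real"] ln_mult_pos[of 2 "2::real"] by simp
  ultimately show ?thesis using ln_2_lower ln_3_bounds(1) ln_5_bounds(1) by simp
qed

text \<open>Two sieving lists: this one covers all odd divisors below \<open>33\<close> and so
  certifies primes below \<open>1089\<close>; the longer one covers those below \<open>211\<close>
  and reaches \<open>44521\<close>, beyond the last break point \<open>41885\<close>.\<close>

definition odd_primes1 :: "int list" where "odd_primes1 = [3, 5, 7, 11, 13, 17, 19, 23, 29, 31]"
lemma odd_primes1_odd: "\<forall>q\<in>set odd_primes1. odd q \<and> q > 0" by (simp add: odd_primes1_def)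
lemma odd_primes1_cover_3: "\<forall>r\<in>set [3..<23]. even r \<or> (\<exists>q\<in>set odd_primes1. q dvd int r)"
  by (rule coverI[where ws = "[(3, 3), (5, 5), (7, 7), (9, 3), (11, 11), (13, 13), (15, 3), (17, 17), (19, 19), (21, 3)]"]) (simp_all add: odd_primes1_def)
lemma odd_primes1_cover_23: "\<forall>r\<in>set [23..<33]. even r \<or> (\<exists>q\<in>set odd_primes1. q dvd int r)"
  by (rule coverI[where ws = "[(23, 23), (25, 5), (27, 3), (29, 29), (31, 31)]"]) (simp_all add: odd_primes1_def)
lemmas odd_primes1_cover = ball_upt_join[OF odd_primes1_cover_3 odd_primes1_cover_23]
definition odd_primes2 :: "int list" where "odd_primes2 = [3, 5, 7, 11, 13, 17, 19, 23, 29, 31, 37, 41, 43, 47, 53, 59, 61, 67, 71, 73, 79, 83, 89, 97, 101, 103, 107, 109, 113, 127, 131, 137, 139, 149, 151, 157, 163, 167, 173, 179, 181, 191, 193, 197, 199]"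
lemma odd_primes2_odd: "\<forall>q\<in>set odd_primes2. odd q \<and> q > 0" by (simp add: odd_primes2_def)
lemma odd_primes2_cover_3: "\<forall>r\<in>set [3..<23]. even r \<or> (\<exists>q\<in>set odd_primes2. q dvd int r)"
  by (rule coverI[where ws = "[(3, 3), (5, 5), (7, 7), (9, 3), (11, 11), (13, 13), (15, 3), (17, 17), (19, 19), (21, 3)]"]) (simp_all add: odd_primes2_def)
lemma odd_primes2_cover_23: "\<forall>r\<in>set [23..<43]. even r \<or> (\<exists>q\<in>set odd_primes2. q dvd int r)"
  by (rule coverI[where ws = "[(23, 23), (25, 5), (27, 3), (29, 29), (31, 31), (33, 3), (35, 5), (37, 37), (39, 3), (41, 41)]"]) (simp_all add: odd_primes2_def)
lemma odd_primes2_cover_43: "\<forall>r\<in>set [43..<63]. even r \<or> (\<exists>q\<in>set odd_primes2. q dvd int r)"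
  by (rule coverI[where ws = "[(43, 43), (45, 3), (47, 47), (49, 7), (51, 3), (53, 53), (55, 5), (57, 3), (59, 59), (61, 61)]"]) (simp_all add: odd_primes2_def)
lemma odd_primes2_cover_63: "\<forall>r\<in>set [63..<83]. even r \<or> (\<exists>q\<in>set odd_primes2. q dvd int r)"
  by (rule coverI[where ws = "[(63, 3), (65, 5), (67, 67), (69, 3), (71, 71), (73, 73), (75, 3), (77, 7), (79, 79), (81, 3)]"]) (simp_all add: odd_primes2_def)
lemma odd_primes2_cover_83: "\<forall>r\<in>set [83..<103]. even r \<or> (\<exists>q\<in>set odd_primes2. q dvd int r)"
  by (rule coverI[where ws = "[(83, 83), (85, 5), (87, 3), (89, 89), (91, 7), (93, 3), (95, 5), (97, 97), (99, 3), (101, 101)]"]) (simp_all add: odd_primes2_def)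
lemma odd_primes2_cover_103: "\<forall>r\<in>set [103..<123]. even r \<or> (\<exists>q\<in>set odd_primes2. q dvd int r)"
  by (rule coverI[where ws = "[(103, 103), (105, 3), (107, 107), (109, 109), (111, 3), (113, 113), (115, 5), (117, 3), (119, 7), (121, 11)]"]) (simp_all add: odd_primes2_def)
lemma odd_primes2_cover_123: "\<forall>r\<in>set [123..<143]. even r \<or> (\<exists>q\<in>set odd_primes2. q dvd int r)"
  by (rule coverI[where ws = "[(123, 3), (125, 5), (127, 127), (129, 3), (131, 131), (133, 7), (135, 3), (137, 137), (139, 139), (141, 3)]"]) (simp_all add: odd_primes2_def)
lemma odd_primes2_cover_143: "\<forall>r\<in>set [143..<163]. even r \<or> (\<exists>q\<in>set odd_primes2. q dvd int r)"
  by (rule coverI[where ws = "[(143, 11), (145, 5), (147, 3), (149, 149), (151, 151), (153, 3), (155, 5), (157, 157), (159, 3), (161, 7)]"]) (simp_all add: odd_primes2_def)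
lemma odd_primes2_cover_163: "\<forall>r\<in>set [163..<183]. even r \<or> (\<exists>q\<in>set odd_primes2. q dvd int r)"
  by (rule coverI[where ws = "[(163, 163), (165, 3), (167, 167), (169, 13), (171, 3), (173, 173), (175, 5), (177, 3), (179, 179), (181, 181)]"]) (simp_all add: odd_primes2_def)
lemma odd_primes2_cover_183: "\<forall>r\<in>set [183..<203]. even r \<or> (\<exists>q\<in>set odd_primes2. q dvd int r)"
  by (rule coverI[where ws = "[(183, 3), (185, 5), (187, 11), (189, 3), (191, 191), (193, 193), (195, 3), (197, 197), (199, 199), (201, 3)]"]) (simp_all add: odd_primes2_def)
lemma odd_primes2_cover_203: "\<forall>r\<in>set [203..<211]. even r \<or> (\<exists>q\<in>set odd_primes2. q dvd int r)"
  by (rule coverI[where ws = "[(203, 7), (205, 5), (207, 3), (209, 11)]"]) (simp_all add: odd_primes2_def)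
lemmas odd_primes2_cover = ball_upt_join[OF ball_upt_join[OF ball_upt_join[OF ball_upt_join[OF ball_upt_join[OF ball_upt_join[OF ball_upt_join[OF ball_upt_join[OF ball_upt_join[OF ball_upt_join[OF odd_primes2_cover_3 odd_primes2_cover_23] odd_primes2_cover_43] odd_primes2_cover_63] odd_primes2_cover_83] odd_primes2_cover_103] odd_primes2_cover_123] odd_primes2_cover_143] odd_primes2_cover_163] odd_primes2_cover_183] odd_primes2_cover_203]
text \<open>Positions run from \<open>61\<close> upwards. Near the start almost every row is a
  single odd number; later rows lengthen, since relative accuracy is what matters for the interval
  end points.\<close>

definition rows0 :: "row list" where "rows0 = [(1, 0, 4110872), (1, 0, 4143130), (1, 1, 4174380), (1, 0, 4204683), (1, 1, 4234094), (1, 1, 4262665), (1, 0, 4290442), (1, 0, 4317469), (1, 1, 4343784), (1, 0, 4369425), (1, 1, 4394425), (1, 0, 4418815), (1, 0, 4442624), (1, 1, 4465879), (1, 0, 4488606), (1, 0, 4510828), (1, 0, 4532567), (1, 1, 4553843), (1, 0, 4574676), (1, 1, 4595084), (1, 1, 4615084), (1, 0, 4634691), (1, 1, 4653921), (1, 1, 4672788), (1, 0, 4691306), (1, 1, 4709487), (1, 0, 4727344), (1, 0, 4744887), (1, 0, 4762128), (1, 0, 4779077), (1, 0, 4795743), (1, 0, 4812136), (1, 1, 4828265), (1, 0, 4844138), (1, 1, 4859763), (1, 0, 4875147), (1, 0, 4890298), (1, 1, 4905223), (1, 1, 4919928), (1, 0, 4934420), (1, 0, 4948705), (1, 0, 4962789),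 (1, 0, 4976677), (1, 1, 4990375), (1, 1, 5003888), (1, 0, 5017221), (1, 0, 5030378), (1, 1, 5043365), (1, 0, 5056185), (1, 0, 5068843), (1, 1, 5081343), (1, 0, 5093688), (1, 1, 5105883), (1, 0, 5117931), (1, 0, 5129835), (1, 1, 5141599), (1, 0, 5153226), (1, 0, 5164720), (1, 1, 5176083), (1, 1, 5187318), (1, 0, 5198429), (1, 0, 5209418), (1, 0, 5220287), (1, 0, 5231039), (1, 1, 5241677), (1, 1, 5252203), (1, 0, 5262619), (1, 1, 5272928), (1, 1, 5283132), (1, 0, 5293233)]"
lemma sieve0: "blk rows0 (segs (int 61 + 2) odd_primes1 [num_of 70])"
  by (simp add: odd_primes1_def sieve_key_def Let_def num_of_numeral del: svs.simps blk.simps trues.simps,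
    simp only: svs.simps fst_conv snd_conv sv_rules trues.simps append.simps, simp add: rows0_def)
lemma rows_sum0: "(\<Sum>r\<leftarrow>rows0. fst r) = 70" "(\<Sum>r\<leftarrow>rows0. fst (snd r) * snd (snd r)) = 134968407" by (simp_all add: rows0_def)
lemma lams0: "lams 61 4110872 rows0 5303233" unfolding rows0_def by (simp add: lams_rules del: lams.simps)
lemma rows_ok0: "rows_ok 61 rows0 \<and> of_int 5303233 \<le> 10 ^ 6 * ln (real (61 + 2 * (\<Sum>r\<leftarrow>rows0. fst r)))"
  by (rule rows_ok_of_sieve[OF sieve0 odd_primes1_odd odd_primes1_cover _ _ lams0]) (use ln_start in \<open>simp_all add: num_of_numeral\<close>)
definition rows1 :: "row list" where "rows1 = [(1, 0, 5303233), (1, 0, 5313133), (1, 0, 5322936), (1, 0, 5332644), (1, 1, 5342259), (1, 0, 5351782), (1, 0, 5361215), (1, 0, 5370560), (1, 0, 5379819), (1, 0, 5388993), (1, 1, 5398083), (1, 0, 5407092), (1, 1, 5416020), (1, 1, 5424869), (1, 0, 5433640), (1, 1, 5442335), (1, 0, 5450955), (1, 0, 5459502), (1, 1, 5467976), (1, 1, 5476379), (1, 0, 5484712), (1, 0, 5492976), (1, 0, 5501172), (1, 0, 5509302), (1, 1, 5517366), (1, 0, 5525366), (1, 0, 5533302), (1, 1, 5541176), (1, 0, 5548988), (1, 0, 5556739), (1, 1, 5564431), (1, 0, 5572064), (1, 0, 5579639), (1, 1, 5587157), (1, 1, 5594619), (1, 0, 5602026), (1, 0, 5609378), (1, 1,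 5616677), (1, 0, 5623923), (1, 1, 5631117), (1, 1, 5638259), (1, 0, 5645351), (1, 0, 5652393), (1, 0, 5659386), (1, 0, 5666330), (1, 1, 5673226), (1, 0, 5680075), (1, 0, 5686877), (1, 0, 5693633), (1, 0, 5700344), (1, 0, 5707010), (1, 0, 5713632), (1, 1, 5720210), (1, 0, 5726745), (1, 1, 5733238), (1, 1, 5739689), (1, 0, 5746099), (1, 1, 5752468), (1, 0, 5758797), (2, 0, 5765086), (1, 0, 5777547), (1, 0, 5783719), (1, 0, 5789853), (1, 1, 5795950), (1, 0, 5802010), (1, 0, 5808034), (1, 1, 5814022), (1, 0, 5819974), (1, 0, 5825891), (1, 0, 5831773)]"
lemma sieve1: "blk rows1 (segs (int 201 + 2) odd_primes1 [num_of 71])"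
  by (simp add: odd_primes1_def sieve_key_def Let_def num_of_numeral del: svs.simps blk.simps trues.simps,
    simp only: svs.simps fst_conv snd_conv sv_rules trues.simps append.simps, simp add: rows1_def)
lemma rows_sum1: "(\<Sum>r\<leftarrow>rows1. fst r) = 71" "(\<Sum>r\<leftarrow>rows1. fst (snd r) * snd (snd r)) = 122887526" by (simp_all add: rows1_def)
lemma lams1: "lams 201 5303233 rows1 5837620" unfolding rows1_def by (simp add: lams_rules del: lams.simps)
lemma rows_ok1: "rows_ok 201 rows1 \<and> of_int 5837620 \<le> 10 ^ 6 * ln (real (201 + 2 * (\<Sum>r\<leftarrow>rows1. fst r)))"
  by (rule rows_ok_of_sieve[OF sieve1 odd_primes1_odd odd_primes1_cover _ _ lams1]) (use conjunct2[OF rows_ok0, unfolded rows_sum0, simplified] in \<open>simp_all add: num_of_numeral\<close>)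
definition rows2 :: "row list" where "rows2 = [(1, 0, 5837620), (1, 1, 5843433), (1, 1, 5849213), (1, 0, 5854960), (1, 1, 5860674), (1, 0, 5866355), (1, 0, 5872004), (1, 1, 5877621), (1, 0, 5883207), (1, 0, 5888762), (1, 0, 5894286), (1, 1, 5899780), (1, 0, 5905244), (1, 0, 5910678), (1, 1, 5916083), (1, 0, 5921459), (1, 0, 5926806), (1, 1, 5932125), (1, 0, 5937416), (1, 1, 5942679), (1, 0, 5947914), (1, 0, 5953122), (1, 1, 5958303), (1, 0, 5963457), (1, 0, 5968585), (1, 0, 5973687), (1, 1, 5978763), (1, 0, 5983813), (1, 1, 5988838), (1, 0, 5993838), (1, 0, 5998813), (1, 0, 6003763), (1, 1, 6008689), (1, 0, 6013590), (1, 0, 6018468), (1, 0, 6023322), (1, 0, 6028152), (1, 1, 6032959), (1, 1, 6037743), (2, 0, 6042504), (1, 0, 6051960), (1, 0, 6056654), (1, 1, 6061326), (1, 1, 6065977), (1, 0, 6070606), (1, 0, 6075214), (1, 1, 6079801), (1, 0, 6084367), (1, 1, 6088912), (1, 0, 6093436), (1, 0, 6097940), (1, 1, 6102424), (1, 0, 6106888), (1, 0, 6111332), (1, 0, 6115756), (1, 1, 6120161), (1, 0, 6124546), (1, 1, 6128912), (1, 1, 6133259), (1, 0, 6137588), (1, 1, 6141898), (1, 0, 6146189), (1, 0, 6150462), (1, 0, 6154717), (1, 0, 6158954), (1, 0, 6163173), (1, 1, 6167374), (1, 0, 6171558), (1, 0, 6175724), (1, 0, 6179873)]"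
lemma sieve2: "blk rows2 (segs (int 343 + 2) odd_primes1 [num_of 71])"
  by (simp add: odd_primes1_def sieve_key_def Let_def num_of_numeral del: svs.simps blk.simps trues.simps,
    simp only: svs.simps fst_conv snd_conv sv_rules trues.simps append.simps, simp add: rows2_def)
lemma rows_sum2: "(\<Sum>r\<leftarrow>rows2. fst r) = 71" "(\<Sum>r\<leftarrow>rows2. fst (snd r) * snd (snd r)) = 144216947" by (simp_all add: rows2_def)
lemma lams2: "lams 343 5837620 rows2 6184005" unfolding rows2_def by (simp add: lams_rules del: lams.simps)
lemma rows_ok2: "rows_ok 343 rows2 \<and> of_int 6184005 \<le> 10 ^ 6 * ln (real (343 + 2 * (\<Sum>r\<leftarrow>rows2. fst r)))"
  by (rule rows_ok_of_sieve[OF sieve2 odd_primes1_odd odd_primes1_cover _ _ lams2]) (use conjunct2[OF rows_ok1, unfolded rows_sum1, simplified] in \<open>simp_all add: num_of_numeral\<close>)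
definition rows3 :: "row list" where "rows3 = [(1, 1, 6184005), (1, 0, 6188120), (1, 1, 6192218), (1, 0, 6196299), (1, 0, 6200364), (1, 0, 6204412), (1, 1, 6208444), (1, 0, 6212460), (1, 1, 6216460), (1, 0, 6220444), (2, 1, 6224412), (1, 0, 6232301), (1, 0, 6236222), (1, 0, 6240128), (1, 0, 6244019), (1, 0, 6247894), (1, 1, 6251755), (1, 1, 6255601), (1, 0, 6259432), (1, 0, 6263248), (1, 0, 6267050), (1, 0, 6270837), (2, 0, 6274610), (1, 0, 6282114), (1, 0, 6285845), (1, 1, 6289562), (1, 0, 6293265), (1, 0, 6296955), (1, 1, 6300631), (1, 0, 6304294), (2, 0, 6307943), (2, 1, 6315202), (1, 0, 6322409), (1, 0, 6325993), (1, 1, 6329564), (1, 0, 6333122), (1, 0, 6336668), (1, 1, 6340201), (1, 1, 6343722), (1, 0, 6347230), (1, 0, 6350726), (1, 1, 6354210), (1, 0, 6357682), (1, 0, 6361142), (1, 0, 6364590), (1, 0, 6368026), (1, 1, 6371450), (1, 0, 6374862), (1, 0, 6378263), (1, 1, 6381652), (1, 0, 6385030), (1, 0, 6388397), (1, 1, 6391752), (1, 1, 6395096), (1, 0, 6398429), (1, 0, 6401751), (1, 1, 6405062), (1, 0, 6408362), (1, 0, 6411651), (1, 1, 6414929), (1, 0, 6418196), (1, 1, 6421453), (1, 1, 6424699), (2, 0, 6427935), (1, 0, 6434376), (1, 0, 6437581), (1, 0, 6440775), (1, 1, 6443959), (1, 0, 6447133), (1, 0, 6450297)]"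
lemma sieve3: "blk rows3 (segs (int 485 + 2) odd_primes1 [num_of 75])"
  by (simp add: odd_primes1_def sieve_key_def Let_def num_of_numeral del: svs.simps blk.simps trues.simps,
    simp only: svs.simps fst_conv snd_conv sv_rules trues.simps append.simps, simp add: rows3_def)
lemma rows_sum3: "(\<Sum>r\<leftarrow>rows3. fst r) = 75" "(\<Sum>r\<leftarrow>rows3. fst (snd r) * snd (snd r)) = 145456039" by (simp_all add: rows3_def)
lemma lams3: "lams 485 6184005 rows3 6453451" unfolding rows3_def by (simp add: lams_rules del: lams.simps)
lemma rows_ok3: "rows_ok 485 rows3 \<and> of_int 6453451 \<le> 10 ^ 6 * ln (real (485 + 2 * (\<Sum>r\<leftarrow>rows3. fst r)))"
  by (rule rows_ok_of_sieve[OF sieve3 odd_primes1_odd odd_primes1_cover _ _ lams3]) (use conjunct2[OF rows_ok2, unfolded rows_sum2, simplified] in \<open>simp_all add: num_of_numeral\<close>)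
definition rows4 :: "row list" where "rows4 = [(1, 0, 6453451), (1, 0, 6456595), (1, 1, 6459729), (1, 1, 6462854), (1, 0, 6465969), (1, 1, 6469074), (1, 0, 6472169), (1, 0, 6475255), (1, 1, 6478331), (1, 0, 6481398), (1, 0, 6484456), (1, 1, 6487504), (1, 1, 6490543), (1, 0, 6493573), (1, 0, 6496594), (1, 0, 6499606), (1, 0, 6502609), (1, 0, 6505603), (1, 1, 6508588), (1, 0, 6511564), (1, 1, 6514531), (1, 0, 6517489), (1, 0, 6520438), (1, 1, 6523379), (1, 0, 6526311), (1, 0, 6529234), (1, 0, 6532149), (1, 1, 6535055), (1, 0, 6537953), (1, 0, 6540843), (1, 0, 6543724), (1, 0, 6546597), (1, 1, 6549462), (1, 0, 6552319), (1, 0, 6555168), (1, 0, 6558008), (1, 1, 6560840), (1, 0, 6563664), (1, 0, 6566480), (1, 0, 6569288), (1, 0, 6572089), (1, 1, 6574882), (1, 0, 6577667), (1, 0, 6580444), (1, 0, 6583214), (1, 1, 6585976), (1, 0, 6588730), (1, 0, 6591477), (1, 1, 6594216), (1, 0, 6596948), (1, 0, 6599672), (1, 1, 6602389), (1, 0, 6605099), (1, 1, 6607801), (1, 0, 6610496), (1, 0, 6613184), (1, 0, 6615864), (1, 1, 6618537), (1, 0, 6621203), (1, 0, 6623862), (1, 1, 6626514), (1, 0, 6629159), (1, 1, 6631797), (1, 0, 6634428), (1, 0, 6637052), (1, 0, 6639669), (1, 1, 6642279), (1, 0, 6644883), (1, 1, 6647480), (1, 0, 6650070)]"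
lemma sieve4: "blk rows4 (segs (int 635 + 2) odd_primes1 [num_of 70])"
  by (simp add: odd_primes1_def sieve_key_def Let_def num_of_numeral del: svs.simps blk.simps trues.simps,
    simp only: svs.simps fst_conv snd_conv sv_rules trues.simps append.simps, simp add: rows4_def)
lemma rows_sum4: "(\<Sum>r\<leftarrow>rows4. fst r) = 70" "(\<Sum>r\<leftarrow>rows4. fst (snd r) * snd (snd r)) = 144171761" by (simp_all add: rows4_def)
lemma lams4: "lams 635 6453451 rows4 6652653" unfolding rows4_def by (simp add: lams_rules del: lams.simps)
lemma rows_ok4: "rows_ok 635 rows4 \<and> of_int 6652653 \<le> 10 ^ 6 * ln (real (635 + 2 * (\<Sum>r\<leftarrow>rows4. fst r)))"
  by (rule rows_ok_of_sieve[OF sieve4 odd_primes1_odd odd_primes1_cover _ _ lams4]) (use conjunct2[OF rows_ok3, unfolded rows_sum3, simplified] in \<open>simp_all add: num_of_numeral\<close>)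
definition rows5 :: "row list" where "rows5 = [(2, 0, 6652653), (1, 0, 6657801), (1, 0, 6660365), (1, 0, 6662922), (1, 1, 6665473), (1, 0, 6668017), (1, 0, 6670555), (1, 0, 6673086), (1, 0, 6675611), (1, 1, 6678129), (1, 0, 6680641), (1, 0, 6683147), (1, 0, 6685647), (1, 0, 6688140), (1, 0, 6690627), (1, 1, 6693108), (1, 1, 6695583), (1, 0, 6698052), (1, 0, 6700515), (1, 0, 6702972), (1, 0, 6705422), (2, 2, 6707866), (1, 0, 6712738), (1, 1, 6715165), (1, 1, 6717586), (1, 0, 6720001), (1, 0, 6722410), (1, 0, 6724813), (1, 0, 6727211), (1, 1, 6729603), (1, 0, 6731989), (1, 0, 6734369), (1, 0, 6736744), (1, 0, 6739113), (1, 0, 6741477), (1, 0, 6743835), (1, 1, 6746187), (1, 0, 6748534), (1, 1, 6750875), (1, 1, 6753211), (2, 1, 6755542), (1, 0, 6760187), (1, 0, 6762501), (1, 0, 6764810), (1, 0, 6767114), (1, 0, 6769412), (1, 0, 6771705), (1, 1, 6773993), (2, 1, 6776276), (1, 1, 6780826), (1, 0, 6783093), (1, 1, 6785355), (1, 0, 6787612), (1, 0, 6789864), (1, 0, 6792111), (1, 0, 6794353), (1, 0, 6796590), (1, 0, 6798822), (1, 0, 6801049), (1, 0, 6803271), (1, 0, 6805488), (1, 1, 6807700), (1, 0, 6809907), (1, 1, 6812109), (1, 0, 6814306), (1, 0, 6816498), (1, 0, 6818686), (1, 1, 6820869), (1, 0, 6823047), (1, 0, 6825220)]"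
lemma sieve5: "blk rows5 (segs (int 775 + 2) odd_primes1 [num_of 74])"
  by (simp add: odd_primes1_def sieve_key_def Let_def num_of_numeral del: svs.simps blk.simps trues.simps,
    simp only: svs.simps fst_conv snd_conv sv_rules trues.simps append.simps, simp add: rows5_def)
lemma rows_sum5: "(\<Sum>r\<leftarrow>rows5. fst r) = 74" "(\<Sum>r\<leftarrow>rows5. fst (snd r) * snd (snd r)) = 134873322" by (simp_all add: rows5_def)
lemma lams5: "lams 775 6652653 rows5 6827389" unfolding rows5_def by (simp add: lams_rules del: lams.simps)
lemma rows_ok5: "rows_ok 775 rows5 \<and> of_int 6827389 \<le> 10 ^ 6 * ln (real (775 + 2 * (\<Sum>r\<leftarrow>rows5. fst r)))"
  by (rule rows_ok_of_sieve[OF sieve5 odd_primes1_odd odd_primes1_cover _ _ lams5]) (use conjunct2[OF rows_ok4, unfolded rows_sum4, simplified] in \<open>simp_all add: num_of_numeral\<close>)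
definition rows6 :: "row list" where "rows6 = [(1, 0, 6827389), (1, 0, 6829553), (1, 1, 6831712), (1, 0, 6833867), (2, 0, 6836017), (1, 1, 6840304), (1, 0, 6842440), (1, 1, 6844572), (1, 0, 6846699), (1, 0, 6848822), (1, 1, 6850940), (1, 0, 6853054), (1, 0, 6855163), (1, 1, 6857268), (1, 0, 6859368), (1, 0, 6861464), (1, 0, 6863556), (1, 0, 6865643), (1, 0, 6867726), (1, 0, 6869805), (1, 1, 6871879), (1, 0, 6873949), (1, 1, 6876015), (1, 0, 6878076), (1, 0, 6880133), (1, 1, 6882186), (1, 0, 6884235), (1, 0, 6886279), (1, 1, 6888319), (1, 0, 6890355), (1, 0, 6892387), (1, 0, 6894415), (1, 1, 6896439), (1, 0, 6898459), (1, 0, 6900475), (1, 1, 6902487), (1, 0, 6904495)]"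
lemma sieve6: "blk rows6 (segs (int 923 + 2) odd_primes1 [num_of 38])"
  by (simp add: odd_primes1_def sieve_key_def Let_def num_of_numeral del: svs.simps blk.simps trues.simps,
    simp only: svs.simps fst_conv snd_conv sv_rules trues.simps append.simps, simp add: rows6_def)
lemma rows_sum6: "(\<Sum>r\<leftarrow>rows6. fst r) = 38" "(\<Sum>r\<leftarrow>rows6. fst (snd r) * snd (snd r)) = 75542121" by (simp_all add: rows6_def)
lemma lams6: "lams 923 6827389 rows6 6906499" unfolding rows6_def by (simp add: lams_rules del: lams.simps)
lemma rows_ok6: "rows_ok 923 rows6 \<and> of_int 6906499 \<le> 10 ^ 6 * ln (real (923 + 2 * (\<Sum>r\<leftarrow>rows6. fst r)))"
  by (rule rows_ok_of_sieve[OF sieve6 odd_primes1_odd odd_primes1_cover _ _ lams6]) (use conjunct2[OF rows_ok5, unfolded rows_sum5, simplified] in \<open>simp_all add: num_of_numeral\<close>)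
definition rows7 :: "row list" where "rows7 = [(1, 0, 6906499)]"
lemma sieve7: "blk rows7 (segs (int 999 + 2) odd_primes1 [num_of 1])"
  by (simp add: odd_primes1_def sieve_key_def Let_def num_of_numeral del: svs.simps blk.simps trues.simps,
    simp only: svs.simps fst_conv snd_conv sv_rules trues.simps append.simps, simp add: rows7_def)
lemma rows_sum7: "(\<Sum>r\<leftarrow>rows7. fst r) = 1" "(\<Sum>r\<leftarrow>rows7. fst (snd r) * snd (snd r)) = 0" by (simp_all add: rows7_def)
lemma lams7: "lams 999 6906499 rows7 6908499" unfolding rows7_def by (simp add: lams_rules del: lams.simps)
lemma rows_ok7: "rows_ok 999 rows7 \<and> of_int 6908499 \<le> 10 ^ 6 * ln (real (999 + 2 * (\<Sum>r\<leftarrow>rows7. fst r)))"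
  by (rule rows_ok_of_sieve[OF sieve7 odd_primes1_odd odd_primes1_cover _ _ lams7]) (use conjunct2[OF rows_ok6, unfolded rows_sum6, simplified] in \<open>simp_all add: num_of_numeral\<close>)
definition rows8 :: "row list" where "rows8 = [(1, 0, 6908499), (1, 0, 6910495), (2, 1, 6912487), (1, 0, 6916459), (1, 1, 6918439), (1, 0, 6920415), (1, 0, 6922387), (1, 1, 6924355), (1, 1, 6926319), (1, 0, 6928279), (1, 0, 6930235), (1, 0, 6932188), (1, 0, 6934137), (1, 1, 6936082), (1, 1, 6938023), (1, 0, 6939960), (1, 0, 6941894), (1, 1, 6943824), (1, 0, 6945750), (1, 0, 6947673), (1, 0, 6949592), (3, 2, 6951507), (1, 0, 6957232), (1, 0, 6959133), (1, 0, 6961030), (1, 0, 6962923), (1, 1, 6964813), (1, 1, 6966699), (1, 0, 6968582), (1, 0, 6970461), (1, 1, 6972337), (1, 0, 6974209), (1, 0, 6976078), (1, 0, 6977943), (1, 0, 6979805), (1, 0, 6981663), (2, 0, 6983518), (1, 0, 6987218), (1, 1, 6989063), (1, 0, 6990904), (1, 1, 6992742), (1, 1, 6994576), (2, 1, 6996407), (1, 0, 7000059), (4, 1, 7001880), (4, 1, 7009132), (4, 2, 7016332), (4, 1, 7023481), (4, 0, 7030579), (4, 0, 7037627), (4, 2, 7044626), (4, 1, 7051576), (4, 1, 7058478), (4, 0, 7065333), (4, 2, 7072141), (4, 1, 7078903), (4, 1, 7085620), (4, 0, 7092292), (4, 2, 7098920), (4, 1, 7105504), (4, 2, 7112045), (4,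 1, 7118543), (4, 1, 7124999), (5, 1, 7131414), (5, 0, 7139375), (5, 2, 7147273), (5, 3, 7155109), (5, 2, 7162885), (5, 2, 7170601), (5, 2, 7178257)]"
lemma sieve8: "blk rows8 (segs (int 1001 + 2) odd_primes2 [num_of 160])"
  by (simp add: odd_primes2_def sieve_key_def Let_def num_of_numeral del: svs.simps blk.simps trues.simps,
    simp only: svs.simps fst_conv snd_conv sv_rules trues.simps append.simps, simp add: rows8_def)
lemma rows_sum8: "(\<Sum>r\<leftarrow>rows8. fst r) = 160" "(\<Sum>r\<leftarrow>rows8. fst (snd r) * snd (snd r)) = 338540197" by (simp_all add: rows8_def)
lemma lams8: "lams 1001 6908499 rows8 7185855" unfolding rows8_def by (simp add: lams_rules del: lams.simps)
lemma rows_ok8: "rows_ok 1001 rows8 \<and> of_int 7185855 \<le> 10 ^ 6 * ln (real (1001 + 2 * (\<Sum>r\<leftarrow>rows8. fst r)))"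
  by (rule rows_ok_of_sieve[OF sieve8 odd_primes2_odd odd_primes2_cover _ _ lams8]) (use conjunct2[OF rows_ok7, unfolded rows_sum7, simplified] in \<open>simp_all add: num_of_numeral\<close>)
definition rows9 :: "row list" where "rows9 = [(5, 1, 7185855), (5, 0, 7193396), (5, 0, 7200881), (5, 1, 7208310), (5, 1, 7215684), (5, 2, 7223004), (5, 0, 7230271), (5, 1, 7237486), (5, 1, 7244649), (5, 0, 7251761), (5, 3, 7258823), (5, 2, 7265835), (5, 2, 7272798), (5, 2, 7279713), (5, 1, 7286581), (5, 1, 7293402), (5, 3, 7300177), (5, 2, 7306906), (6, 1, 7313590), (6, 1, 7321552), (6, 1, 7329451), (6, 2, 7337289), (6, 2, 7345066), (6, 2, 7352783), (6, 2, 7360440), (6, 1, 7368039), (6, 3, 7375581), (6, 3, 7383066), (6, 1, 7390496), (6, 1, 7397871), (6, 1, 7405192), (6, 3, 7412460), (6, 0, 7419675), (6, 1, 7426839), (6, 2, 7433952), (6, 1, 7441014), (6, 2, 7448027), (6, 2, 7454991), (6, 2, 7461907), (7, 1, 7468775), (7, 1, 7476729), (7, 3, 7484620), (7, 1, 7492449), (7, 2, 7500218), (7, 1, 7507927), (7, 1, 7515577), (7, 1, 7523169), (7, 5, 7530703), (7, 1, 7538181), (7, 2, 7545604), (7, 1, 7552972), (7, 2, 7560286), (7, 1, 7567547), (7, 1, 7574756), (7, 1, 7581913), (7, 2, 7589019), (7, 4, 7596075), (8, 2, 7603082), (8, 2, 7611030), (8, 2, 7618915), (8, 2, 7626738), (8,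 2, 7634501), (8, 3, 7642204), (8, 2, 7649848), (8, 2, 7657434), (8, 3, 7664963), (8, 2, 7672436), (8, 1, 7679853), (8, 0, 7687216), (8, 3, 7694525)]"
lemma sieve9: "blk rows9 (segs (int 1321 + 2) odd_primes2 [num_of 446])"
  by (simp add: odd_primes2_def sieve_key_def Let_def num_of_numeral del: svs.simps blk.simps trues.simps,
    simp only: svs.simps fst_conv snd_conv sv_rules trues.simps append.simps, simp add: rows9_def)
lemma rows_sum9: "(\<Sum>r\<leftarrow>rows9. fst r) = 446" "(\<Sum>r\<leftarrow>rows9. fst (snd r) * snd (snd r)) = 850856575" by (simp_all add: rows9_def)
lemma lams9: "lams 1321 7185855 rows9 7701781" unfolding rows9_def by (simp add: lams_rules del: lams.simps)
lemma rows_ok9: "rows_ok 1321 rows9 \<and> of_int 7701781 \<le> 10 ^ 6 * ln (real (1321 + 2 * (\<Sum>r\<leftarrow>rows9. fst r)))"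
  by (rule rows_ok_of_sieve[OF sieve9 odd_primes2_odd odd_primes2_cover _ _ lams9]) (use conjunct2[OF rows_ok8, unfolded rows_sum8, simplified] in \<open>simp_all add: num_of_numeral\<close>)
definition rows10 :: "row list" where "rows10 = [(8, 1, 7701781), (8, 3, 7708984), (8, 1, 7716136), (9, 3, 7723237), (9, 4, 7731166), (9, 2, 7739033), (9, 1, 7746838), (9, 4, 7754583), (9, 1, 7762268), (9, 4, 7769895), (9, 3, 7777464), (9, 3, 7784976), (9, 2, 7792432), (9, 2, 7799833), (9, 3, 7807179), (9, 0, 7814472), (9, 1, 7821712), (10, 2, 7828900), (10, 4, 7836827), (10, 1, 7844691), (10, 3, 7852494), (10, 1, 7860236), (10, 3, 7867919), (10, 1, 7875543), (10, 4, 7883110), (10, 5, 7890620), (10, 4, 7898074), (10, 3, 7905473), (10, 3, 7912817), (11, 1, 7920108), (11, 4, 7928067), (11, 3, 7935963), (11, 2, 7943797), (11, 4, 7951570), (11, 1, 7959283), (11, 3, 7966937), (11, 3, 7974533), (11, 1, 7982072), (11, 5, 7989554), (11, 0, 7996981), (11, 3, 8004353), (12, 4, 8011671), (12, 2, 8019594), (12, 4, 8027455), (12, 1, 8035254), (12, 3, 8042993), (12, 0, 8050673), (12, 4, 8058294), (12, 4, 8065857), (12, 3, 8073364), (12, 3, 8080815), (13, 2, 8088210), (13, 3, 8096161), (13, 5, 8104049), (13, 4, 8111875), (13, 2, 8119640), (13, 4, 8127345), (13, 1, 8134992), (13, 4, 8142581), (13, 3, 8150112), (13, 3, 8157587), (14,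 5, 8165007), (14, 4, 8172936), (14, 3, 8180803), (14, 4, 8188608), (14, 3, 8196353), (14, 4, 8204038), (14, 4, 8211665), (14, 4, 8219234), (14, 3, 8226746)]"
lemma sieve10: "blk rows10 (segs (int 2213 + 2) odd_primes2 [num_of 778])"
  by (simp add: odd_primes2_def sieve_key_def Let_def num_of_numeral del: svs.simps blk.simps trues.simps,
    simp only: svs.simps fst_conv snd_conv sv_rules trues.simps append.simps, simp add: rows10_def)
lemma rows_sum10: "(\<Sum>r\<leftarrow>rows10. fst r) = 778" "(\<Sum>r\<leftarrow>rows10. fst (snd r) * snd (snd r)) = 1557231135" by (simp_all add: rows10_def)
lemma lams10: "lams 2213 7701781 rows10 8234202" unfolding rows10_def by (simp add: lams_rules del: lams.simps)
lemma rows_ok10: "rows_ok 2213 rows10 \<and> of_int 8234202 \<le> 10 ^ 6 * ln (real (2213 + 2 * (\<Sum>r\<leftarrow>rows10. fst r)))"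
  by (rule rows_ok_of_sieve[OF sieve10 odd_primes2_odd odd_primes2_cover _ _ lams10]) (use conjunct2[OF rows_ok9, unfolded rows_sum9, simplified] in \<open>simp_all add: num_of_numeral\<close>)
definition rows11 :: "row list" where "rows11 = [(15, 3, 8234202), (15, 3, 8242130), (15, 4, 8249995), (15, 4, 8257799), (15, 4, 8265542), (15, 5, 8273226), (15, 1, 8280851), (15, 4, 8288419), (16, 4, 8295930), (16, 4, 8303880), (16, 4, 8311767), (16, 4, 8319592), (16, 4, 8327357), (16, 2, 8335062), (16, 5, 8342708), (16, 5, 8350296), (17, 5, 8357827), (17, 1, 8365767), (17, 5, 8373644), (17, 3, 8381460), (17, 3, 8389215), (17, 5, 8396910), (17, 3, 8404547), (18, 5, 8412126), (18, 4, 8420088), (18, 4, 8427987), (18, 4, 8435825), (18, 6, 8443602), (18, 2, 8451319), (18, 5, 8458976), (19, 5, 8466575), (19, 5, 8474534), (19, 1, 8482430), (19, 4, 8490265), (19, 6, 8498039), (19, 5, 8505753), (19, 7, 8513408), (20, 4, 8521004), (20, 5, 8528938), (20, 3, 8536810), (20, 5, 8544620), (20, 3, 8552370), (20, 5, 8560060), (21, 5, 8567692), (21, 3, 8575643), (21, 4, 8583531), (21, 6, 8591358), (21, 6, 8599124), (21, 6, 8606830), (22, 5, 8614477), (22, 5, 8622426), (22, 3, 8630312), (22, 8, 8638137), (22, 4, 8645901)]"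
lemma sieve11: "blk rows11 (segs (int 3769 + 2) odd_primes2 [num_of 982])"
  by (simp add: odd_primes2_def sieve_key_def Let_def num_of_numeral del: svs.simps blk.simps trues.simps,
    simp only: svs.simps fst_conv snd_conv sv_rules trues.simps append.simps, simp add: rows11_def)
lemma rows_sum11: "(\<Sum>r\<leftarrow>rows11. fst r) = 982" "(\<Sum>r\<leftarrow>rows11. fst (snd r) * snd (snd r)) = 1927508015" by (simp_all add: rows11_def)
lemma lams11: "lams 3769 8234202 rows11 8653605" unfolding rows11_def by (simp add: lams_rules del: lams.simps)
lemma rows_ok11: "rows_ok 3769 rows11 \<and> of_int 8653605 \<le> 10 ^ 6 * ln (real (3769 + 2 * (\<Sum>r\<leftarrow>rows11. fst r)))"
  by (rule rows_ok_of_sieve[OF sieve11 odd_primes2_odd odd_primes2_cover _ _ lams11]) (use conjunct2[OF rows_ok10, unfolded rows_sum10, simplified] in \<open>simp_all add: num_of_numeral\<close>)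
definition rows12 :: "row list" where "rows12 = [(22, 4, 8653605), (23, 7, 8661250), (23, 9, 8669181), (23, 4, 8677049), (23, 4, 8684856), (23, 3, 8692602), (24, 6, 8700289), (24, 6, 8708247), (24, 6, 8716143), (24, 4, 8723977), (24, 6, 8731750), (24, 6, 8739463), (25, 8, 8747117), (25, 7, 8755028), (25, 3, 8762877), (25, 6, 8770665), (25, 2, 8778392), (26, 8, 8786060), (26, 4, 8793973), (26, 8, 8801824), (26, 5, 8809614), (27, 7, 8817344), (27, 6, 8825308), (27, 7, 8833209), (27, 6, 8841048), (27, 8, 8848826), (28, 6, 8856544), (28, 5, 8864486), (28, 4, 8872365), (28, 9, 8880182), (28, 3, 8887939), (29, 7, 8895636), (29, 4, 8903546), (29, 5, 8911394), (29, 8, 8919181), (30, 11, 8926908), (30, 6, 8934839), (30, 7, 8942707)]"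
lemma sieve12: "blk rows12 (segs (int 5733 + 2) odd_primes2 [num_of 991])"
  by (simp add: odd_primes2_def sieve_key_def Let_def num_of_numeral del: svs.simps blk.simps trues.simps,
    simp only: svs.simps fst_conv snd_conv sv_rules trues.simps append.simps, simp add: rows12_def)
lemma rows_sum12: "(\<Sum>r\<leftarrow>rows12. fst r) = 991" "(\<Sum>r\<leftarrow>rows12. fst (snd r) * snd (snd r)) = 1980998305" by (simp_all add: rows12_def)
lemma lams12: "lams 5733 8653605 rows12 8950514" unfolding rows12_def by (simp add: lams_rules del: lams.simps)
lemma rows_ok12: "rows_ok 5733 rows12 \<and> of_int 8950514 \<le> 10 ^ 6 * ln (real (5733 + 2 * (\<Sum>r\<leftarrow>rows12. fst r)))"
  by (rule rows_ok_of_sieve[OF sieve12 odd_primes2_odd odd_primes2_cover _ _ lams12]) (use conjunct2[OF rows_ok11, unfolded rows_sum11, simplified] in \<open>simp_all add: num_of_numeral\<close>)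
definition rows13 :: "row list" where "rows13 = [(30, 7, 8950514), (31, 5, 8958260), (31, 7, 8966202), (31, 8, 8974082), (31, 5, 8981900), (32, 6, 8989657), (32, 7, 8997602), (32, 6, 9005484), (32, 9, 9013305), (33, 7, 9021065), (33, 6, 9029005), (33, 8, 9036882), (33, 7, 9044698), (34, 6, 9052453), (34, 8, 9060381), (34, 11, 9068246), (34, 6, 9076050), (35, 9, 9083793), (35, 7, 9091702), (35, 8, 9099549), (36, 7, 9107335), (36, 8, 9115281), (36, 10, 9123164), (36, 6, 9130985), (37, 8, 9138746), (37, 11, 9146660), (37, 9, 9154512), (38, 5, 9162303), (38, 10, 9170241)]"
lemma sieve13: "blk rows13 (segs (int 7715 + 2) odd_primes2 [num_of 986])"
  by (simp add: odd_primes2_def sieve_key_def Let_def num_of_numeral del: svs.simps blk.simps trues.simps,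
    simp only: svs.simps fst_conv snd_conv sv_rules trues.simps append.simps, simp add: rows13_def)
lemma rows_sum13: "(\<Sum>r\<leftarrow>rows13. fst r) = 986" "(\<Sum>r\<leftarrow>rows13. fst (snd r) * snd (snd r)) = 1967429819" by (simp_all add: rows13_def)
lemma lams13: "lams 7715 8950514 rows13 9178117" unfolding rows13_def by (simp add: lams_rules del: lams.simps)
lemma rows_ok13: "rows_ok 7715 rows13 \<and> of_int 9178117 \<le> 10 ^ 6 * ln (real (7715 + 2 * (\<Sum>r\<leftarrow>rows13. fst r)))"
  by (rule rows_ok_of_sieve[OF sieve13 odd_primes2_odd odd_primes2_cover _ _ lams13]) (use conjunct2[OF rows_ok12, unfolded rows_sum12, simplified] in \<open>simp_all add: num_of_numeral\<close>)
definition rows14 :: "row list" where "rows14 = [(38, 8, 9178117), (39, 11, 9185931), (39, 8, 9193888), (39, 7, 9201782), (39, 7, 9209614), (40, 10, 9217386), (40, 8, 9225295), (40, 11, 9233141), (41, 8, 9240926), (41, 9, 9248844), (41, 7, 9256699), (42, 9, 9264493), (42, 10, 9272415), (42, 7, 9280275), (43, 10, 9288073), (43, 8, 9295994), (43, 9, 9303853), (44, 9, 9311651), (44, 8, 9319568), (44, 11, 9327423), (45, 8, 9335216), (45, 10, 9343124), (46, 8, 9350970)]"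
lemma sieve14: "blk rows14 (segs (int 9687 + 2) odd_primes2 [num_of 960])"
  by (simp add: odd_primes2_def sieve_key_def Let_def num_of_numeral del: svs.simps blk.simps trues.simps,
    simp only: svs.simps fst_conv snd_conv sv_rules trues.simps append.simps, simp add: rows14_def)
lemma rows_sum14: "(\<Sum>r\<leftarrow>rows14. fst r) = 960" "(\<Sum>r\<leftarrow>rows14. fst (snd r) * snd (snd r)) = 1862339376" by (simp_all add: rows14_def)
lemma lams14: "lams 9687 9178117 rows14 9358927" unfolding rows14_def by (simp add: lams_rules del: lams.simps)
lemma rows_ok14: "rows_ok 9687 rows14 \<and> of_int 9358927 \<le> 10 ^ 6 * ln (real (9687 + 2 * (\<Sum>r\<leftarrow>rows14. fst r)))"
  by (rule rows_ok_of_sieve[OF sieve14 odd_primes2_odd odd_primes2_cover _ _ lams14]) (use conjunct2[OF rows_ok13, unfolded rows_sum13, simplified] in \<open>simp_all add: num_of_numeral\<close>)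
definition rows15 :: "row list" where "rows15 = [(46, 8, 9358927), (46, 9, 9366821), (47, 10, 9374654), (47, 13, 9382594), (47, 10, 9390471), (48, 11, 9398287), (48, 9, 9406207), (49, 9, 9414064), (49, 12, 9422022), (49, 13, 9429917), (50, 13, 9437750), (50, 9, 9445680), (51, 10, 9453548), (51, 11, 9461510), (51, 13, 9469409), (52, 10, 9477246), (52, 11, 9485174), (53, 9, 9493040), (53, 12, 9500994), (53, 9, 9508885)]"
lemma sieve15: "blk rows15 (segs (int 11607 + 2) odd_primes2 [num_of 992])"
  by (simp add: odd_primes2_def sieve_key_def Let_def num_of_numeral del: svs.simps blk.simps trues.simps,
    simp only: svs.simps fst_conv snd_conv sv_rules trues.simps append.simps, simp add: rows15_def)
lemma rows_sum15: "(\<Sum>r\<leftarrow>rows15. fst r) = 992" "(\<Sum>r\<leftarrow>rows15. fst (snd r) * snd (snd r)) = 1990769462" by (simp_all add: rows15_def)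
lemma lams15: "lams 11607 9358927 rows15 9516714" unfolding rows15_def by (simp add: lams_rules del: lams.simps)
lemma rows_ok15: "rows_ok 11607 rows15 \<and> of_int 9516714 \<le> 10 ^ 6 * ln (real (11607 + 2 * (\<Sum>r\<leftarrow>rows15. fst r)))"
  by (rule rows_ok_of_sieve[OF sieve15 odd_primes2_odd odd_primes2_cover _ _ lams15]) (use conjunct2[OF rows_ok14, unfolded rows_sum14, simplified] in \<open>simp_all add: num_of_numeral\<close>)
definition rows16 :: "row list" where "rows16 = [(54, 13, 9516714), (54, 13, 9524628), (55, 12, 9532480), (55, 9, 9540415), (56, 9, 9548287), (56, 12, 9556239), (57, 8, 9564129), (57, 14, 9572096), (57, 13, 9580000), (58, 10, 9587842), (58, 16, 9595759), (59, 13, 9603614), (59, 10, 9611541), (60, 13, 9619406), (60, 15, 9627341), (61, 14, 9635214), (61, 12, 9643155)]"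
lemma sieve16: "blk rows16 (segs (int 13591 + 2) odd_primes2 [num_of 977])"
  by (simp add: odd_primes2_def sieve_key_def Let_def num_of_numeral del: svs.simps blk.simps trues.simps,
    simp only: svs.simps fst_conv snd_conv sv_rules trues.simps append.simps, simp add: rows16_def)
lemma rows_sum16: "(\<Sum>r\<leftarrow>rows16. fst r) = 977" "(\<Sum>r\<leftarrow>rows16. fst (snd r) * snd (snd r)) = 1973908973" by (simp_all add: rows16_def)
lemma lams16: "lams 13591 9516714 rows16 9651034" unfolding rows16_def by (simp add: lams_rules del: lams.simps)
lemma rows_ok16: "rows_ok 13591 rows16 \<and> of_int 9651034 \<le> 10 ^ 6 * ln (real (13591 + 2 * (\<Sum>r\<leftarrow>rows16. fst r)))"
  by (rule rows_ok_of_sieve[OF sieve16 odd_primes2_odd odd_primes2_cover _ _ lams16]) (use conjunct2[OF rows_ok15, unfolded rows_sum15, simplified] in \<open>simp_all add: num_of_numeral\<close>)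
definition rows17 :: "row list" where "rows17 = [(62, 15, 9651034), (62, 14, 9658979), (63, 14, 9666861), (63, 9, 9674807), (64, 14, 9682690), (64, 13, 9690635), (65, 12, 9698518), (65, 13, 9706461), (66, 14, 9714341), (66, 10, 9722279), (67, 14, 9730155), (67, 15, 9738087), (68, 13, 9745957), (68, 13, 9753881), (69, 18, 9761743)]"
lemma sieve17: "blk rows17 (segs (int 15545 + 2) odd_primes2 [num_of 979])"
  by (simp add: odd_primes2_def sieve_key_def Let_def num_of_numeral del: svs.simps blk.simps trues.simps,
    simp only: svs.simps fst_conv snd_conv sv_rules trues.simps append.simps, simp add: rows17_def)
lemma rows_sum17: "(\<Sum>r\<leftarrow>rows17. fst r) = 979" "(\<Sum>r\<leftarrow>rows17. fst (snd r) * snd (snd r)) = 1951228964" by (simp_all add: rows17_def)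
lemma lams17: "lams 15545 9651034 rows17 9769658" unfolding rows17_def by (simp add: lams_rules del: lams.simps)
lemma rows_ok17: "rows_ok 15545 rows17 \<and> of_int 9769658 \<le> 10 ^ 6 * ln (real (15545 + 2 * (\<Sum>r\<leftarrow>rows17. fst r)))"
  by (rule rows_ok_of_sieve[OF sieve17 odd_primes2_odd odd_primes2_cover _ _ lams17]) (use conjunct2[OF rows_ok16, unfolded rows_sum16, simplified] in \<open>simp_all add: num_of_numeral\<close>)
definition rows18 :: "row list" where "rows18 = [(70, 13, 9769658), (70, 13, 9777624), (71, 15, 9785527), (71, 16, 9793480), (72, 15, 9801370), (72, 17, 9809308), (73, 15, 9817184), (74, 12, 9825106), (74, 15, 9833073), (75, 10, 9840977), (75, 14, 9848925), (76, 14, 9856810), (76, 13, 9864737)]"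
lemma sieve18: "blk rows18 (segs (int 17503 + 2) odd_primes2 [num_of 949])"
  by (simp add: odd_primes2_def sieve_key_def Let_def num_of_numeral del: svs.simps blk.simps trues.simps,
    simp only: svs.simps fst_conv snd_conv sv_rules trues.simps append.simps, simp add: rows18_def)
lemma rows_sum18: "(\<Sum>r\<leftarrow>rows18. fst r) = 949" "(\<Sum>r\<leftarrow>rows18. fst (snd r) * snd (snd r)) = 1786558805" by (simp_all add: rows18_def)
lemma lams18: "lams 17503 9769658 rows18 9872602" unfolding rows18_def by (simp add: lams_rules del: lams.simps)
lemma rows_ok18: "rows_ok 17503 rows18 \<and> of_int 9872602 \<le> 10 ^ 6 * ln (real (17503 + 2 * (\<Sum>r\<leftarrow>rows18. fst r)))"
  by (rule rows_ok_of_sieve[OF sieve18 odd_primes2_odd odd_primes2_cover _ _ lams18]) (use conjunct2[OF rows_ok17, unfolded rows_sum17, simplified] in \<open>simp_all add: num_of_numeral\<close>)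
definition rows19 :: "row list" where "rows19 = [(77, 22, 9872602), (78, 13, 9880508), (78, 17, 9888453), (79, 17, 9896336), (80, 19, 9904257), (80, 13, 9912215), (81, 17, 9920110), (82, 14, 9928041), (82, 16, 9936006), (83, 17, 9943908), (84, 19, 9951843), (84, 15, 9959810)]"
lemma sieve19: "blk rows19 (segs (int 19401 + 2) odd_primes2 [num_of 968])"
  by (simp add: odd_primes2_def sieve_key_def Let_def num_of_numeral del: svs.simps blk.simps trues.simps,
    simp only: svs.simps fst_conv snd_conv sv_rules trues.simps append.simps, simp add: rows19_def)
lemma rows_sum19: "(\<Sum>r\<leftarrow>rows19. fst r) = 968" "(\<Sum>r\<leftarrow>rows19. fst (snd r) * snd (snd r)) = 1973164082" by (simp_all add: rows19_def)
lemma lams19: "lams 19401 9872602 rows19 9967714" unfolding rows19_def by (simp add: lams_rules del: lams.simps)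
lemma rows_ok19: "rows_ok 19401 rows19 \<and> of_int 9967714 \<le> 10 ^ 6 * ln (real (19401 + 2 * (\<Sum>r\<leftarrow>rows19. fst r)))"
  by (rule rows_ok_of_sieve[OF sieve19 odd_primes2_odd odd_primes2_cover _ _ lams19]) (use conjunct2[OF rows_ok18, unfolded rows_sum18, simplified] in \<open>simp_all add: num_of_numeral\<close>)
definition rows20 :: "row list" where "rows20 = [(85, 18, 9967714), (86, 20, 9975649), (86, 18, 9983614), (87, 15, 9991516), (88, 23, 9999447), (177, 32, 10007406), (90, 19, 10023225), (90, 17, 10031173), (91, 22, 10039059), (92, 16, 10046969)]"
lemma sieve20: "blk rows20 (segs (int 21337 + 2) odd_primes2 [num_of 972])"
  by (simp add: odd_primes2_def sieve_key_def Let_def num_of_numeral del: svs.simps blk.simps trues.simps,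
    simp only: svs.simps fst_conv snd_conv sv_rules trues.simps append.simps, simp add: rows20_def)
lemma rows_sum20: "(\<Sum>r\<leftarrow>rows20. fst r) = 972" "(\<Sum>r\<leftarrow>rows20. fst (snd r) * snd (snd r)) = 2001315915" by (simp_all add: rows20_def)
lemma lams20: "lams 21337 9967714 rows20 10054903" unfolding rows20_def by (simp add: lams_rules del: lams.simps)
lemma rows_ok20: "rows_ok 21337 rows20 \<and> of_int 10054903 \<le> 10 ^ 6 * ln (real (21337 + 2 * (\<Sum>r\<leftarrow>rows20. fst r)))"
  by (rule rows_ok_of_sieve[OF sieve20 odd_primes2_odd odd_primes2_cover _ _ lams20]) (use conjunct2[OF rows_ok19, unfolded rows_sum19, simplified] in \<open>simp_all add: num_of_numeral\<close>)
definition rows21 :: "row list" where "rows21 = [(93, 16, 10054903), (93, 20, 10062860), (94, 21, 10070754), (95, 21, 10078670), (96, 22, 10086607), (96, 15, 10094564), (97, 16, 10102459), (98, 17, 10110373), (99, 19, 10118305), (100, 19, 10126255)]"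
lemma sieve21: "blk rows21 (segs (int 23281 + 2) odd_primes2 [num_of 961])"
  by (simp add: odd_primes2_def sieve_key_def Let_def num_of_numeral del: svs.simps blk.simps trues.simps,
    simp only: svs.simps fst_conv snd_conv sv_rules trues.simps append.simps, simp add: rows21_def)
lemma rows_sum21: "(\<Sum>r\<leftarrow>rows21. fst r) = 961" "(\<Sum>r\<leftarrow>rows21. fst (snd r) * snd (snd r)) = 1876759691" by (simp_all add: rows21_def)
lemma lams21: "lams 23281 10054903 rows21 10134222" unfolding rows21_def by (simp add: lams_rules del: lams.simps)
lemma rows_ok21: "rows_ok 23281 rows21 \<and> of_int 10134222 \<le> 10 ^ 6 * ln (real (23281 + 2 * (\<Sum>r\<leftarrow>rows21. fst r)))"
  by (rule rows_ok_of_sieve[OF sieve21 odd_primes2_odd odd_primes2_cover _ _ lams21]) (use conjunct2[OF rows_ok20, unfolded rows_sum20, simplified] in \<open>simp_all add: num_of_numeral\<close>)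
definition rows22 :: "row list" where "rows22 = [(100, 19, 10134222), (101, 20, 10142126), (102, 21, 10150046), (103, 20, 10157981), (104, 20, 10165930), (104, 23, 10173893), (105, 17, 10181793), (106, 24, 10189706), (107, 23, 10197632)]"
lemma sieve22: "blk rows22 (segs (int 25203 + 2) odd_primes2 [num_of 932])"
  by (simp add: odd_primes2_def sieve_key_def Let_def num_of_numeral del: svs.simps blk.simps trues.simps,
    simp only: svs.simps fst_conv snd_conv sv_rules trues.simps append.simps, simp add: rows22_def)
lemma rows_sum22: "(\<Sum>r\<leftarrow>rows22. fst r) = 932" "(\<Sum>r\<leftarrow>rows22. fst (snd r) * snd (snd r)) = 1901210424" by (simp_all add: rows22_def)
lemma lams22: "lams 25203 10134222 rows22 10205569" unfolding rows22_def by (simp add: lams_rules del: lams.simps)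
lemma rows_ok22: "rows_ok 25203 rows22 \<and> of_int 10205569 \<le> 10 ^ 6 * ln (real (25203 + 2 * (\<Sum>r\<leftarrow>rows22. fst r)))"
  by (rule rows_ok_of_sieve[OF sieve22 odd_primes2_odd odd_primes2_cover _ _ lams22]) (use conjunct2[OF rows_ok21, unfolded rows_sum21, simplified] in \<open>simp_all add: num_of_numeral\<close>)
definition rows23 :: "row list" where "rows23 = [(108, 20, 10205569), (109, 16, 10213517), (110, 18, 10221475), (110, 26, 10229442), (111, 23, 10237346), (112, 17, 10245259), (113, 26, 10253181), (114, 26, 10261110)]"
lemma sieve23: "blk rows23 (segs (int 27067 + 2) odd_primes2 [num_of 887])"
  by (simp add: odd_primes2_def sieve_key_def Let_def num_of_numeral del: svs.simps blk.simps trues.simps,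
    simp only: svs.simps fst_conv snd_conv sv_rules trues.simps append.simps, simp add: rows23_def)
lemma rows_sum23: "(\<Sum>r\<leftarrow>rows23. fst r) = 887" "(\<Sum>r\<leftarrow>rows23. fst (snd r) * snd (snd r)) = 1760479621" by (simp_all add: rows23_def)
lemma lams23: "lams 27067 10205569 rows23 10269046" unfolding rows23_def by (simp add: lams_rules del: lams.simps)
lemma rows_ok23: "rows_ok 27067 rows23 \<and> of_int 10269046 \<le> 10 ^ 6 * ln (real (27067 + 2 * (\<Sum>r\<leftarrow>rows23. fst r)))"
  by (rule rows_ok_of_sieve[OF sieve23 odd_primes2_odd odd_primes2_cover _ _ lams23]) (use conjunct2[OF rows_ok22, unfolded rows_sum22, simplified] in \<open>simp_all add: num_of_numeral\<close>)
definition rows24 :: "row list" where "rows24 = [(115, 21, 10269046), (233, 46, 10276989), (118, 20, 10292891), (119, 19, 10300849), (120, 24, 10308810), (121, 22, 10316775), (121, 23, 10324742)]"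
lemma sieve24: "blk rows24 (segs (int 28841 + 2) odd_primes2 [num_of 947])"
  by (simp add: odd_primes2_def sieve_key_def Let_def num_of_numeral del: svs.simps blk.simps trues.simps,
    simp only: svs.simps fst_conv snd_conv sv_rules trues.simps append.simps, simp add: rows24_def)
lemma rows_sum24: "(\<Sum>r\<leftarrow>rows24. fst r) = 947" "(\<Sum>r\<leftarrow>rows24. fst (snd r) * snd (snd r)) = 1801814967" by (simp_all add: rows24_def)
lemma lams24: "lams 28841 10269046 rows24 10332646" unfolding rows24_def by (simp add: lams_rules del: lams.simps)
lemma rows_ok24: "rows_ok 28841 rows24 \<and> of_int 10332646 \<le> 10 ^ 6 * ln (real (28841 + 2 * (\<Sum>r\<leftarrow>rows24. fst r)))"
  by (rule rows_ok_of_sieve[OF sieve24 odd_primes2_odd odd_primes2_cover _ _ lams24]) (use conjunct2[OF rows_ok23, unfolded rows_sum23, simplified] in \<open>simp_all add: num_of_numeral\<close>)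
definition rows25 :: "row list" where "rows25 = [(122, 24, 10332646), (123, 25, 10340553), (124, 22, 10348462), (125, 25, 10356372), (126, 19, 10364283), (127, 26, 10372195), (128, 29, 10380107)]"
lemma sieve25: "blk rows25 (segs (int 30735 + 2) odd_primes2 [num_of 875])"
  by (simp add: odd_primes2_def sieve_key_def Let_def num_of_numeral del: svs.simps blk.simps trues.simps,
    simp only: svs.simps fst_conv snd_conv sv_rules trues.simps append.simps, simp add: rows25_def)
lemma rows_sum25: "(\<Sum>r\<leftarrow>rows25. fst r) = 875" "(\<Sum>r\<leftarrow>rows25. fst (snd r) * snd (snd r)) = 1760694343" by (simp_all add: rows25_def)
lemma lams25: "lams 30735 10332646 rows25 10388018" unfolding rows25_def by (simp add: lams_rules del: lams.simps)
lemma rows_ok25: "rows_ok 30735 rows25 \<and> of_int 10388018 \<le> 10 ^ 6 * ln (real (30735 + 2 * (\<Sum>r\<leftarrow>rows25. fst r)))"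
  by (rule rows_ok_of_sieve[OF sieve25 odd_primes2_odd odd_primes2_cover _ _ lams25]) (use conjunct2[OF rows_ok24, unfolded rows_sum24, simplified] in \<open>simp_all add: num_of_numeral\<close>)
definition rows26 :: "row list" where "rows26 = [(129, 26, 10388018), (130, 27, 10395928), (132, 24, 10403837), (133, 28, 10411804), (134, 30, 10419768), (135, 24, 10427728), (136, 26, 10435684)]"
lemma sieve26: "blk rows26 (segs (int 32485 + 2) odd_primes2 [num_of 929])"
  by (simp add: odd_primes2_def sieve_key_def Let_def num_of_numeral del: svs.simps blk.simps trues.simps,
    simp only: svs.simps fst_conv snd_conv sv_rules trues.simps append.simps, simp add: rows26_def)
lemma rows_sum26: "(\<Sum>r\<leftarrow>rows26. fst r) = 929" "(\<Sum>r\<leftarrow>rows26. fst (snd r) * snd (snd r)) = 1926187420" by (simp_all add: rows26_def)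
lemma lams26: "lams 32485 10388018 rows26 10443635" unfolding rows26_def by (simp add: lams_rules del: lams.simps)
lemma rows_ok26: "rows_ok 32485 rows26 \<and> of_int 10443635 \<le> 10 ^ 6 * ln (real (32485 + 2 * (\<Sum>r\<leftarrow>rows26. fst r)))"
  by (rule rows_ok_of_sieve[OF sieve26 odd_primes2_odd odd_primes2_cover _ _ lams26]) (use conjunct2[OF rows_ok25, unfolded rows_sum25, simplified] in \<open>simp_all add: num_of_numeral\<close>)
definition rows27 :: "row list" where "rows27 = [(137, 28, 10443635), (138, 26, 10451581), (139, 27, 10459522), (140, 25, 10467457), (141, 21, 10475386), (142, 31, 10483309)]"
lemma sieve27: "blk rows27 (segs (int 34343 + 2) odd_primes2 [num_of 837])"
  by (simp add: odd_primes2_def sieve_key_def Let_def num_of_numeral del: svs.simps blk.simps trues.simps,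
    simp only: svs.simps fst_conv snd_conv sv_rules trues.simps append.simps, simp add: rows27_def)
lemma rows_sum27: "(\<Sum>r\<leftarrow>rows27. fst r) = 837" "(\<Sum>r\<leftarrow>rows27. fst (snd r) * snd (snd r)) = 1653222090" by (simp_all add: rows27_def)
lemma lams27: "lams 34343 10443635 rows27 10491225" unfolding rows27_def by (simp add: lams_rules del: lams.simps)
lemma rows_ok27: "rows_ok 34343 rows27 \<and> of_int 10491225 \<le> 10 ^ 6 * ln (real (34343 + 2 * (\<Sum>r\<leftarrow>rows27. fst r)))"
  by (rule rows_ok_of_sieve[OF sieve27 odd_primes2_odd odd_primes2_cover _ _ lams27]) (use conjunct2[OF rows_ok26, unfolded rows_sum26, simplified] in \<open>simp_all add: num_of_numeral\<close>)
definition rows28 :: "row list" where "rows28 = [(289, 52, 10491225), (146, 31, 10507145), (295, 54, 10515092)]"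
lemma sieve28: "blk rows28 (segs (int 36017 + 2) odd_primes2 [num_of 730])"
  by (simp add: odd_primes2_def sieve_key_def Let_def num_of_numeral del: svs.simps blk.simps trues.simps,
    simp only: svs.simps fst_conv snd_conv sv_rules trues.simps append.simps, simp add: rows28_def)
lemma rows_sum28: "(\<Sum>r\<leftarrow>rows28. fst r) = 730" "(\<Sum>r\<leftarrow>rows28. fst (snd r) * snd (snd r)) = 1439080163" by (simp_all add: rows28_def)
lemma lams28: "lams 36017 10491225 rows28 10530959" unfolding rows28_def by (simp add: lams_rules del: lams.simps)
lemma rows_ok28: "rows_ok 36017 rows28 \<and> of_int 10530959 \<le> 10 ^ 6 * ln (real (36017 + 2 * (\<Sum>r\<leftarrow>rows28. fst r)))"
  by (rule rows_ok_of_sieve[OF sieve28 odd_primes2_odd odd_primes2_cover _ _ lams28]) (use conjunct2[OF rows_ok27, unfolded rows_sum27, simplified] in \<open>simp_all add: num_of_numeral\<close>)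
definition rows29 :: "row list" where "rows29 = [(300, 57, 10530959), (152, 29, 10546841), (307, 56, 10554793), (155, 30, 10570663)]"
lemma sieve29: "blk rows29 (segs (int 37477 + 2) odd_primes2 [num_of 914])"
  by (simp add: odd_primes2_def sieve_key_def Let_def num_of_numeral del: svs.simps blk.simps trues.simps,
    simp only: svs.simps fst_conv snd_conv sv_rules trues.simps append.simps, simp add: rows29_def)
lemma rows_sum29: "(\<Sum>r\<leftarrow>rows29. fst r) = 914" "(\<Sum>r\<leftarrow>rows29. fst (snd r) * snd (snd r)) = 1814311350" by (simp_all add: rows29_def)
lemma lams29: "lams 37477 10530959 rows29 10578581" unfolding rows29_def by (simp add: lams_rules del: lams.simps)
lemma rows_ok29: "rows_ok 37477 rows29 \<and> of_int 10578581 \<le> 10 ^ 6 * ln (real (37477 + 2 * (\<Sum>r\<leftarrow>rows29. fst r)))"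
  by (rule rows_ok_of_sieve[OF sieve29 odd_primes2_odd odd_primes2_cover _ _ lams29]) (use conjunct2[OF rows_ok28, unfolded rows_sum28, simplified] in \<open>simp_all add: num_of_numeral\<close>)
definition rows30 :: "row list" where "rows30 = [(315, 60, 10578581), (159, 31, 10594482), (161, 24, 10602413), (162, 31, 10610380), (163, 32, 10618333)]"
lemma sieve30: "blk rows30 (segs (int 39305 + 2) odd_primes2 [num_of 960])"
  by (simp add: odd_primes2_def sieve_key_def Let_def num_of_numeral del: svs.simps blk.simps trues.simps,
    simp only: svs.simps fst_conv snd_conv sv_rules trues.simps append.simps, simp add: rows30_def)
lemma rows_sum30: "(\<Sum>r\<leftarrow>rows30. fst r) = 960" "(\<Sum>r\<leftarrow>rows30. fst (snd r) * snd (snd r)) = 1886310150" by (simp_all add: rows30_def)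
lemma lams30: "lams 39305 10578581 rows30 10626272" unfolding rows30_def by (simp add: lams_rules del: lams.simps)
lemma rows_ok30: "rows_ok 39305 rows30 \<and> of_int 10626272 \<le> 10 ^ 6 * ln (real (39305 + 2 * (\<Sum>r\<leftarrow>rows30. fst r)))"
  by (rule rows_ok_of_sieve[OF sieve30 odd_primes2_odd odd_primes2_cover _ _ lams30]) (use conjunct2[OF rows_ok29, unfolded rows_sum29, simplified] in \<open>simp_all add: num_of_numeral\<close>)
definition rows31 :: "row list" where "rows31 = [(330, 62, 10626272)]"
lemma sieve31: "blk rows31 (segs (int 41225 + 2) odd_primes2 [num_of 330])"
  by (simp add: odd_primes2_def sieve_key_def Let_def num_of_numeral del: svs.simps blk.simps trues.simps,
    simp only: svs.simps fst_conv snd_conv sv_rules trues.simps append.simps, simp add: rows31_def)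
lemma rows_sum31: "(\<Sum>r\<leftarrow>rows31. fst r) = 330" "(\<Sum>r\<leftarrow>rows31. fst (snd r) * snd (snd r)) = 658828864" by (simp_all add: rows31_def)
lemma lams31: "lams 41225 10626272 rows31 10642154" unfolding rows31_def by (simp add: lams_rules del: lams.simps)
lemma rows_ok31: "rows_ok 41225 rows31 \<and> of_int 10642154 \<le> 10 ^ 6 * ln (real (41225 + 2 * (\<Sum>r\<leftarrow>rows31. fst r)))"
  by (rule rows_ok_of_sieve[OF sieve31 odd_primes2_odd odd_primes2_cover _ _ lams31]) (use conjunct2[OF rows_ok30, unfolded rows_sum30, simplified] in \<open>simp_all add: num_of_numeral\<close>)
text \<open>The table is assembled from its last block backwards, so validity, positivity and break
  points each need one short step per block and no block is unfolded inside another.\<close>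

definition tail31 :: "row list" where "tail31 = rows31"
lemma tail_ok31: "rows_ok 41225 tail31"
  using rows_ok31 by (simp add: tail31_def)
definition tail30 :: "row list" where "tail30 = rows30 @ tail31"
lemma tail_ok30: "rows_ok 39305 tail30"
  using rows_ok30 tail_ok31 by (simp add: tail30_def rows_ok_append rows_sum30)
definition tail29 :: "row list" where "tail29 = rows29 @ tail30"
lemma tail_ok29: "rows_ok 37477 tail29"
  using rows_ok29 tail_ok30 by (simp add: tail29_def rows_ok_append rows_sum29)
definition tail28 :: "row list" where "tail28 = rows28 @ tail29"
lemma tail_ok28: "rows_ok 36017 tail28"
  using rows_ok28 tail_ok29 by (simp add: tail28_def rows_ok_append rows_sum28)
definition tail27 :: "row list" where "tail27 = rows27 @ tail28"
lemma tail_ok27: "rows_ok 34343 tail27"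
  using rows_ok27 tail_ok28 by (simp add: tail27_def rows_ok_append rows_sum27)
definition tail26 :: "row list" where "tail26 = rows26 @ tail27"
lemma tail_ok26: "rows_ok 32485 tail26"
  using rows_ok26 tail_ok27 by (simp add: tail26_def rows_ok_append rows_sum26)
definition tail25 :: "row list" where "tail25 = rows25 @ tail26"
lemma tail_ok25: "rows_ok 30735 tail25"
  using rows_ok25 tail_ok26 by (simp add: tail25_def rows_ok_append rows_sum25)
definition tail24 :: "row list" where "tail24 = rows24 @ tail25"
lemma tail_ok24: "rows_ok 28841 tail24"
  using rows_ok24 tail_ok25 by (simp add: tail24_def rows_ok_append rows_sum24)
definition tail23 :: "row list" where "tail23 = rows23 @ tail24"
lemma tail_ok23: "rows_ok 27067 tail23"
  using rows_ok23 tail_ok24 by (simp add: tail23_def rows_ok_append rows_sum23)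
definition tail22 :: "row list" where "tail22 = rows22 @ tail23"
lemma tail_ok22: "rows_ok 25203 tail22"
  using rows_ok22 tail_ok23 by (simp add: tail22_def rows_ok_append rows_sum22)
definition tail21 :: "row list" where "tail21 = rows21 @ tail22"
lemma tail_ok21: "rows_ok 23281 tail21"
  using rows_ok21 tail_ok22 by (simp add: tail21_def rows_ok_append rows_sum21)
definition tail20 :: "row list" where "tail20 = rows20 @ tail21"
lemma tail_ok20: "rows_ok 21337 tail20"
  using rows_ok20 tail_ok21 by (simp add: tail20_def rows_ok_append rows_sum20)
definition tail19 :: "row list" where "tail19 = rows19 @ tail20"
lemma tail_ok19: "rows_ok 19401 tail19"
  using rows_ok19 tail_ok20 by (simp add: tail19_def rows_ok_append rows_sum19)
definition tail18 :: "row list" where "tail18 = rows18 @ tail19"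
lemma tail_ok18: "rows_ok 17503 tail18"
  using rows_ok18 tail_ok19 by (simp add: tail18_def rows_ok_append rows_sum18)
definition tail17 :: "row list" where "tail17 = rows17 @ tail18"
lemma tail_ok17: "rows_ok 15545 tail17"
  using rows_ok17 tail_ok18 by (simp add: tail17_def rows_ok_append rows_sum17)
definition tail16 :: "row list" where "tail16 = rows16 @ tail17"
lemma tail_ok16: "rows_ok 13591 tail16"
  using rows_ok16 tail_ok17 by (simp add: tail16_def rows_ok_append rows_sum16)
definition tail15 :: "row list" where "tail15 = rows15 @ tail16"
lemma tail_ok15: "rows_ok 11607 tail15"
  using rows_ok15 tail_ok16 by (simp add: tail15_def rows_ok_append rows_sum15)
definition tail14 :: "row list" where "tail14 = rows14 @ tail15"
lemma tail_ok14: "rows_ok 9687 tail14"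
  using rows_ok14 tail_ok15 by (simp add: tail14_def rows_ok_append rows_sum14)
definition tail13 :: "row list" where "tail13 = rows13 @ tail14"
lemma tail_ok13: "rows_ok 7715 tail13"
  using rows_ok13 tail_ok14 by (simp add: tail13_def rows_ok_append rows_sum13)
definition tail12 :: "row list" where "tail12 = rows12 @ tail13"
lemma tail_ok12: "rows_ok 5733 tail12"
  using rows_ok12 tail_ok13 by (simp add: tail12_def rows_ok_append rows_sum12)
definition tail11 :: "row list" where "tail11 = rows11 @ tail12"
lemma tail_ok11: "rows_ok 3769 tail11"
  using rows_ok11 tail_ok12 by (simp add: tail11_def rows_ok_append rows_sum11)
definition tail10 :: "row list" where "tail10 = rows10 @ tail11"
lemma tail_ok10: "rows_ok 2213 tail10"
  using rows_ok10 tail_ok11 by (simp add: tail10_def rows_ok_append rows_sum10)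
definition tail9 :: "row list" where "tail9 = rows9 @ tail10"
lemma tail_ok9: "rows_ok 1321 tail9"
  using rows_ok9 tail_ok10 by (simp add: tail9_def rows_ok_append rows_sum9)
definition tail8 :: "row list" where "tail8 = rows8 @ tail9"
lemma tail_ok8: "rows_ok 1001 tail8"
  using rows_ok8 tail_ok9 by (simp add: tail8_def rows_ok_append rows_sum8)
definition tail7 :: "row list" where "tail7 = rows7 @ tail8"
lemma tail_ok7: "rows_ok 999 tail7"
  using rows_ok7 tail_ok8 by (simp add: tail7_def rows_ok_append rows_sum7)
definition tail6 :: "row list" where "tail6 = rows6 @ tail7"
lemma tail_ok6: "rows_ok 923 tail6"
  using rows_ok6 tail_ok7 by (simp add: tail6_def rows_ok_append rows_sum6)
definition tail5 :: "row list" where "tail5 = rows5 @ tail6"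
lemma tail_ok5: "rows_ok 775 tail5"
  using rows_ok5 tail_ok6 by (simp add: tail5_def rows_ok_append rows_sum5)
definition tail4 :: "row list" where "tail4 = rows4 @ tail5"
lemma tail_ok4: "rows_ok 635 tail4"
  using rows_ok4 tail_ok5 by (simp add: tail4_def rows_ok_append rows_sum4)
definition tail3 :: "row list" where "tail3 = rows3 @ tail4"
lemma tail_ok3: "rows_ok 485 tail3"
  using rows_ok3 tail_ok4 by (simp add: tail3_def rows_ok_append rows_sum3)
definition tail2 :: "row list" where "tail2 = rows2 @ tail3"
lemma tail_ok2: "rows_ok 343 tail2"
  using rows_ok2 tail_ok3 by (simp add: tail2_def rows_ok_append rows_sum2)
definition tail1 :: "row list" where "tail1 = rows1 @ tail2"
lemma tail_ok1: "rows_ok 201 tail1"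
  using rows_ok1 tail_ok2 by (simp add: tail1_def rows_ok_append rows_sum1)
definition tail0 :: "row list" where "tail0 = rows0 @ tail1"
lemma tail_ok0: "rows_ok 61 tail0"
  using rows_ok0 tail_ok1 by (simp add: tail0_def rows_ok_append rows_sum0)
text \<open>The break points form a partial function by \<open>pts_unique\<close>. With
  \<open>bp_val\<close> each lookup becomes a simplification rule, and the grid checks never have to
  search the table.\<close>

definition bp :: "nat \<Rightarrow> int \<Rightarrow> bool" where "bp x p \<longleftrightarrow> (x, p) \<in> set (pts 61 0 tail0)"
definition bp_val :: "nat \<Rightarrow> int" where "bp_val x = (THE p. bp x p)"
lemma rows_pos0: "\<forall>r\<in>set rows0. fst r > 0" by (simp add: rows0_def)
lemma rows_pos1: "\<forall>r\<in>set rows1. fst r > 0" by (simp add: rows1_def)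
lemma rows_pos2: "\<forall>r\<in>set rows2. fst r > 0" by (simp add: rows2_def)
lemma rows_pos3: "\<forall>r\<in>set rows3. fst r > 0" by (simp add: rows3_def)
lemma rows_pos4: "\<forall>r\<in>set rows4. fst r > 0" by (simp add: rows4_def)
lemma rows_pos5: "\<forall>r\<in>set rows5. fst r > 0" by (simp add: rows5_def)
lemma rows_pos6: "\<forall>r\<in>set rows6. fst r > 0" by (simp add: rows6_def)
lemma rows_pos7: "\<forall>r\<in>set rows7. fst r > 0" by (simp add: rows7_def)
lemma rows_pos8: "\<forall>r\<in>set rows8. fst r > 0" by (simp add: rows8_def)
lemma rows_pos9: "\<forall>r\<in>set rows9. fst r > 0" by (simp add: rows9_def)
lemma rows_pos10: "\<forall>r\<in>set rows10. fst r > 0" by (simp add: rows10_def)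
lemma rows_pos11: "\<forall>r\<in>set rows11. fst r > 0" by (simp add: rows11_def)
lemma rows_pos12: "\<forall>r\<in>set rows12. fst r > 0" by (simp add: rows12_def)
lemma rows_pos13: "\<forall>r\<in>set rows13. fst r > 0" by (simp add: rows13_def)
lemma rows_pos14: "\<forall>r\<in>set rows14. fst r > 0" by (simp add: rows14_def)
lemma rows_pos15: "\<forall>r\<in>set rows15. fst r > 0" by (simp add: rows15_def)
lemma rows_pos16: "\<forall>r\<in>set rows16. fst r > 0" by (simp add: rows16_def)
lemma rows_pos17: "\<forall>r\<in>set rows17. fst r > 0" by (simp add: rows17_def)
lemma rows_pos18: "\<forall>r\<in>set rows18. fst r > 0" by (simp add: rows18_def)
lemma rows_pos19: "\<forall>r\<in>set rows19. fst r > 0" by (simp add: rows19_def)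
lemma rows_pos20: "\<forall>r\<in>set rows20. fst r > 0" by (simp add: rows20_def)
lemma rows_pos21: "\<forall>r\<in>set rows21. fst r > 0" by (simp add: rows21_def)
lemma rows_pos22: "\<forall>r\<in>set rows22. fst r > 0" by (simp add: rows22_def)
lemma rows_pos23: "\<forall>r\<in>set rows23. fst r > 0" by (simp add: rows23_def)
lemma rows_pos24: "\<forall>r\<in>set rows24. fst r > 0" by (simp add: rows24_def)
lemma rows_pos25: "\<forall>r\<in>set rows25. fst r > 0" by (simp add: rows25_def)
lemma rows_pos26: "\<forall>r\<in>set rows26. fst r > 0" by (simp add: rows26_def)
lemma rows_pos27: "\<forall>r\<in>set rows27. fst r > 0" by (simp add: rows27_def)
lemma rows_pos28: "\<forall>r\<in>set rows28. fst r > 0" by (simp add: rows28_def)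
lemma rows_pos29: "\<forall>r\<in>set rows29. fst r > 0" by (simp add: rows29_def)
lemma rows_pos30: "\<forall>r\<in>set rows30. fst r > 0" by (simp add: rows30_def)
lemma rows_pos31: "\<forall>r\<in>set rows31. fst r > 0" by (simp add: rows31_def)
lemma tail_pos31: "\<forall>r\<in>set tail31. fst r > 0" using rows_pos31 by (auto simp: tail31_def)
lemma tail_pos30: "\<forall>r\<in>set tail30. fst r > 0" using rows_pos30 tail_pos31 by (auto simp: tail30_def)
lemma tail_pos29: "\<forall>r\<in>set tail29. fst r > 0" using rows_pos29 tail_pos30 by (auto simp: tail29_def)
lemma tail_pos28: "\<forall>r\<in>set tail28. fst r > 0" using rows_pos28 tail_pos29 by (auto simp: tail28_def)
lemma tail_pos27: "\<forall>r\<in>set tail27. fst r > 0" using rows_pos27 tail_pos28 by (auto simp: tail27_def)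
lemma tail_pos26: "\<forall>r\<in>set tail26. fst r > 0" using rows_pos26 tail_pos27 by (auto simp: tail26_def)
lemma tail_pos25: "\<forall>r\<in>set tail25. fst r > 0" using rows_pos25 tail_pos26 by (auto simp: tail25_def)
lemma tail_pos24: "\<forall>r\<in>set tail24. fst r > 0" using rows_pos24 tail_pos25 by (auto simp: tail24_def)
lemma tail_pos23: "\<forall>r\<in>set tail23. fst r > 0" using rows_pos23 tail_pos24 by (auto simp: tail23_def)
lemma tail_pos22: "\<forall>r\<in>set tail22. fst r > 0" using rows_pos22 tail_pos23 by (auto simp: tail22_def)
lemma tail_pos21: "\<forall>r\<in>set tail21. fst r > 0" using rows_pos21 tail_pos22 by (auto simp: tail21_def)
lemma tail_pos20: "\<forall>r\<in>set tail20. fst r > 0" using rows_pos20 tail_pos21 by (auto simp: tail20_def)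
lemma tail_pos19: "\<forall>r\<in>set tail19. fst r > 0" using rows_pos19 tail_pos20 by (auto simp: tail19_def)
lemma tail_pos18: "\<forall>r\<in>set tail18. fst r > 0" using rows_pos18 tail_pos19 by (auto simp: tail18_def)
lemma tail_pos17: "\<forall>r\<in>set tail17. fst r > 0" using rows_pos17 tail_pos18 by (auto simp: tail17_def)
lemma tail_pos16: "\<forall>r\<in>set tail16. fst r > 0" using rows_pos16 tail_pos17 by (auto simp: tail16_def)
lemma tail_pos15: "\<forall>r\<in>set tail15. fst r > 0" using rows_pos15 tail_pos16 by (auto simp: tail15_def)
lemma tail_pos14: "\<forall>r\<in>set tail14. fst r > 0" using rows_pos14 tail_pos15 by (auto simp: tail14_def)
lemma tail_pos13: "\<forall>r\<in>set tail13. fst r > 0" using rows_pos13 tail_pos14 by (auto simp: tail13_def)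
lemma tail_pos12: "\<forall>r\<in>set tail12. fst r > 0" using rows_pos12 tail_pos13 by (auto simp: tail12_def)
lemma tail_pos11: "\<forall>r\<in>set tail11. fst r > 0" using rows_pos11 tail_pos12 by (auto simp: tail11_def)
lemma tail_pos10: "\<forall>r\<in>set tail10. fst r > 0" using rows_pos10 tail_pos11 by (auto simp: tail10_def)
lemma tail_pos9: "\<forall>r\<in>set tail9. fst r > 0" using rows_pos9 tail_pos10 by (auto simp: tail9_def)
lemma tail_pos8: "\<forall>r\<in>set tail8. fst r > 0" using rows_pos8 tail_pos9 by (auto simp: tail8_def)
lemma tail_pos7: "\<forall>r\<in>set tail7. fst r > 0" using rows_pos7 tail_pos8 by (auto simp: tail7_def)
lemma tail_pos6: "\<forall>r\<in>set tail6. fst r > 0" using rows_pos6 tail_pos7 by (auto simp: tail6_def)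
lemma tail_pos5: "\<forall>r\<in>set tail5. fst r > 0" using rows_pos5 tail_pos6 by (auto simp: tail5_def)
lemma tail_pos4: "\<forall>r\<in>set tail4. fst r > 0" using rows_pos4 tail_pos5 by (auto simp: tail4_def)
lemma tail_pos3: "\<forall>r\<in>set tail3. fst r > 0" using rows_pos3 tail_pos4 by (auto simp: tail3_def)
lemma tail_pos2: "\<forall>r\<in>set tail2. fst r > 0" using rows_pos2 tail_pos3 by (auto simp: tail2_def)
lemma tail_pos1: "\<forall>r\<in>set tail1. fst r > 0" using rows_pos1 tail_pos2 by (auto simp: tail1_def)
lemma tail_pos0: "\<forall>r\<in>set tail0. fst r > 0" using rows_pos0 tail_pos1 by (auto simp: tail0_def)
lemma bp_unique: "bp x p \<Longrightarrow> bp x p' \<Longrightarrow> p = p'" unfolding bp_def by (rule pts_unique[OF tail_pos0])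
definition is_bp :: "nat \<Rightarrow> bool" where "is_bp x \<longleftrightarrow> bp x (bp_val x)"
lemma bp_valI: "bp x p \<Longrightarrow> is_bp x \<and> bp_val x = p" unfolding is_bp_def bp_val_def using bp_unique by (metis the_equality)
lemma bp_val_all: "(\<forall>xp\<in>set xs. bp (fst xp) (snd xp)) \<Longrightarrow> \<forall>xp\<in>set xs. is_bp (fst xp) \<and> bp_val (fst xp) = snd xp" using bp_valI by blast
lemma tail_sub0: "set (pts 61 0 tail0) \<subseteq> {(x, p). bp x p}" by (auto simp: bp_def)
lemma bp_rows0: "\<forall>xp\<in>set (pts 61 0 rows0). bp (fst xp) (snd xp)"
  using tail_sub0 unfolding tail0_def pts_append by auto
lemmas bp_vals0 = bp_val_all[OF bp_rows0, unfolded rows0_def, simplified]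
lemma tail_sub1: "set (pts 201 134968407 tail1) \<subseteq> {(x, p). bp x p}"
  using tail_sub0 unfolding tail0_def pts_append rows_sum0 by simp
lemma bp_rows1: "\<forall>xp\<in>set (pts 201 134968407 rows1). bp (fst xp) (snd xp)"
  using tail_sub1 unfolding tail1_def pts_append by auto
lemmas bp_vals1 = bp_val_all[OF bp_rows1, unfolded rows1_def, simplified]
lemma tail_sub2: "set (pts 343 257855933 tail2) \<subseteq> {(x, p). bp x p}"
  using tail_sub1 unfolding tail1_def pts_append rows_sum1 by simp
lemma bp_rows2: "\<forall>xp\<in>set (pts 343 257855933 rows2). bp (fst xp) (snd xp)"
  using tail_sub2 unfolding tail2_def pts_append by auto
lemmas bp_vals2 = bp_val_all[OF bp_rows2, unfolded rows2_def, simplified]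
lemma tail_sub3: "set (pts 485 402072880 tail3) \<subseteq> {(x, p). bp x p}"
  using tail_sub2 unfolding tail2_def pts_append rows_sum2 by simp
lemma bp_rows3: "\<forall>xp\<in>set (pts 485 402072880 rows3). bp (fst xp) (snd xp)"
  using tail_sub3 unfolding tail3_def pts_append by auto
lemmas bp_vals3 = bp_val_all[OF bp_rows3, unfolded rows3_def, simplified]
lemma tail_sub4: "set (pts 635 547528919 tail4) \<subseteq> {(x, p). bp x p}"
  using tail_sub3 unfolding tail3_def pts_append rows_sum3 by simp
lemma bp_rows4: "\<forall>xp\<in>set (pts 635 547528919 rows4). bp (fst xp) (snd xp)"
  using tail_sub4 unfolding tail4_def pts_append by auto
lemmas bp_vals4 = bp_val_all[OF bp_rows4, unfolded rows4_def, simplified]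
lemma tail_sub5: "set (pts 775 691700680 tail5) \<subseteq> {(x, p). bp x p}"
  using tail_sub4 unfolding tail4_def pts_append rows_sum4 by simp
lemma bp_rows5: "\<forall>xp\<in>set (pts 775 691700680 rows5). bp (fst xp) (snd xp)"
  using tail_sub5 unfolding tail5_def pts_append by auto
lemmas bp_vals5 = bp_val_all[OF bp_rows5, unfolded rows5_def, simplified]
lemma tail_sub6: "set (pts 923 826574002 tail6) \<subseteq> {(x, p). bp x p}"
  using tail_sub5 unfolding tail5_def pts_append rows_sum5 by simp
lemma bp_rows6: "\<forall>xp\<in>set (pts 923 826574002 rows6). bp (fst xp) (snd xp)"
  using tail_sub6 unfolding tail6_def pts_append by auto
lemmas bp_vals6 = bp_val_all[OF bp_rows6, unfolded rows6_def, simplified]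
lemma tail_sub7: "set (pts 999 902116123 tail7) \<subseteq> {(x, p). bp x p}"
  using tail_sub6 unfolding tail6_def pts_append rows_sum6 by simp
lemma bp_rows7: "\<forall>xp\<in>set (pts 999 902116123 rows7). bp (fst xp) (snd xp)"
  using tail_sub7 unfolding tail7_def pts_append by auto
lemmas bp_vals7 = bp_val_all[OF bp_rows7, unfolded rows7_def, simplified]
lemma tail_sub8: "set (pts 1001 902116123 tail8) \<subseteq> {(x, p). bp x p}"
  using tail_sub7 unfolding tail7_def pts_append rows_sum7 by simp
lemma bp_rows8: "\<forall>xp\<in>set (pts 1001 902116123 rows8). bp (fst xp) (snd xp)"
  using tail_sub8 unfolding tail8_def pts_append by auto
lemmas bp_vals8 = bp_val_all[OF bp_rows8, unfolded rows8_def, simplified]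
lemma tail_sub9: "set (pts 1321 1240656320 tail9) \<subseteq> {(x, p). bp x p}"
  using tail_sub8 unfolding tail8_def pts_append rows_sum8 by simp
lemma bp_rows9: "\<forall>xp\<in>set (pts 1321 1240656320 rows9). bp (fst xp) (snd xp)"
  using tail_sub9 unfolding tail9_def pts_append by auto
lemmas bp_vals9 = bp_val_all[OF bp_rows9, unfolded rows9_def, simplified]
lemma tail_sub10: "set (pts 2213 2091512895 tail10) \<subseteq> {(x, p). bp x p}"
  using tail_sub9 unfolding tail9_def pts_append rows_sum9 by simp
lemma bp_rows10: "\<forall>xp\<in>set (pts 2213 2091512895 rows10). bp (fst xp) (snd xp)"
  using tail_sub10 unfolding tail10_def pts_append by auto
lemmas bp_vals10 = bp_val_all[OF bp_rows10, unfolded rows10_def, simplified]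
lemma tail_sub11: "set (pts 3769 3648744030 tail11) \<subseteq> {(x, p). bp x p}"
  using tail_sub10 unfolding tail10_def pts_append rows_sum10 by simp
lemma bp_rows11: "\<forall>xp\<in>set (pts 3769 3648744030 rows11). bp (fst xp) (snd xp)"
  using tail_sub11 unfolding tail11_def pts_append by auto
lemmas bp_vals11 = bp_val_all[OF bp_rows11, unfolded rows11_def, simplified]
lemma tail_sub12: "set (pts 5733 5576252045 tail12) \<subseteq> {(x, p). bp x p}"
  using tail_sub11 unfolding tail11_def pts_append rows_sum11 by simp
lemma bp_rows12: "\<forall>xp\<in>set (pts 5733 5576252045 rows12). bp (fst xp) (snd xp)"
  using tail_sub12 unfolding tail12_def pts_append by auto
lemmas bp_vals12 = bp_val_all[OF bp_rows12, unfolded rows12_def, simplified]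
lemma tail_sub13: "set (pts 7715 7557250350 tail13) \<subseteq> {(x, p). bp x p}"
  using tail_sub12 unfolding tail12_def pts_append rows_sum12 by simp
lemma bp_rows13: "\<forall>xp\<in>set (pts 7715 7557250350 rows13). bp (fst xp) (snd xp)"
  using tail_sub13 unfolding tail13_def pts_append by auto
lemmas bp_vals13 = bp_val_all[OF bp_rows13, unfolded rows13_def, simplified]
lemma tail_sub14: "set (pts 9687 9524680169 tail14) \<subseteq> {(x, p). bp x p}"
  using tail_sub13 unfolding tail13_def pts_append rows_sum13 by simp
lemma bp_rows14: "\<forall>xp\<in>set (pts 9687 9524680169 rows14). bp (fst xp) (snd xp)"
  using tail_sub14 unfolding tail14_def pts_append by auto
lemmas bp_vals14 = bp_val_all[OF bp_rows14, unfolded rows14_def, simplified]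
lemma tail_sub15: "set (pts 11607 11387019545 tail15) \<subseteq> {(x, p). bp x p}"
  using tail_sub14 unfolding tail14_def pts_append rows_sum14 by simp
lemma bp_rows15: "\<forall>xp\<in>set (pts 11607 11387019545 rows15). bp (fst xp) (snd xp)"
  using tail_sub15 unfolding tail15_def pts_append by auto
lemmas bp_vals15 = bp_val_all[OF bp_rows15, unfolded rows15_def, simplified]
lemma tail_sub16: "set (pts 13591 13377789007 tail16) \<subseteq> {(x, p). bp x p}"
  using tail_sub15 unfolding tail15_def pts_append rows_sum15 by simp
lemma bp_rows16: "\<forall>xp\<in>set (pts 13591 13377789007 rows16). bp (fst xp) (snd xp)"
  using tail_sub16 unfolding tail16_def pts_append by auto
lemmas bp_vals16 = bp_val_all[OF bp_rows16, unfolded rows16_def, simplified]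
lemma tail_sub17: "set (pts 15545 15351697980 tail17) \<subseteq> {(x, p). bp x p}"
  using tail_sub16 unfolding tail16_def pts_append rows_sum16 by simp
lemma bp_rows17: "\<forall>xp\<in>set (pts 15545 15351697980 rows17). bp (fst xp) (snd xp)"
  using tail_sub17 unfolding tail17_def pts_append by auto
lemmas bp_vals17 = bp_val_all[OF bp_rows17, unfolded rows17_def, simplified]
lemma tail_sub18: "set (pts 17503 17302926944 tail18) \<subseteq> {(x, p). bp x p}"
  using tail_sub17 unfolding tail17_def pts_append rows_sum17 by simp
lemma bp_rows18: "\<forall>xp\<in>set (pts 17503 17302926944 rows18). bp (fst xp) (snd xp)"
  using tail_sub18 unfolding tail18_def pts_append by auto
lemmas bp_vals18 = bp_val_all[OF bp_rows18, unfolded rows18_def, simplified]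
lemma tail_sub19: "set (pts 19401 19089485749 tail19) \<subseteq> {(x, p). bp x p}"
  using tail_sub18 unfolding tail18_def pts_append rows_sum18 by simp
lemma bp_rows19: "\<forall>xp\<in>set (pts 19401 19089485749 rows19). bp (fst xp) (snd xp)"
  using tail_sub19 unfolding tail19_def pts_append by auto
lemmas bp_vals19 = bp_val_all[OF bp_rows19, unfolded rows19_def, simplified]
lemma tail_sub20: "set (pts 21337 21062649831 tail20) \<subseteq> {(x, p). bp x p}"
  using tail_sub19 unfolding tail19_def pts_append rows_sum19 by simp
lemma bp_rows20: "\<forall>xp\<in>set (pts 21337 21062649831 rows20). bp (fst xp) (snd xp)"
  using tail_sub20 unfolding tail20_def pts_append by auto
lemmas bp_vals20 = bp_val_all[OF bp_rows20, unfolded rows20_def, simplified]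
lemma tail_sub21: "set (pts 23281 23063965746 tail21) \<subseteq> {(x, p). bp x p}"
  using tail_sub20 unfolding tail20_def pts_append rows_sum20 by simp
lemma bp_rows21: "\<forall>xp\<in>set (pts 23281 23063965746 rows21). bp (fst xp) (snd xp)"
  using tail_sub21 unfolding tail21_def pts_append by auto
lemmas bp_vals21 = bp_val_all[OF bp_rows21, unfolded rows21_def, simplified]
lemma tail_sub22: "set (pts 25203 24940725437 tail22) \<subseteq> {(x, p). bp x p}"
  using tail_sub21 unfolding tail21_def pts_append rows_sum21 by simp
lemma bp_rows22: "\<forall>xp\<in>set (pts 25203 24940725437 rows22). bp (fst xp) (snd xp)"
  using tail_sub22 unfolding tail22_def pts_append by auto
lemmas bp_vals22 = bp_val_all[OF bp_rows22, unfolded rows22_def, simplified]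
lemma tail_sub23: "set (pts 27067 26841935861 tail23) \<subseteq> {(x, p). bp x p}"
  using tail_sub22 unfolding tail22_def pts_append rows_sum22 by simp
lemma bp_rows23: "\<forall>xp\<in>set (pts 27067 26841935861 rows23). bp (fst xp) (snd xp)"
  using tail_sub23 unfolding tail23_def pts_append by auto
lemmas bp_vals23 = bp_val_all[OF bp_rows23, unfolded rows23_def, simplified]
lemma tail_sub24: "set (pts 28841 28602415482 tail24) \<subseteq> {(x, p). bp x p}"
  using tail_sub23 unfolding tail23_def pts_append rows_sum23 by simp
lemma bp_rows24: "\<forall>xp\<in>set (pts 28841 28602415482 rows24). bp (fst xp) (snd xp)"
  using tail_sub24 unfolding tail24_def pts_append by auto
lemmas bp_vals24 = bp_val_all[OF bp_rows24, unfolded rows24_def, simplified]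
lemma tail_sub25: "set (pts 30735 30404230449 tail25) \<subseteq> {(x, p). bp x p}"
  using tail_sub24 unfolding tail24_def pts_append rows_sum24 by simp
lemma bp_rows25: "\<forall>xp\<in>set (pts 30735 30404230449 rows25). bp (fst xp) (snd xp)"
  using tail_sub25 unfolding tail25_def pts_append by auto
lemmas bp_vals25 = bp_val_all[OF bp_rows25, unfolded rows25_def, simplified]
lemma tail_sub26: "set (pts 32485 32164924792 tail26) \<subseteq> {(x, p). bp x p}"
  using tail_sub25 unfolding tail25_def pts_append rows_sum25 by simp
lemma bp_rows26: "\<forall>xp\<in>set (pts 32485 32164924792 rows26). bp (fst xp) (snd xp)"
  using tail_sub26 unfolding tail26_def pts_append by auto
lemmas bp_vals26 = bp_val_all[OF bp_rows26, unfolded rows26_def, simplified]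
lemma tail_sub27: "set (pts 34343 34091112212 tail27) \<subseteq> {(x, p). bp x p}"
  using tail_sub26 unfolding tail26_def pts_append rows_sum26 by simp
lemma bp_rows27: "\<forall>xp\<in>set (pts 34343 34091112212 rows27). bp (fst xp) (snd xp)"
  using tail_sub27 unfolding tail27_def pts_append by auto
lemmas bp_vals27 = bp_val_all[OF bp_rows27, unfolded rows27_def, simplified]
lemma tail_sub28: "set (pts 36017 35744334302 tail28) \<subseteq> {(x, p). bp x p}"
  using tail_sub27 unfolding tail27_def pts_append rows_sum27 by simp
lemma bp_rows28: "\<forall>xp\<in>set (pts 36017 35744334302 rows28). bp (fst xp) (snd xp)"
  using tail_sub28 unfolding tail28_def pts_append by auto
lemmas bp_vals28 = bp_val_all[OF bp_rows28, unfolded rows28_def, simplified]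
lemma tail_sub29: "set (pts 37477 37183414465 tail29) \<subseteq> {(x, p). bp x p}"
  using tail_sub28 unfolding tail28_def pts_append rows_sum28 by simp
lemma bp_rows29: "\<forall>xp\<in>set (pts 37477 37183414465 rows29). bp (fst xp) (snd xp)"
  using tail_sub29 unfolding tail29_def pts_append by auto
lemmas bp_vals29 = bp_val_all[OF bp_rows29, unfolded rows29_def, simplified]
lemma tail_sub30: "set (pts 39305 38997725815 tail30) \<subseteq> {(x, p). bp x p}"
  using tail_sub29 unfolding tail29_def pts_append rows_sum29 by simp
lemma bp_rows30: "\<forall>xp\<in>set (pts 39305 38997725815 rows30). bp (fst xp) (snd xp)"
  using tail_sub30 unfolding tail30_def pts_append by auto
lemmas bp_vals30 = bp_val_all[OF bp_rows30, unfolded rows30_def, simplified]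
lemma tail_sub31: "set (pts 41225 40884035965 tail31) \<subseteq> {(x, p). bp x p}"
  using tail_sub30 unfolding tail30_def pts_append rows_sum30 by simp
lemma bp_rows31: "\<forall>xp\<in>set (pts 41225 40884035965 rows31). bp (fst xp) (snd xp)"
  using tail_sub31 unfolding tail31_def  by auto
lemmas bp_vals31 = bp_val_all[OF bp_rows31, unfolded rows31_def, simplified]

section \<open>Exponents from 1600 to 96000: a grid of parameters\<close>

text \<open>An entry \<open>(w, n, A, N, j, ivs)\<close> fixes Pade parameters serving the exponents
  from \<open>2 * w\<close> to \<open>2 * w + j\<close>, and lists half-open intervals all of whose
  primes divide the coefficients.\<close>

type_synonym gentry = "nat \<times> nat \<times> nat \<times> nat \<times> nat \<times> (nat \<times> nat) list"

text \<open>The last two inequalities are those of \<open>dist_nint_gt_of_ln_content\<close>, with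
  logarithms rounded unfavourably and everything in units of \<open>10 ^ (-8)\<close>; the factor
  \<open>100\<close> converts the break point totals. The coefficient \<open>162186036\<close> is
  twice the rounded \<open>ln (9/4)\<close>.\<close>

definition gok :: "gentry \<Rightarrow> bool" where
  "gok = (\<lambda>(w, n, A, N, j, ivs). w = n + N + 1 \<and> n < A \<and> 3 * A \<le> w + 3 * n \<and> chain 0 ivs \<and>
    list_all (\<lambda>(a, b). odd a \<and> is_bp a \<and> is_bp b \<and>
      (A div (a + 2) + n div (a + 2) + N div (a + 2) + 2) * b \<le> A + n + N) ivs \<and>
    (let V = 100 * (\<Sum>(a, b)\<leftarrow>ivs. bp_val b - bp_val a) in
      int w * 69314719 + int N * 109861230 - int A * 167397642 + (int n + 1) * 23361487 + int j * 138629438 + 69314719 \<le> V \<and>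
      int n * 321887589 + (int A + 1) * 38566249 + (int A + int w) * 3922072 - int w * 162186036 + int j * 28768210 + 69314719 < V))"

text \<open>The separation condition need only be tested at the ends of an interval: the three small
  quotients are largest at the first odd number \<open>a + 2\<close>, the large one is smallest at
  \<open>b\<close>. The two logarithmic inequalities are monotone in \<open>j\<close>, so the test
  at \<open>j0\<close> covers all smaller values.\<close>

lemma gok_sound:
  assumes g: "gok (w, n, A, N, j0, ivs)" and j: "j \<le> j0"
  shows "dist_nint ((4/3) ^ (2 * w + j)) > (4/9) ^ (2 * w + j)"
proof -
  define m where "m = A + n + N"
  define V where "V = 100 * (\<Sum>(a, b)\<leftarrow>ivs. bp_val b - bp_val a)"
  have w: "w = n + N + 1" and nA: "n < A" and A3: "3 * (A - n) \<le> w" and ch: "chain 0 ivs"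
    and iv: "\<forall>(a, b)\<in>set ivs. odd a \<and> is_bp a \<and> is_bp b \<and> (A div (a + 2) + n div (a + 2) + N div (a + 2) + 2) * b \<le> m"
    and E: "int w * 69314719 + int N * 109861230 - int A * 167397642 + (int n + 1) * 23361487 + int j0 * 138629438 + 69314719 \<le> V"
    and Q: "int n * 321887589 + (int A + 1) * 38566249 + (int A + int w) * 3922072 - int w * 162186036 + int j0 * 28768210 + 69314719 < V"
    using g by (auto simp: gok_def m_def V_def Let_def list_all_iff)
  define P where "P = (\<lambda>d. A div d + n div d + N div d + 2 \<le> m div d)"
  define S where "S = {p :: nat. prime p \<and> (\<exists>(a, b)\<in>set ivs. a < p \<and> p \<le> b)}"
  define C where "C = ln (real (content (m * (m + 1)) (sep (m * (m + 1)) P)))"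
  have S: "finite S" "(\<Sum>(a, b)\<leftarrow>ivs. prime_logs a b) = (\<Sum>p\<in>S. ln (real p))"
    using prime_logs_chain[OF ch] by (auto simp: S_def)
  have lt: "\<forall>(a, b)\<in>set ivs. a < b"
    using ch by (rule chain_lt)
  have "prime p \<and> p \<le> m \<and> P p" if pS: "p \<in> S" for p
  proof -
    obtain a b where ab: "(a, b) \<in> set ivs" "a < p" "p \<le> b" "prime p" using pS unfolding S_def by blast
    define s where "s = A div (a + 2) + n div (a + 2) + N div (a + 2) + 2"
    have s: "s * b \<le> m" using iv ab by (auto simp: s_def)
    have p0: "p > 0" using ab by simp
    \<comment> \<open>\<open>a\<close> is odd and \<open>p\<close> is an odd prime, so
      \<open>a + 1\<close> is impossible; \<open>p = 2\<close> is excluded because break points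
      start at \<open>61\<close>.\<close>
    have a2: "a + 2 \<le> p"
    proof (rule ccontr)
      assume "\<not> a + 2 \<le> p"
      hence "p = Suc a" using ab by simp
      hence "even p" using iv ab(1) by auto
      hence "p = 2" using ab(4) prime_odd_nat[of p] prime_ge_2_nat[of p] by fastforce
      hence "a + 2 \<le> 3" using \<open>p = Suc a\<close> by simp
      moreover have "a \<ge> 61" using iv ab(1) pts_ge[OF tail_ok0, of a _ 0] by (auto simp: is_bp_def bp_def)
      ultimately show False by simp
    qed
    have sp: "s * p \<le> m" using s ab by (meson le_trans mult_le_mono2)
    have "A div p + n div p + N div p + 2 \<le> s" unfolding s_def using ab a2 by (intro add_mono div_le_mono2) auto
    also have "s \<le> m div p" using sp p0 by (simp add: less_eq_div_iff_mult_less_eq)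
    finally have "P p" by (simp add: P_def)
    moreover have "p \<le> m"
    proof -
      have "1 * p \<le> s * p" by (intro mult_right_mono) (auto simp: s_def)
      thus ?thesis using sp by linarith
    qed
    ultimately show ?thesis using ab by simp
  qed
  hence "(\<Sum>p\<in>S. ln (real p)) \<le> C" unfolding C_def using S(1) by (intro ln_content_ge_primes) auto
  moreover have "of_int V / 10 ^ 8 \<le> (\<Sum>(a, b)\<leftarrow>ivs. prime_logs a b)"
  proof -
    have "of_int (\<Sum>(a, b)\<leftarrow>ivs. bp_val b - bp_val a) / 10 ^ 6 \<le> (\<Sum>(a, b)\<leftarrow>ivs. prime_logs a b)"
      using iv lt
    proof (induction ivs)
      case (Cons ab ivs)
      obtain a b where ab: "ab = (a, b)" by (cases ab)
      have "prime_logs a b \<ge> of_int (bp_val b - bp_val a) / 10 ^ 6"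
        using Cons.prems by (intro pts_diff[OF tail_ok0, of a _ 0]) (auto simp: ab is_bp_def bp_def)
      moreover have "of_int (\<Sum>(a, b)\<leftarrow>ivs. bp_val b - bp_val a) / 10 ^ 6 \<le> (\<Sum>(a, b)\<leftarrow>ivs. prime_logs a b)"
        by (rule Cons.IH) (use Cons.prems in auto)
      moreover have "of_int (\<Sum>(a, b)\<leftarrow>ab # ivs. bp_val b - bp_val a) / 10 ^ 6
          = of_int (bp_val b - bp_val a) / 10 ^ 6 + of_int (\<Sum>(a, b)\<leftarrow>ivs. bp_val b - bp_val a) / (10 ^ 6 :: real)"
        by (simp add: ab add_divide_distrib diff_divide_distrib)
      moreover have "(\<Sum>(a, b)\<leftarrow>ab # ivs. prime_logs a b) = prime_logs a b + (\<Sum>(a, b)\<leftarrow>ivs. prime_logs a b)" by (simp add: ab)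
      ultimately show ?case by linarith
    qed simp
    moreover have "of_int V / 10 ^ 8 = of_int (\<Sum>(a, b)\<leftarrow>ivs. bp_val b - bp_val a) / (10 ^ 6 :: real)" by (simp add: V_def)
    ultimately show ?thesis by linarith
  qed
  ultimately have "of_int V / 10 ^ 8 \<le> C" unfolding S(2) by linarith
  hence CV: "of_int V \<le> C * 10 ^ 8" by simp
  have jr: "real j \<le> real j0" using j by simp
  have rE: "real w * 69314719 + real N * 109861230 - real A * 167397642 + (real n + 1) * 23361487 + real j0 * 138629438 + 69314719 \<le> of_int V"
  proof -
    have "real_of_int (int w * 69314719 + int N * 109861230 - int A * 167397642 + (int n + 1) * 23361487 + int j0 * 138629438 + 69314719) \<le> of_int V"
      using E by (simp only: of_int_le_iff)
    thus ?thesis by simp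
  qed
  have rQ: "real n * 321887589 + (real A + 1) * 38566249 + (real A + real w) * 3922072 - real w * 162186036 + real j0 * 28768210 + 69314719 < of_int V"
  proof -
    have "real_of_int (int n * 321887589 + (int A + 1) * 38566249 + (int A + int w) * 3922072 - int w * 162186036 + int j0 * 28768210 + 69314719) < of_int V"
      using Q by (simp only: of_int_less_iff)
    thus ?thesis by simp
  qed
  have "A div d + n div d + N div d + 2 \<le> (A + n + N) div d" if "d > 0" "sep (m * (m + 1)) P (m * (m + 1) div d)" for d
    using that by (auto simp: sep_def P_def m_def)
  moreover note nA A3 w
  moreover have "real w * ln 2 + real N * ln 3 + real A * ln (3 / 16) + (real n + 1) * ln (24 / 19) + real j * ln 4 + ln 2 \<le> C"
  proof -
    have "real w * ln 2 \<le> real w * 0.69314719" using ln_2_upper by (intro mult_left_mono) auto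
    moreover have "real N * ln 3 \<le> real N * 1.0986123" using ln_3_bounds(2) by (intro mult_left_mono) auto
    moreover have "real A * ln (3/16) \<le> real A * (-1.67397642)" using ln_const_bounds by (intro mult_left_mono) auto
    moreover have "(real n + 1) * ln (24/19) \<le> (real n + 1) * 0.23361487" using ln_const_bounds by (intro mult_left_mono) auto
    moreover have "real j * ln 4 \<le> real j0 * 1.38629438" using ln_const_bounds jr by (intro mult_mono) auto
    ultimately show ?thesis using CV rE ln_2_upper by ((simp; fail) | (simp add: field_simps; fail) | linarith)
  qed
  moreover have "real n * ln 25 + (real A + 1) * ln (25 / 17) + (real A + real w) * ln (26 / 25) - 2 * real w * ln (9 / 4) + real j * ln (4 / 3) + ln 2 < C"
  proof -
    have "real n * ln 25 \<le> real n * 3.21887589" using ln_const_bounds by (intro mult_left_mono) auto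
    moreover have "(real A + 1) * ln (25/17) \<le> (real A + 1) * 0.38566249" using ln_const_bounds by (intro mult_left_mono) auto
    moreover have "(real A + real w) * ln (26/25) \<le> (real A + real w) * 0.03922072" using ln_const_bounds by (intro mult_left_mono) auto
    moreover have "2 * real w * ln (9/4) \<ge> 2 * real w * 0.81093018" using ln_const_bounds by (intro mult_left_mono) auto
    moreover have "real j * ln (4/3) \<le> real j0 * 0.28768210" using ln_const_bounds jr by (intro mult_mono) auto
    ultimately show ?thesis using CV rQ ln_2_upper by ((simp; fail) | (simp add: field_simps; fail) | linarith)
  qed
  ultimately show ?thesis unfolding C_def by (rule dist_nint_gt_of_ln_content)
qed

primrec covers :: "nat \<Rightarrow> gentry list \<Rightarrow> nat \<Rightarrow> bool" where
  "covers k [] k1 = (k1 \<le> k)"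
| "covers k (g # gs) k1 = (2 * fst g \<le> k \<and> covers (2 * fst g + fst (snd (snd (snd (snd g)))) + 1) gs k1)"

lemma covers_sound:
  assumes "list_all gok gs" "covers k0 gs k1" "k0 \<le> k" "k < k1"
  shows "dist_nint ((4/3) ^ k) > (4/9) ^ k"
  using assms
proof (induction gs arbitrary: k0)
  case (Cons g gs)
  obtain w n A N j ivs where g: "g = (w, n, A, N, j, ivs)" by (cases g)
  show ?case
  proof (cases "k \<le> 2 * w + j")
    case True
    have kw: "2 * w \<le> k" using Cons.prems by (simp add: g)
    have "dist_nint ((4/3) ^ (2 * w + (k - 2 * w))) > (4/9) ^ (2 * w + (k - 2 * w))"
      using Cons.prems(1) True by (intro gok_sound[of w n A N j ivs]) (auto simp: g)
    thus ?thesis using kw by simp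
  next
    case False
    thus ?thesis using Cons.prems by (intro Cons.IH[of "2 * w + j + 1"]) (auto simp: g)
  qed
qed simp

lemmas bp_vals = bp_vals0 bp_vals1 bp_vals2 bp_vals3 bp_vals4 bp_vals5 bp_vals6 bp_vals7 bp_vals8 bp_vals9 bp_vals10 bp_vals11 bp_vals12 bp_vals13 bp_vals14 bp_vals15 bp_vals16 bp_vals17 bp_vals18 bp_vals19 bp_vals20 bp_vals21 bp_vals22 bp_vals23 bp_vals24 bp_vals25 bp_vals26 bp_vals27 bp_vals28 bp_vals29 bp_vals30 bp_vals31
text \<open>In each entry the last and widest interval consists of primes above \<open>A\<close> and
  up to half of \<open>A + n + N\<close>, where all three quotients vanish and the large one is at
  least \<open>2\<close>. The shorter intervals belong to larger quotients. Consecutive entries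
  leave no exponent uncovered.\<close>

definition grid0 :: "gentry list" where "grid0 = [(800, 352, 618, 447, 38, [(123, 127), (153, 157), (223, 235), (351, 353), (447, 471), (617, 707)]),
  (819, 357, 630, 461, 37, [(77, 79), (125, 131), (177, 181), (229, 241), (357, 361), (461, 481), (629, 723)]),
  (837, 366, 645, 470, 27, [(93, 97), (129, 133), (161, 163), (235, 245), (365, 369), (469, 493), (645, 739)]),
  (851, 375, 658, 475, 38, [(81, 83), (95, 99), (131, 137), (163, 167), (237, 251), (475, 501), (657, 753)]),
  (870, 380, 670, 489, 36, [(97, 101), (125, 127), (133, 139), (189, 191), (243, 255), (379, 383), (489, 513), (669, 769)]),
  (888, 391, 687, 496, 40, [(99, 103), (129, 131), (137, 143), (171, 173), (247, 261), (495, 523), (687, 787)]),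
  (908, 396, 698, 511, 22, [(87, 89), (101, 107), (197, 199), (255, 267), (395, 401), (511, 535), (697, 801)]),
  (919, 400, 706, 518, 25, [(87, 89), (99, 101), (103, 107), (175, 179), (259, 269), (399, 405), (517, 541), (705, 811)])]"
lemma grid_ok0: "list_all gok grid0" by (simp add: grid0_def gok_def Let_def bp_vals)
lemma grid_cover0: "covers 1600 grid0 1864" by (simp add: grid0_def)
definition grid1 :: "gentry list" where "grid1 = [(932, 408, 718, 523, 40, [(101, 103), (103, 109), (135, 137), (143, 149), (179, 183), (261, 273), (407, 411), (523, 549), (717, 823)]),
  (952, 421, 738, 530, 52, [(105, 111), (147, 153), (209, 211), (265, 281), (529, 563), (737, 843)]),
  (978, 430, 756, 547, 54, [(109, 115), (151, 157), (189, 191), (273, 287), (429, 433), (547, 577), (755, 865)]),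
  (1005, 445, 780, 559, 54, [(111, 117), (155, 161), (195, 197), (221, 223), (279, 297), (559, 593), (779, 891)]),
  (1032, 451, 795, 580, 40, [(99, 101), (149, 151), (159, 165), (197, 201), (225, 227), (289, 303), (579, 607), (795, 913)]),
  (1052, 457, 807, 594, 51, [(99, 103), (161, 167), (227, 231), (297, 309), (457, 463), (593, 619), (807, 929)]),
  (1077, 474, 833, 602, 47, [(119, 127), (165, 173), (207, 211), (301, 317), (601, 635), (833, 953)]),
  (1100, 486, 852, 613, 58, [(105, 107), (121, 129), (169, 177), (305, 325), (485, 487), (613, 649), (851, 975)])]"
lemma grid_ok1: "list_all gok grid1" by (simp add: grid1_def gok_def Let_def bp_vals)
lemma grid_cover1: "covers 1864 grid1 2258" by (simp add: grid1_def)
definition grid2 :: "gentry list" where "grid2 = [(1129, 498, 874, 630, 55, [(125, 133), (173, 181), (315, 333), (497, 499), (629, 667), (873, 1001)]),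
  (1156, 509, 894, 646, 51, [(111, 113), (129, 135), (177, 185), (223, 227), (323, 341), (645, 683), (893, 1023)]),
  (1181, 520, 913, 660, 51, [(131, 139), (227, 231), (329, 347), (519, 523), (659, 697), (913, 1045)]),
  (1206, 534, 936, 671, 74, [(133, 141), (187, 193), (335, 355), (671, 713), (935, 1069)]),
  (1242, 549, 963, 692, 74, [(137, 145), (191, 199), (239, 243), (345, 367), (691, 733), (963, 1099)]),
  (1278, 562, 988, 715, 72, [(143, 151), (197, 205), (247, 251), (281, 283), (357, 377), (561, 565), (715, 755), (987, 1131)]),
  (1313, 581, 1018, 731, 76, [(145, 155), (203, 211), (253, 257), (365, 387), (731, 775), (1017, 1163)]),
  (1350, 595, 1045, 754, 63, [(129, 133), (149, 159), (197, 199), (209, 217), (261, 265), (377, 399), (753, 797), (1045, 1195)])]"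
lemma grid_ok2: "list_all gok grid2" by (simp add: grid2_def gok_def Let_def bp_vals)
lemma grid_cover2: "covers 2258 grid2 2762" by (simp add: grid2_def)
definition grid3 :: "gentry list" where "grid3 = [(1381, 600, 1060, 780, 29, [(155, 161), (265, 271), (389, 405), (599, 609), (779, 813), (1059, 1219)]),
  (1396, 612, 1077, 783, 64, [(133, 137), (155, 163), (215, 223), (269, 273), (305, 309), (391, 411), (611, 617), (783, 823), (1077, 1235)]),
  (1428, 631, 1107, 796, 77, [(137, 139), (159, 167), (209, 211), (221, 229), (275, 281), (397, 421), (795, 843), (1107, 1261)]),
  (1466, 649, 1137, 816, 77, [(163, 173), (227, 235), (407, 433), (815, 867), (1139, 1301)]),
  (1504, 666, 1167, 837, 90, [(167, 177), (233, 241), (291, 295), (417, 445), (837, 889), (1171, 1331)]),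
  (1548, 672, 1188, 875, 59, [(147, 151), (175, 181), (223, 227), (237, 247), (335, 341), (437, 455), (671, 683), (875, 911), (1187, 1361)]),
  (1577, 682, 1207, 894, 41, [(149, 153), (171, 173), (177, 185), (227, 231), (241, 253), (301, 309), (341, 347), (447, 463), (681, 695), (893, 927), (1211, 1391)]),
  (1597, 700, 1232, 896, 53, [(153, 157), (179, 187), (245, 257), (307, 313), (349, 353), (447, 471), (699, 707), (895, 941), (1235, 1411)])]"
lemma grid_ok3: "list_all gok grid3" by (simp add: grid3_def gok_def Let_def bp_vals)
lemma grid_cover3: "covers 2762 grid3 3246" by (simp add: grid3_def)
definition grid4 :: "gentry list" where "grid4 = [(1623, 711, 1252, 911, 55, [(155, 159), (177, 179), (181, 191), (237, 239), (249, 261), (313, 319), (355, 359), (455, 479), (911, 957), (1251, 1431)]),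
  (1650, 724, 1274, 925, 60, [(185, 193), (253, 265), (461, 487), (723, 729), (925, 973), (1281, 1461)]),
  (1680, 732, 1292, 947, 45, [(161, 165), (189, 197), (257, 269), (365, 371), (473, 495), (731, 741), (947, 989), (1291, 1481)]),
  (1702, 745, 1312, 956, 72, [(163, 167), (191, 199), (247, 251), (261, 273), (327, 333), (371, 375), (477, 501), (745, 753), (955, 1003), (1311, 1501)]),
  (1737, 765, 1344, 971, 81, [(193, 205), (267, 279), (335, 341), (381, 385), (485, 513), (765, 769), (971, 1025), (1351, 1537)]),
  (1777, 786, 1378, 990, 114, [(171, 175), (195, 197), (197, 209), (275, 285), (343, 349), (495, 525), (785, 787), (989, 1051), (1381, 1573)]),
  (1833, 810, 1421, 1022, 110, [(177, 179), (203, 215), (269, 271), (283, 295), (355, 361), (511, 541), (809, 813), (1021, 1083), (1421, 1621)]),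
  (1887, 830, 1459, 1056, 80, [(211, 223), (275, 277), (291, 303), (363, 371), (527, 557), (1055, 1115), (1461, 1669)])]"
lemma grid_ok4: "list_all gok grid4" by (simp add: grid4_def gok_def Let_def bp_vals)
lemma grid_cover4: "covers 3246 grid4 3852" by (simp add: grid4_def)
definition grid5 :: "gentry list" where "grid5 = [(1926, 848, 1490, 1077, 90, [(215, 227), (281, 283), (297, 309), (371, 379), (537, 569), (847, 853), (1077, 1131), (1491, 1705)]),
  (1970, 870, 1526, 1099, 106, [(189, 193), (219, 233), (305, 317), (381, 387), (549, 581), (1099, 1163), (1525, 1741)]),
  (2022, 876, 1550, 1145, 75, [(193, 197), (221, 223), (229, 237), (291, 297), (309, 323), (387, 395), (437, 445), (571, 595), (875, 891), (1147, 1187), (1549, 1781)]),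
  (2059, 902, 1588, 1156, 71, [(197, 201), (225, 227), (231, 243), (317, 331), (397, 405), (577, 607), (901, 911), (1155, 1211), (1597, 1823)]),
  (2094, 918, 1616, 1175, 69, [(235, 247), (305, 309), (323, 337), (403, 411), (459, 463), (587, 617), (917, 927), (1179, 1235), (1621, 1851)]),
  (2128, 936, 1645, 1191, 89, [(237, 251), (311, 313), (329, 341), (411, 419), (595, 627), (935, 943), (1195, 1251), (1645, 1879)]),
  (2172, 951, 1675, 1220, 73, [(209, 213), (243, 255), (335, 349), (417, 427), (475, 479), (609, 641), (951, 961), (1219, 1281), (1681, 1921)]),
  (2208, 970, 1706, 1237, 87, [(247, 259), (341, 355), (425, 433), (485, 489), (617, 651), (969, 977), (1243, 1301), (1705, 1949)])]"
lemma grid_ok5: "list_all gok grid5" by (simp add: grid5_def gok_def Let_def bp_vals)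
lemma grid_cover5: "covers 3852 grid5 4502" by (simp add: grid5_def)
definition grid6 :: "gentry list" where "grid6 = [(2251, 992, 1742, 1258, 103, [(251, 265), (329, 331), (347, 361), (435, 443), (495, 499), (629, 665), (991, 997), (1261, 1321), (1741, 1991)]),
  (2301, 1010, 1777, 1290, 93, [(221, 225), (257, 271), (335, 339), (355, 369), (443, 453), (505, 509), (645, 679), (1009, 1019), (1291, 1351), (1781, 2037)]),
  (2347, 1027, 1809, 1319, 68, [(225, 229), (263, 277), (361, 377), (451, 461), (659, 691), (1027, 1037), (1321, 1381), (1809, 2069)]),
  (2380, 1038, 1831, 1341, 106, [(227, 233), (261, 263), (267, 279), (345, 349), (365, 381), (457, 467), (519, 525), (669, 701), (1037, 1051), (1341, 1401), (1837, 2101)]),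
  (2432, 1053, 1863, 1378, 63, [(231, 237), (275, 285), (351, 357), (371, 389), (465, 477), (689, 715), (1053, 1073), (1381, 1431), (1865, 2133)]),
  (2463, 1084, 1905, 1378, 100, [(237, 241), (275, 291), (381, 397), (475, 485), (689, 727), (1083, 1091), (1381, 1451), (1907, 2181)]),
  (2512, 1099, 1936, 1412, 94, [(275, 277), (281, 295), (365, 369), (387, 403), (483, 493), (705, 741), (1099, 1107), (1411, 1481), (1935, 2213)]),
  (2558, 1125, 1977, 1432, 122, [(247, 251), (281, 283), (285, 301), (395, 411), (493, 503), (561, 565), (715, 755), (1431, 1501), (1977, 2261)])]"
lemma grid_ok6: "list_all gok grid6" by (simp add: grid6_def gok_def Let_def bp_vals)
lemma grid_cover6: "covers 4502 grid6 5236" by (simp add: grid6_def)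
definition grid7 :: "gentry list" where "grid7 = [(2618, 1147, 2019, 1470, 101, [(251, 257), (293, 309), (381, 385), (403, 421), (503, 515), (573, 579), (735, 771), (1147, 1155), (1471, 1537), (2021, 2315)]),
  (2667, 1165, 2054, 1501, 91, [(255, 261), (299, 313), (387, 393), (409, 429), (513, 523), (581, 589), (749, 785), (1501, 1573), (2053, 2351)]),
  (2712, 1197, 2101, 1514, 117, [(261, 267), (301, 319), (399, 401), (419, 437), (597, 601), (757, 801), (1513, 1597), (2101, 2405)]),
  (2769, 1223, 2146, 1545, 140, [(267, 273), (305, 307), (309, 327), (407, 409), (429, 445), (535, 545), (611, 613), (771, 819), (1549, 1633), (2149, 2441)]),
  (2837, 1253, 2198, 1583, 129, [(273, 279), (315, 335), (417, 419), (439, 457), (549, 559), (791, 839), (1585, 1669), (2197, 2513)]),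
  (2900, 1278, 2244, 1621, 110, [(279, 285), (323, 341), (447, 467), (561, 571), (639, 641), (809, 857), (1621, 1705), (2245, 2553)]),
  (2954, 1296, 2280, 1657, 106, [(331, 347), (431, 435), (455, 475), (569, 581), (647, 653), (827, 871), (1657, 1741), (2279, 2613)]),
  (3006, 1312, 2314, 1693, 102, [(289, 295), (329, 331), (337, 353), (437, 443), (461, 483), (577, 591), (655, 663), (845, 885), (1311, 1321), (1693, 1767), (2315, 2653)])]"
lemma grid_ok7: "list_all gok grid7" by (simp add: grid7_def gok_def Let_def bp_vals)
lemma grid_cover7: "covers 5236 grid7 6112" by (simp add: grid7_def)
definition grid8 :: "gentry list" where "grid8 = [(3056, 1344, 2362, 1711, 129, [(341, 361), (447, 451), (471, 491), (589, 601), (671, 677), (855, 901), (1717, 1795), (2369, 2693)]),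
  (3119, 1367, 2406, 1751, 115, [(349, 367), (455, 459), (481, 501), (601, 613), (875, 919), (1371, 1381), (1753, 1837), (2405, 2753)]),
  (3175, 1392, 2450, 1782, 108, [(305, 311), (355, 373), (463, 467), (489, 511), (611, 623), (695, 703), (891, 937), (1391, 1401), (1781, 1865), (2459, 2797)]),
  (3228, 1423, 2499, 1804, 151, [(311, 317), (359, 381), (499, 519), (623, 635), (901, 953), (1809, 1907), (2513, 2863)]),
  (3302, 1452, 2552, 1849, 147, [(369, 389), (483, 487), (509, 531), (637, 649), (725, 731), (923, 975), (1451, 1461), (1851, 1949), (2553, 2907)]),
  (3374, 1482, 2606, 1891, 146, [(377, 397), (521, 543), (651, 663), (741, 747), (945, 995), (1481, 1491), (1893, 1991), (2613, 2973)]),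
  (3445, 1512, 2660, 1932, 130, [(385, 405), (531, 553), (665, 677), (755, 763), (965, 1017), (1513, 1525), (1935, 2021), (2673, 3041)]),
  (3509, 1535, 2704, 1973, 129, [(393, 413), (539, 563), (675, 689), (767, 775), (985, 1035), (1537, 1549), (1977, 2069), (2713, 3089)])]"
lemma grid_ok8: "list_all gok grid8" by (simp add: grid8_def gok_def Let_def bp_vals)
lemma grid_cover8: "covers 6112 grid8 7144" by (simp add: grid8_def)
definition grid9 :: "gentry list" where "grid9 = [(3572, 1562, 2752, 2009, 113, [(343, 351), (401, 421), (519, 525), (549, 573), (687, 701), (781, 789), (1003, 1053), (1561, 1573), (2021, 2101), (2753, 3161)]),
  (3627, 1588, 2797, 2038, 114, [(407, 427), (559, 583), (699, 713), (793, 801), (1019, 1069), (2037, 2133), (2797, 3209)]),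
  (3683, 1614, 2841, 2068, 122, [(413, 433), (567, 593), (709, 723), (807, 815), (1033, 1087), (2069, 2165), (2841, 3257)]),
  (3743, 1633, 2880, 2109, 82, [(421, 441), (575, 601), (719, 735), (815, 827), (1053, 1099), (1633, 1645), (2117, 2197), (2885, 3309)]),
  (3783, 1653, 2914, 2129, 104, [(425, 445), (581, 607), (727, 743), (825, 837), (1063, 1115), (1657, 1669), (2133, 2229), (2929, 3335)]),
  (3834, 1673, 2951, 2160, 104, [(431, 451), (589, 615), (737, 753), (1079, 1123), (1681, 1693), (2165, 2261), (2951, 3387)]),
  (3885, 1699, 2994, 2185, 142, [(437, 457), (565, 573), (597, 625), (747, 763), (849, 859), (1091, 1139), (1705, 1717), (2197, 2279), (2995, 3439)]),
  (3954, 1712, 3030, 2241, 105, [(377, 387), (447, 465), (569, 581), (605, 633), (757, 775), (855, 871), (1123, 1163), (1717, 1741), (2245, 2315), (3041, 3491)])]"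
lemma grid_ok9: "list_all gok grid9" by (simp add: grid9_def gok_def Let_def bp_vals)
lemma grid_cover9: "covers 7144 grid9 8010" by (simp add: grid9_def)
definition grid10 :: "gentry list" where "grid10 = [(4005, 1752, 3087, 2252, 124, [(449, 471), (617, 643), (771, 787), (875, 885), (1131, 1179), (1753, 1767), (2261, 2351), (3089, 3545)]),
  (4066, 1795, 3150, 2270, 184, [(453, 481), (597, 601), (629, 655), (1139, 1195), (2279, 2405), (3161, 3601)]),
  (4156, 1822, 3207, 2333, 158, [(399, 409), (465, 489), (641, 669), (801, 817), (1171, 1227), (1823, 1837), (2333, 2441), (3209, 3657)]),
  (4233, 1866, 3277, 2366, 201, [(473, 499), (655, 681), (819, 833), (1187, 1251), (2369, 2495), (3283, 3741)]),
  (4331, 1892, 3335, 2438, 134, [(415, 425), (487, 511), (667, 695), (945, 957), (1219, 1271), (1893, 1907), (2441, 2553), (3335, 3829)]),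
  (4396, 1921, 3386, 2474, 158, [(493, 517), (639, 647), (677, 707), (845, 863), (959, 971), (1243, 1291), (1921, 1935), (2477, 2593), (3387, 3889)]),
  (4473, 1970, 3461, 2502, 201, [(431, 439), (499, 527), (655, 661), (691, 721), (865, 881), (1251, 1321), (2513, 2633), (3465, 3949)]),
  (4571, 1992, 3515, 2578, 181, [(439, 449), (515, 539), (703, 735), (877, 897), (995, 1009), (1291, 1341), (1991, 2021), (2593, 2693), (3517, 4041)])]"
lemma grid_ok10: "list_all gok grid10" by (simp add: grid10_def gok_def Let_def bp_vals)
lemma grid_cover10: "covers 8010 grid10 9318" by (simp add: grid10_def)
definition grid11 :: "gentry list" where "grid11 = [(4659, 2038, 3591, 2620, 150, [(447, 457), (523, 549), (717, 749), (897, 915), (1019, 1031), (1311, 1371), (2037, 2053), (2633, 2733), (3601, 4105)]),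
  (4732, 2077, 3654, 2654, 167, [(455, 465), (529, 559), (729, 761), (913, 931), (1331, 1391), (2653, 2775), (3657, 4169)]),
  (4813, 2108, 3712, 2704, 146, [(539, 567), (741, 773), (927, 947), (1053, 1065), (1351, 1411), (2713, 2841), (3713, 4233)]),
  (4884, 2114, 3742, 2769, 137, [(553, 575), (747, 783), (935, 957), (1057, 1077), (1391, 1431), (2117, 2149), (2775, 2863), (3741, 4299)]),
  (4951, 2178, 3828, 2772, 201, [(477, 487), (553, 585), (765, 797), (957, 975), (1089, 1097), (1391, 1461), (2775, 2907), (3829, 4367)]),
  (5049, 2216, 3899, 2832, 187, [(565, 595), (737, 745), (779, 813), (973, 993), (1421, 1491), (2841, 2973), (3919, 4469)]),
  (5140, 2256, 3969, 2883, 169, [(495, 505), (575, 607), (793, 827), (991, 1011), (1441, 1513), (2885, 3017), (3979, 4539)]),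
  (5222, 2279, 4019, 2942, 180, [(501, 513), (587, 615), (759, 769), (803, 839), (1003, 1025), (1139, 1155), (1471, 1537), (2279, 2297), (2951, 3065), (4041, 4611)])]"
lemma grid_ok11: "list_all gok grid11" by (simp add: grid11_def gok_def Let_def bp_vals)
lemma grid_cover11: "covers 9318 grid11 10620" by (simp add: grid11_def)
definition grid12 :: "gentry list" where "grid12 = [(5310, 2333, 4103, 2976, 183, [(595, 627), (819, 855), (1025, 1045), (1491, 1561), (2333, 2351), (2995, 3137), (4105, 4683)]),
  (5399, 2359, 4158, 3039, 149, [(519, 529), (607, 637), (831, 867), (1039, 1061), (1179, 1187), (1525, 1585), (2369, 2387), (3041, 3185), (4169, 4755)]),
  (5472, 2407, 4231, 3064, 153, [(611, 645), (845, 881), (1057, 1077), (1537, 1609), (3065, 3233), (4233, 4831)]),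
  (5547, 2424, 4273, 3122, 152, [(623, 653), (807, 817), (853, 891), (1067, 1091), (1211, 1227), (1561, 1633), (2423, 2441), (3137, 3257), (4299, 4907)]),
  (5621, 2459, 4332, 3161, 194, [(631, 663), (819, 829), (865, 903), (1083, 1099), (1585, 1657), (2459, 2477), (3161, 3309), (4333, 4945)]),
  (5716, 2506, 4411, 3209, 192, [(641, 675), (881, 919), (1107, 1123), (1609, 1681), (3209, 3361), (4435, 5061)]),
  (5810, 2544, 4480, 3265, 180, [(559, 571), (639, 643), (653, 685), (847, 857), (895, 935), (1271, 1281), (1633, 1705), (3283, 3413), (4503, 5141)]),
  (5898, 2565, 4531, 3332, 162, [(565, 579), (665, 695), (855, 869), (905, 947), (1131, 1155), (1281, 1301), (1669, 1729), (2573, 2593), (3335, 3465), (4539, 5181)])]"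
lemma grid_ok12: "list_all gok grid12" by (simp add: grid12_def gok_def Let_def bp_vals)
lemma grid_cover12: "covers 10620 grid12 11954" by (simp add: grid12_def)
definition grid13 :: "gentry list" where "grid13 = [(5977, 2614, 4606, 3362, 195, [(575, 587), (657, 661), (671, 705), (871, 881), (921, 961), (1155, 1171), (1311, 1321), (1681, 1753), (2613, 2633), (3361, 3517), (4611, 5261)]),
  (6072, 2653, 4677, 3418, 149, [(583, 597), (683, 715), (935, 977), (1171, 1187), (1717, 1781), (2653, 2673), (3439, 3573), (4683, 5345)]),
  (6145, 2670, 4718, 3474, 179, [(589, 603), (693, 723), (943, 987), (1179, 1203), (1741, 1809), (2673, 2713), (3491, 3601), (4719, 5429)]),
  (6232, 2729, 4806, 3502, 197, [(599, 613), (699, 735), (909, 919), (961, 1003), (1203, 1219), (1753, 1837), (2733, 2753), (3517, 3657), (4831, 5513)]),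
  (6328, 2787, 4896, 3540, 261, [(611, 623), (707, 747), (979, 1019), (1227, 1243), (1781, 1865), (3545, 3741), (4907, 5601)]),
  (6455, 2833, 4984, 3621, 211, [(723, 761), (943, 953), (995, 1039), (1809, 1893), (3629, 3799), (4983, 5689)]),
  (6558, 2875, 5061, 3682, 218, [(631, 645), (735, 773), (1011, 1055), (1271, 1281), (1441, 1451), (1851, 1935), (3685, 3859), (5061, 5777)]),
  (6664, 2905, 5126, 3758, 233, [(639, 653), (751, 785), (967, 981), (1025, 1071), (1281, 1301), (1451, 1471), (1879, 1963), (2907, 2929), (3769, 3919), (5141, 5869)])]"
lemma grid_ok13: "list_all gok grid13" by (simp add: grid13_def gok_def Let_def bp_vals)
lemma grid_cover13: "covers 11954 grid13 13556" by (simp add: grid13_def)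
definition grid14 :: "gentry list" where "grid14 = [(6778, 2951, 5210, 3826, 209, [(651, 665), (765, 799), (983, 997), (1041, 1089), (1301, 1331), (1481, 1491), (1921, 1991), (2951, 2995), (3829, 3979), (5221, 5961)]),
  (6880, 3010, 5303, 3869, 192, [(773, 811), (1003, 1015), (1059, 1107), (1935, 2021), (3017, 3041), (3889, 4041), (5303, 6055)]),
  (6974, 3061, 5385, 3912, 288, [(673, 685), (781, 823), (1077, 1123), (1351, 1371), (1963, 2053), (3065, 3089), (3919, 4105), (5387, 6151)]),
  (7114, 3133, 5504, 3980, 221, [(795, 841), (1043, 1051), (1099, 1147), (1991, 2101), (3979, 4201), (5513, 6295)]),
  (7222, 3181, 5588, 4040, 323, [(697, 711), (807, 853), (1059, 1067), (1123, 1163), (2021, 2133), (4041, 4265), (5601, 6395)]),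
  (7379, 3184, 5643, 4194, 216, [(705, 723), (805, 813), (837, 867), (1061, 1085), (1131, 1179), (1411, 1441), (1597, 1621), (2101, 2165), (3185, 3233), (4201, 4333), (5645, 6495)]),
  (7484, 3281, 5775, 4202, 243, [(839, 883), (1155, 1203), (1451, 1471), (2101, 2197), (3283, 3309), (4201, 4401), (5777, 6597)]),
  (7602, 3284, 5818, 4317, 183, [(727, 745), (863, 893), (1093, 1115), (1163, 1219), (1461, 1491), (1645, 1669), (2165, 2229), (3283, 3335), (4333, 4469), (5823, 6701)])]"
lemma grid_ok14: "list_all gok grid14" by (simp add: grid14_def gok_def Let_def bp_vals)
lemma grid_cover14: "covers 13556 grid14 15382" by (simp add: grid14_def)
definition grid15 :: "gentry list" where "grid15 = [(7691, 3364, 5927, 4326, 189, [(865, 907), (1187, 1235), (1481, 1513), (2165, 2261), (4333, 4539), (5961, 6807)]),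
  (7783, 3408, 6002, 4374, 223, [(749, 765), (873, 917), (1203, 1251), (1501, 1525), (2197, 2297), (4401, 4575), (6007, 6861)]),
  (7892, 3456, 6086, 4435, 265, [(759, 775), (887, 931), (1219, 1261), (1525, 1549), (1729, 1741), (2229, 2315), (3465, 3491), (4435, 4647), (6103, 6969)]),
  (8021, 3517, 6190, 4503, 307, [(899, 947), (1243, 1291), (1549, 1573), (2261, 2351), (3517, 3545), (4503, 4719), (6199, 7079)]),
  (8170, 3562, 6285, 4607, 215, [(921, 963), (1261, 1311), (1573, 1597), (1781, 1795), (2315, 2405), (3573, 3601), (4611, 4793), (6295, 7191)]),
  (8275, 3628, 6386, 4646, 275, [(929, 977), (1281, 1331), (1597, 1621), (2333, 2441), (3629, 3657), (4647, 4869), (6395, 7303)]),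
  (8409, 3657, 6460, 4751, 195, [(807, 825), (949, 991), (1219, 1235), (1291, 1351), (2387, 2477), (3657, 3713), (4755, 4945), (6495, 7419)]),
  (8504, 3711, 6545, 4792, 205, [(817, 835), (957, 1003), (1311, 1361), (1645, 1669), (1865, 1879), (2405, 2495), (3713, 3741), (4793, 4983), (6545, 7477)])]"
lemma grid_ok15: "list_all gok grid15" by (simp add: grid15_def gok_def Let_def bp_vals)
lemma grid_cover15: "covers 15382 grid15 17208" by (simp add: grid15_def)
definition grid16 :: "gentry list" where "grid16 = [(8604, 3764, 6632, 4839, 238, [(967, 1015), (1331, 1381), (1657, 1681), (2423, 2533), (3769, 3799), (4869, 5061), (6649, 7595)]),
  (8720, 3823, 6729, 4896, 286, [(979, 1029), (1351, 1401), (1681, 1705), (2459, 2573), (3829, 3859), (4907, 5141), (6753, 7715)]),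
  (8859, 3880, 6833, 4978, 269, [(853, 871), (995, 1045), (1371, 1421), (1717, 1741), (2495, 2613), (3889, 3919), (4983, 5221), (6861, 7837)]),
  (8990, 3937, 6933, 5052, 240, [(865, 883), (1009, 1061), (1391, 1441), (1741, 1767), (2533, 2653), (5061, 5303), (6969, 7961)]),
  (9107, 3979, 7014, 5127, 226, [(875, 895), (1025, 1073), (1401, 1461), (1991, 2005), (2573, 2673), (3979, 4009), (5141, 5345), (7023, 8023)]),
  (9217, 4041, 7113, 5175, 302, [(1035, 1087), (1421, 1481), (1781, 1809), (2593, 2713), (4041, 4073), (5181, 5429), (7135, 8151)]),
  (9364, 4106, 7227, 5257, 340, [(903, 921), (1051, 1099), (1451, 1501), (1809, 1837), (2633, 2753), (4105, 4137), (5261, 5513), (7247, 8279)]),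
  (9529, 4168, 7344, 5360, 263, [(917, 937), (1071, 1123), (1471, 1525), (2085, 2101), (2693, 2797), (5387, 5601), (7361, 8411)])]"
lemma grid_ok16: "list_all gok grid16" by (simp add: grid16_def gok_def Let_def bp_vals)
lemma grid_cover16: "covers 17208 grid16 19314" by (simp add: grid16_def)
definition grid17 :: "gentry list" where "grid17 = [(9657, 4234, 7453, 5422, 394, [(931, 949), (1083, 1139), (1491, 1549), (1865, 1893), (2713, 2841), (4233, 4265), (5429, 5689), (7477, 8543)]),
  (9849, 4230, 7513, 5618, 169, [(939, 963), (1123, 1155), (1411, 1441), (1501, 1573), (1879, 1921), (2117, 2165), (2819, 2885), (4233, 4333), (5645, 5777), (7535, 8679)]),
  (9931, 4334, 7644, 5596, 252, [(1123, 1171), (1537, 1597), (1921, 1949), (2797, 2929), (4333, 4367), (5601, 5823), (7655, 8747)]),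
  (10054, 4393, 7744, 5660, 268, [(967, 987), (1131, 1179), (1549, 1609), (1935, 1977), (2197, 2213), (2841, 2951), (4401, 4435), (5689, 5915), (7775, 8885)]),
  (10184, 4435, 7829, 5748, 280, [(977, 999), (1155, 1195), (1481, 1501), (1573, 1633), (1963, 1991), (2229, 2245), (2885, 2995), (4435, 4503), (5777, 5961), (7837, 8955)]),
  (10320, 4504, 7944, 5815, 290, [(993, 1013), (1163, 1211), (1597, 1657), (1991, 2021), (2261, 2279), (2907, 3041), (4503, 4539), (5823, 6055), (7961, 9097)]),
  (10461, 4560, 8047, 5900, 301, [(1005, 1027), (1179, 1227), (1609, 1681), (2021, 2053), (2279, 2297), (2951, 3065), (4575, 4611), (5915, 6151), (8087, 9241)]),
  (10607, 4645, 8180, 5961, 352, [(1021, 1043), (1195, 1251), (1645, 1705), (2053, 2085), (2995, 3113), (4647, 4683), (5961, 6247), (8215, 9387)])]"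
lemma grid_ok17: "list_all gok grid17" by (simp add: grid17_def gok_def Let_def bp_vals)
lemma grid_cover17: "covers 19314 grid17 21556" by (simp add: grid17_def)
definition grid18 :: "gentry list" where "grid18 = [(10778, 4731, 8323, 6046, 367, [(1039, 1061), (1211, 1271), (1669, 1729), (2085, 2117), (2369, 2387), (3041, 3161), (6055, 6345), (8345, 9535)]),
  (10956, 4809, 8461, 6146, 401, [(1057, 1077), (1235, 1291), (1693, 1753), (2117, 2149), (2405, 2423), (3089, 3233), (6151, 6445), (8477, 9687)]),
  (11151, 4884, 8601, 6266, 344, [(1075, 1097), (1261, 1311), (1729, 1795), (2149, 2181), (3137, 3283), (6295, 6545), (8611, 9841)]),
  (11318, 4945, 8717, 6372, 323, [(1089, 1107), (1281, 1331), (1657, 1669), (1753, 1809), (2181, 2213), (3185, 3335), (4945, 4983), (6395, 6649), (8747, 9997)]),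
  (11475, 5014, 8839, 6460, 307, [(1107, 1123), (1291, 1351), (1767, 1837), (2213, 2245), (3233, 3361), (5021, 5061), (6495, 6753), (8885, 10155)]),
  (11624, 5079, 8953, 6544, 295, [(1311, 1371), (1795, 1865), (2245, 2279), (3283, 3413), (5101, 5141), (6545, 6807), (8955, 10235)]),
  (11768, 5148, 9070, 6619, 361, [(1331, 1381), (1823, 1893), (2279, 2315), (2573, 2593), (3309, 3465), (6649, 6915), (9097, 10397)]),
  (11944, 5189, 9170, 6754, 338, [(1147, 1171), (1351, 1401), (1729, 1753), (1837, 1907), (2297, 2333), (2593, 2633), (3387, 3517), (5221, 5261), (6753, 7023), (9169, 10479)])]"
lemma grid_ok18: "list_all gok grid18" by (simp add: grid18_def gok_def Let_def bp_vals)
lemma grid_cover18: "covers 21556 grid18 24216" by (simp add: grid18_def)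
definition grid19 :: "gentry list" where "grid19 = [(12108, 5297, 9333, 6810, 295, [(1361, 1421), (1865, 1949), (2333, 2369), (2653, 2673), (3413, 3573), (5303, 5345), (6861, 7135), (9387, 10645)]),
  (12252, 5341, 9425, 6910, 330, [(1179, 1203), (1381, 1441), (1781, 1795), (1893, 1963), (2369, 2405), (2673, 2693), (3465, 3601), (5345, 5387), (6915, 7191), (9461, 10813)]),
  (12413, 5430, 9567, 6982, 341, [(1401, 1461), (1921, 1991), (2405, 2441), (3491, 3657), (5429, 5471), (7023, 7303), (9611, 10985)]),
  (12579, 5490, 9683, 7088, 316, [(1211, 1235), (1421, 1481), (1935, 2021), (2423, 2459), (3545, 3685), (5513, 5557), (7135, 7419), (9687, 11071)]),
  (12733, 5551, 9795, 7181, 304, [(1227, 1251), (1441, 1501), (1963, 2037), (2459, 2495), (2775, 2797), (3601, 3741), (5557, 5601), (7191, 7477), (9841, 11247)]),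
  (12881, 5635, 9928, 7245, 352, [(1451, 1513), (1991, 2069), (2495, 2533), (3629, 3799), (5645, 5689), (7247, 7595), (9997, 11335)]),
  (13052, 5690, 10040, 7361, 292, [(1471, 1537), (2021, 2085), (2513, 2553), (3685, 3829), (5689, 5733), (7361, 7655), (10075, 11515)]),
  (13194, 5778, 10176, 7415, 370, [(1271, 1291), (1491, 1549), (2037, 2117), (2553, 2593), (3713, 3889), (5777, 5823), (7419, 7775), (10235, 11607)])]"
lemma grid_ok19: "list_all gok grid19" by (simp add: grid19_def gok_def Let_def bp_vals)
lemma grid_cover19: "covers 24216 grid19 26748" by (simp add: grid19_def)
definition grid20 :: "gentry list" where "grid20 = [(13374, 5837, 10295, 7536, 297, [(1291, 1311), (1513, 1573), (2069, 2149), (2573, 2613), (3769, 3919), (5869, 5915), (7535, 7837), (10315, 11791)]),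
  (13519, 5887, 10393, 7631, 296, [(1301, 1321), (1525, 1585), (2085, 2165), (2613, 2653), (2951, 2973), (3829, 3979), (5915, 5961), (7655, 7961), (10397, 11885)]),
  (13663, 5957, 10511, 7705, 298, [(1549, 1609), (1991, 2005), (2101, 2197), (2633, 2673), (3859, 4009), (5961, 6007), (7715, 8023), (10561, 12073)]),
  (13808, 6034, 10636, 7773, 385, [(1561, 1621), (2133, 2213), (2673, 2713), (3017, 3041), (3889, 4073), (6055, 6103), (7775, 8087), (10645, 12169)]),
  (13995, 6101, 10766, 7893, 300, [(1585, 1645), (2165, 2245), (2693, 2733), (3065, 3089), (3949, 4105), (6103, 6151), (7899, 8215), (10813, 12363)]),
  (14141, 6186, 10899, 7954, 410, [(1597, 1669), (2181, 2261), (2733, 2775), (3979, 4169), (6199, 6247), (7961, 8345), (10899, 12461)]),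
  (14340, 6288, 11068, 8051, 487, [(1609, 1693), (2213, 2297), (2775, 2819), (4041, 4233), (6295, 6345), (8087, 8411), (11071, 12659)]),
  (14577, 6370, 11229, 8206, 437, [(1645, 1717), (2245, 2333), (2819, 2863), (3185, 3209), (4105, 4299), (6395, 6445), (8215, 8543), (11247, 12861)])]"
lemma grid_ok20: "list_all gok grid20" by (simp add: grid20_def gok_def Let_def bp_vals)
lemma grid_cover20: "covers 26748 grid20 29578" by (simp add: grid20_def)
definition grid21 :: "gentry list" where "grid21 = [(14789, 6462, 11391, 8326, 371, [(1431, 1451), (1669, 1741), (2279, 2369), (2863, 2907), (4169, 4333), (8345, 8679), (11425, 13065)]),
  (14969, 6526, 11515, 8442, 434, [(1441, 1471), (1693, 1753), (2315, 2405), (2885, 2929), (4233, 4401), (6545, 6597), (8477, 8815), (11515, 13169)]),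
  (15180, 6648, 11708, 8531, 511, [(1471, 1491), (1705, 1781), (2351, 2441), (2929, 2973), (4265, 4469), (6649, 6701), (8543, 8955), (11791, 13379)]),
  (15428, 6742, 11884, 8685, 412, [(1741, 1809), (2387, 2477), (3387, 3413), (4367, 4539), (6753, 6807), (8747, 9097), (11885, 13591)]),
  (15628, 6837, 12046, 8790, 480, [(1767, 1837), (2279, 2297), (2423, 2513), (3017, 3065), (4401, 4611), (6861, 6915), (8815, 9169), (12073, 13807)]),
  (15861, 6955, 12242, 8905, 528, [(1537, 1561), (1781, 1865), (2459, 2553), (3065, 3113), (4469, 4683), (6969, 7023), (8955, 9313), (12265, 14027)]),
  (16118, 7051, 12423, 9066, 455, [(1561, 1585), (1823, 1893), (2495, 2593), (4539, 4755), (7079, 7135), (9097, 9461), (12461, 14251)]),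
  (16339, 7107, 12553, 9231, 323, [(1851, 1921), (2369, 2405), (2513, 2613), (3137, 3209), (4647, 4793), (7135, 7191), (9241, 9611), (12559, 14365)])]"
lemma grid_ok21: "list_all gok grid21" by (simp add: grid21_def gok_def Let_def bp_vals)
lemma grid_cover21: "covers 29578 grid21 32992" by (simp add: grid21_def)
definition grid22 :: "gentry list" where "grid22 = [(16496, 7200, 12698, 9295, 427, [(1597, 1621), (1865, 1935), (2553, 2653), (3185, 3233), (3601, 3629), (4647, 4831), (9313, 9687), (12759, 14593)]),
  (16704, 7266, 12834, 9437, 393, [(1609, 1633), (1893, 1963), (2423, 2459), (2573, 2673), (3209, 3257), (3657, 3685), (4719, 4907), (7303, 7361), (9461, 9841), (12861, 14709)]),
  (16895, 7391, 13022, 9503, 467, [(1907, 1991), (2613, 2713), (3257, 3309), (4755, 4983), (7419, 7477), (9535, 9919), (13065, 14943)]),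
  (17122, 7456, 13163, 9665, 426, [(1935, 2005), (2633, 2753), (3309, 3361), (4831, 5021), (7477, 7535), (9687, 10075), (13169, 15061)]),
  (17329, 7590, 13366, 9738, 559, [(1949, 2037), (2533, 2553), (2673, 2775), (4869, 5101), (7595, 7655), (9763, 10155), (13379, 15301)]),
  (17601, 7709, 13576, 9891, 551, [(1977, 2069), (2733, 2819), (3859, 3889), (4945, 5181), (7715, 7775), (9919, 10315), (13591, 15545)]),
  (17869, 7835, 13791, 10033, 610, [(2005, 2101), (2775, 2863), (3465, 3517), (3919, 3949), (5021, 5261), (7837, 7899), (10075, 10479), (13807, 15793)]),
  (18165, 7938, 13993, 10226, 503, [(2053, 2133), (2797, 2907), (3517, 3573), (3979, 4009), (5141, 5345), (7961, 8023), (10235, 10645), (14027, 16045)])]"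
lemma grid_ok22: "list_all gok grid22" by (simp add: grid22_def gok_def Let_def bp_vals)
lemma grid_cover22: "covers 32992 grid22 36818" by (simp add: grid22_def)
definition grid23 :: "gentry list" where "grid23 = [(18409, 8063, 14199, 10345, 512, [(2069, 2165), (2841, 2951), (4041, 4073), (5181, 5429), (8087, 8151), (10397, 10813), (14251, 16301)]),
  (18658, 8144, 14363, 10513, 517, [(2101, 2197), (2885, 2995), (3601, 3657), (4073, 4105), (5261, 5471), (8151, 8215), (10561, 10985), (14365, 16431)]),
  (18909, 8272, 14575, 10636, 606, [(2133, 2229), (2929, 3041), (3657, 3713), (5345, 5557), (8279, 8345), (10645, 11159), (14593, 16693)]),
  (19203, 8410, 14811, 10792, 615, [(1851, 1879), (2165, 2261), (2973, 3089), (3713, 3769), (5429, 5645), (8411, 8477), (10813, 11335), (14825, 16959)]),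
  (19502, 8532, 15032, 10969, 561, [(2197, 2297), (3017, 3137), (3769, 3829), (4265, 4299), (5513, 5733), (8543, 8611), (10985, 11425), (15061, 17229)]),
  (19775, 8661, 15252, 11113, 621, [(2229, 2333), (3065, 3161), (3829, 3889), (4333, 4367), (5557, 5823), (8679, 8747), (11159, 11607), (15301, 17503)]),
  (20077, 8803, 15495, 11273, 550, [(2261, 2369), (3113, 3233), (3889, 3949), (5645, 5915), (8815, 8885), (11335, 11791), (15545, 17783)]),
  (20344, 8880, 15661, 11463, 479, [(2297, 2387), (3137, 3257), (3919, 3979), (5733, 5961), (8885, 8955), (11515, 11979), (15669, 17925)])]"
lemma grid_ok23: "list_all gok grid23" by (simp add: grid23_def gok_def Let_def bp_vals)
lemma grid_cover23: "covers 36818 grid23 41154" by (simp add: grid23_def)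
definition grid24 :: "gentry list" where "grid24 = [(20577, 9023, 15882, 11553, 659, [(1991, 2021), (2315, 2423), (3185, 3309), (3979, 4041), (5777, 6055), (9025, 9097), (11607, 12073), (15919, 18211)]),
  (20897, 9163, 16128, 11733, 703, [(2351, 2459), (3233, 3361), (4041, 4105), (5869, 6151), (9169, 9241), (11791, 12265), (16173, 18501)]),
  (21238, 9291, 16370, 11946, 634, [(2405, 2495), (3283, 3413), (4105, 4169), (4647, 4683), (6007, 6247), (9313, 9387), (11979, 12461), (16431, 18797)]),
  (21546, 9372, 16554, 12173, 512, [(2069, 2101), (2441, 2533), (3309, 3439), (4137, 4233), (4719, 4755), (6103, 6345), (9387, 9461), (12265, 12659), (16561, 18947)]),
  (21795, 9535, 16800, 12259, 652, [(2459, 2553), (3361, 3491), (4201, 4265), (6151, 6395), (9535, 9611), (12265, 12861), (16825, 19249)]),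
  (22112, 9674, 17044, 12437, 609, [(2495, 2593), (3413, 3545), (4265, 4333), (6247, 6495), (9687, 9763), (12461, 12963), (17093, 19555)]),
  (22408, 9758, 17227, 12649, 543, [(2533, 2633), (3465, 3601), (4333, 4401), (4907, 4945), (6345, 6597), (9763, 9841), (12659, 13169), (17229, 19711)]),
  (22672, 9919, 17476, 12752, 493, [(2553, 2673), (3309, 3335), (3517, 3629), (6395, 6649), (9919, 9997), (12759, 13379), (17503, 20025)])]"
lemma grid_ok24: "list_all gok grid24" by (simp add: grid24_def gok_def Let_def bp_vals)
lemma grid_cover24: "covers 41154 grid24 45824" by (simp add: grid24_def)
definition grid25 :: "gentry list" where "grid25 = [(22912, 9989, 17626, 12922, 556, [(2593, 2693), (3545, 3685), (4435, 4503), (6495, 6753), (9997, 10075), (12963, 13485), (17643, 20185)]),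
  (23182, 10118, 17845, 13063, 685, [(2229, 2279), (2613, 2733), (3573, 3713), (4469, 4539), (5061, 5101), (6545, 6807), (10155, 10235), (13065, 13591), (17925, 20507)]),
  (23515, 10264, 18102, 13250, 573, [(2261, 2297), (2653, 2753), (3629, 3769), (4539, 4611), (5141, 5181), (6649, 6915), (10315, 10397), (13273, 13807), (18211, 20671)]),
  (23793, 10421, 18352, 13371, 680, [(2673, 2797), (3685, 3829), (5221, 5261), (6701, 7023), (13379, 14027), (18355, 21001)]),
  (24123, 10541, 18582, 13581, 560, [(2733, 2841), (3741, 3859), (4647, 4719), (6807, 7079), (10561, 10645), (13591, 14139), (18649, 21337)]),
  (24395, 10636, 18767, 13758, 528, [(2753, 2863), (3769, 3919), (4719, 4793), (6915, 7191), (10645, 10729), (13807, 14365), (18797, 21507)]),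
  (24652, 10772, 18989, 13879, 656, [(2387, 2423), (2775, 2907), (3799, 3949), (4755, 4831), (5387, 5429), (6969, 7247), (10813, 10899), (13917, 14479), (19097, 21679)]),
  (24971, 10899, 19222, 14071, 609, [(2819, 2929), (3859, 4009), (5471, 5513), (7079, 7361), (10899, 10985), (14139, 14709), (19249, 22025)])]"
lemma grid_ok25: "list_all gok grid25" by (simp add: grid25_def gok_def Let_def bp_vals)
lemma grid_cover25: "covers 45824 grid25 50534" by (simp add: grid25_def)
definition grid26 :: "gentry list" where "grid26 = [(25267, 10965, 19387, 14301, 660, [(2423, 2477), (2863, 2973), (3657, 3713), (3889, 4041), (4869, 4945), (7191, 7419), (10985, 11159), (14365, 14825), (19401, 22201)]),
  (25588, 11143, 19672, 14444, 659, [(2907, 3017), (3713, 3769), (3949, 4105), (4945, 5021), (7247, 7535), (11159, 11247), (14479, 15061), (19711, 22555)]),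
  (25908, 11373, 20009, 14534, 784, [(2907, 3041), (4009, 4169), (5021, 5101), (7303, 7595), (14593, 15301), (20025, 22915)]),
  (26289, 11514, 20277, 14774, 680, [(2973, 3089), (4073, 4233), (7419, 7715), (11515, 11607), (14825, 15423), (20345, 23281)]),
  (26619, 11579, 20452, 15039, 777, [(3017, 3137), (3859, 3919), (4105, 4265), (5141, 5221), (5823, 5869), (7535, 7837), (11607, 11699), (15061, 15669), (20507, 23467)]),
  (26996, 11837, 20835, 15158, 970, [(3041, 3185), (4169, 4333), (5221, 5303), (7595, 7961), (15181, 15919), (20835, 23841)]),
  (27467, 11975, 21130, 15491, 821, [(2653, 2693), (3113, 3233), (4233, 4401), (5303, 5387), (6007, 6055), (7775, 8087), (11979, 12073), (15545, 16173), (21169, 24223)]),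
  (27866, 12205, 21493, 15660, 950, [(2693, 2733), (3137, 3283), (4299, 4469), (5387, 5471), (6103, 6151), (7837, 8215), (15669, 16431), (21507, 24609)])]"
lemma grid_ok26: "list_all gok grid26" by (simp add: grid26_def gok_def Let_def bp_vals)
lemma grid_cover26: "covers 50534 grid26 56654" by (simp add: grid26_def)
definition grid27 :: "gentry list" where "grid27 = [(28327, 12364, 21806, 15962, 774, [(3209, 3335), (4367, 4539), (5471, 5557), (6199, 6247), (8023, 8345), (12363, 12461), (16045, 16693), (21851, 25003)]),
  (28703, 12557, 22124, 16145, 840, [(2775, 2819), (3233, 3387), (4435, 4611), (5557, 5645), (6295, 6345), (8087, 8411), (12559, 12659), (16173, 16825), (22201, 25403)]),
  (29111, 12692, 22395, 16418, 604, [(3283, 3413), (4503, 4647), (5601, 5689), (6345, 6395), (8215, 8543), (12759, 12861), (16431, 17093), (22555, 25605)]),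
  (29404, 12893, 22694, 16510, 812, [(3309, 3465), (4539, 4719), (5689, 5777), (6445, 6495), (8279, 8679), (16561, 17365), (22735, 26015)]),
  (29798, 12977, 22909, 16820, 693, [(3387, 3491), (4611, 4755), (5733, 5823), (8411, 8747), (13065, 13169), (16825, 17503), (22915, 26223)]),
  (30135, 13199, 23244, 16935, 978, [(3387, 3545), (4647, 4831), (5823, 5915), (8477, 8885), (16959, 17783), (23281, 26641)]),
  (30610, 13422, 23625, 17187, 1008, [(3439, 3601), (4755, 4907), (5915, 6007), (8611, 9025), (17229, 18067), (23653, 27067)]),
  (31099, 13605, 23971, 17493, 943, [(2995, 3041), (3517, 3657), (4793, 4983), (6007, 6103), (8747, 9169), (17503, 18355), (24031, 27501)])]"
lemma grid_ok27: "list_all gok grid27" by (simp add: grid27_def gok_def Let_def bp_vals)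
lemma grid_cover27: "covers 56654 grid27 63114" by (simp add: grid27_def)
definition grid28 :: "gentry list" where "grid28 = [(31557, 13695, 24214, 17861, 701, [(3573, 3713), (4575, 4647), (4869, 5061), (6055, 6151), (6861, 6969), (8955, 9241), (13699, 13917), (17925, 18501), (24223, 27721)]),
  (31897, 13907, 24539, 17989, 849, [(3601, 3741), (4907, 5101), (6151, 6247), (6969, 7023), (9025, 9387), (13917, 14027), (18067, 18797), (24609, 28163)]),
  (32309, 14151, 24920, 18157, 727, [(3657, 3799), (4983, 5181), (6247, 6345), (9097, 9535), (18211, 18947), (25003, 28613)]),
  (32662, 14240, 25127, 18421, 767, [(3161, 3209), (3685, 3829), (5061, 5221), (6295, 6395), (9241, 9611), (14251, 14365), (18501, 19249), (25203, 28841)]),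
  (33034, 14353, 25364, 18680, 677, [(3741, 3889), (5101, 5303), (6345, 6445), (7191, 7247), (9387, 9687), (14365, 14593), (18797, 19401), (25403, 29071)]),
  (33363, 14596, 25717, 18766, 916, [(3769, 3919), (5181, 5345), (6445, 6545), (7303, 7361), (9387, 9841), (18797, 19555), (25809, 29537)]),
  (33808, 14723, 25992, 19084, 842, [(3829, 3979), (4907, 4983), (5221, 5429), (6545, 6597), (9611, 9919), (14825, 14943), (19097, 19867), (26015, 29773)]),
  (34217, 15004, 26409, 19212, 1142, [(3309, 3361), (3859, 4041), (5303, 5471), (6649, 6701), (9611, 10075), (19249, 20185), (26431, 30251)])]"
lemma grid_ok28: "list_all gok grid28" by (simp add: grid28_def gok_def Let_def bp_vals)
lemma grid_cover28: "covers 63114 grid28 69542" by (simp add: grid28_def)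
definition grid29 :: "gentry list" where "grid29 = [(34771, 15177, 26767, 19593, 879, [(3919, 4073), (5387, 5557), (6701, 6807), (9841, 10235), (15181, 15301), (19711, 20507), (26853, 30735)]),
  (35198, 15275, 27007, 19922, 742, [(4009, 4137), (5101, 5181), (5429, 5645), (6753, 6861), (7655, 7775), (9997, 10315), (15301, 15545), (20025, 20671), (27067, 30979)]),
  (35558, 15538, 27390, 20019, 954, [(4009, 4169), (5513, 5689), (6861, 6969), (10075, 10479), (15545, 15669), (20025, 20835), (27501, 31473)]),
  (36021, 15705, 27712, 20315, 924, [(4073, 4233), (5557, 5777), (6969, 7079), (7899, 7961), (10235, 10561), (15793, 15919), (20345, 21169), (27721, 31723)]),
  (36470, 15937, 28093, 20532, 964, [(3517, 3573), (4105, 4299), (5645, 5869), (7023, 7135), (10315, 10729), (20671, 21507), (28163, 32229)]),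
  (36938, 16031, 28343, 20906, 868, [(4201, 4333), (5345, 5429), (5689, 5915), (7135, 7247), (8023, 8151), (10479, 10813), (16045, 16301), (21001, 21679), (28387, 32485)]),
  (37359, 16288, 28741, 21070, 907, [(4233, 4401), (5777, 6007), (7191, 7303), (10561, 10985), (16301, 16431), (21169, 22025), (28841, 33003)]),
  (37799, 16404, 29003, 21394, 837, [(4299, 4435), (5471, 5557), (5823, 6055), (7303, 7419), (8215, 8345), (10729, 11071), (16431, 16693), (21507, 22201), (29071, 33267)])]"
lemma grid_ok29: "list_all gok grid29" by (simp add: grid29_def gok_def Let_def bp_vals)
lemma grid_cover29: "covers 69542 grid29 76410" by (simp add: grid29_def)
definition grid30 :: "gentry list" where "grid30 = [(38205, 16733, 29468, 21471, 814, [(4299, 4503), (5915, 6151), (10813, 11247), (21507, 22555), (29537, 33801)]),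
  (38601, 16926, 29793, 21674, 1277, [(4333, 4539), (5645, 5689), (5961, 6199), (7477, 7595), (10899, 11335), (16959, 17093), (21679, 22735), (30011, 34071)]),
  (39221, 17198, 30271, 22022, 1272, [(4435, 4611), (6055, 6295), (7595, 7715), (8611, 8679), (11071, 11515), (17229, 17365), (22025, 23097), (30493, 34617)]),
  (39838, 17429, 30708, 22408, 1160, [(4503, 4683), (5823, 5869), (6151, 6395), (7715, 7837), (11247, 11699), (22555, 23467), (30735, 35171)]),
  (40401, 17675, 31142, 22725, 1075, [(4575, 4755), (6247, 6495), (11425, 11885), (22735, 23841), (31225, 35733)]),
  (40923, 17903, 31544, 23019, 1057, [(4611, 4831), (6345, 6545), (7899, 8023), (8955, 9025), (11515, 12073), (17925, 18067), (23097, 24031), (31723, 36017)]),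
  (41436, 18128, 31940, 23307, 1100, [(4683, 4869), (6395, 6649), (8023, 8151), (11699, 12169), (23467, 24415), (31975, 36595)]),
  (41970, 18340, 32330, 23629, 1047, [(4755, 4945), (6495, 6753), (8087, 8215), (9169, 9241), (11885, 12363), (18355, 18501), (23653, 24609), (32485, 36887)])]"
lemma grid_ok30: "list_all gok grid30" by (simp add: grid30_def gok_def Let_def bp_vals)
lemma grid_cover30: "covers 76410 grid30 84956" by (simp add: grid30_def)
definition grid31 :: "gentry list" where "grid31 = [(42478, 18562, 32721, 23915, 1153, [(4793, 4983), (6545, 6807), (8215, 8345), (11979, 12461), (18649, 18797), (24031, 25003), (32743, 37477)]),
  (43038, 18829, 33175, 24208, 1144, [(4869, 5061), (6649, 6915), (12169, 12659), (24223, 25403), (33267, 38077)]),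
  (43594, 18985, 33516, 24608, 1017, [(4201, 4265), (4945, 5101), (6753, 6969), (8411, 8543), (12363, 12759), (19097, 19249), (24609, 25605), (33533, 38381)]),
  (44088, 19288, 33984, 24799, 1153, [(4983, 5181), (6807, 7079), (12461, 12963), (24805, 26015), (34071, 38995)]),
  (44649, 19444, 34327, 25204, 1018, [(5061, 5261), (6915, 7135), (8611, 8747), (9763, 9841), (12659, 13065), (19555, 19711), (25203, 26223), (34343, 39305)]),
  (45144, 19750, 34798, 25393, 968, [(5101, 5303), (6969, 7247), (12759, 13273), (25403, 26641), (34893, 39935)]),
  (45616, 19934, 35139, 25681, 1172, [(5141, 5345), (7079, 7303), (8815, 8955), (12861, 13379), (20025, 20185), (25809, 26853), (35171, 40253)]),
  (46185, 20021, 35416, 26163, 755, [(5261, 5429), (7135, 7361), (8885, 9025), (10075, 10155), (13169, 13591), (20025, 20345), (26223, 27067), (35451, 40575)])]"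
lemma grid_ok31: "list_all gok grid31" by (simp add: grid31_def gok_def Let_def bp_vals)
lemma grid_cover31: "covers 84956 grid31 93104" by (simp add: grid31_def)
definition grid32 :: "gentry list" where "grid32 = [(46552, 20133, 35650, 26418, 775, [(5303, 5471), (7135, 7419), (8955, 9097), (10075, 10235), (13273, 13699), (20185, 20507), (26431, 27283), (35733, 40899)]),
  (46929, 20320, 35963, 26608, 852, [(5345, 5513), (7191, 7535), (9025, 9169), (10235, 10315), (13379, 13807), (20345, 20671), (26641, 27501), (36017, 41225)]),
  (47343, 20736, 36517, 26606, 1471, [(5345, 5557), (7303, 7595), (9169, 9313), (13379, 13917), (26641, 27941), (36595, 41885)])]"
lemma grid_ok32: "list_all gok grid32" by (simp add: grid32_def gok_def Let_def bp_vals)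
lemma grid_cover32: "covers 93104 grid32 96000" by (simp add: grid32_def)

lemma dist_nint_gt_mid:
  assumes "1600 \<le> k" "k < 96000"
  shows "dist_nint ((4/3) ^ k) > (4/9) ^ k"
proof -
  have c0: ?thesis if "k < 1864" by (rule covers_sound[OF grid_ok0 grid_cover0 assms(1) that])
  have c1: ?thesis if "k < 2258"
    using c0 covers_sound[OF grid_ok1 grid_cover1 _ that] by (cases "k < 1864") auto
  have c2: ?thesis if "k < 2762"
    using c1 covers_sound[OF grid_ok2 grid_cover2 _ that] by (cases "k < 2258") auto
  have c3: ?thesis if "k < 3246"
    using c2 covers_sound[OF grid_ok3 grid_cover3 _ that] by (cases "k < 2762") auto
  have c4: ?thesis if "k < 3852"
    using c3 covers_sound[OF grid_ok4 grid_cover4 _ that] by (cases "k < 3246") auto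
  have c5: ?thesis if "k < 4502"
    using c4 covers_sound[OF grid_ok5 grid_cover5 _ that] by (cases "k < 3852") auto
  have c6: ?thesis if "k < 5236"
    using c5 covers_sound[OF grid_ok6 grid_cover6 _ that] by (cases "k < 4502") auto
  have c7: ?thesis if "k < 6112"
    using c6 covers_sound[OF grid_ok7 grid_cover7 _ that] by (cases "k < 5236") auto
  have c8: ?thesis if "k < 7144"
    using c7 covers_sound[OF grid_ok8 grid_cover8 _ that] by (cases "k < 6112") auto
  have c9: ?thesis if "k < 8010"
    using c8 covers_sound[OF grid_ok9 grid_cover9 _ that] by (cases "k < 7144") auto
  have c10: ?thesis if "k < 9318"
    using c9 covers_sound[OF grid_ok10 grid_cover10 _ that] by (cases "k < 8010") auto
  have c11: ?thesis if "k < 10620"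
    using c10 covers_sound[OF grid_ok11 grid_cover11 _ that] by (cases "k < 9318") auto
  have c12: ?thesis if "k < 11954"
    using c11 covers_sound[OF grid_ok12 grid_cover12 _ that] by (cases "k < 10620") auto
  have c13: ?thesis if "k < 13556"
    using c12 covers_sound[OF grid_ok13 grid_cover13 _ that] by (cases "k < 11954") auto
  have c14: ?thesis if "k < 15382"
    using c13 covers_sound[OF grid_ok14 grid_cover14 _ that] by (cases "k < 13556") auto
  have c15: ?thesis if "k < 17208"
    using c14 covers_sound[OF grid_ok15 grid_cover15 _ that] by (cases "k < 15382") auto
  have c16: ?thesis if "k < 19314"
    using c15 covers_sound[OF grid_ok16 grid_cover16 _ that] by (cases "k < 17208") auto
  have c17: ?thesis if "k < 21556"
    using c16 covers_sound[OF grid_ok17 grid_cover17 _ that] by (cases "k < 19314") auto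
  have c18: ?thesis if "k < 24216"
    using c17 covers_sound[OF grid_ok18 grid_cover18 _ that] by (cases "k < 21556") auto
  have c19: ?thesis if "k < 26748"
    using c18 covers_sound[OF grid_ok19 grid_cover19 _ that] by (cases "k < 24216") auto
  have c20: ?thesis if "k < 29578"
    using c19 covers_sound[OF grid_ok20 grid_cover20 _ that] by (cases "k < 26748") auto
  have c21: ?thesis if "k < 32992"
    using c20 covers_sound[OF grid_ok21 grid_cover21 _ that] by (cases "k < 29578") auto
  have c22: ?thesis if "k < 36818"
    using c21 covers_sound[OF grid_ok22 grid_cover22 _ that] by (cases "k < 32992") auto
  have c23: ?thesis if "k < 41154"
    using c22 covers_sound[OF grid_ok23 grid_cover23 _ that] by (cases "k < 36818") auto
  have c24: ?thesis if "k < 45824"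
    using c23 covers_sound[OF grid_ok24 grid_cover24 _ that] by (cases "k < 41154") auto
  have c25: ?thesis if "k < 50534"
    using c24 covers_sound[OF grid_ok25 grid_cover25 _ that] by (cases "k < 45824") auto
  have c26: ?thesis if "k < 56654"
    using c25 covers_sound[OF grid_ok26 grid_cover26 _ that] by (cases "k < 50534") auto
  have c27: ?thesis if "k < 63114"
    using c26 covers_sound[OF grid_ok27 grid_cover27 _ that] by (cases "k < 56654") auto
  have c28: ?thesis if "k < 69542"
    using c27 covers_sound[OF grid_ok28 grid_cover28 _ that] by (cases "k < 63114") auto
  have c29: ?thesis if "k < 76410"
    using c28 covers_sound[OF grid_ok29 grid_cover29 _ that] by (cases "k < 69542") auto
  have c30: ?thesis if "k < 84956"
    using c29 covers_sound[OF grid_ok30 grid_cover30 _ that] by (cases "k < 76410") auto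
  have c31: ?thesis if "k < 93104"
    using c30 covers_sound[OF grid_ok31 grid_cover31 _ that] by (cases "k < 84956") auto
  have c32: ?thesis if "k < 96000"
    using c31 covers_sound[OF grid_ok32 grid_cover32 _ that] by (cases "k < 93104") auto
  show ?thesis by (rule c32[OF assms(2)])
qed

section \<open>Certified logarithms of small integers\<close>

text \<open>In units of \<open>10 ^ (-10)\<close>, \<open>k\<close> is a guaranteed error bound for
  the approximation \<open>l\<close>. Composite arguments are obtained from their factors by
  \<open>near_mult\<close>, further primes from their predecessor by \<open>near_step\<close>; the
  errors simply add up and stay below \<open>10 ^ 4\<close>.\<close>

definition near :: "int \<Rightarrow> int \<Rightarrow> int \<Rightarrow> bool" where
  "near j l k \<longleftrightarrow> j > 0 \<and> of_int (l - k) \<le> 10 ^ 10 * ln (real_of_int j) \<and> 10 ^ 10 * ln (real_of_int j) \<le> of_int (l + k)"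

lemma near_of_bounds:
  assumes "j > 0" "of_int (l - k) \<le> 10 ^ 10 * ln (real_of_int j)" "10 ^ 10 * ln (real_of_int j) \<le> of_int (l + k)"
  shows "near j l k"
  using assms by (simp add: near_def)

lemma near_mult:
  assumes "near a l k" "near b l' k'"
  shows "near (a * b) (l + l') (k + k')"
proof -
  have "ln (real_of_int (a * b)) = ln (real_of_int a) + ln (real_of_int b)"
    using assms by (simp add: near_def ln_mult_pos)
  thus ?thesis using assms unfolding near_def by (simp add: distrib_left)
qed

lemma near_step:
  fixes x y z :: real
  assumes "near a l k" "ln x \<in> {y..z}" "0 < j" "of_int j / of_int a = x"
    "of_int (l' - k' - (l - k)) \<le> 10 ^ 10 * y" "10 ^ 10 * z \<le> of_int (l' + k' - (l + k))"
  shows "near j l' k'"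
proof -
  have lin: "b1 \<le> 10 ^ 10 * lj \<and> 10 ^ 10 * lj \<le> b2"
    if "a1 \<le> 10 ^ 10 * la" "10 ^ 10 * la \<le> a2" "y \<le> lx" "lx \<le> z" "lx = lj - la" "b1 - a1 \<le> 10 ^ 10 * y" "10 ^ 10 * z \<le> b2 - a2"
    for a1 a2 b1 b2 la lj lx :: real using that by simp
  have "ln x = ln (real_of_int j) - ln (real_of_int a)"
    using assms(1,3,4) by (auto simp: near_def ln_divide_pos)
  moreover have "of_int (l' - k') - of_int (l - k) \<le> 10 ^ 10 * y" "10 ^ 10 * z \<le> of_int (l' + k') - of_int (l + k)"
    using assms(5,6) by (simp_all only: of_int_diff)
  moreover have "y \<le> ln x" "ln x \<le> z" using assms(2) by auto
  moreover have "of_int (l - k) \<le> 10 ^ 10 * ln (real_of_int a)" "10 ^ 10 * ln (real_of_int a) \<le> of_int (l + k)"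
    using assms(1) by (auto simp only: near_def)
  ultimately show ?thesis using assms(3) lin[of "of_int (l - k)" "ln (real_of_int a)" "of_int (l + k)" "ln x" "ln (real_of_int j)" "of_int (l' - k')" "of_int (l' + k')"]
    by (simp only: near_def)
qed

definition ln_ok :: "int \<Rightarrow> int \<Rightarrow> bool" where
  "ln_ok j l \<longleftrightarrow> j > 0 \<and> \<bar>ln (real_of_int j) - of_int l / 10 ^ 10\<bar> \<le> 1 / 10 ^ 6"

lemma ln_ok_1: "ln_ok 1 0"
  by (simp add: ln_ok_def)

lemma near_ok:
  assumes "near j l k" "k \<le> 10 ^ 4"
  shows "ln_ok j l"
proof -
  have "real_of_int k \<le> of_int (10 ^ 4)" using assms(2) by (simp only: of_int_le_iff)
  hence "of_int l / 10 ^ 10 - 1 / 10 ^ 6 \<le> ln (real_of_int j)" "ln (real_of_int j) \<le> of_int l / 10 ^ 10 + 1 / 10 ^ 6"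
    using assms(1) unfolding near_def by simp_all
  thus ?thesis using assms(1) unfolding ln_ok_def near_def abs_le_iff by simp
qed

lemma near_2: "near 2 6931471805 100" by (rule near_of_bounds) (use ln_2_bounds' ln_3_bounds ln_5_bounds in simp_all)
lemma near_3: "near 3 10986122886 260" by (rule near_of_bounds) (use ln_2_bounds' ln_3_bounds ln_5_bounds in simp_all)
lemma near_4: "near 4 13862943610 200" using near_mult[OF near_2 near_2] by simp
lemma near_5: "near 5 16094379124 300" by (rule near_of_bounds) (use ln_2_bounds' ln_3_bounds ln_5_bounds in simp_all)
lemma near_6: "near 6 17917594691 360" using near_mult[OF near_2 near_3] by simp
lemma near_7: "near 7 19459101489 362" by (rule near_step[OF near_6 ln_approx_bounds[of "7/6" 5]]) (simp_all add: eval_nat_numeral)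
lemma near_8: "near 8 20794415415 300" using near_mult[OF near_2 near_4] by simp
lemma near_9: "near 9 21972245772 520" using near_mult[OF near_3 near_3] by simp
lemma near_10: "near 10 23025850929 400" using near_mult[OF near_2 near_5] by simp
lemma near_11: "near 11 23978952727 402" by (rule near_step[OF near_10 ln_approx_bounds[of "11/10" 5]]) (simp_all add: eval_nat_numeral)
lemma near_12: "near 12 24849066496 460" using near_mult[OF near_2 near_6] by simp
lemma near_13: "near 13 25649493572 462" by (rule near_step[OF near_12 ln_approx_bounds[of "13/12" 4]]) (simp_all add: eval_nat_numeral)
lemma near_14: "near 14 26390573294 462" using near_mult[OF near_2 near_7] by simp
lemma near_15: "near 15 27080502010 560" using near_mult[OF near_3 near_5] by simp
lemma near_16: "near 16 27725887220 400" using near_mult[OF near_2 near_8] by simp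
lemma near_17: "near 17 28332133438 402" by (rule near_step[OF near_16 ln_approx_bounds[of "17/16" 4]]) (simp_all add: eval_nat_numeral)
lemma near_18: "near 18 28903717577 620" using near_mult[OF near_2 near_9] by simp
lemma near_19: "near 19 29444389789 622" by (rule near_step[OF near_18 ln_approx_bounds[of "19/18" 4]]) (simp_all add: eval_nat_numeral)
lemma near_20: "near 20 29957322734 500" using near_mult[OF near_2 near_10] by simp
lemma near_21: "near 21 30445224375 622" using near_mult[OF near_3 near_7] by simp
lemma near_22: "near 22 30910424532 502" using near_mult[OF near_2 near_11] by simp
lemma near_23: "near 23 31354942157 504" by (rule near_step[OF near_22 ln_approx_bounds[of "23/22" 4]]) (simp_all add: eval_nat_numeral)
lemma near_24: "near 24 31780538301 560" using near_mult[OF near_2 near_12] by simp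
lemma near_25: "near 25 32188758248 600" using near_mult[OF near_5 near_5] by simp
lemma near_26: "near 26 32580965377 562" using near_mult[OF near_2 near_13] by simp
lemma near_27: "near 27 32958368658 780" using near_mult[OF near_3 near_9] by simp
lemma near_28: "near 28 33322045099 562" using near_mult[OF near_2 near_14] by simp
lemma near_29: "near 29 33672958297 564" by (rule near_step[OF near_28 ln_approx_bounds[of "29/28" 4]]) (simp_all add: eval_nat_numeral)
lemma near_30: "near 30 34011973815 660" using near_mult[OF near_2 near_15] by simp
lemma near_31: "near 31 34339872043 662" by (rule near_step[OF near_30 ln_approx_bounds[of "31/30" 4]]) (simp_all add: eval_nat_numeral)
lemma near_32: "near 32 34657359025 500" using near_mult[OF near_2 near_16] by simp
lemma near_33: "near 33 34965075613 662" using near_mult[OF near_3 near_11] by simp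
lemma near_34: "near 34 35263605243 502" using near_mult[OF near_2 near_17] by simp
lemma near_35: "near 35 35553480613 662" using near_mult[OF near_5 near_7] by simp
lemma near_36: "near 36 35835189382 720" using near_mult[OF near_2 near_18] by simp
lemma near_37: "near 37 36109179123 722" by (rule near_step[OF near_36 ln_approx_bounds[of "37/36" 4]]) (simp_all add: eval_nat_numeral)
lemma near_38: "near 38 36375861594 722" using near_mult[OF near_2 near_19] by simp
lemma near_39: "near 39 36635616458 722" using near_mult[OF near_3 near_13] by simp
lemma near_40: "near 40 36888794539 600" using near_mult[OF near_2 near_20] by simp
lemma near_41: "near 41 37135720664 602" by (rule near_step[OF near_40 ln_approx_bounds[of "41/40" 4]]) (simp_all add: eval_nat_numeral)
lemma near_42: "near 42 37376696180 722" using near_mult[OF near_2 near_21] by simp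
lemma near_43: "near 43 37612001154 724" by (rule near_step[OF near_42 ln_approx_bounds[of "43/42" 3]]) (simp_all add: eval_nat_numeral)
lemma near_44: "near 44 37841896337 602" using near_mult[OF near_2 near_22] by simp
lemma near_45: "near 45 38066624896 820" using near_mult[OF near_3 near_15] by simp
lemma near_46: "near 46 38286413962 604" using near_mult[OF near_2 near_23] by simp
lemma near_47: "near 47 38501476014 606" by (rule near_step[OF near_46 ln_approx_bounds[of "47/46" 3]]) (simp_all add: eval_nat_numeral)
lemma near_48: "near 48 38712010106 660" using near_mult[OF near_2 near_24] by simp
lemma near_49: "near 49 38918202978 724" using near_mult[OF near_7 near_7] by simp
lemma near_50: "near 50 39120230053 700" using near_mult[OF near_2 near_25] by simp
lemma near_51: "near 51 39318256324 662" using near_mult[OF near_3 near_17] by simp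
lemma near_52: "near 52 39512437182 662" using near_mult[OF near_2 near_26] by simp
lemma near_53: "near 53 39702919131 664" by (rule near_step[OF near_52 ln_approx_bounds[of "53/52" 3]]) (simp_all add: eval_nat_numeral)
lemma near_54: "near 54 39889840463 880" using near_mult[OF near_2 near_27] by simp
lemma near_55: "near 55 40073331851 702" using near_mult[OF near_5 near_11] by simp
lemma near_56: "near 56 40253516904 662" using near_mult[OF near_2 near_28] by simp
lemma near_57: "near 57 40430512675 882" using near_mult[OF near_3 near_19] by simp
lemma near_58: "near 58 40604430102 664" using near_mult[OF near_2 near_29] by simp
lemma near_59: "near 59 40775374435 666" by (rule near_step[OF near_58 ln_approx_bounds[of "59/58" 3]]) (simp_all add: eval_nat_numeral)
lemma near_60: "near 60 40943445620 760" using near_mult[OF near_2 near_30] by simp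
lemma near_61: "near 61 41108738639 762" by (rule near_step[OF near_60 ln_approx_bounds[of "61/60" 3]]) (simp_all add: eval_nat_numeral)
lemma near_62: "near 62 41271343848 762" using near_mult[OF near_2 near_31] by simp
lemma near_63: "near 63 41431347261 882" using near_mult[OF near_3 near_21] by simp
lemma near_64: "near 64 41588830830 600" using near_mult[OF near_2 near_32] by simp
lemma near_65: "near 65 41743872696 762" using near_mult[OF near_5 near_13] by simp
lemma near_66: "near 66 41896547418 762" using near_mult[OF near_2 near_33] by simp
lemma near_67: "near 67 42046926191 764" by (rule near_step[OF near_66 ln_approx_bounds[of "67/66" 3]]) (simp_all add: eval_nat_numeral)
lemma near_69: "near 69 42341065043 764" using near_mult[OF near_3 near_23] by simp
lemma near_70: "near 70 42484952418 762" using near_mult[OF near_2 near_35] by simp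
lemma near_71: "near 71 42626798767 764" by (rule near_step[OF near_70 ln_approx_bounds[of "71/70" 3]]) (simp_all add: eval_nat_numeral)
lemma near_74: "near 74 43040650928 822" using near_mult[OF near_2 near_37] by simp
lemma near_75: "near 75 43174881134 860" using near_mult[OF near_3 near_25] by simp
lemma near_76: "near 76 43307333399 822" using near_mult[OF near_2 near_38] by simp
lemma near_77: "near 77 43438054216 764" using near_mult[OF near_7 near_11] by simp
lemma near_78: "near 78 43567088263 822" using near_mult[OF near_2 near_39] by simp
lemma near_79: "near 79 43694478520 824" by (rule near_step[OF near_78 ln_approx_bounds[of "79/78" 3]]) (simp_all add: eval_nat_numeral)
lemma near_80: "near 80 43820266344 700" using near_mult[OF near_2 near_40] by simp
lemma near_81: "near 81 43944491544 1040" using near_mult[OF near_3 near_27] by simp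
lemma near_82: "near 82 44067192469 702" using near_mult[OF near_2 near_41] by simp
lemma near_83: "near 83 44188406074 704" by (rule near_step[OF near_82 ln_approx_bounds[of "83/82" 3]]) (simp_all add: eval_nat_numeral)
lemma near_86: "near 86 44543472959 824" using near_mult[OF near_2 near_43] by simp
lemma near_87: "near 87 44659081183 824" using near_mult[OF near_3 near_29] by simp
lemma near_88: "near 88 44773368142 702" using near_mult[OF near_2 near_44] by simp
lemma near_89: "near 89 44886363694 704" by (rule near_step[OF near_88 ln_approx_bounds[of "89/88" 3]]) (simp_all add: eval_nat_numeral)
lemma near_90: "near 90 44998096701 920" using near_mult[OF near_2 near_45] by simp
lemma near_91: "near 91 45108595061 824" using near_mult[OF near_7 near_13] by simp
lemma near_92: "near 92 45217885767 704" using near_mult[OF near_2 near_46] by simp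
lemma near_93: "near 93 45325994929 922" using near_mult[OF near_3 near_31] by simp
lemma near_95: "near 95 45538768913 922" using near_mult[OF near_5 near_19] by simp
lemma near_96: "near 96 45643481911 760" using near_mult[OF near_2 near_48] by simp
lemma near_98: "near 98 45849674783 824" using near_mult[OF near_2 near_49] by simp
lemma near_99: "near 99 45951198499 922" using near_mult[OF near_3 near_33] by simp
lemma near_100: "near 100 46051701858 800" using near_mult[OF near_2 near_50] by simp
lemma near_101: "near 101 46151205166 802" by (rule near_step[OF near_100 ln_approx_bounds[of "101/100" 3]]) (simp_all add: eval_nat_numeral)
lemma near_102: "near 102 46249728129 762" using near_mult[OF near_2 near_51] by simp
lemma near_106: "near 106 46634390936 764" using near_mult[OF near_2 near_53] by simp
lemma near_107: "near 107 46728288339 766" by (rule near_step[OF near_106 ln_approx_bounds[of "107/106" 3]]) (simp_all add: eval_nat_numeral)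
lemma near_108: "near 108 46821312268 980" using near_mult[OF near_2 near_54] by simp
lemma near_109: "near 109 46913478819 982" by (rule near_step[OF near_108 ln_approx_bounds[of "109/108" 3]]) (simp_all add: eval_nat_numeral)
lemma near_111: "near 111 47095302009 982" using near_mult[OF near_3 near_37] by simp
lemma near_112: "near 112 47184988709 762" using near_mult[OF near_2 near_56] by simp
lemma near_113: "near 113 47273878183 764" by (rule near_step[OF near_112 ln_approx_bounds[of "113/112" 3]]) (simp_all add: eval_nat_numeral)
lemma near_114: "near 114 47361984480 982" using near_mult[OF near_2 near_57] by simp
lemma near_115: "near 115 47449321281 804" using near_mult[OF near_5 near_23] by simp
lemma near_116: "near 116 47535901907 764" using near_mult[OF near_2 near_58] by simp
lemma near_118: "near 118 47706846240 766" using near_mult[OF near_2 near_59] by simp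
lemma near_119: "near 119 47791234927 764" using near_mult[OF near_7 near_17] by simp
lemma near_121: "near 121 47957905454 804" using near_mult[OF near_11 near_11] by simp
lemma near_124: "near 124 48202815653 862" using near_mult[OF near_2 near_62] by simp
lemma near_126: "near 126 48362819066 982" using near_mult[OF near_2 near_63] by simp
lemma near_129: "near 129 48598124040 984" using near_mult[OF near_3 near_43] by simp
lemma near_132: "near 132 48828019223 862" using near_mult[OF near_2 near_66] by simp
lemma near_134: "near 134 48978397996 864" using near_mult[OF near_2 near_67] by simp
lemma near_145: "near 145 49767337421 864" using near_mult[OF near_5 near_29] by simp
lemma near_148: "near 148 49972122733 922" using near_mult[OF near_2 near_74] by simp
lemma near_149: "near 149 50039463054 924" by (rule near_step[OF near_148 ln_approx_bounds[of "149/148" 3]]) (simp_all add: eval_nat_numeral)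
lemma near_150: "near 150 50106352939 960" using near_mult[OF near_2 near_75] by simp
lemma near_151: "near 151 50172798366 962" by (rule near_step[OF near_150 ln_approx_bounds[of "151/150" 3]]) (simp_all add: eval_nat_numeral)
lemma near_158: "near 158 50625950325 924" using near_mult[OF near_2 near_79] by simp
lemma near_162: "near 162 50875963349 1140" using near_mult[OF near_2 near_81] by simp
lemma near_163: "near 163 50937502004 1142" by (rule near_step[OF near_162 ln_approx_bounds[of "163/162" 3]]) (simp_all add: eval_nat_numeral)
lemma near_164: "near 164 50998664274 802" using near_mult[OF near_2 near_82] by simp
lemma near_166: "near 166 51119877879 804" using near_mult[OF near_2 near_83] by simp
lemma near_167: "near 167 51179938119 806" by (rule near_step[OF near_166 ln_approx_bounds[of "167/166" 3]]) (simp_all add: eval_nat_numeral)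
lemma near_169: "near 169 51298987144 924" using near_mult[OF near_13 near_13] by simp
lemma near_178: "near 178 51817835499 804" using near_mult[OF near_2 near_89] by simp
lemma near_182: "near 182 52040066866 924" using near_mult[OF near_2 near_91] by simp
lemma near_192: "near 192 52574953716 860" using near_mult[OF near_2 near_96] by simp
lemma near_193: "near 193 52626901884 862" by (rule near_step[OF near_192 ln_approx_bounds[of "193/192" 3]]) (simp_all add: eval_nat_numeral)
lemma near_196: "near 196 52781146588 924" using near_mult[OF near_2 near_98] by simp
lemma near_197: "near 197 52832037283 926" by (rule near_step[OF near_196 ln_approx_bounds[of "197/196" 3]]) (simp_all add: eval_nat_numeral)
lemmas ln_oks = ln_ok_1 near_2[THEN near_ok, simplified] near_3[THEN near_ok, simplified] near_4[THEN near_ok, simplified] near_5[THEN near_ok, simplified] near_6[THEN near_ok, simplified] near_7[THEN near_ok, simplified] near_8[THEN near_ok, simplified] near_9[THEN near_ok, simplified] near_10[THEN near_ok, simplified] near_11[THEN near_ok, simplified] near_12[THEN near_ok, simplified] near_13[THEN near_ok, simplified] near_14[THEN near_ok, simplified] near_15[THEN near_ok, simplified] near_16[THEN near_ok, simplified] near_17[THEN near_ok, simplified] near_18[THEN near_ok, simplified] near_19[THEN near_ok, simplified] near_20[THEN near_ok, simplified] near_21[THEN near_ok, simplified] near_22[THEN near_ok, simplified] near_23[THEN near_ok, simplified] near_24[THEN near_ok, simplified] near_25[THEN near_ok, simplified] near_26[THEN near_ok, simplified] near_27[THEN near_ok, simplified] near_28[THEN near_ok, simplified] near_29[THEN near_ok,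 simplified] near_30[THEN near_ok, simplified] near_31[THEN near_ok, simplified] near_32[THEN near_ok, simplified] near_33[THEN near_ok, simplified] near_34[THEN near_ok, simplified] near_35[THEN near_ok, simplified] near_36[THEN near_ok, simplified] near_37[THEN near_ok, simplified] near_38[THEN near_ok, simplified] near_39[THEN near_ok, simplified] near_40[THEN near_ok, simplified] near_41[THEN near_ok, simplified] near_42[THEN near_ok, simplified] near_43[THEN near_ok, simplified] near_44[THEN near_ok, simplified] near_45[THEN near_ok, simplified] near_46[THEN near_ok, simplified] near_47[THEN near_ok, simplified] near_48[THEN near_ok, simplified] near_49[THEN near_ok, simplified] near_50[THEN near_ok, simplified] near_51[THEN near_ok, simplified] near_52[THEN near_ok, simplified] near_53[THEN near_ok, simplified] near_54[THEN near_ok, simplified] near_55[THEN near_ok, simplified] near_56[THEN near_ok, simplified] near_57[THEN near_ok, simplified] near_58[THEN near_ok, simplified] near_59[THEN near_ok, simplified] near_60[THEN near_ok, simplified] near_61[THEN near_ok, simplified] near_62[THEN near_ok, simplified] near_63[THEN near_ok, simplified] near_64[THEN near_ok, simplified] near_65[THEN near_ok, simplified] near_66[THEN near_ok, simplified] near_67[THEN near_ok, simplified] near_69[THEN near_ok, simplified] near_70[THEN near_ok, simplified] near_71[THEN near_ok, simplified] near_74[THEN near_ok, simplified] near_75[THEN near_ok, simplified] near_76[THEN near_ok, simplified] near_77[THEN near_ok, simplified] near_78[THEN near_ok, simplified] near_79[THEN near_ok, simplified] near_80[THEN near_ok, simplified] near_81[THEN near_ok, simplified] near_82[THEN near_ok,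 simplified] near_83[THEN near_ok, simplified] near_86[THEN near_ok, simplified] near_87[THEN near_ok, simplified] near_88[THEN near_ok, simplified] near_89[THEN near_ok, simplified] near_90[THEN near_ok, simplified] near_91[THEN near_ok, simplified] near_92[THEN near_ok, simplified] near_93[THEN near_ok, simplified] near_95[THEN near_ok, simplified] near_96[THEN near_ok, simplified] near_98[THEN near_ok, simplified] near_99[THEN near_ok, simplified] near_100[THEN near_ok, simplified] near_101[THEN near_ok, simplified] near_102[THEN near_ok, simplified] near_106[THEN near_ok, simplified] near_107[THEN near_ok, simplified] near_108[THEN near_ok, simplified] near_109[THEN near_ok, simplified] near_111[THEN near_ok, simplified] near_112[THEN near_ok, simplified] near_113[THEN near_ok, simplified] near_114[THEN near_ok, simplified] near_115[THEN near_ok, simplified] near_116[THEN near_ok, simplified] near_118[THEN near_ok, simplified] near_119[THEN near_ok, simplified] near_121[THEN near_ok, simplified] near_124[THEN near_ok, simplified] near_126[THEN near_ok, simplified] near_129[THEN near_ok, simplified] near_132[THEN near_ok, simplified] near_134[THEN near_ok, simplified] near_145[THEN near_ok, simplified] near_148[THEN near_ok, simplified] near_149[THEN near_ok, simplified] near_150[THEN near_ok, simplified] near_151[THEN near_ok, simplified] near_158[THEN near_ok, simplified] near_162[THEN near_ok, simplified] near_163[THEN near_ok, simplified] near_164[THEN near_ok, simplified] near_166[THEN near_ok, simplified] near_167[THEN near_ok, simplified] near_169[THEN near_ok, simplified] near_178[THEN near_ok, simplified] near_182[THEN near_ok, simplified] near_192[THEN near_ok, simplified] near_193[THEN near_ok,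 simplified] near_196[THEN near_ok, simplified] near_197[THEN near_ok, simplified]

section \<open>The Chebyshev weights and their envelope\<close>

text \<open>Weights in hundredths for \<open>t div j\<close>, where \<open>t\<close> is
  \<open>z\<close> divided by \<open>10000\<close> here and by \<open>23054\<close>,
  \<open>31123\<close>, \<open>40817\<close> for \<open>wA\<close>, \<open>wN\<close>,
  \<open>wn\<close>. The weights are free choices: all that counts is how far the resulting step
  function exceeds the indicator it has to minorize, and how large its main term is. The companion
  lists with \<open>l\<close> hold logarithms of the keys in units of
  \<open>10 ^ (-10)\<close>.\<close>

definition wU :: "(int \<times> int) list" where "wU = [(2, 100), (3, 100), (6, -100), (10, -100), (11, 100), (14, -100), (20, 98), (21, -92), (22, -157), (23, 12), (26, -61), (29, 7), (30, 20), (31, 17), (33, -164), (37, 33), (38, -100), (40, 2), (41, 12), (42, 117), (43, 15), (44, 64), (48, -32), (51, -81), (52, 61), (53, 49), (55, -5), (56, 1), (57, -32), (58, -7), (59, 43), (60, -98), (61, 53), (62, -17), (63, -8), (65, 44), (66, 121), (67, 29), (69, -12), (70, 67), (71, -17), (74, -5), (76, 8), (77, 26), (79, 36), (80, 10), (81, -69), (82, -33), (86, -29), (87, -56), (88, -107), (89, 57), (90, -20), (92, -12), (93, -27), (95, 83), (96, 32), (98, 33), (99, 86), (100, -50), (101, 36), (102, 12), (106, -48), (107, -17), (109, -41), (111, 7), (112, 37), (113, -51), (114, 70), (115, 24), (116, 56), (118, -13), (119, 68), (121, -4), (124, -7), (126, 83), (129, -15), (132, 14), (134, -29), (145, 68),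 (149, 20), (151, 63), (158, -55), (162, -14), (163, 47), (164, 12), (166, -11), (167, 36), (169, 3), (178, -16), (182, 9), (192, -21), (193, -100), (197, -62)]"
definition wUl :: "int list" where "wUl = [6931471805, 10986122886, 17917594691, 23025850929, 23978952727, 26390573294, 29957322734, 30445224375, 30910424532, 31354942157, 32580965377, 33672958297, 34011973815, 34339872043, 34965075613, 36109179123, 36375861594, 36888794539, 37135720664, 37376696180, 37612001154, 37841896337, 38712010106, 39318256324, 39512437182, 39702919131, 40073331851, 40253516904, 40430512675, 40604430102, 40775374435, 40943445620, 41108738639, 41271343848, 41431347261, 41743872696, 41896547418, 42046926191, 42341065043, 42484952418, 42626798767, 43040650928, 43307333399, 43438054216, 43694478520, 43820266344, 43944491544, 44067192469, 44543472959, 44659081183, 44773368142, 44886363694, 44998096701, 45217885767, 45325994929, 45538768913, 45643481911, 45849674783, 45951198499, 46051701858, 46151205166, 46249728129, 46634390936, 46728288339, 46913478819, 47095302009, 47184988709, 47273878183, 47361984480, 47449321281, 47535901907, 47706846240, 47791234927, 47957905454, 48202815653, 48362819066, 48598124040, 48828019223, 48978397996, 49767337421, 50039463054, 50172798366, 50625950325, 50875963349, 50937502004, 50998664274, 51119877879, 51179938119, 51298987144, 51817835499, 52040066866, 52574953716, 52626901884, 52832037283]"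
definition wA :: "(int \<times> int) list" where "wA = [(1, -100), (2, 100), (3, 100), (4, -100), (6, -100), (9, -8), (10, -12), (11, 61), (13, 80), (14, -17), (16, 61), (18, 16), (20, 21), (21, -68), (22, -32), (24, 4), (26, -43), (27, -92), (28, 17), (29, 71), (30, -88), (31, -99), (34, 14), (36, 67), (39, -37), (40, -9), (41, 18), (42, 64), (44, 10), (46, -8), (47, -17), (52, 13), (55, 7), (57, -24), (58, -13), (64, -90), (74, 5), (81, 35), (82, -1)]"
definition wAl :: "int list" where "wAl = [0, 6931471805, 10986122886, 13862943610, 17917594691, 21972245772, 23025850929, 23978952727, 25649493572, 26390573294, 27725887220, 28903717577, 29957322734, 30445224375, 30910424532, 31780538301, 32580965377, 32958368658, 33322045099, 33672958297, 34011973815, 34339872043, 35263605243, 35835189382, 36635616458, 36888794539, 37135720664, 37376696180, 37841896337, 38286413962, 38501476014, 39512437182, 40073331851, 40430512675, 40604430102, 41588830830, 43040650928, 43944491544, 44067192469]"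
definition wN :: "(int \<times> int) list" where "wN = [(1, -100), (3, 100), (4, 100), (7, 57), (12, -95), (16, -48), (21, -57), (24, 23), (25, 25), (28, -49), (29, 100), (30, -90), (35, -16), (42, -19), (46, 32), (49, 24), (51, -28), (53, 9), (56, 40)]"
definition wNl :: "int list" where "wNl = [0, 10986122886, 13862943610, 19459101489, 24849066496, 27725887220, 30445224375, 31780538301, 32188758248, 33322045099, 33672958297, 34011973815, 35553480613, 37376696180, 38286413962, 38918202978, 39318256324, 39702919131, 40253516904]"
definition wn :: "(int \<times> int) list" where "wn = [(1, -100), (4, 100), (5, 2), (7, 93), (8, -36), (10, 53), (13, 51), (14, -60), (15, 45), (16, -8), (17, 100), (19, 13), (20, -65), (21, -39), (24, 2), (28, 3), (29, -26), (35, -64), (36, -8), (41, 35), (42, 10)]"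
definition wnl :: "int list" where "wnl = [0, 13862943610, 16094379124, 19459101489, 20794415415, 23025850929, 25649493572, 26390573294, 27080502010, 27725887220, 28332133438, 29444389789, 29957322734, 30445224375, 31780538301, 33322045099, 33672958297, 35553480613, 35835189382, 37135720664, 37376696180]"

definition lin_val :: "(int \<times> int) list \<Rightarrow> int \<Rightarrow> int" where
  "lin_val ws t = (\<Sum>(j, c)\<leftarrow>ws. c * (t div j))"

definition pos_keys :: "(int \<times> int) list \<Rightarrow> bool" where
  "pos_keys ws \<longleftrightarrow> (\<forall>(j, c)\<in>set ws. j > 0)"

lemma pos_keys_lists: "pos_keys wU" "pos_keys wA" "pos_keys wN" "pos_keys wn"
  by (simp_all add: pos_keys_def wU_def wA_def wN_def wn_def)

lemma lin_val_0 [simp]: "lin_val ws 0 = 0"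
  by (induction ws) (auto simp: lin_val_def)

lemma cval_mkc: "pos_keys ws \<Longrightarrow> cval (map (mkc n) ws) t = lin_val ws t"
  by (induction ws) (auto simp: pos_keys_def cval_def lin_val_def mkc_def numeral_num_of)

lemma cok_mkc:
  assumes "j > 0"
  shows "cok n (mkc n (j, c))"
proof -
  have m: "n mod j \<ge> 0" "n mod j < j" using assms by auto
  have "j dvd n - n mod j" by simp
  moreover have "n + (j - n mod j) = (n - n mod j) + j" by simp
  ultimately have "j dvd n + (j - n mod j)" by (metis dvd_add dvd_refl)
  thus ?thesis using m assms by (simp add: cok_def mkc_def numeral_num_of)
qed

definition fam_of :: "int \<times> int \<times> int \<times> (int \<times> int) list \<Rightarrow> fam" where
  "fam_of = (\<lambda>(T, \<theta>, dg, ws). Fm T \<theta> dg (map (mkc (T div \<theta> - 1)) ws))"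

definition total :: "int \<Rightarrow> int" where
  "total z = lin_val wU (z div 10000) + lin_val wA (z div 23054) + lin_val wN (z div 31123) + lin_val wn (z div 40817)"

text \<open>The separation of \<open>A\<close>, \<open>N\<close> and \<open>n\<close> in a form
  depending on \<open>z = y div d\<close> alone, with \<open>y = 10000 * (A + n + N)\<close>: the
  divisors are rational approximations from below to \<open>(A + n + N) / A\<close> and its
  analogues. The value \<open>2\<close> or more is what admits \<open>d\<close> to the common
  factor.\<close>

definition excess :: "int \<Rightarrow> int" where
  "excess z = z div 10000 - z div 23054 - z div 31123 - z div 40817"

definition within_env :: "int \<Rightarrow> int \<Rightarrow> bool" where
  "within_env E z \<longleftrightarrow> total z \<le> E \<or> (2 \<le> excess z \<and> total z \<le> E + 100)"

text \<open>Connects a sweep with the envelope statement. An entry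
  \<open>(T, \<theta>, dg, ws)\<close> lists the first event of a family in the stretch, so
  \<open>T div \<theta> - 1\<close> is its quotient just before, and \<open>F\<close> and
  \<open>G\<close> are the corresponding initial values.\<close>

lemma run_env:
  assumes rn: "rnn k z1 E (map fam_of sp) F G" and ne: "sp \<noteq> []" and srt: "sorted (map fst sp)"
    and ok: "\<forall>(T, \<theta>, dg, ws)\<in>set sp. \<theta> > 0 \<and> \<theta> dvd T \<and> T - \<theta> \<le> fst (hd sp) \<and> pos_keys ws"
    and F: "F = (\<Sum>(T, \<theta>, dg, ws)\<leftarrow>sp. lin_val ws (T div \<theta> - 1))"
    and G: "G = (\<Sum>(T, \<theta>, dg, ws)\<leftarrow>sp. dg * (T div \<theta> - 1))"
    and tot: "(\<Sum>(T, \<theta>, dg, ws)\<leftarrow>sp. lin_val ws (z div \<theta>)) = total z"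
    and exc: "(\<Sum>(T, \<theta>, dg, ws)\<leftarrow>sp. dg * (z div \<theta>)) = excess z"
    and z: "fst (hd sp) \<le> z" "z < z1"
  shows "within_env E z"
proof -
  have hd: "fT (hd (map fam_of sp)) = fst (hd sp)"
    using ne by (cases sp) (auto simp: fam_of_def split: prod.splits)
  have pk: "\<forall>(T, \<theta>, dg, ws)\<in>set sp. pos_keys ws" using ok by auto
  have sF: "(\<Sum>f\<leftarrow>map fam_of sp. cval (fL f) (h f)) = (\<Sum>(T, \<theta>, dg, ws)\<leftarrow>sp. lin_val ws (h (fam_of (T, \<theta>, dg, ws))))" for h
    using pk by (induction sp) (auto simp: fam_of_def cval_mkc)
  have sG: "(\<Sum>f\<leftarrow>map fam_of sp. fdg f * (h f)) = (\<Sum>(T, \<theta>, dg, ws)\<leftarrow>sp. dg * (h (fam_of (T, \<theta>, dg, ws))))" for h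
    by (induction sp) (auto simp: fam_of_def)
  have "semF (map fam_of sp) z \<le> E \<or> (2 \<le> semG (map fam_of sp) z \<and> semF (map fam_of sp) z \<le> E + 100)"
  proof (rule rn_sound[OF rn[unfolded rnn_def]])
    show "map fam_of sp \<noteq> []" using ne by simp
    have e: "map fT (map fam_of sp) = map fst sp" by (induction sp) (auto simp: fam_of_def)
    show "sorted (map fT (map fam_of sp))" unfolding e by (rule srt)
    show "\<forall>f\<in>set (map fam_of sp). fok f"
      using ok by (force simp: fam_of_def fok_def pos_keys_def intro!: cok_mkc)
    show "F = (\<Sum>f\<leftarrow>map fam_of sp. cval (fL f) (fT f div fth f - 1))"
      unfolding sF F by (simp add: fam_of_def)
    show "G = (\<Sum>f\<leftarrow>map fam_of sp. fdg f * (fT f div fth f - 1))"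
      unfolding sG G by (simp add: fam_of_def)
    show "\<forall>f\<in>set (map fam_of sp). fT f - fth f \<le> fT (hd (map fam_of sp))"
      unfolding hd using ok by (auto simp: fam_of_def)
    show "fT (hd (map fam_of sp)) \<le> z" unfolding hd by (rule z)
    show "z < z1" by (rule z)
  qed
  moreover have "semF (map fam_of sp) z = total z"
    unfolding semF_def sF tot[symmetric] by (simp add: fam_of_def)
  moreover have "semG (map fam_of sp) z = excess z"
    unfolding semG_def sG exc[symmetric] by (simp add: fam_of_def)
  ultimately show ?thesis by (simp add: within_env_def)
qed

lemma lin_val_numeral: "lin_val ws (numeral k) = (\<Sum>(j, c)\<leftarrow>ws. c * (numeral k div j))" "lin_val ws 1 = (\<Sum>(j, c)\<leftarrow>ws. c * (1 div j))"
  by (simp_all add: lin_val_def)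
lemmas lin_val_lists =
  lin_val_numeral[of wU, unfolded wU_def list.map sum_list.Cons sum_list.Nil prod.case, folded wU_def]
  lin_val_numeral[of wA, unfolded wA_def list.map sum_list.Cons sum_list.Nil prod.case, folded wA_def]
  lin_val_numeral[of wN, unfolded wN_def list.map sum_list.Cons sum_list.Nil prod.case, folded wN_def]
  lin_val_numeral[of wn, unfolded wn_def list.map sum_list.Cons sum_list.Nil prod.case, folded wn_def]
lemmas fam_defs = total_def excess_def pos_keys_lists

text \<open>One run per stretch on which the envelope is constant; up to \<open>1010000\<close> the
  step function never exceeds the indicator. The preparatory rewrites compute the initial counters
  and chunk them, and the final one executes the sweep event by event.\<close>

lemma run_1: "rnn (num_of 200) 1010000 0 (map fam_of [(10000, 10000, 1, wU), (23054, 23054, -1, wA), (31123, 31123, -1, wN), (40817, 40817, -1, wn)]) (0) (0)"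
  apply (simp add: fam_of_def del: rnn_One)
  apply (simp only: wU_def wA_def wN_def wn_def mkc_def list.map prod.case Fm_groups)
  apply (simp del: rnn_One add: num_of_numeral groups.simps)
  by (simp only: run_rules num_arith cong: run_congs)
lemma envelope_1: "10000 \<le> z \<Longrightarrow> z < 1010000 \<Longrightarrow> within_env 0 z"
  by (rule run_env[OF run_1]) (simp_all add: lin_val_lists fam_defs)
lemma run_101: "rnn (num_of 41) 1210000 1 (map fam_of [(1010000, 10000, 1, wU), (1014376, 23054, -1, wA), (1020425, 40817, -1, wn), (1027059, 31123, -1, wN)]) (0) (1)"
  apply (simp add: fam_of_def del: rnn_One)
  apply (simp only: wU_def wA_def wN_def wn_def mkc_def list.map prod.case Fm_groups)
  apply (simp del: rnn_One add: num_of_numeral groups.simps)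
  by (simp only: run_rules num_arith cong: run_congs)
lemma envelope_101: "1010000 \<le> z \<Longrightarrow> z < 1210000 \<Longrightarrow> within_env 1 z"
  by (rule run_env[OF run_101]) (simp_all add: lin_val_lists fam_defs)
lemma run_121: "rnn (num_of 30) 1350000 121 (map fam_of [(1210000, 10000, 1, wU), (1213797, 31123, -1, wN), (1221862, 23054, -1, wA), (1224510, 40817, -1, wn)]) (-149) (1)"
  apply (simp add: fam_of_def del: rnn_One)
  apply (simp only: wU_def wA_def wN_def wn_def mkc_def list.map prod.case Fm_groups)
  apply (simp del: rnn_One add: num_of_numeral groups.simps)
  by (simp only: run_rules num_arith cong: run_congs)
lemma envelope_121: "1210000 \<le> z \<Longrightarrow> z < 1350000 \<Longrightarrow> within_env 121 z"
  by (rule run_env[OF run_121]) (simp_all add: lin_val_lists fam_defs)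
lemma run_135: "rnn (num_of 380) 3250000 122 (map fam_of [(1350000, 10000, 1, wU), (1360186, 23054, -1, wA), (1369412, 31123, -1, wN), (1387778, 40817, -1, wn)]) (21) (0)"
  apply (simp add: fam_of_def del: rnn_One)
  apply (simp only: wU_def wA_def wN_def wn_def mkc_def list.map prod.case Fm_groups)
  apply (simp del: rnn_One add: num_of_numeral groups.simps)
  by (simp only: run_rules num_arith cong: run_congs)
lemma envelope_135: "1350000 \<le> z \<Longrightarrow> z < 3250000 \<Longrightarrow> within_env 122 z"
  by (rule run_env[OF run_135]) (simp_all add: lin_val_lists fam_defs)
lemma run_325: "rnn (num_of 128) 3880000 172 (map fam_of [(3250000, 10000, 1, wU), (3250614, 23054, -1, wA), (3265360, 40817, -1, wn), (3267915, 31123, -1, wN)]) (-123) (1)"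
  apply (simp add: fam_of_def del: rnn_One)
  apply (simp only: wU_def wA_def wN_def wn_def mkc_def list.map prod.case Fm_groups)
  apply (simp del: rnn_One add: num_of_numeral groups.simps)
  by (simp only: run_rules num_arith cong: run_congs)
lemma envelope_325: "3250000 \<le> z \<Longrightarrow> z < 3880000 \<Longrightarrow> within_env 172 z"
  by (rule run_env[OF run_325]) (simp_all add: lin_val_lists fam_defs)
lemma run_388: "rnn (num_of 47) 4110000 186 (map fam_of [(3880000, 10000, 1, wU), (3890375, 31123, -1, wN), (3896126, 23054, -1, wA), (3918432, 40817, -1, wn)]) (85) (0)"
  apply (simp add: fam_of_def del: rnn_One)
  apply (simp only: wU_def wA_def wN_def wn_def mkc_def list.map prod.case Fm_groups)
  apply (simp del: rnn_One add: num_of_numeral groups.simps)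
  by (simp only: run_rules num_arith cong: run_congs)
lemma envelope_388: "3880000 \<le> z \<Longrightarrow> z < 4110000 \<Longrightarrow> within_env 186 z"
  by (rule run_env[OF run_388]) (simp_all add: lin_val_lists fam_defs)
lemma run_411: "rnn (num_of 103) 4620000 187 (map fam_of [(4110000, 10000, 1, wU), (4122517, 40817, -1, wn), (4126666, 23054, -1, wA), (4139359, 31123, -1, wN)]) (87) (0)"
  apply (simp add: fam_of_def del: rnn_One)
  apply (simp only: wU_def wA_def wN_def wn_def mkc_def list.map prod.case Fm_groups)
  apply (simp del: rnn_One add: num_of_numeral groups.simps)
  by (simp only: run_rules num_arith cong: run_congs)
lemma envelope_411: "4110000 \<le> z \<Longrightarrow> z < 4620000 \<Longrightarrow> within_env 187 z"
  by (rule run_env[OF run_411]) (simp_all add: lin_val_lists fam_defs)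
lemma run_462: "rnn (num_of 830) 8770000 222 (map fam_of [(4620000, 10000, 1, wU), (4633854, 23054, -1, wA), (4637327, 31123, -1, wN), (4653138, 40817, -1, wn)]) (-272) (0)"
  apply (simp add: fam_of_def del: rnn_One)
  apply (simp only: wU_def wA_def wN_def wn_def mkc_def list.map prod.case Fm_groups)
  apply (simp del: rnn_One add: num_of_numeral groups.simps)
  by (simp only: run_rules num_arith cong: run_congs)
lemma envelope_462: "4620000 \<le> z \<Longrightarrow> z < 8770000 \<Longrightarrow> within_env 222 z"
  by (rule run_env[OF run_462]) (simp_all add: lin_val_lists fam_defs)
lemma run_877: "rnn (num_of 1044) 13980000 280 (map fam_of [(8770000, 10000, 1, wU), (8775655, 40817, -1, wn), (8776686, 31123, -1, wN), (8783574, 23054, -1, wA)]) (-164) (1)"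
  apply (simp add: fam_of_def del: rnn_One)
  apply (simp only: wU_def wA_def wN_def wn_def mkc_def list.map prod.case Fm_groups)
  apply (simp del: rnn_One add: num_of_numeral groups.simps)
  by (simp only: run_rules num_arith cong: run_congs)
lemma envelope_877: "8770000 \<le> z \<Longrightarrow> z < 13980000 \<Longrightarrow> within_env 280 z"
  by (rule run_env[OF run_877]) (simp_all add: lin_val_lists fam_defs)
lemma run_1398: "rnn (num_of 169) 14820000 313 (map fam_of [(13980000, 10000, 1, wU), (13993778, 23054, -1, wA), (14000231, 40817, -1, wn), (14005350, 31123, -1, wN)]) (-75) (0)"
  apply (simp add: fam_of_def del: rnn_One)
  apply (simp only: wU_def wA_def wN_def wn_def mkc_def list.map prod.case Fm_groups)
  apply (simp del: rnn_One add: num_of_numeral groups.simps)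
  by (simp only: run_rules num_arith cong: run_congs)
lemma envelope_1398: "13980000 \<le> z \<Longrightarrow> z < 14820000 \<Longrightarrow> within_env 313 z"
  by (rule run_env[OF run_1398]) (simp_all add: lin_val_lists fam_defs)
lemma run_1482: "rnn (num_of 1762) 23630000 332 (map fam_of [(14820000, 10000, 1, wU), (14823722, 23054, -1, wA), (14845671, 31123, -1, wN), (14857388, 40817, -1, wn)]) (105) (0)"
  apply (simp add: fam_of_def del: rnn_One)
  apply (simp only: wU_def wA_def wN_def wn_def mkc_def list.map prod.case Fm_groups)
  apply (simp del: rnn_One add: num_of_numeral groups.simps)
  by (simp only: run_rules num_arith cong: run_congs)
lemma envelope_1482: "14820000 \<le> z \<Longrightarrow> z < 23630000 \<Longrightarrow> within_env 332 z"
  by (rule run_env[OF run_1482]) (simp_all add: lin_val_lists fam_defs)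
lemma run_2363: "rnn (num_of 2382) 35530000 352 (map fam_of [(23630000, 10000, 1, wU), (23630350, 23054, -1, wA), (23633043, 40817, -1, wn), (23653480, 31123, -1, wN)]) (-127) (1)"
  apply (simp add: fam_of_def del: rnn_One)
  apply (simp only: wU_def wA_def wN_def wn_def mkc_def list.map prod.case Fm_groups)
  apply (simp del: rnn_One add: num_of_numeral groups.simps)
  by (simp only: run_rules num_arith cong: run_congs)
lemma envelope_2363: "23630000 \<le> z \<Longrightarrow> z < 35530000 \<Longrightarrow> within_env 352 z"
  by (rule run_env[OF run_2363]) (simp_all add: lin_val_lists fam_defs)
lemma run_3553: "rnn (num_of 1357) 42310000 395 (map fam_of [(35530000, 10000, 1, wU), (35542466, 31123, -1, wN), (35549268, 23054, -1, wA), (35551607, 40817, -1, wn)]) (-284) (0)"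
  apply (simp add: fam_of_def del: rnn_One)
  apply (simp only: wU_def wA_def wN_def wn_def mkc_def list.map prod.case Fm_groups)
  apply (simp del: rnn_One add: num_of_numeral groups.simps)
  by (simp only: run_rules num_arith cong: run_congs)
lemma envelope_3553: "35530000 \<le> z \<Longrightarrow> z < 42310000 \<Longrightarrow> within_env 395 z"
  by (rule run_env[OF run_3553]) (simp_all add: lin_val_lists fam_defs)
lemma run_4231: "rnn (num_of 509) 44850000 404 (map fam_of [(42310000, 10000, 1, wU), (42327144, 23054, -1, wA), (42327229, 40817, -1, wn), (42327280, 31123, -1, wN)]) (-140) (0)"
  apply (simp add: fam_of_def del: rnn_One)
  apply (simp only: wU_def wA_def wN_def wn_def mkc_def list.map prod.case Fm_groups)
  apply (simp del: rnn_One add: num_of_numeral groups.simps)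
  by (simp only: run_rules num_arith cong: run_congs)
lemma envelope_4231: "42310000 \<le> z \<Longrightarrow> z < 44850000 \<Longrightarrow> within_env 404 z"
  by (rule run_env[OF run_4231]) (simp_all add: lin_val_lists fam_defs)
lemma run_4485: "rnn (num_of 1111) 50400000 405 (map fam_of [(44850000, 10000, 1, wU), (44857883, 40817, -1, wn), (44863084, 23054, -1, wA), (44879366, 31123, -1, wN)]) (-188) (0)"
  apply (simp add: fam_of_def del: rnn_One)
  apply (simp only: wU_def wA_def wN_def wn_def mkc_def list.map prod.case Fm_groups)
  apply (simp del: rnn_One add: num_of_numeral groups.simps)
  by (simp only: run_rules num_arith cong: run_congs)
lemma envelope_4485: "44850000 \<le> z \<Longrightarrow> z < 50400000 \<Longrightarrow> within_env 405 z"
  by (rule run_env[OF run_4485]) (simp_all add: lin_val_lists fam_defs)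
lemma run_5040: "rnn (num_of 605) 53420000 415 (map fam_of [(50400000, 10000, 1, wU), (50408995, 40817, -1, wn), (50419098, 23054, -1, wA), (50419260, 31123, -1, wN)]) (-116) (0)"
  apply (simp add: fam_of_def del: rnn_One)
  apply (simp only: wU_def wA_def wN_def wn_def mkc_def list.map prod.case Fm_groups)
  apply (simp del: rnn_One add: num_of_numeral groups.simps)
  by (simp only: run_rules num_arith cong: run_congs)
lemma envelope_5040: "50400000 \<le> z \<Longrightarrow> z < 53420000 \<Longrightarrow> within_env 415 z"
  by (rule run_env[OF run_5040]) (simp_all add: lin_val_lists fam_defs)
lemma run_5342: "rnn (num_of 2805) 67440000 420 (map fam_of [(53420000, 10000, 1, wU), (53429453, 40817, -1, wn), (53438191, 31123, -1, wN), (53439172, 23054, -1, wA)]) (-276) (0)"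
  apply (simp add: fam_of_def del: rnn_One)
  apply (simp only: wU_def wA_def wN_def wn_def mkc_def list.map prod.case Fm_groups)
  apply (simp del: rnn_One add: num_of_numeral groups.simps)
  by (simp only: run_rules num_arith cong: run_congs)
lemma envelope_5342: "53420000 \<le> z \<Longrightarrow> z < 67440000 \<Longrightarrow> within_env 420 z"
  by (rule run_env[OF run_5342]) (simp_all add: lin_val_lists fam_defs)
lemma run_6744: "rnn (num_of 811) 71490000 457 (map fam_of [(67440000, 10000, 1, wU), (67443541, 31123, -1, wN), (67456004, 23054, -1, wA), (67470501, 40817, -1, wn)]) (122) (0)"
  apply (simp add: fam_of_def del: rnn_One)
  apply (simp only: wU_def wA_def wN_def wn_def mkc_def list.map prod.case Fm_groups)
  apply (simp del: rnn_One add: num_of_numeral groups.simps)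
  by (simp only: run_rules num_arith cong: run_congs)
lemma envelope_6744: "67440000 \<le> z \<Longrightarrow> z < 71490000 \<Longrightarrow> within_env 457 z"
  by (rule run_env[OF run_6744]) (simp_all add: lin_val_lists fam_defs)
lemma run_7149: "rnn (num_of 1770) 80330000 458 (map fam_of [(71490000, 10000, 1, wU), (71490454, 23054, -1, wA), (71511384, 40817, -1, wn), (71520654, 31123, -1, wN)]) (-190) (0)"
  apply (simp add: fam_of_def del: rnn_One)
  apply (simp only: wU_def wA_def wN_def wn_def mkc_def list.map prod.case Fm_groups)
  apply (simp del: rnn_One add: num_of_numeral groups.simps)
  by (simp only: run_rules num_arith cong: run_congs)
lemma envelope_7149: "71490000 \<le> z \<Longrightarrow> z < 80330000 \<Longrightarrow> within_env 458 z"
  by (rule run_env[OF run_7149]) (simp_all add: lin_val_lists fam_defs)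
lemma run_8033: "rnn (num_of 2643) 93550000 460 (map fam_of [(80330000, 10000, 1, wU), (80343190, 23054, -1, wA), (80359586, 31123, -1, wN), (80368673, 40817, -1, wn)]) (-107) (-1)"
  apply (simp add: fam_of_def del: rnn_One)
  apply (simp only: wU_def wA_def wN_def wn_def mkc_def list.map prod.case Fm_groups)
  apply (simp del: rnn_One add: num_of_numeral groups.simps)
  by (simp only: run_rules num_arith cong: run_congs)
lemma envelope_8033: "80330000 \<le> z \<Longrightarrow> z < 93550000 \<Longrightarrow> within_env 460 z"
  by (rule run_env[OF run_8033]) (simp_all add: lin_val_lists fam_defs)
text \<open>Same envelope value \<open>460\<close> as in the preceding and the following run; the
  stretch from \<open>80330000\<close> to \<open>120000000\<close> is divided in three to bound the
  length of a single computation.\<close>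

lemma run_9355: "rnn (num_of 2646) 106770000 460 (map fam_of [(93550000, 10000, 1, wU), (93552564, 40817, -1, wn), (93553132, 23054, -1, wA), (93555738, 31123, -1, wN)]) (-404) (1)"
  apply (simp add: fam_of_def del: rnn_One)
  apply (simp only: wU_def wA_def wN_def wn_def mkc_def list.map prod.case Fm_groups)
  apply (simp del: rnn_One add: num_of_numeral groups.simps)
  by (simp only: run_rules num_arith cong: run_congs)
lemma envelope_9355: "93550000 \<le> z \<Longrightarrow> z < 106770000 \<Longrightarrow> within_env 460 z"
  by (rule run_env[OF run_9355]) (simp_all add: lin_val_lists fam_defs)
lemma run_10677: "rnn (num_of 2647) 120000000 460 (map fam_of [(106770000, 10000, 1, wU), (106777272, 40817, -1, wn), (106783013, 31123, -1, wN), (106786128, 23054, -1, wA)]) (2) (0)"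
  apply (simp add: fam_of_def del: rnn_One)
  apply (simp only: wU_def wA_def wN_def wn_def mkc_def list.map prod.case Fm_groups)
  apply (simp del: rnn_One add: num_of_numeral groups.simps)
  by (simp only: run_rules num_arith cong: run_congs)
lemma envelope_10677: "106770000 \<le> z \<Longrightarrow> z < 120000000 \<Longrightarrow> within_env 460 z"
  by (rule run_env[OF run_10677]) (simp_all add: lin_val_lists fam_defs)
text \<open>The jumps between the bounds of successive runs. The last one lifts \<open>4.60\<close>
  to \<open>39.62\<close>, a bound that holds for every \<open>z\<close>; placed this far out, it
  costs little in spite of its height.\<close>

definition env :: "(nat \<times> real) list" where "env = [(1010000, 1/100), (1210000, 120/100), (1350000, 1/100), (3250000, 50/100), (3880000, 14/100), (4110000, 1/100), (4620000, 35/100), (8770000, 58/100), (13980000, 33/100), (14820000, 19/100), (23630000, 20/100), (35530000, 43/100), (42310000, 9/100), (44850000, 1/100), (50400000, 10/100), (53420000, 5/100), (67440000, 37/100), (71490000, 1/100), (80330000, 2/100), (120000000, 3502/100)]"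

section \<open>Explicit upper bounds for \<open>psi\<close>\<close>

lemma lcmb_rec: "m \<ge> 2 \<Longrightarrow> lcmb m = lcmb (m div 2) * (fact m div (fact (m div 2))\<^sup>2)"
  and lcmb_1: "lcmb 1 = 1" "lcmb (Suc 0) = 1"
  by (simp_all add: lcmb.simps[of m] lcmb.simps[of 1] lcmb.simps[of "Suc 0"])

lemma lcmb_2: "lcmb 2 = 2" using lcmb_rec[of 2] by (simp add: lcmb_1 fact_numeral)
lemma lcmb_3: "lcmb 3 = 6" using lcmb_rec[of 3] by (simp add: lcmb_1 fact_numeral)
lemma lcmb_4: "lcmb 4 = 12" using lcmb_rec[of 4] by (simp add: lcmb_2 fact_numeral)
lemma lcmb_5: "lcmb 5 = 60" using lcmb_rec[of 5] by (simp add: lcmb_2 fact_numeral)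
lemma lcmb_6: "lcmb 6 = 120" using lcmb_rec[of 6] by (simp add: lcmb_3 fact_numeral)
lemma lcmb_7: "lcmb 7 = 840" using lcmb_rec[of 7] by (simp add: lcmb_3 fact_numeral)
lemma lcmb_8: "lcmb 8 = 840" using lcmb_rec[of 8] by (simp add: lcmb_4 fact_numeral)
lemma lcmb_9: "lcmb 9 = 7560" using lcmb_rec[of 9] by (simp add: lcmb_4 fact_numeral)
lemma lcmb_10: "lcmb 10 = 15120" using lcmb_rec[of 10] by (simp add: lcmb_5 fact_numeral)
lemma lcmb_11: "lcmb 11 = 166320" using lcmb_rec[of 11] by (simp add: lcmb_5 fact_numeral)
lemma lcmb_12: "lcmb 12 = 110880" using lcmb_rec[of 12] by (simp add: lcmb_6 fact_numeral)
lemma lcmb_13: "lcmb 13 = 1441440" using lcmb_rec[of 13] by (simp add: lcmb_6 fact_numeral)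
lemma lcmb_14: "lcmb 14 = 2882880" using lcmb_rec[of 14] by (simp add: lcmb_7 fact_numeral)
lemma lcmb_15: "lcmb 15 = 43243200" using lcmb_rec[of 15] by (simp add: lcmb_7 fact_numeral)
lemma lcmb_16: "lcmb 16 = 10810800" using lcmb_rec[of 16] by (simp add: lcmb_8 fact_numeral)
lemma lcmb_17: "lcmb 17 = 183783600" using lcmb_rec[of 17] by (simp add: lcmb_8 fact_numeral)
lemma lcmb_18: "lcmb 18 = 367567200" using lcmb_rec[of 18] by (simp add: lcmb_9 fact_numeral)
lemma lcmb_19: "lcmb 19 = 6983776800" using lcmb_rec[of 19] by (simp add: lcmb_9 fact_numeral)
lemma lcmb_20: "lcmb 20 = 2793510720" using lcmb_rec[of 20] by (simp add: lcmb_10 fact_numeral)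
lemma lcmb_21: "lcmb 21 = 58663725120" using lcmb_rec[of 21] by (simp add: lcmb_10 fact_numeral)
lemma lcmb_22: "lcmb 22 = 117327450240" using lcmb_rec[of 22] by (simp add: lcmb_11 fact_numeral)
lemma lcmb_23: "lcmb 23 = 2698531355520" using lcmb_rec[of 23] by (simp add: lcmb_11 fact_numeral)
lemma lcmb_24: "lcmb 24 = 299836817280" using lcmb_rec[of 24] by (simp add: lcmb_12 fact_numeral)
lemma lcmb_25: "lcmb 25 = 7495920432000" using lcmb_rec[of 25] by (simp add: lcmb_12 fact_numeral)
lemma lcmb_26: "lcmb 26 = 14991840864000" using lcmb_rec[of 26] by (simp add: lcmb_13 fact_numeral)
lemma lcmb_27: "lcmb 27 = 404779703328000" using lcmb_rec[of 27] by (simp add: lcmb_13 fact_numeral)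
lemma lcmb_28: "lcmb 28 = 115651343808000" using lcmb_rec[of 28] by (simp add: lcmb_14 fact_numeral)
lemma lcmb_29: "lcmb 29 = 3353888970432000" using lcmb_rec[of 29] by (simp add: lcmb_14 fact_numeral)
lemma lcmb_30: "lcmb 30 = 6707777940864000" using lcmb_rec[of 30] by (simp add: lcmb_15 fact_numeral)
lemma lcmb_31: "lcmb 31 = 207941116166784000" using lcmb_rec[of 31] by (simp add: lcmb_15 fact_numeral)
lemma lcmb_32: "lcmb 32 = 6498159880212000" using lcmb_rec[of 32] by (simp add: lcmb_16 fact_numeral)
lemma lcmb_33: "lcmb 33 = 214439276046996000" using lcmb_rec[of 33] by (simp add: lcmb_16 fact_numeral)
lemma lcmb_34: "lcmb 34 = 428878552093992000" using lcmb_rec[of 34] by (simp add: lcmb_17 fact_numeral)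
lemma lcmb_35: "lcmb 35 = 15010749323289720000" using lcmb_rec[of 35] by (simp add: lcmb_17 fact_numeral)

text \<open>The two bounds supply the small cases of \<open>psi_le_linear\<close> and of
  \<open>psi_le\<close>, respectively.\<close>

lemma lcmb_le_small:
  assumes "1 \<le> m" "m < 36"
  shows "lcmb m \<le> 4 ^ m \<and> lcmb m \<le> 3 ^ m * m ^ 3"
proof -
  have "m = 1 \<or> m \<in> set [2..<8] \<or> m \<in> set [8..<14] \<or> m \<in> set [14..<20] \<or> m \<in> set [20..<26] \<or> m \<in> set [26..<31] \<or> m \<in> set [31..<36]"
    using assms unfolding atLeastLessThan_upt[symmetric] atLeastLessThan_iff by linarith
  moreover have "\<forall>m\<in>set [2..<8]. lcmb m \<le> 4 ^ m \<and> lcmb m \<le> 3 ^ m * m ^ 3" by (simp add: lcmb_2 lcmb_3 lcmb_4 lcmb_5 lcmb_6 lcmb_7)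
  moreover have "\<forall>m\<in>set [8..<14]. lcmb m \<le> 4 ^ m \<and> lcmb m \<le> 3 ^ m * m ^ 3" by (simp add: lcmb_8 lcmb_9 lcmb_10 lcmb_11 lcmb_12 lcmb_13)
  moreover have "\<forall>m\<in>set [14..<20]. lcmb m \<le> 4 ^ m \<and> lcmb m \<le> 3 ^ m * m ^ 3" by (simp add: lcmb_14 lcmb_15 lcmb_16 lcmb_17 lcmb_18 lcmb_19)
  moreover have "\<forall>m\<in>set [20..<26]. lcmb m \<le> 4 ^ m \<and> lcmb m \<le> 3 ^ m * m ^ 3" by (simp add: lcmb_20 lcmb_21 lcmb_22 lcmb_23 lcmb_24 lcmb_25)
  moreover have "\<forall>m\<in>set [26..<31]. lcmb m \<le> 4 ^ m \<and> lcmb m \<le> 3 ^ m * m ^ 3" by (simp add: lcmb_26 lcmb_27 lcmb_28 lcmb_29 lcmb_30)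
  moreover have "\<forall>m\<in>set [31..<36]. lcmb m \<le> 4 ^ m \<and> lcmb m \<le> 3 ^ m * m ^ 3" by (simp add: lcmb_31 lcmb_32 lcmb_33 lcmb_34 lcmb_35)
  ultimately show ?thesis using lcmb_1 by fastforce
qed

lemma real_div_le: "real (n div x) \<le> real n / real x"
  using real_of_int_div4[of "int n" "int x"] by (simp flip: zdiv_int)
lemma real_div_ge: "real n / real x \<le> real (n div x) + 1"
  using real_of_int_div3[of "int n" "int x"] by (simp flip: zdiv_int)

lemma ln_le_tangent:
  assumes "x > 0" "a > (0::real)"
  shows "ln x \<le> ln a - 1 + x / a"
  using ln_le_minus_one[of "x / a"] assms by (simp add: ln_div)

text \<open>Tangent points for the logarithm are taken among numbers with prime factors
  \<open>2\<close>, \<open>3\<close>, \<open>5\<close>, so three logarithms suffice to evaluate all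
  tangents.\<close>

lemma ln_smooth: "ln (2 ^ a * 3 ^ b * 5 ^ c :: real) \<le> real a * 0.69314719 + real b * 1.0986123 + real c * 1.60943794"
proof -
  have "ln (2 ^ a * 3 ^ b * 5 ^ c :: real) = real a * ln 2 + real b * ln 3 + real c * ln 5"
    by (simp add: ln_mult_pos ln_realpow)
  also have "\<dots> \<le> real a * 0.69314719 + real b * 1.0986123 + real c * 1.60943794"
    using ln_2_upper ln_3_bounds(2) ln_5_bounds(2) by (intro add_mono mult_left_mono) auto
  finally show ?thesis .
qed

text \<open>Iterating \<open>psi_step\<close> would give a coefficient near
  \<open>6/5 * 0.9213\<close>, about \<open>1.106\<close>. The margin up to \<open>1.15\<close>
  absorbs the logarithms collected on the way, so that a fixed multiple of \<open>ln m\<close>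
  survives the induction.\<close>

lemma psi_le: "m \<ge> 1 \<Longrightarrow> psi m \<le> 1.15 * real m + 7/2 * ln (real m)"
proof (induction m rule: less_induct)
  case (less m)
  show ?case
  proof (cases "m < 30")
    case True
    hence s: "lcmb m \<le> 3 ^ m * m ^ 3" using lcmb_le_small[of m] less.prems by auto
    have "psi m \<le> ln (real (lcmb m))" by (rule psi_le_lcmb)
    also have "\<dots> \<le> ln (real (3 ^ m * m ^ 3))" using s lcmb_pos[of m] less.prems by (subst ln_le_cancel_iff) (auto simp del: of_nat_mult of_nat_power)
    also have "\<dots> = real m * ln 3 + 3 * ln (real m)" using less.prems by (simp add: ln_mult_pos ln_realpow)
    also have "\<dots> \<le> 1.15 * real m + 7/2 * ln (real m)"
    proof -
      have "real m * ln 3 \<le> real m * 1.15" using ln_3_bounds(2) by (intro mult_left_mono) auto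
      moreover have "ln (real m) \<ge> 0" using less.prems by simp
      ultimately show ?thesis by simp
    qed
    finally show ?thesis .
  next
    case False
    define q where "q = m div 6"
    have q1: "q \<ge> 1" using False by (simp add: q_def)
    have "real q \<le> real m / 6" unfolding q_def by (rule order.trans[OF real_div_le]) simp
    moreover from this have "ln (real q) \<le> ln (real m / 6)" using q1 by (subst ln_le_cancel_iff) auto
    moreover have "ln (real m / 6) = ln (real m) - (ln 2 + ln 3)"
      using False ln_mult_pos[of 2 "3::real"] by (simp add: ln_div)
    moreover have "psi q \<le> 1.15 * real q + 7/2 * ln (real q)"
      using less.IH[of q] q1 False by (simp add: q_def)
    moreover have "psi m \<le> psi q + 0.9213 * real m + 5/2 * ln (real m) - 2.15"
      unfolding q_def using False by (intro psi_step) simp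
    \<comment> \<open>The surplus \<open>5/2 * ln m\<close> of the step has to fit under the slack
      \<open>1.15 - 1.15/6 - 0.9213\<close>, about \<open>0.037\<close>, per unit of
      \<open>m\<close>; the tangent at \<open>72\<close> has slope \<open>1/72\<close> and does
      so.\<close>
    moreover have "ln (real m) \<le> ln 72 - 1 + real m / 72" using False by (intro ln_le_tangent) auto
    moreover have "ln (72::real) \<le> 4.27667" using ln_smooth[of 3 2 0] by simp
    ultimately show ?thesis using ln_2_lower ln_3_bounds(1) False by simp
  qed
qed

lemma psi_le_linear: "psi m \<le> 1.5 * real m"
proof (cases "m < 36")
  case True
  show ?thesis
  proof (cases "m = 0")
    case False
    hence s: "lcmb m \<le> 4 ^ m" using True lcmb_le_small[of m] by auto
    have "psi m \<le> ln (real (lcmb m))" by (rule psi_le_lcmb)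
    also have "\<dots> \<le> ln (real (4 ^ m))" using s lcmb_pos[of m] by (subst ln_le_cancel_iff) (auto simp del: of_nat_mult of_nat_power)
    also have "\<dots> = real m * ln 4" by (simp add: ln_realpow)
    also have "\<dots> \<le> real m * 1.5" using ln_smooth[of 2 0 0] by (intro mult_left_mono) auto
    finally show ?thesis by simp
  qed (simp add: psi_def)
next
  case False
  have "ln (real m) \<le> ln 36 - 1 + real m / 36" using False by (intro ln_le_tangent) auto
  moreover have "ln (36::real) \<le> 3.58352" using ln_smooth[of 2 2 0] by simp
  ultimately show ?thesis using psi_le[of m] False by simp
qed

text \<open>Makes the bound for \<open>psi (y div X)\<close> linear in \<open>y / X\<close>, with
  the tangent point \<open>2 ^ a * 3 ^ b * 5 ^ c\<close> left free to be adapted to each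
  \<open>X\<close>.\<close>

lemma psi_div_tangent:
  assumes "X \<le> y" "X > 0"
  shows "psi (y div X) \<le> 1.15 * (real y / real X) + 7/2 * (real a * 0.69314719 + real b * 1.0986123 + real c * 1.60943794 - 1 + (real y / real X) / (2 ^ a * 3 ^ b * 5 ^ c))"
proof -
  have lin: "p \<le> 1.15 * v + 7/2 * (S - 1 + u)"
    if "q \<le> v" "lq \<le> lv" "lv \<le> lt - 1 + u" "p \<le> 1.15 * q + 7/2 * lq" "lt \<le> S" for p q v lq lv lt u S :: real
    using that by ((simp add: add_divide_distrib diff_divide_distrib; fail) | (simp add: field_simps; fail) | (simp only: add_divide_distrib diff_divide_distrib; linarith))
  have q: "y div X \<ge> 1" using assms by (simp add: div_greater_zero_iff Suc_le_eq)
  have 1: "real (y div X) \<le> real y / real X" by (rule real_div_le)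
  have 2: "ln (real (y div X)) \<le> ln (real y / real X)" using q 1 by (subst ln_le_cancel_iff) auto
  have 3: "ln (real y / real X) \<le> ln (2 ^ a * 3 ^ b * 5 ^ c) - 1 + (real y / real X) / (2 ^ a * 3 ^ b * 5 ^ c)"
    using assms by (intro ln_le_tangent) auto
  show ?thesis by (rule lin[OF 1 2 3 psi_le[OF q] ln_smooth])
qed

lemma psi_lin_eq:
  fixes a b T m X S v :: real
  shows "a * (T * m / X) + b * (S - 1 + (T * m / X) / v) = ((a + b / v) * T / X) * m + b * (S - 1)"
proof -
  have "a * (T * m * i) + b * (S - 1 + (T * m * i) * w) = ((a + b * w) * T * i) * m + b * (S - 1)" for i w :: real
    by (simp add: algebra_simps)
  thus ?thesis unfolding divide_inverse .
qed

lemma psi_lin: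
  fixes p m X S v \<alpha> \<beta> :: real
  assumes "p \<le> 1.15 * (10000 * m / X) + 7/2 * (S - 1 + (10000 * m / X) / v)"
    "(1.15 + 7/2 / v) * 10000 / X \<le> \<alpha>" "7/2 * (S - 1) \<le> \<beta>" "0 \<le> m"
  shows "p \<le> \<alpha> * m + \<beta>"
proof -
  have "1.15 * (10000 * m / X) + 7/2 * (S - 1 + (10000 * m / X) / v) = ((1.15 + 7/2 / v) * 10000 / X) * m + 7/2 * (S - 1)"
    by (rule psi_lin_eq)
  also have "\<dots> \<le> \<alpha> * m + \<beta>" using assms(2,3,4) by (intro add_mono mult_right_mono)
  finally show ?thesis using assms(1) by linarith
qed

lemma lin_add:
  fixes x a b s c d k m :: real
  assumes "x \<le> a * m + b" "s \<le> c * m + d" "0 \<le> k"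
  shows "k * x + s \<le> (k * a + c) * m + (k * b + d)"
proof -
  have "k * x \<le> k * (a * m + b)" using assms(1,3) by (rule mult_left_mono)
  moreover have "(k * a + c) * m + (k * b + d) = k * (a * m + b) + (c * m + d)" by (simp add: algebra_simps)
  ultimately show ?thesis using assms(2) by linarith
qed

lemma lin_zero: "(0::real) \<le> 0 * m + 0"
  by simp

lemma lin_total:
  fixes s A B P Q m :: real
  assumes "s \<le> A * m + B" "A \<le> P" "B \<le> Q" "0 \<le> m"
  shows "s \<le> P * m + Q"
proof -
  have "A * m \<le> P * m" using assms(2,4) by (rule mult_right_mono)
  thus ?thesis using assms(1,3) by linarith
qed

lemma psi_div_linear: "psi (y div X) \<le> 1.5 * (real y / real X)"
  using psi_le_linear[of "y div X"] real_div_le[of y X] by linarith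

section \<open>Main term and error term of the weights\<close>

definition scaled :: "int \<Rightarrow> (int \<times> int) list \<Rightarrow> (nat \<times> real) list" where
  "scaled \<theta> ws = map (\<lambda>(j, c). (nat (\<theta> * j), real_of_int c / 100)) ws"

definition cs0 :: "(nat \<times> real) list" where
  "cs0 = scaled 10000 wU @ scaled 23054 wA @ scaled 31123 wN @ scaled 40817 wn"

text \<open>Weight of the divisor \<open>10000\<close> that makes the reciprocal sum exactly zero.
  The rounded weights nearly achieve this already, so the correction is tiny; its sign matters
  later, since a nonpositive \<open>cu\<close> cannot raise the step function.\<close>

definition cu :: real where "cu = - 10000 * (\<Sum>(r, c)\<leftarrow>cs0. c / real r)"

definition cs :: "(nat \<times> real) list" where "cs = (10000, cu) # cs0"

lemma cs_zero: "(\<Sum>(r, c)\<leftarrow>cs. c / real r) = 0"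
  by (simp add: cs_def cu_def)

definition recip :: "(int \<times> int) list \<Rightarrow> real" where
  "recip ws = (\<Sum>(j, c)\<leftarrow>ws. of_int c / of_int j)"
text \<open>Certificate for the reciprocal sums: \<open>q\<close> encloses \<open>c / j\<close> from
  both sides in units of \<open>10 ^ (-13)\<close>, so a total is known up to one unit per
  entry.\<close>

definition recip_ok :: "(int \<times> int) list \<Rightarrow> int list \<Rightarrow> bool" where
  "recip_ok ws qs \<longleftrightarrow> list_all2 (\<lambda>(j, c) q. j > 0 \<and> j * q \<le> c * 10 ^ 13 \<and> c * 10 ^ 13 \<le> j * (q + 1)) ws qs"

lemma recip_bounds:
  assumes "recip_ok ws qs"
  shows "of_int (sum_list qs) / 10 ^ 13 \<le> recip ws" "recip ws \<le> (of_int (sum_list qs) + real (length ws)) / 10 ^ 13"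
proof -
  have "of_int (sum_list qs) \<le> recip ws * 10 ^ 13 \<and> recip ws * 10 ^ 13 \<le> of_int (sum_list qs) + real (length ws)"
    using assms
  proof (induction ws arbitrary: qs)
    case (Cons a ws)
    obtain j c where a: "a = (j, c)" by (cases a)
    obtain q qs' where qs: "qs = q # qs'" and j: "j > 0" and q: "j * q \<le> c * 10 ^ 13" "c * 10 ^ 13 \<le> j * (q + 1)" and ok: "recip_ok ws qs'"
      using Cons.prems by (auto simp: recip_ok_def a list_all2_Cons1)
    have "of_int (j * q) \<le> real_of_int (c * 10 ^ 13)" "real_of_int (c * 10 ^ 13) \<le> of_int (j * (q + 1))"
      using q by (simp_all only: of_int_le_iff)
    hence "of_int q \<le> of_int c / of_int j * (10 ^ 13 :: real)" "of_int c / of_int j * (10 ^ 13 :: real) \<le> of_int q + 1"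
      using j by (simp_all add: field_simps)
    thus ?case using Cons.IH[OF ok] by (simp add: a qs recip_def distrib_right)
  qed (simp add: recip_def recip_ok_def)
  thus "of_int (sum_list qs) / 10 ^ 13 \<le> recip ws" "recip ws \<le> (of_int (sum_list qs) + real (length ws)) / 10 ^ 13"
    by (simp_all add: field_simps)
qed

definition log_recip :: "(int \<times> int) list \<Rightarrow> real" where
  "log_recip ws = (\<Sum>(j, c)\<leftarrow>ws. of_int c * ln (of_int j) / of_int j)"
definition lns_ok :: "(int \<times> int) list \<Rightarrow> int list \<Rightarrow> bool" where
  "lns_ok ws ls \<longleftrightarrow> list_all2 (\<lambda>(j, c) l. ln_ok j l) ws ls"

text \<open>Certificate for upper bounds of \<open>c * ln j / j\<close> in units of
  \<open>10 ^ (-10)\<close>; the term with \<open>10 ^ 4\<close> covers the tolerance of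
  \<open>ln_ok\<close>, whatever the sign of \<open>c\<close>.\<close>

definition log_recip_ok :: "(int \<times> int) list \<Rightarrow> int list \<Rightarrow> int list \<Rightarrow> bool" where
  "log_recip_ok ws ls ps \<longleftrightarrow> list_all2 (\<lambda>((j, c), l) p. c * l + \<bar>c\<bar> * 10 ^ 4 \<le> j * p) (zip ws ls) ps"

lemma log_recip_le:
  assumes "lns_ok ws ls" "log_recip_ok ws ls ps"
  shows "log_recip ws \<le> of_int (sum_list ps) / 10 ^ 10"
  using assms
proof (induction ws arbitrary: ls ps)
  case (Cons a ws)
  obtain j c where a: "a = (j, c)" by (cases a)
  obtain l ls' where ls: "ls = l # ls'" and ok: "ln_ok j l" and ok': "lns_ok ws ls'"
    using Cons.prems(1) by (auto simp: lns_ok_def a list_all2_Cons1)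
  obtain p ps' where ps: "ps = p # ps'" and p: "c * l + \<bar>c\<bar> * 10 ^ 4 \<le> j * p" and pok': "log_recip_ok ws ls' ps'"
    using Cons.prems(2) by (auto simp: log_recip_ok_def a ls list_all2_Cons1)
  have j: "j > 0" and e: "\<bar>ln (real_of_int j) - of_int l / 10 ^ 10\<bar> \<le> 1 / 10 ^ 6" using ok by (auto simp: ln_ok_def)
  have "of_int c * (ln (of_int j) - of_int l / 10 ^ 10) \<le> \<bar>of_int c\<bar> * (1 / 10 ^ 6 :: real)"
  proof -
    have "of_int c * (ln (of_int j) - of_int l / 10 ^ 10) \<le> \<bar>of_int c * (ln (of_int j) - of_int l / 10 ^ 10) :: real\<bar>" by simp
    also have "\<dots> \<le> \<bar>of_int c\<bar> * (1 / 10 ^ 6)" unfolding abs_mult using e by (intro mult_left_mono) auto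
    finally show ?thesis .
  qed
  hence "of_int c * ln (of_int j) \<le> of_int (c * l + \<bar>c\<bar> * 10 ^ 4) / (10 ^ 10 :: real)"
    by (simp add: algebra_simps add_divide_distrib)
  also have "\<dots> \<le> of_int (j * p) / 10 ^ 10" using p by (intro divide_right_mono) (simp_all only: of_int_le_iff zero_le_power zero_le_numeral)
  finally have "of_int c * ln (of_int j) / of_int j \<le> of_int p / (10 ^ 10 :: real)"
    using j by (simp add: field_simps)
  moreover have "log_recip (a # ws) = of_int c * ln (of_int j) / of_int j + log_recip ws" by (simp add: a log_recip_def)
  moreover have "of_int (sum_list ps) / 10 ^ 10 = of_int p / 10 ^ 10 + real_of_int (sum_list ps') / 10 ^ 10" by (simp add: ps add_divide_distrib)
  ultimately show ?case using Cons.IH[OF ok' pok'] by linarith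
qed (simp add: log_recip_def log_recip_ok_def)

definition abs_log :: "(int \<times> int) list \<Rightarrow> real" where
  "abs_log ws = (\<Sum>(j, c)\<leftarrow>ws. of_int \<bar>c\<bar> * ln (of_int j))"
definition abs_log_floor :: "(int \<times> int) list \<Rightarrow> int list \<Rightarrow> int" where
  "abs_log_floor ws ls = (\<Sum>((j, c), l)\<leftarrow>zip ws ls. \<bar>c\<bar> * (l - 10 ^ 4))"

lemma abs_log_ge:
  assumes "lns_ok ws ls"
  shows "abs_log ws \<ge> of_int (abs_log_floor ws ls) / 10 ^ 10"
  using assms
proof (induction ws arbitrary: ls)
  case (Cons a ws)
  obtain j c where a: "a = (j, c)" by (cases a)
  obtain l ls' where ls: "ls = l # ls'" and ok: "ln_ok j l" and ok': "lns_ok ws ls'"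
    using Cons.prems by (auto simp: lns_ok_def a list_all2_Cons1)
  have e: "\<bar>ln (real_of_int j) - of_int l / 10 ^ 10\<bar> \<le> 1 / 10 ^ 6" using ok by (auto simp: ln_ok_def)
  have "of_int \<bar>c\<bar> * (of_int (l - 10 ^ 4) / 10 ^ 10) \<le> real_of_int \<bar>c\<bar> * ln (real_of_int j)"
  proof (intro mult_left_mono)
    have "of_int l / 10 ^ 10 - 1 / 10 ^ 6 \<le> ln (real_of_int j)" using e by linarith
    thus "of_int (l - 10 ^ 4) / 10 ^ 10 \<le> ln (real_of_int j)" by (simp add: diff_divide_distrib)
  qed simp
  thus ?case using Cons.IH[OF ok']
    by (simp add: a ls abs_log_def abs_log_floor_def add_divide_distrib)
qed (simp add: abs_log_def abs_log_floor_def)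

definition abs_sum :: "(int \<times> int) list \<Rightarrow> int" where "abs_sum ws = (\<Sum>(j, c)\<leftarrow>ws. \<bar>c\<bar>)"
text \<open>Four times the constant contributions in \<open>err_sum\<close>, which keeps the value
  integral.\<close>

definition skew_sum :: "(int \<times> int) list \<Rightarrow> int" where "skew_sum ws = (\<Sum>(j, c)\<leftarrow>ws. if c \<ge> 0 then - c else - 4 * c)"
definition neg_sum :: "(int \<times> int) list \<Rightarrow> int" where "neg_sum ws = (\<Sum>(j, c)\<leftarrow>ws. max 0 (- c))"

lemma sum_scaled_recip:
  assumes "pos_keys ws" "\<theta> > 0"
  shows "(\<Sum>(r, c)\<leftarrow>scaled \<theta> ws. c / real r) = recip ws / (100 * of_int \<theta>)"
  using assms by (induction ws) (auto simp: scaled_def recip_def pos_keys_def add_divide_distrib)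

lemma sum_scaled_log:
  assumes "pos_keys ws" "\<theta> > 0"
  shows "(\<Sum>(r, c)\<leftarrow>scaled \<theta> ws. c * ln (real r) / real r) =
     (recip ws * ln (of_int \<theta>) + log_recip ws) / (100 * of_int \<theta>)"
  using assms by (induction ws) (auto simp: scaled_def recip_def log_recip_def pos_keys_def ln_mult_pos add_divide_distrib distrib_left distrib_right mult.commute)

lemma err_sum_scaled:
  assumes "pos_keys ws" "\<theta> > 0" "y > 0"
  shows "err_sum (scaled \<theta> ws) y =
     (of_int (abs_sum ws) * (ln y - ln (of_int \<theta>)) / 2 - abs_log ws / 2 + of_int (skew_sum ws) / 4) / 100"
  using assms by (induction ws) (auto simp: scaled_def err_sum_def abs_sum_def abs_log_def skew_sum_def pos_keys_def
      ln_mult_pos ln_div add_divide_distrib diff_divide_distrib distrib_left distrib_right left_diff_distrib right_diff_distrib abs_mult)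

lemma neg_sum_scaled: "(\<Sum>(r, c)\<leftarrow>scaled \<theta> ws. max 0 (- c)) = of_int (neg_sum ws) / 100"
  by (induction ws) (auto simp: scaled_def neg_sum_def add_divide_distrib max_def)

lemma floor_sum_scaled:
  assumes "pos_keys ws" "\<theta> > 0"
  shows "floor_sum (scaled \<theta> ws) z = of_int (lin_val ws (int z div \<theta>)) / 100"
  using assms(1)
proof (induction ws)
  case (Cons a ws)
  obtain j c where a: "a = (j, c)" by (cases a)
  have j: "j > 0" using Cons.prems by (simp add: a pos_keys_def)
  have "int (z div nat (\<theta> * j)) = int z div \<theta> div j"
    using j assms(2) by (simp add: zdiv_int zdiv_zmult2_eq)
  hence "real (z div nat (\<theta> * j)) = of_int (int z div \<theta> div j)" by (metis of_int_of_nat_eq)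
  thus ?case using Cons by (simp add: a scaled_def lin_val_def pos_keys_def add_divide_distrib)
qed (simp add: scaled_def lin_val_def)

lemma floor_sum_append: "floor_sum (xs @ ys) z = floor_sum xs z + floor_sum ys z"
  by (simp add: floor_sum_def)

lemma floor_sum_cs0: "floor_sum cs0 z = of_int (total (int z)) / 100"
  by (simp add: cs0_def floor_sum_append floor_sum_scaled pos_keys_lists total_def)

text \<open>With zero reciprocal sum, replacing each floor by the exact quotient gives zero. A floor
  is smaller than the quotient by at most one, so only negative weights can push the sum upwards,
  each by at most its modulus.\<close>

lemma floor_sum_le_neg:
  assumes "\<forall>(r, c)\<in>set xs. r > 0" "(\<Sum>(r, c)\<leftarrow>xs. c / real r) = 0"
  shows "floor_sum xs z \<le> (\<Sum>(r, c)\<leftarrow>xs. max 0 (- c))"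
proof -
  have "floor_sum xs z \<le> (\<Sum>(r, c)\<leftarrow>xs. c / real r) * real z + (\<Sum>(r, c)\<leftarrow>xs. max 0 (- c))"
    using assms(1)
  proof (induction xs)
    case (Cons a xs)
    obtain r c where a: "a = (r, c)" by (cases a)
    have r: "r > 0" using Cons.prems by (simp add: a)
    have lo: "real (z div r) \<le> real z / real r" by (rule real_div_le)
    have hi: "real z / real r \<le> real (z div r) + 1" by (rule real_div_ge)
    have "c * real (z div r) \<le> c / real r * real z + max 0 (- c)"
    proof (cases "c \<ge> 0")
      case True
      thus ?thesis using mult_left_mono[OF lo True] by simp
    next
      case False
      hence "c * (real (z div r) + 1) \<le> c * (real z / real r)" using hi by (intro mult_left_mono_neg) auto
      thus ?thesis using False by (simp add: algebra_simps)
    qed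
    moreover have "floor_sum xs z \<le> (\<Sum>(r, c)\<leftarrow>xs. c / real r) * real z + (\<Sum>(r, c)\<leftarrow>xs. max 0 (- c))"
      using Cons by simp
    ultimately show ?case by (simp add: a distrib_right)
  qed simp
  thus ?thesis using assms(2) by simp
qed

lemma scaled_bound:
  assumes "\<forall>(j, c)\<in>set ws. 0 < j \<and> j \<le> 200" "0 < \<theta>" "\<theta> \<le> 50000"
  shows "\<forall>(r, c)\<in>set (scaled \<theta> ws). 0 < r \<and> r \<le> 10000000"
proof -
  have "\<theta> * j \<le> 10000000 \<and> 0 < \<theta> * j" if m: "(j, c) \<in> set ws" for j c
  proof -
    have j: "0 < j" "j \<le> 200" using assms(1) m by auto
    have "\<theta> * j \<le> 50000 * 200" using assms(2,3) j by (intro mult_mono) auto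
    thus ?thesis using assms(2) j by simp
  qed
  thus ?thesis by (force simp: scaled_def)
qed

lemma keys_small: "\<forall>(j, c)\<in>set wU. 0 < j \<and> j \<le> 200" "\<forall>(j, c)\<in>set wA. 0 < j \<and> j \<le> 200"
  "\<forall>(j, c)\<in>set wN. 0 < j \<and> j \<le> 200" "\<forall>(j, c)\<in>set wn. 0 < j \<and> j \<le> 200"
  by (simp_all add: wU_def wA_def wN_def wn_def)

definition wUq :: "int list" where "wUq = [500000000000000, 333333333333333, -166666666666667, -100000000000000, 90909090909090, -71428571428572, 49000000000000, -43809523809524, -71363636363637, 5217391304347, -23461538461539, 2413793103448, 6666666666666, 5483870967741, -49696969696970, 8918918918918, -26315789473685, 500000000000, 2926829268292, 27857142857142, 3488372093023, 14545454545454, -6666666666667, -15882352941177, 11730769230769, 9245283018867, -909090909091, 178571428571, -5614035087720, -1206896551725, 7288135593220, -16333333333334, 8688524590163, -2741935483871, -1269841269842, 6769230769230, 18333333333333, 4328358208955, -1739130434783, 9571428571428, -2394366197184, -675675675676, 1052631578947, 3376623376623, 4556962025316, 1250000000000, -8518518518519, -4024390243903, -3372093023256, -6436781609196, -12159090909091, 6404494382022, -2222222222223, -1304347826087, -2903225806452, 8736842105263, 3333333333333, 3367346938775, 8686868686868, -5000000000000, 3564356435643, 1176470588235, -4528301886793, -1588785046729, -3761467889909, 630630630630, 3303571428571, -4513274336284, 6140350877192, 2086956521739, 4827586206896, -1101694915255, 5714285714285, -330578512397, -564516129033, 6587301587301, -1162790697675, 1060606060606, -2164179104478, 4689655172413,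 1342281879194, 4172185430463, -3481012658228, -864197530865, 2883435582822, 731707317073, -662650602410, 2155688622754, 177514792899, -898876404495, 494505494505, -1093750000000, -5181347150260, -3147208121828]"
definition wUp :: "int list" where "wUp = [346574090250, 366204429534, -298626411516, -230258409290, 217990570246, -188504023528, 146790930397, -133379034404, -220587958251, 16359105474, -76439933769, 8127957865, 22674655877, 18831548218, -173765780622, 32205493002, -95725925247, 1844440227, 10868994341, 104120824359, 13120469008, 55042772854, -25808000070, -62446626514, 46351139964, 36706481650, -3643029259, 718812981, -22697826063, -4900533460, 29717653063, -66874278179, 35717437343, -11316333474, -5261122191, 28257397518, 76810355267, 18199420143, -7363661746, 40664178315, -10206414211, -2908151414, 4558667727, 14667398307, 19911412491, 5477534543, -37434187981, -17734353920, -15020470067, -28746068807, -54440333195, 28747452816, -9999574822, -5897983795, -13159156914, 39786512103, 15214497304, 15439179570, 39917211424, -23025845929, 16449938079, 5441145663, -21117455518, -7424118988, -17646350656, 2969974632, 15587901360, -21335993604, 29081926436, 9902469137, 22948371266, -5255837890, 27309282816, -1585384973, -2721126125, 31858054068, -5650943493, 5178730373, -10599800387, 23339169826, 6716707793, 20933026008, -17622953910, -4396687326, 14687503462, 3731610313, -3387461124, 11032803188, 910633086, -4657782067, 2573410395, -5750384468, -27267819629, -16627338535]"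
lemma length_wU: "length wU = 94" by (simp add:  wU_def wUl_def)
lemma recip_sum_wU: "sum_list wUq = 530737369885328" by (simp add: wUq_def wU_def wUl_def)
lemma log_recip_sum_wU: "sum_list wUp = 89052814751" by (simp add: wUp_def wU_def wUl_def)
lemma abs_log_wU: "abs_log_floor wU wUl = 168171903617547" by (simp add: abs_log_floor_def wU_def wUl_def)
lemma abs_sum_wU: "abs_sum wU = 4296" by (simp add: abs_sum_def wU_def wUl_def)
lemma skew_sum_wU: "skew_sum wU = 6179" by (simp add: skew_sum_def wU_def wUl_def)
lemma neg_sum_wU: "neg_sum wU = 2095" by (simp add: neg_sum_def wU_def wUl_def)
lemma lns_ok_wU: "lns_ok wU wUl" by (simp add: lns_ok_def ln_oks wU_def wUl_def)
lemma recip_ok_wU: "recip_ok wU wUq" by (simp add: recip_ok_def wUq_def wU_def wUl_def)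
lemma log_recip_ok_wU: "log_recip_ok wU wUl wUp" by (simp add: log_recip_ok_def wUp_def wU_def wUl_def)
definition wAq :: "int list" where "wAq = [-1000000000000000, 500000000000000, 333333333333333, -250000000000000, -166666666666667, -8888888888889, -12000000000000, 55454545454545, 61538461538461, -12142857142858, 38125000000000, 8888888888888, 10500000000000, -32380952380953, -14545454545455, 1666666666666, -16538461538462, -34074074074075, 6071428571428, 24482758620689, -29333333333334, -31935483870968, 4117647058823, 18611111111111, -9487179487180, -2250000000000, 4390243902439, 15238095238095, 2272727272727, -1739130434783, -3617021276596, 2500000000000, 1272727272727, -4210526315790, -2241379310345, -14062500000000, 675675675675, 4320987654320, -121951219513]"
definition wAp :: "int list" where "wAp = [1000000, 346574090250, 366204429534, -346573340250, -298626411516, -19530876241, -27631009114, 132974247850, 157843098905, -32045683999, 105704983152, 25692202291, 31455199371, -98584503690, -44960602955, 5296758051, -53883887738, -112302555427, 20231247739, 82440715486, -99768427190, -109666011040, 14520312159, 66693287739, -34756857408, -8299976521, 16303491512, 56954980846, 8600433259, -6658505036, -13926062175, 9878111796, 5100243509, -17023369547, -9100990712, -58484279292, 2908152766, 18988364865, -537404664]"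
lemma length_wA: "length wA = 39" by (simp add:  wA_def wAl_def)
lemma recip_sum_wA: "sum_list wAq = -552775562225941" by (simp add: wAq_def wA_def wAl_def)
lemma log_recip_sum_wA: "sum_list wAp = 82004596565" by (simp add: wAp_def wA_def wAl_def)
lemma abs_log_wA: "abs_log_floor wA wAl = 45952319585184" by (simp add: abs_log_floor_def wA_def wAl_def)
lemma abs_sum_wA: "abs_sum wA = 1722" by (simp add: abs_sum_def wA_def wAl_def)
lemma skew_sum_wA: "skew_sum wA = 3068" by (simp add: skew_sum_def wA_def wAl_def)
lemma neg_sum_wA: "neg_sum wA = 958" by (simp add: neg_sum_def wA_def wAl_def)
lemma lns_ok_wA: "lns_ok wA wAl" by (simp add: lns_ok_def ln_oks wA_def wAl_def)
lemma recip_ok_wA: "recip_ok wA wAq" by (simp add: recip_ok_def wAq_def wA_def wAl_def)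
lemma log_recip_ok_wA: "log_recip_ok wA wAl wAp" by (simp add: log_recip_ok_def wAp_def wA_def wAl_def)
definition wNq :: "int list" where "wNq = [-1000000000000000, 333333333333333, 250000000000000, 81428571428571, -79166666666667, -30000000000000, -27142857142858, 9583333333333, 10000000000000, -17500000000000, 34482758620689, -30000000000000, -4571428571429, -4523809523810, 6956521739130, 4897959183673, -5490196078432, 1698113207547, 7142857142857]"
definition wNp :: "int list" where "wNp = [1000000, 366204429534, 346573840250, 158452764982, -196721697260, -83177631660, -82637010446, 30456358789, 32188768248, -58313561423, 116113683783, -102035891445, -16253015137, -16908500890, 26634034061, 19061981867, -21586488177, 6742006834, 28752519218]"
lemma length_wN: "length wN = 19" by (simp add:  wN_def wNl_def)
lemma recip_sum_wN: "sum_list wNq = -458871509994063" by (simp add: wNq_def wN_def wNl_def)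
lemma log_recip_sum_wN: "sum_list wNp = 553547591128" by (simp add: wNp_def wN_def wNl_def)
lemma abs_log_wN: "abs_log_floor wN wNl = 25124365188447" by (simp add: abs_log_floor_def wN_def wNl_def)
lemma abs_sum_wN: "abs_sum wN = 1012" by (simp add: abs_sum_def wN_def wNl_def)
lemma skew_sum_wN: "skew_sum wN = 1498" by (simp add: skew_sum_def wN_def wNl_def)
lemma neg_sum_wN: "neg_sum wN = 502" by (simp add: neg_sum_def wN_def wNl_def)
lemma lns_ok_wN: "lns_ok wN wNl" by (simp add: lns_ok_def ln_oks wN_def wNl_def)
lemma recip_ok_wN: "recip_ok wN wNq" by (simp add: recip_ok_def wNq_def wN_def wNl_def)
lemma log_recip_ok_wN: "log_recip_ok wN wNl wNp" by (simp add: log_recip_ok_def wNp_def wN_def wNl_def)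
definition wnq :: "int list" where "wnq = [-1000000000000000, 250000000000000, 4000000000000, 132857142857142, -45000000000000, 53000000000000, 39230769230769, -42857142857143, 30000000000000, -5000000000000, 58823529411764, 6842105263157, -32500000000000, -18571428571429, 833333333333, 1071428571428, -8965517241380, -18285714285715, -2222222222223, 8536585365853, 2380952380952]"
definition wnp :: "int list" where "wnp = [1000000, 346573840250, 6437755650, 258528195497, -93574824367, 122037062924, 100624975552, -113102414117, 81241536030, -13862938610, 166659667283, 20146168277, -97361266385, -56541112410, 2648379026, 3570220190, -30189539852, -65012060549, -7963373196, 31701233494, 8899215758]"
lemma length_wn: "length wn = 21" by (simp add:  wn_def wnl_def)
lemma recip_sum_wn: "sum_list wnq = -585826178763492" by (simp add: wnq_def wn_def wnl_def)
lemma log_recip_sum_wn: "sum_list wnp = 671461720445" by (simp add: wnp_def wn_def wnl_def)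
lemma abs_log_wn: "abs_log_floor wn wnl = 21154353466265" by (simp add: abs_log_floor_def wn_def wnl_def)
lemma abs_sum_wn: "abs_sum wn = 913" by (simp add: abs_sum_def wn_def wnl_def)
lemma skew_sum_wn: "skew_sum wn = 1117" by (simp add: skew_sum_def wn_def wnl_def)
lemma neg_sum_wn: "neg_sum wn = 406" by (simp add: neg_sum_def wn_def wnl_def)
lemma lns_ok_wn: "lns_ok wn wnl" by (simp add: lns_ok_def ln_oks wn_def wnl_def)
lemma recip_ok_wn: "recip_ok wn wnq" by (simp add: recip_ok_def wnq_def wn_def wnl_def)
lemma log_recip_ok_wn: "log_recip_ok wn wnl wnp" by (simp add: log_recip_ok_def wnp_def wn_def wnl_def)
lemmas recip_bounds_lists = recip_bounds[OF recip_ok_wU] recip_bounds[OF recip_ok_wA] recip_bounds[OF recip_ok_wN] recip_bounds[OF recip_ok_wn]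
lemmas log_recip_bounds_lists = log_recip_le[OF lns_ok_wU log_recip_ok_wU] log_recip_le[OF lns_ok_wA log_recip_ok_wA] log_recip_le[OF lns_ok_wN log_recip_ok_wN] log_recip_le[OF lns_ok_wn log_recip_ok_wn]
lemmas abs_log_bounds_lists = abs_log_ge[OF lns_ok_wU] abs_log_ge[OF lns_ok_wA] abs_log_ge[OF lns_ok_wN] abs_log_ge[OF lns_ok_wn]
lemmas list_values = length_wU recip_sum_wU log_recip_sum_wU abs_log_wU abs_sum_wU skew_sum_wU neg_sum_wU length_wA recip_sum_wA log_recip_sum_wA abs_log_wA abs_sum_wA skew_sum_wA neg_sum_wA length_wN recip_sum_wN log_recip_sum_wN abs_log_wN abs_sum_wN skew_sum_wN neg_sum_wN length_wn recip_sum_wn log_recip_sum_wn abs_log_wn abs_sum_wn skew_sum_wn neg_sum_wn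


lemma cu_bounds: "cu \<le> 0" "cu \<ge> - 1 / 10 ^ 6"
proof -
  have c: "cu = - 100 * (recip wU / 10000 + recip wA / 23054 + recip wN / 31123 + recip wn / 40817)"
    unfolding cu_def cs0_def by (simp add: sum_scaled_recip pos_keys_lists)
  show "cu \<le> 0" "cu \<ge> - 1 / 10 ^ 6" using recip_bounds_lists unfolding c list_values by simp_all
qed

lemma ln_theta_bounds:
  "\<bar>ln 23054 - ln 10000 - (83525420/100000000)\<bar> \<le> (1 / 10000000 :: real)"
  "\<bar>ln 31123 - ln 10000 - (113536200/100000000)\<bar> \<le> (1 / 10000000 :: real)"
  "\<bar>ln 40817 - ln 10000 - (140651357/100000000)\<bar> \<le> (1 / 10000000 :: real)"
proof -
  have l: "ln (23054::real) - ln 10000 = ln 2 + ln (11527/10000)" "ln (31123::real) - ln 10000 = ln 3 + ln (31123/30000)"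
     "ln (40817::real) - ln 10000 = 2 * ln 2 + ln (40817/40000)"
    using ln_mult_pos[of 2 "11527::real"] ln_mult_pos[of 3 "10000::real"] ln_mult_pos[of 4 "10000::real"] ln_mult_pos[of 2 "2::real"]
    by (simp_all add: ln_divide_pos)
  have a: "ln (11527/10000 :: real) \<in> {(142107017/1000000000) - 1 / 10 ^ 8..(142107017/1000000000) + 1 / 10 ^ 8}"
    using ln_approx_bounds[of "11527/10000" 5] by (simp add: eval_nat_numeral)
  have b: "ln (31123/30000 :: real) \<in> {(36749714/1000000000) - 1 / 10 ^ 8..(36749714/1000000000) + 1 / 10 ^ 8}"
    using ln_approx_bounds[of "31123/30000" 4] by (simp add: eval_nat_numeral)
  have c: "ln (40817/40000 :: real) \<in> {(20219207/1000000000) - 1 / 10 ^ 8..(20219207/1000000000) + 1 / 10 ^ 8}"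
    using ln_approx_bounds[of "40817/40000" 4] by (simp add: eval_nat_numeral)
  show "\<bar>ln 23054 - ln 10000 - (83525420/100000000)\<bar> \<le> (1 / 10000000 :: real)"
    "\<bar>ln 31123 - ln 10000 - (113536200/100000000)\<bar> \<le> (1 / 10000000 :: real)"
    "\<bar>ln 40817 - ln 10000 - (140651357/100000000)\<bar> \<le> (1 / 10000000 :: real)"
    unfolding l abs_le_iff using a b c ln_2_bounds' ln_3_bounds by simp_all
qed

lemma mult_bounds:
  fixes a x b e :: real
  assumes "\<bar>x - b\<bar> \<le> e" "\<bar>a\<bar> \<le> k"
  shows "a * x \<le> a * b + k * e"
proof -
  have "a * (x - b) \<le> \<bar>a * (x - b)\<bar>" by simp
  also have "\<dots> \<le> k * e" unfolding abs_mult using assms by (intro mult_mono) auto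
  finally show ?thesis by (simp add: algebra_simps)
qed

text \<open>The purely linear content of \<open>main_sum_ge\<close>, with every transcendental or
  long expression replaced by a variable so that linear arithmetic sees nothing else.\<close>

lemma lin_main:
  fixes M lU pA lA pN lN pn ln' rA rN rn :: real
  assumes "M = - lU / 1000000 - (pA + lA) / 2305400 - (pN + lN) / 3112300 - (pn + ln') / 4081700"
    "pA \<le> rA * (83525420/100000000) + 1 / 5000" "pN \<le> rN * (113536200/100000000) + 1 / 5000" "pn \<le> rn * (140651357/100000000) + 1 / 5000"
    "lU \<le> 89052814751 / 10000000000" "lA \<le> 82004596565 / 10000000000" "lN \<le> 553547591128 / 10000000000" "ln' \<le> 671461720445 / 10000000000" "-552775562225941 / 10000000000000 \<le> rA" "rA \<le> -552775562225902 / 10000000000000" "-458871509994063 / 10000000000000 \<le> rN" "rN \<le> -458871509994044 / 10000000000000" "-585826178763492 / 10000000000000 \<le> rn" "rn \<le> -585826178763471 / 10000000000000"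
  shows "(1025462/10000000) \<le> M * 10000"
  using assms by ((simp add: add_divide_distrib diff_divide_distrib; fail) | (simp add: field_simps; fail) | (simp only: add_divide_distrib diff_divide_distrib; linarith))

text \<open>Because the reciprocal sum is zero, \<open>ln 10000\<close> drops out and only the
  logarithms of the three scale ratios remain, multiplied by the enclosed reciprocal sums.\<close>

lemma main_sum_ge: "main_sum cs * 10000 \<ge> (1025462/10000000)"
proof -
  note b' = recip_bounds_lists[unfolded list_values, simplified]
  have "main_sum cs = - cu * ln 10000 / 10000 - (\<Sum>(r, c)\<leftarrow>cs0. c * ln (real r) / real r)"
    by (simp add: main_sum_def cs_def)
  also have "- cu * ln 10000 / 10000 = ln 10000 * (recip wU / 1000000 + recip wA / 2305400 + recip wN / 3112300 + recip wn / 4081700)"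
    unfolding cu_def cs0_def by (simp add: sum_scaled_recip pos_keys_lists)
  also have "(\<Sum>(r, c)\<leftarrow>cs0. c * ln (real r) / real r) = (recip wU * ln 10000 + log_recip wU) / 1000000 + (recip wA * ln 23054 + log_recip wA) / 2305400
      + (recip wN * ln 31123 + log_recip wN) / 3112300 + (recip wn * ln 40817 + log_recip wn) / 4081700"
    unfolding cs0_def by (simp add: sum_scaled_log pos_keys_lists)
  finally have "main_sum cs = - log_recip wU / 1000000 - (recip wA * (ln 23054 - ln 10000) + log_recip wA) / 2305400
      - (recip wN * (ln 31123 - ln 10000) + log_recip wN) / 3112300 - (recip wn * (ln 40817 - ln 10000) + log_recip wn) / 4081700"
    by (simp add: right_diff_distrib add_divide_distrib diff_divide_distrib distrib_left mult.commute)
  moreover have "recip wA * (ln 23054 - ln 10000) \<le> recip wA * (83525420/100000000) + 2000 * (1 / 10000000)"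
    using b' by (intro mult_bounds ln_theta_bounds) (simp add: abs_le_iff)
  moreover have "recip wN * (ln 31123 - ln 10000) \<le> recip wN * (113536200/100000000) + 2000 * (1 / 10000000)"
    using b' by (intro mult_bounds ln_theta_bounds) (simp add: abs_le_iff)
  moreover have "recip wn * (ln 40817 - ln 10000) \<le> recip wn * (140651357/100000000) + 2000 * (1 / 10000000)"
    using b' by (intro mult_bounds ln_theta_bounds) (simp add: abs_le_iff)
  moreover note log_recip_bounds_lists[unfolded list_values, simplified]
  ultimately show ?thesis using b'
    by (intro lin_main[of "main_sum cs" "log_recip wU" "recip wA * (ln 23054 - ln 10000)" "log_recip wA"
        "recip wN * (ln 31123 - ln 10000)" "log_recip wN" "recip wn * (ln 40817 - ln 10000)" "log_recip wn" "recip wA" "recip wN" "recip wn"]) simp_all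
qed

lemma err_sum_append: "err_sum (xs @ ys) y = err_sum xs y + err_sum ys y"
  by (simp add: err_sum_def)

text \<open>The coefficient of the logarithm is half the total modulus of the weights,
  \<open>(4296 + 1722 + 1012 + 913) / 200 = 39.715\<close>. The term \<open>m / 1000000\<close>
  generously covers the contribution of \<open>cu\<close>.\<close>

lemma lin_err:
  fixes e d e0 m l aU t0 t1 aA t2 aN t3 an :: real
  assumes "e = d + e0" "d \<le> m / 1000000"
    "e0 = (4296 * l / 2 - aU / 2 + 6179 / 4) / 100 + (1722 * (t0 + l - t1) / 2 - aA / 2 + 3068 / 4) / 100 + (1012 * (t0 + l - t2) / 2 - aN / 2 + 1498 / 4) / 100 + (913 * (t0 + l - t3) / 2 - an / 2 + 1117 / 4) / 100"
    "168171903617547 / 10000000000 \<le> aU" "45952319585184 / 10000000000 \<le> aA" "25124365188447 / 10000000000 \<le> aN" "21154353466265 / 10000000000 \<le> an"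
    "t1 - t0 - (83525420/100000000) \<le> 1 / 10000000 \<and> - (t1 - t0 - (83525420/100000000)) \<le> 1 / 10000000"
    "t2 - t0 - (113536200/100000000) \<le> 1 / 10000000 \<and> - (t2 - t0 - (113536200/100000000)) \<le> 1 / 10000000"
    "t3 - t0 - (140651357/100000000) \<le> 1 / 10000000 \<and> - (t3 - t0 - (140651357/100000000)) \<le> 1 / 10000000"
  shows "e \<le> (39715/1000) * l + (-119902/1000) + m / 1000000"
  using assms by ((simp add: add_divide_distrib diff_divide_distrib; fail) | (simp add: field_simps; fail) | (simp only: add_divide_distrib diff_divide_distrib; linarith))

lemma err_sum_le:
  assumes "m \<ge> 1"
  shows "err_sum cs (10000 * m) \<le> (39715/1000) * ln m + (-119902/1000) + m / 1000000"
proof -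
  have "err_sum cs (10000 * m) = - cu * ln m / 2 - cu + err_sum cs0 (10000 * m)"
    using cu_bounds by (auto simp: err_sum_def cs_def)
  moreover have "- cu * ln m / 2 - cu \<le> m / 1000000"
  proof -
    have l: "ln m \<ge> 0" "ln m \<le> m - 1" using assms ln_le_minus_one[of m] by auto
    have "- cu * (ln m / 2 + 1) \<le> 1 / 1000000 * (ln m / 2 + 1)" using l cu_bounds by (intro mult_right_mono) auto
    thus ?thesis using l assms by (simp add: algebra_simps)
  qed
  moreover have "err_sum cs0 (10000 * m) =
     (of_int (abs_sum wU) * ln m / 2 - abs_log wU / 2 + of_int (skew_sum wU) / 4) / 100
   + (of_int (abs_sum wA) * (ln 10000 + ln m - ln 23054) / 2 - abs_log wA / 2 + of_int (skew_sum wA) / 4) / 100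
   + (of_int (abs_sum wN) * (ln 10000 + ln m - ln 31123) / 2 - abs_log wN / 2 + of_int (skew_sum wN) / 4) / 100
   + (of_int (abs_sum wn) * (ln 10000 + ln m - ln 40817) / 2 - abs_log wn / 2 + of_int (skew_sum wn) / 4) / 100"
  proof -
    have l: "ln (10000 * m) = ln 10000 + ln m" using assms by (intro ln_mult_pos) auto
    show ?thesis using assms by (simp add: cs0_def err_sum_append err_sum_scaled pos_keys_lists l)
  qed
  ultimately show ?thesis
    using abs_log_bounds_lists[unfolded list_values, simplified] ln_theta_bounds[unfolded abs_le_iff]
    unfolding list_values of_int_numeral
    by (intro lin_err[of "err_sum cs (10000 * m)" "- cu * ln m / 2 - cu" "err_sum cs0 (10000 * m)" m "ln m" "abs_log wU" "ln 10000" "ln 23054" "abs_log wA" "ln 31123" "abs_log wN" "ln 40817" "abs_log wn"]) simp_all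
qed

section \<open>Exponents from 96000 on\<close>

definition wide :: "nat \<Rightarrow> bool" where
  "wide z \<longleftrightarrow> z div 23054 + z div 31123 + z div 40817 + 2 \<le> z div 10000"

lemma wide_excess: "wide z \<longleftrightarrow> 2 \<le> excess (int z)"
proof -
  have "excess (int z) = int (z div 10000) - int (z div 23054) - int (z div 31123) - int (z div 40817)"
    by (simp add: excess_def zdiv_int)
  thus ?thesis by (simp add: wide_def) linarith
qed

lemma floor_sum_cs_le: "floor_sum cs z \<le> of_int (total (int z)) / 100"
  using cu_bounds by (simp add: cs_def floor_sum_cs0 mult_nonpos_nonneg)

lemma within_env_le:
  assumes "within_env E (int z)"
  shows "floor_sum cs z \<le> of_int E / 100 + of_bool (wide z)"
proof -
  have "real_of_int (total (int z)) \<le> of_int (E + 100 * of_bool (wide z))"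
    using assms unfolding of_int_le_iff by (auto simp: within_env_def wide_excess)
  thus ?thesis using floor_sum_cs_le[of z] by (simp add: field_simps)
qed

text \<open>Below \<open>10000\<close> all terms vanish, up to \<open>120000000\<close> the sweeps
  apply, and beyond that the universal bound \<open>floor_sum_le_neg\<close> does. The negative
  weights total \<open>39.61\<close>, and \<open>0.01\<close> is set aside for
  \<open>cu\<close>.\<close>

lemma floor_sum_env: "floor_sum cs z \<le> of_bool (wide z) + (\<Sum>(X, \<kappa>)\<leftarrow>env. \<kappa> * of_bool (X \<le> z))" (is ?thesis)
proof -
  have c0: ?thesis if "z < 10000"
  proof -
    have "total (int z) = 0" using that by (simp add: total_def)
    thus ?thesis using floor_sum_cs_le[of z] that by (simp add: env_def)
  qed
  have c1: ?thesis if "z < 1010000"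
  proof (cases "z < 10000")
    case False
    thus ?thesis using within_env_le[OF envelope_1[of "int z"]] that by (simp add: env_def)
  qed (rule c0)
  have c2: ?thesis if "z < 1210000"
  proof (cases "z < 1010000")
    case False
    thus ?thesis using within_env_le[OF envelope_101[of "int z"]] that by (simp add: env_def)
  qed (rule c1)
  have c3: ?thesis if "z < 1350000"
  proof (cases "z < 1210000")
    case False
    thus ?thesis using within_env_le[OF envelope_121[of "int z"]] that by (simp add: env_def)
  qed (rule c2)
  have c4: ?thesis if "z < 3250000"
  proof (cases "z < 1350000")
    case False
    thus ?thesis using within_env_le[OF envelope_135[of "int z"]] that by (simp add: env_def)
  qed (rule c3)
  have c5: ?thesis if "z < 3880000"
  proof (cases "z < 3250000")
    case False
    thus ?thesis using within_env_le[OF envelope_325[of "int z"]] that by (simp add: env_def)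
  qed (rule c4)
  have c6: ?thesis if "z < 4110000"
  proof (cases "z < 3880000")
    case False
    thus ?thesis using within_env_le[OF envelope_388[of "int z"]] that by (simp add: env_def)
  qed (rule c5)
  have c7: ?thesis if "z < 4620000"
  proof (cases "z < 4110000")
    case False
    thus ?thesis using within_env_le[OF envelope_411[of "int z"]] that by (simp add: env_def)
  qed (rule c6)
  have c8: ?thesis if "z < 8770000"
  proof (cases "z < 4620000")
    case False
    thus ?thesis using within_env_le[OF envelope_462[of "int z"]] that by (simp add: env_def)
  qed (rule c7)
  have c9: ?thesis if "z < 13980000"
  proof (cases "z < 8770000")
    case False
    thus ?thesis using within_env_le[OF envelope_877[of "int z"]] that by (simp add: env_def)
  qed (rule c8)
  have c10: ?thesis if "z < 14820000"
  proof (cases "z < 13980000")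
    case False
    thus ?thesis using within_env_le[OF envelope_1398[of "int z"]] that by (simp add: env_def)
  qed (rule c9)
  have c11: ?thesis if "z < 23630000"
  proof (cases "z < 14820000")
    case False
    thus ?thesis using within_env_le[OF envelope_1482[of "int z"]] that by (simp add: env_def)
  qed (rule c10)
  have c12: ?thesis if "z < 35530000"
  proof (cases "z < 23630000")
    case False
    thus ?thesis using within_env_le[OF envelope_2363[of "int z"]] that by (simp add: env_def)
  qed (rule c11)
  have c13: ?thesis if "z < 42310000"
  proof (cases "z < 35530000")
    case False
    thus ?thesis using within_env_le[OF envelope_3553[of "int z"]] that by (simp add: env_def)
  qed (rule c12)
  have c14: ?thesis if "z < 44850000"
  proof (cases "z < 42310000")
    case False
    thus ?thesis using within_env_le[OF envelope_4231[of "int z"]] that by (simp add: env_def)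
  qed (rule c13)
  have c15: ?thesis if "z < 50400000"
  proof (cases "z < 44850000")
    case False
    thus ?thesis using within_env_le[OF envelope_4485[of "int z"]] that by (simp add: env_def)
  qed (rule c14)
  have c16: ?thesis if "z < 53420000"
  proof (cases "z < 50400000")
    case False
    thus ?thesis using within_env_le[OF envelope_5040[of "int z"]] that by (simp add: env_def)
  qed (rule c15)
  have c17: ?thesis if "z < 67440000"
  proof (cases "z < 53420000")
    case False
    thus ?thesis using within_env_le[OF envelope_5342[of "int z"]] that by (simp add: env_def)
  qed (rule c16)
  have c18: ?thesis if "z < 71490000"
  proof (cases "z < 67440000")
    case False
    thus ?thesis using within_env_le[OF envelope_6744[of "int z"]] that by (simp add: env_def)
  qed (rule c17)
  have c19: ?thesis if "z < 80330000"
  proof (cases "z < 71490000")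
    case False
    thus ?thesis using within_env_le[OF envelope_7149[of "int z"]] that by (simp add: env_def)
  qed (rule c18)
  have c20: ?thesis if "z < 93550000"
  proof (cases "z < 80330000")
    case False
    thus ?thesis using within_env_le[OF envelope_8033[of "int z"]] that by (simp add: env_def)
  qed (rule c19)
  have c21: ?thesis if "z < 106770000"
  proof (cases "z < 93550000")
    case False
    thus ?thesis using within_env_le[OF envelope_9355[of "int z"]] that by (simp add: env_def)
  qed (rule c20)
  have c22: ?thesis if "z < 120000000"
  proof (cases "z < 106770000")
    case False
    thus ?thesis using within_env_le[OF envelope_10677[of "int z"]] that by (simp add: env_def)
  qed (rule c21)
  show ?thesis
  proof (cases "z < 120000000")
    case True
    thus ?thesis by (rule c22)
  next
    case False
    have "\<forall>(r, c)\<in>set cs. r > 0" using pos_keys_lists by (auto simp: cs_def cs0_def scaled_def pos_keys_def)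
    hence "floor_sum cs z \<le> (\<Sum>(r, c)\<leftarrow>cs. max 0 (- c))" using cs_zero by (intro floor_sum_le_neg) auto
    also have "\<dots> \<le> 3962 / 100"
    proof -
      have "max 0 (- cu) \<le> 1 / 100" using cu_bounds by simp
      thus ?thesis by (simp add: cs_def cs0_def neg_sum_scaled list_values)
    qed
    finally show ?thesis using False by (simp add: env_def)
  qed
qed

text \<open>The main coefficient \<open>0.1025462\<close> is reduced by the envelope cost
  \<open>0.0207821\<close>, by the slope \<open>39.715 / 98304\<close> of the linearized logarithm
  and by \<open>1 / 1000000\<close>; about \<open>0.0813589\<close> per unit of \<open>m\<close>
  remains.\<close>

lemma lin_C:
  fixes F S C M e m l :: real
  assumes "F - S \<le> C" "M - e \<le> F" "(1025462/10000000) * m \<le> M" "e \<le> (39715/1000) * l + (-119902/1000) + m / 1000000"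
    "l \<le> 15 * (69314719/100000000) + (10986123/10000000) - 1 + m / 98304" "S \<le> (207821/10000000) * m + (62382/1000)" "0 \<le> m"
  shows "(813589/10000000) * m - (359323/1000) \<le> C"
  using assms by linarith

text \<open>Here \<open>m\<close> is about \<open>1.76593 * x\<close>, so the common factor grows at
  rate about \<open>0.14367\<close> per unit of \<open>x\<close> against \<open>0.13541\<close> for
  the remainder. The difference, about \<open>0.0083\<close>, exceeds the fixed loss of roughly
  \<open>360\<close> when \<open>x \<ge> 48000\<close>.\<close>

lemma lin_E:
  fixes C m A n N x f g p1 p2 p3 p4 p5 p6 :: real
  assumes "(813589/10000000) * m - (359323/1000) \<le> C" "m = A + n + N" "n = (2163/5000) * x + f" "A = (2163/5000) * x + f + (x / 3 - g)"
    "N = x - 1 - ((2163/5000) * x + f)" "0 \<le> f" "f \<le> 1" "0 \<le> g" "g \<le> 2/3" "48000 \<le> x"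
    "p1 \<le> x * (69314719/100000000)" "p2 \<le> N * (10986123/10000000)" "p3 \<le> A * (- 167397642/100000000)"
    "p4 \<le> (n + 1) * (23361487/100000000)" "p5 \<le> 1 * (138629438/100000000)" "p6 \<le> 69314719/100000000"
  shows "p1 + p2 + p3 + p4 + p5 + p6 \<le> C"
  using assms by ((simp add: algebra_simps; fail) | (simp add: distrib_right; fail) | (simp only: distrib_right mult_1; linarith) | smt (verit) | smt (z3))

text \<open>The rate of the denominator term is about \<open>0.13528\<close>, practically that of
  the remainder in \<open>lin_E\<close>: the ratio \<open>2163/5000\<close> balances the two
  conditions.\<close>

lemma lin_Q:
  fixes C m A n N x f g p1 p2 p3 p4 p5 p6 :: real
  assumes "(813589/10000000) * m - (359323/1000) \<le> C" "m = A + n + N" "n = (2163/5000) * x + f" "A = (2163/5000) * x + f + (x / 3 - g)"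
    "N = x - 1 - ((2163/5000) * x + f)" "0 \<le> f" "f \<le> 1" "0 \<le> g" "g \<le> 2/3" "48000 \<le> x"
    "p1 \<le> n * (321887589/100000000)" "p2 \<le> (A + 1) * (38566249/100000000)" "p3 \<le> (A + x) * (3922072/100000000)"
    "2 * x * (81093018/100000000) \<le> p4" "p5 \<le> 1 * (28768210/100000000)" "p6 \<le> 69314719/100000000"
  shows "p1 + p2 + p3 - p4 + p5 + p6 < C"
  using assms by ((simp add: algebra_simps; fail) | (simp add: distrib_right; fail) | (simp only: distrib_right mult_1; linarith) | smt (verit) | smt (z3))

lemma dist_nint_gt_large:
  assumes w: "w \<ge> 48000" and j: "j < 2"
  shows "dist_nint ((4/3) ^ (2 * w + j)) > (4/9) ^ (2 * w + j)"
proof -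
  define n where "n = (2163 * w + 4999) div 5000"
  \<comment> \<open>The largest \<open>A\<close> compatible with \<open>3 * (A - n) \<le> w\<close>,
    since the remainder shrinks with \<open>A\<close>.\<close>
  define A where "A = n + w div 3"
  define N where "N = w - 1 - n"
  define m where "m = A + n + N"
  have n1: "2163 * w \<le> 5000 * n" and n2: "5000 * n \<le> 2163 * w + 4999" unfolding n_def by auto
  have d3: "3 * (w div 3) \<le> w" "w \<le> 3 * (w div 3) + 2" by auto
  have nw: "n < w" using n2 w by linarith
  have wN: "w = n + N + 1" using nw by (simp add: N_def)
  define x where "x = real w"
  define \<phi> where "\<phi> = real n - (2163/5000) * x"
  define \<xi> where "\<xi> = x / 3 - real (w div 3)"
  have \<phi>: "0 \<le> \<phi>" "\<phi> \<le> 1"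
  proof -
    have "real (2163 * w) \<le> real (5000 * n)" "real (5000 * n) \<le> real (2163 * w + 4999)" using n1 n2 by (simp_all only: of_nat_le_iff)
    thus "0 \<le> \<phi>" "\<phi> \<le> 1" by (simp_all add: \<phi>_def x_def)
  qed
  have \<xi>: "0 \<le> \<xi>" "\<xi> \<le> 2/3"
  proof -
    have "real (3 * (w div 3)) \<le> real w" "real w \<le> real (3 * (w div 3) + 2)" using d3 by (simp_all only: of_nat_le_iff)
    thus "0 \<le> \<xi>" "\<xi> \<le> 2/3" by (simp_all add: \<xi>_def x_def)
  qed
  have rn: "real n = (2163/5000) * x + \<phi>" by (simp add: \<phi>_def)
  have rA: "real A = (2163/5000) * x + \<phi> + (x / 3 - \<xi>)" by (simp add: A_def \<phi>_def \<xi>_def)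
  have rN: "real N = x - 1 - ((2163/5000) * x + \<phi>)" using nw by (simp add: N_def \<phi>_def x_def of_nat_diff)
  have rm: "real m = real A + real n + real N" by (simp add: m_def)
  have xw: "x \<ge> 48000" using w by (simp add: x_def)
  have m1: "real m \<ge> 84000" unfolding rm rA rn rN using xw \<phi> \<xi> by simp
  \<comment> \<open>The scale ratios were rounded down from the limits of \<open>m / A\<close>,
    \<open>m / N\<close>, \<open>m / n\<close>; the slack absorbs the rounding of \<open>n\<close>
    and of \<open>w div 3\<close>.\<close>
  have fits: "23054 * A \<le> 10000 * m" "31123 * N \<le> 10000 * m" "40817 * n \<le> 10000 * m"
  proof -
    have "real (23054 * A) \<le> real (10000 * m)" "real (31123 * N) \<le> real (10000 * m)" "real (40817 * n) \<le> real (10000 * m)"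
      unfolding of_nat_mult rm rA rn rN using xw \<phi> \<xi> by simp_all
    thus "23054 * A \<le> 10000 * m" "31123 * N \<le> 10000 * m" "40817 * n \<le> 10000 * m" by (simp_all only: of_nat_le_iff)
  qed
  define y where "y = 10000 * m"
  define C where "C = ln (real (content y wide))"
  have C: "C \<ge> (813589/10000000) * real m - (359323/1000)"
  proof -
    have "\<forall>(X, \<kappa>)\<in>set env. 0 < X" by (simp add: env_def)
    hence "C \<ge> fact_sum cs y - (\<Sum>(X, \<kappa>)\<leftarrow>env. \<kappa> * psi (y div X))"
      unfolding C_def by (intro ln_content_ge floor_sum_env)
    moreover have "fact_sum cs y \<ge> main_sum cs * real y - err_sum cs (real y)"
    proof (rule fact_sum_bounds[OF _ cs_zero])
      have "\<forall>(r, c)\<in>set cs. 0 < r \<and> r \<le> 10000000"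
        using keys_small[THEN scaled_bound, of 10000] keys_small[THEN scaled_bound, of 23054]
          keys_small[THEN scaled_bound, of 31123] keys_small[THEN scaled_bound, of 40817]
        unfolding cs_def cs0_def by (simp add: ball_Un)
      moreover have "10000000 \<le> y" using m1 unfolding y_def by simp
      ultimately show "\<forall>(r, c)\<in>set cs. 0 < r \<and> r \<le> y" by force
    qed
    moreover have "main_sum cs * real y \<ge> (1025462/10000000) * real m"
    proof -
      have "(1025462/10000000) * real m \<le> (main_sum cs * 10000) * real m" using main_sum_ge by (intro mult_right_mono) auto
      thus ?thesis by (simp add: y_def mult.assoc)
    qed
    moreover have "err_sum cs (real y) \<le> (39715/1000) * ln (real m) + (-119902/1000) + real m / 1000000"
      using err_sum_le[of "real m"] m1 by (simp add: y_def)
    \<comment> \<open>Tangent at \<open>98304 = 2 ^ 15 * 3\<close>, close to the smallest values of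
      \<open>m\<close>, where the final inequality has least room.\<close>
    moreover have "ln (real m) \<le> 15 * (69314719/100000000) + (10986123/10000000) - 1 + real m / 98304"
    proof -
      have "ln (real m) \<le> ln (2 ^ 15 * 3 ^ 1 * 5 ^ 0) - 1 + real m / (2 ^ 15 * 3 ^ 1 * 5 ^ 0)" using m1 by (intro ln_le_tangent) auto
      thus ?thesis using ln_smooth[of 15 1 0] by simp
    qed
    moreover have "(\<Sum>(X, \<kappa>)\<leftarrow>env. \<kappa> * psi (y div X)) \<le> (207821/10000000) * real m + (62382/1000)"
    proof -
      have yr: "real y = 10000 * real m" by (simp add: y_def)
      have X: "X \<le> y" if "X \<le> 840000000" for X using that m1 unfolding y_def by simp
      \<comment> \<open>The three exponents after the modulus give a tangent point near the smallest
        possible quotient, here \<open>900\<close> for a quotient of about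
        \<open>830\<close>.\<close>
      have p0: "psi (y div 1010000) \<le> 11424644 / 1000000000 * real m + 203085 / 10000"
        by (rule psi_lin[OF psi_div_tangent[OF X, of 1010000 2 2 2, unfolded yr]]) simp_all
      have p1: "psi (y div 1210000) \<le> 9541797 / 1000000000 * real m + 197534 / 10000"
        by (rule psi_lin[OF psi_div_tangent[OF X, of 1210000 8 1 0, unfolded yr]]) simp_all
      have p2: "psi (y div 1350000) \<le> 8556929 / 1000000000 * real m + 193016 / 10000"
        by (rule psi_lin[OF psi_div_tangent[OF X, of 1350000 0 3 2, unfolded yr]]) simp_all
      have p3: "psi (y div 3250000) \<le> 3575856 / 1000000000 * real m + 163205 / 10000"
        by (rule psi_lin[OF psi_div_tangent[OF X, of 3250000 5 2 0, unfolded yr]]) simp_all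
      have p4: "psi (y div 3880000) \<le> 3001505 / 1000000000 * real m + 156824 / 10000"
        by (rule psi_lin[OF psi_div_tangent[OF X, of 3880000 4 1 1, unfolded yr]]) simp_all
      have p5: "psi (y div 4110000) \<le> 2835903 / 1000000000 * real m + 154565 / 10000"
        by (rule psi_lin[OF psi_div_tangent[OF X, of 4110000 0 2 2, unfolded yr]]) simp_all
      have p6: "psi (y div 4620000) \<le> 2527058 / 1000000000 * real m + 150443 / 10000"
        by (rule psi_lin[OF psi_div_tangent[OF X, of 4620000 3 0 2, unfolded yr]]) simp_all
      have p7: "psi (y div 8770000) \<le> 1348243 / 1000000000 * real m + 128876 / 10000"
        by (rule psi_lin[OF psi_div_tangent[OF X, of 8770000 2 3 0, unfolded yr]]) simp_all
      have p8: "psi (y div 13980000) \<le> 861724 / 1000000000 * real m + 110562 / 10000"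
        by (rule psi_lin[OF psi_div_tangent[OF X, of 13980000 6 0 0, unfolded yr]]) simp_all
      have p9: "psi (y div 14820000) \<le> 812881 / 1000000000 * real m + 110562 / 10000"
        by (rule psi_lin[OF psi_div_tangent[OF X, of 14820000 6 0 0, unfolded yr]]) simp_all
      have p10: "psi (y div 23630000) \<le> 523700 / 1000000000 * real m + 94112 / 10000"
        by (rule psi_lin[OF psi_div_tangent[OF X, of 23630000 3 0 1, unfolded yr]]) simp_all
      have p11: "psi (y div 35530000) \<le> 363075 / 1000000000 * real m + 77662 / 10000"
        by (rule psi_lin[OF psi_div_tangent[OF X, of 35530000 0 0 2, unfolded yr]]) simp_all
      have p12: "psi (y div 42310000) \<le> 313166 / 1000000000 * real m + 69852 / 10000"
        by (rule psi_lin[OF psi_div_tangent[OF X, of 42310000 2 0 1, unfolded yr]]) simp_all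
      have p13: "psi (y div 44850000) \<le> 295431 / 1000000000 * real m + 69852 / 10000"
        by (rule psi_lin[OF psi_div_tangent[OF X, of 44850000 2 0 1, unfolded yr]]) simp_all
      have p14: "psi (y div 50400000) \<le> 266756 / 1000000000 * real m + 66165 / 10000"
        by (rule psi_lin[OF psi_div_tangent[OF X, of 50400000 1 2 0, unfolded yr]]) simp_all
      have p15: "psi (y div 53420000) \<le> 251676 / 1000000000 * real m + 66165 / 10000"
        by (rule psi_lin[OF psi_div_tangent[OF X, of 53420000 1 2 0, unfolded yr]]) simp_all
      have p16: "psi (y div 67440000) \<le> 205122 / 1000000000 * real m + 59783 / 10000"
        by (rule psi_lin[OF psi_div_tangent[OF X, of 67440000 0 1 1, unfolded yr]]) simp_all
      have p17: "psi (y div 71490000) \<le> 201661 / 1000000000 * real m + 51973 / 10000"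
        by (rule psi_lin[OF psi_div_tangent[OF X, of 71490000 2 1 0, unfolded yr]]) simp_all
      have p18: "psi (y div 80330000) \<le> 179470 / 1000000000 * real m + 51973 / 10000"
        by (rule psi_lin[OF psi_div_tangent[OF X, of 80330000 2 1 0, unfolded yr]]) simp_all
      \<comment> \<open>The last jump has weight \<open>35.02\<close>, so any additive constant
        would be multiplied by it; the homogeneous bound \<open>psi_div_linear\<close> has
        none.\<close>
      have p19: "psi (y div 120000000) \<le> 1 / 8000 * real m + 0" using psi_div_linear[of y 120000000] unfolding yr by simp
      show ?thesis unfolding env_def list.map sum_list.Cons sum_list.Nil prod.case by (rule lin_total[OF lin_add[OF p0 lin_add[OF p1 lin_add[OF p2 lin_add[OF p3 lin_add[OF p4 lin_add[OF p5 lin_add[OF p6 lin_add[OF p7 lin_add[OF p8 lin_add[OF p9 lin_add[OF p10 lin_add[OF p11 lin_add[OF p12 lin_add[OF p13 lin_add[OF p14 lin_add[OF p15 lin_add[OF p16 lin_add[OF p17 lin_add[OF p18 lin_add[OF p19 lin_zero]]]]]]]]]]]]]]]]]]]]]) simp_all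
    qed
    ultimately show ?thesis using m1 by (intro lin_C[of "fact_sum cs y" _ C "main_sum cs * real y" "err_sum cs (real y)" "real m" "ln (real m)"]) simp_all
  qed
  \<comment> \<open>By \<open>fits\<close>, each of \<open>A\<close>, \<open>N\<close>,
    \<open>n\<close> is at most the corresponding quotient of \<open>y\<close>. As divisions
    commute, \<open>wide (y div d)\<close> compares upper bounds for their quotients with the exact
    value of \<open>m div d\<close>.\<close>
  have "A div d + n div d + N div d + 2 \<le> (A + n + N) div d" if "d > 0" "wide (y div d)" for d
  proof -
    have sw: "y div d div r = y div r div d" for r by (simp only: div_mult2_eq[symmetric] mult.commute)
    have "A \<le> y div 23054" "N \<le> y div 31123" "n \<le> y div 40817" using fits by (simp_all add: y_def less_eq_div_iff_mult_less_eq mult.commute)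
    hence "A div d \<le> y div d div 23054" "N div d \<le> y div d div 31123" "n div d \<le> y div d div 40817"
      unfolding sw by (simp_all add: div_le_mono)
    moreover have "y div d div 10000 = m div d" unfolding sw by (simp add: y_def)
    ultimately show ?thesis using that(2) unfolding wide_def m_def by linarith
  qed
  moreover have "n < A" using w by (simp add: A_def)
  moreover have "3 * (A - n) \<le> w" by (simp add: A_def)
  moreover note wN
  moreover have "real w * ln 2 + real N * ln 3 + real A * ln (3 / 16) + (real n + 1) * ln (24 / 19) + real j * ln 4 + ln 2 \<le> ln (real (content y wide))"
  proof -
    have "real w * ln 2 \<le> x * (69314719/100000000)" unfolding x_def using ln_2_upper by (intro mult_left_mono) auto
    moreover have "real N * ln 3 \<le> real N * (10986123/10000000)" using ln_3_bounds(2) by (intro mult_left_mono) auto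
    moreover have "real A * ln (3/16) \<le> real A * (- 167397642/100000000)" using ln_const_bounds by (intro mult_left_mono) auto
    moreover have "(real n + 1) * ln (24/19) \<le> (real n + 1) * (23361487/100000000)" using ln_const_bounds by (intro mult_left_mono) auto
    moreover have "real j * ln 4 \<le> 1 * (138629438/100000000)" using ln_const_bounds j by (intro mult_mono) auto
    moreover have "ln 2 \<le> (69314719/100000000 :: real)" using ln_2_upper by simp
    ultimately show ?thesis unfolding C_def[symmetric] by (rule lin_E[OF C rm rn rA rN \<phi> \<xi> xw])
  qed
  moreover have "real n * ln 25 + (real A + 1) * ln (25 / 17) + (real A + real w) * ln (26 / 25) - 2 * real w * ln (9 / 4) + real j * ln (4 / 3) + ln 2 < ln (real (content y wide))"
  proof -
    have "real n * ln 25 \<le> real n * (321887589/100000000)" using ln_const_bounds by (intro mult_left_mono) auto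
    moreover have "(real A + 1) * ln (25/17) \<le> (real A + 1) * (38566249/100000000)" using ln_const_bounds by (intro mult_left_mono) auto
    moreover have "(real A + real w) * ln (26/25) \<le> (real A + x) * (3922072/100000000)" unfolding x_def using ln_const_bounds by (intro mult_left_mono) auto
    moreover have "2 * real w * ln (9/4) \<ge> 2 * x * (81093018/100000000)" unfolding x_def using ln_const_bounds by (intro mult_left_mono) auto
    moreover have "real j * ln (4/3) \<le> 1 * (28768210/100000000)" using ln_const_bounds j by (intro mult_mono) auto
    moreover have "ln 2 \<le> (69314719/100000000 :: real)" using ln_2_upper by simp
    ultimately show ?thesis unfolding C_def[symmetric] by (rule lin_Q[OF C rm rn rA rN \<phi> \<xi> xw])
  qed
  ultimately show ?thesis by (rule dist_nint_gt_of_ln_content)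
qed

theorem theorem1:
  fixes k :: nat
  assumes "k \<ge> 6"
  shows "dist_nint ((4/3) ^ k) > (4/9) ^ k"
proof -
  have s6: ?thesis if "k \<le> 6" using assms that by (intro small_6) linarith+
  have s10: ?thesis if "k \<le> 10"
  proof (cases "k \<le> 6")
    case False
    thus ?thesis using that by (intro small_10) linarith+
  qed (rule s6)
  have s16: ?thesis if "k \<le> 16"
  proof (cases "k \<le> 10")
    case False
    thus ?thesis using that by (intro small_16) linarith+
  qed (rule s10)
  have s26: ?thesis if "k \<le> 26"
  proof (cases "k \<le> 16")
    case False
    thus ?thesis using that by (intro small_26) linarith+
  qed (rule s16)
  have s41: ?thesis if "k \<le> 41"
  proof (cases "k \<le> 26")
    case False
    thus ?thesis using that by (intro small_41) linarith+
  qed (rule s26)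
  have s64: ?thesis if "k \<le> 64"
  proof (cases "k \<le> 41")
    case False
    thus ?thesis using that by (intro small_64) linarith+
  qed (rule s41)
  have s102: ?thesis if "k \<le> 102"
  proof (cases "k \<le> 64")
    case False
    thus ?thesis using that by (intro small_102) linarith+
  qed (rule s64)
  have s161: ?thesis if "k \<le> 161"
  proof (cases "k \<le> 102")
    case False
    thus ?thesis using that by (intro small_161) linarith+
  qed (rule s102)
  have s255: ?thesis if "k \<le> 255"
  proof (cases "k \<le> 161")
    case False
    thus ?thesis using that by (intro small_255) linarith+
  qed (rule s161)
  have s403: ?thesis if "k \<le> 403"
  proof (cases "k \<le> 255")
    case False
    thus ?thesis using that by (intro small_403) linarith+
  qed (rule s255)
  have s638: ?thesis if "k \<le> 638"
  proof (cases "k \<le> 403")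
    case False
    thus ?thesis using that by (intro small_638) linarith+
  qed (rule s403)
  have s1010: ?thesis if "k \<le> 1010"
  proof (cases "k \<le> 638")
    case False
    thus ?thesis using that by (intro small_1010) linarith+
  qed (rule s638)
  have s1600: ?thesis if "k \<le> 1600"
  proof (cases "k \<le> 1010")
    case False
    thus ?thesis using that by (intro small_1600) linarith+
  qed (rule s1010)
  show ?thesis
  proof (cases "k < 96000")
    case True
    thus ?thesis using s1600 dist_nint_gt_mid[of k] by (cases "k \<le> 1600") auto
  next
    case False
    \<comment> \<open>For \<open>k \<ge> 96000\<close> the half \<open>k div 2\<close> is at least
      \<open>48000\<close>, and the parity of \<open>k\<close> is the leftover exponent
      \<open>j\<close>.\<close>
    have "dist_nint ((4/3) ^ (2 * (k div 2) + k mod 2)) > (4/9) ^ (2 * (k div 2) + k mod 2)"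
      using False by (intro dist_nint_gt_large) auto
    thus ?thesis by simp
  qed
qed

end
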